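(* Let $X$ be a complete finite type hyperbolic surface with at least one cusp. There exists a constant $K(X)$ depending on $X$ such that for all integers $k \ge K(X)$, if $\gamma_k$ is a closed geodesic on $X$ which is shortest among all closed geodesics on $X$ with self-intersection number at least $k$, then (1) $\gamma_k$ self-intersects exactly $k$ times; (2) $\gamma_k$ is freely homotopic to $\kappa * \tau^k$, where $\tau$ is a loop freely homotopic to a cusp of $X$, and $\kappa$ is a non-contractible simple loop that is not freely homotopic to $\tau$.
   Context: All closed geodesics are assumed primitive (not proper powers of other closed geodesics). The self-intersection number $i(\gamma,\gamma)$ of a closed geodesic $\gamma$ is its number of (transversal) self-intersections, which is the minimal number of self-intersections among all curves in its free homotopy class. A loop is freely homotopic to a cusp if it is freely homotopic to a closed horocycle winding once around that cusp. In $\kappa*\tau^k$, the loops $\kappa$ and $\tau$ share a base point, $*$ denotes concatenation and $\tau^k$ is the $k$-fold concatenation of $\tau$. *)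

theory Defs
  imports "HOL-Analysis.Analysis"
begin

section \<open>Lengths of curves\<close>

definition curve_length :: "(real \<Rightarrow> 'a::metric_space) \<Rightarrow> ereal" where
  "curve_length g =
     (SUP (n, t) \<in> {(n, t). mono t \<and> range t \<subseteq> {0..1}}.
        ereal (\<Sum>i<(n::nat). dist (g (t i)) (g (t (Suc i)))))"

definition curves_between :: "'a::metric_space set \<Rightarrow> 'a \<Rightarrow> 'a \<Rightarrow> (real \<Rightarrow> 'a) set" where
  "curves_between X x y =
     {g. path g \<and> path_image g \<subseteq> X \<and> pathstart g = x \<and> pathfinish g = y}"

definition length_space :: "'a::metric_space set \<Rightarrow> bool" where
  "length_space X \<longleftrightarrow>
     (\<forall>x\<in>X. \<forall>y\<in>X. ereal (dist x y) = (INF g\<in>curves_between X x y. curve_length g))"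

section \<open>Hyperbolic surfaces\<close>

text \<open>The hyperbolic plane is the upper half-plane with the distance of the Riemannian
  metric (dx^2 + dy^2) / y^2, which has curvature -1.\<close>

definition upper_half_plane :: "complex set" where
  "upper_half_plane = {z. Im z > 0}"

definition hdist :: "complex \<Rightarrow> complex \<Rightarrow> real" where
  "hdist z w = arcosh (1 + (cmod (z - w))\<^sup>2 / (2 * Im z * Im w))"

text \<open>A surface is a subset of a metric type (possibly the whole type), and the ambient
  distance restricted to it is its Riemannian distance. Charts are isometries onto open
  subsets of the hyperbolic plane. An isometric transition map is locally a Moebius
  transformation or the composition of one with a reflection; holomorphy leaves only the
  former, so the atlas orients the surface.\<close>

definition hyperbolic_atlas :: "'a::metric_space set \<Rightarrow> ('a set \<times> ('a \<Rightarrow> complex)) set \<Rightarrow> bool" where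
  "hyperbolic_atlas X \<A> \<longleftrightarrow>
     (\<Union>(U, f)\<in>\<A>. U) = X \<and>
     (\<forall>(U, f)\<in>\<A>. openin (top_of_set X) U \<and> open (f ` U) \<and> f ` U \<subseteq> upper_half_plane \<and>
        (\<forall>x\<in>U. \<forall>y\<in>U. hdist (f x) (f y) = dist x y)) \<and>
     (\<forall>(U, f)\<in>\<A>. \<forall>(V, g)\<in>\<A>. (g \<circ> inv_into U f) holomorphic_on f ` (U \<inter> V))"

definition hyperbolic_surface :: "'a::metric_space set \<Rightarrow> bool" where
  "hyperbolic_surface X \<longleftrightarrow>
     X \<noteq> {} \<and> connected X \<and> length_space X \<and> (\<exists>\<A>. hyperbolic_atlas X \<A>)"

section \<open>Finite type\<close>

definition loops_at :: "'a::metric_space set \<Rightarrow> 'a \<Rightarrow> (real \<Rightarrow> 'a) set" where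
  "loops_at X p = curves_between X p p"

inductive_set loop_words :: "'a::metric_space \<Rightarrow> (real \<Rightarrow> 'a) set \<Rightarrow> (real \<Rightarrow> 'a) set"
  for p F where
  const: "(\<lambda>_. p) \<in> loop_words p F"
| forward: "f \<in> F \<Longrightarrow> g \<in> loop_words p F \<Longrightarrow> f +++ g \<in> loop_words p F"
| backward: "f \<in> F \<Longrightarrow> g \<in> loop_words p F \<Longrightarrow> reversepath f +++ g \<in> loop_words p F"

text \<open>Finite type means that the fundamental group is finitely generated.\<close>

definition finite_type :: "'a::metric_space set \<Rightarrow> bool" where
  "finite_type X \<longleftrightarrow>
     (\<forall>p\<in>X. \<exists>F. finite F \<and> F \<subseteq> loops_at X p \<and>
        (\<forall>g\<in>loops_at X p. \<exists>h\<in>loop_words p F. homotopic_paths X g h))"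

section \<open>Cusps\<close>

text \<open>\<open>cusp_chart X h \<phi>\<close>: the map \<open>\<phi>\<close> induces an injective local isometry into \<open>X\<close> of the quotient
  of the horoball \<open>Im z > h\<close> by the translation by 1. It may preserve or reverse the
  orientation, so the horocycles below wind once around the cusp in either direction.\<close>

definition cusp_chart :: "'a::metric_space set \<Rightarrow> real \<Rightarrow> (complex \<Rightarrow> 'a) \<Rightarrow> bool" where
  "cusp_chart X h \<phi> \<longleftrightarrow> h > 0 \<and> \<phi> ` {z. Im z > h} \<subseteq> X \<and>
     (\<forall>z w. Im z > h \<longrightarrow> Im w > h \<longrightarrow> (\<phi> z = \<phi> w \<longleftrightarrow> z - w \<in> \<int>)) \<and>
     (\<forall>z. Im z > h \<longrightarrow> (\<exists>e>0. \<forall>u\<in>ball z e. \<forall>v\<in>ball z e. Im u > h \<longrightarrow> Im v > h \<longrightarrow>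
        dist (\<phi> u) (\<phi> v) = hdist u v))"

definition has_cusp :: "'a::metric_space set \<Rightarrow> bool" where
  "has_cusp X \<longleftrightarrow> (\<exists>h \<phi>. cusp_chart X h \<phi>)"

definition closed_horocycle :: "'a::metric_space set \<Rightarrow> (real \<Rightarrow> 'a) \<Rightarrow> bool" where
  "closed_horocycle X c \<longleftrightarrow>
     (\<exists>h \<phi> y. cusp_chart X h \<phi> \<and> y > h \<and> c = (\<lambda>t. \<phi> (Complex t y)))"

definition homotopic_to_cusp :: "'a::metric_space set \<Rightarrow> (real \<Rightarrow> 'a) \<Rightarrow> bool" where
  "homotopic_to_cusp X \<tau> \<longleftrightarrow> (\<exists>c. closed_horocycle X c \<and> homotopic_loops X \<tau> c)"

section \<open>Closed geodesics\<close>

text \<open>A closed geodesic is a 1-periodic curve, parametrised on the whole line with constant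
  positive speed, that locally realises the distance. Its restriction to \<open>{0..1}\<close> is the
  closed curve.\<close>

definition closed_geodesic :: "'a::metric_space set \<Rightarrow> (real \<Rightarrow> 'a) \<Rightarrow> bool" where
  "closed_geodesic X \<gamma> \<longleftrightarrow> range \<gamma> \<subseteq> X \<and> (\<forall>t. \<gamma> (t + 1) = \<gamma> t) \<and>
     (\<exists>v>0. \<forall>t. \<exists>e>0. \<forall>r\<in>ball t e. \<forall>s\<in>ball t e. dist (\<gamma> r) (\<gamma> s) = v * \<bar>r - s\<bar>)"

definition primitive_closed_geodesic :: "'a::metric_space set \<Rightarrow> (real \<Rightarrow> 'a) \<Rightarrow> bool" where
  "primitive_closed_geodesic X \<gamma> \<longleftrightarrow> closed_geodesic X \<gamma> \<and>
     \<not> (\<exists>\<delta> n. closed_geodesic X \<delta> \<and> n \<ge> (2::nat) \<and> \<gamma> = (\<lambda>t. \<delta> (real n * t)))"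

text \<open>Self-intersections are counted with multiplicity, as pairs of parameters: a point passed
  m times counts m (m - 1) / 2 times. Two branches of a primitive closed geodesic that meet
  are automatically transversal.\<close>

definition self_intersections :: "(real \<Rightarrow> 'a::metric_space) \<Rightarrow> (real \<times> real) set" where
  "self_intersections \<gamma> = {(s, t). 0 \<le> s \<and> s < t \<and> t < 1 \<and> \<gamma> s = \<gamma> t}"

definition self_intersection_number :: "(real \<Rightarrow> 'a::metric_space) \<Rightarrow> enat" where
  "self_intersection_number \<gamma> =
     (if finite (self_intersections \<gamma>) then enat (card (self_intersections \<gamma>)) else \<infinity>)"

definition shortest_geodesic :: "'a::metric_space set \<Rightarrow> nat \<Rightarrow> (real \<Rightarrow> 'a) \<Rightarrow> bool" where
  "shortest_geodesic X k \<gamma> \<longleftrightarrow>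
     primitive_closed_geodesic X \<gamma> \<and> self_intersection_number \<gamma> \<ge> enat k \<and>
     (\<forall>\<delta>. primitive_closed_geodesic X \<delta> \<and> self_intersection_number \<delta> \<ge> enat k \<longrightarrow>
        curve_length \<gamma> \<le> curve_length \<delta>)"

section \<open>Loops\<close>

definition simple_loop :: "'a::metric_space set \<Rightarrow> (real \<Rightarrow> 'a) \<Rightarrow> bool" where
  "simple_loop X \<kappa> \<longleftrightarrow>
     simple_path \<kappa> \<and> path_image \<kappa> \<subseteq> X \<and> pathfinish \<kappa> = pathstart \<kappa>"

definition contractible_loop :: "'a::metric_space set \<Rightarrow> (real \<Rightarrow> 'a) \<Rightarrow> bool" where
  "contractible_loop X \<kappa> \<longleftrightarrow> (\<exists>a. homotopic_loops X \<kappa> (\<lambda>_. a))"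

primrec loop_power :: "(real \<Rightarrow> 'a::metric_space) \<Rightarrow> nat \<Rightarrow> (real \<Rightarrow> 'a)" where
  "loop_power \<tau> 0 = (\<lambda>_. pathstart \<tau>)"
| "loop_power \<tau> (Suc n) = \<tau> +++ loop_power \<tau> n"

end

theory Submission
 imports Defs "HOL-Complex_Analysis.Complex_Analysis"
begin

text \<open>The developing map presents the surface as the quotient of the upper half-plane by a discrete,
torsion-free group of Moebius transformations. Normalise a cusp at infinity with stabiliser generated
by z + 1. The axis of a hyperbolic element g of trace t and lower left entry c is then a semicircle
of radius about t / (2 |c|). If |c| is minimal, the part of the axis between g and its inverse
isometric circle stays in the Ford domain, so the closed geodesic meets itself only along integer
translations, exactly floor (t / |c|) times. Finite generation makes the values of |c| discrete over
all cusps and bounds the translation lengths below. Hence a closed geodesic of length v has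
O(v^2 exp (v / 4)) self-intersections outside a single deep excursion into a cusp, which
contributes at most t / |c|. With c0 the least value of |c|, the products of an element realising
c0 with translations give competitors of trace at most (k + 1) c0 with exactly k self-intersections.
For large k the shortest geodesic must therefore realise c0 itself, and comparing it with its own
products with translations gives k = floor (t / c0). Then g is the product of an element of trace
between 2 and c0 - 2, which is represented by the simple loop, and the k-th power of a translation.\<close>

section \<open>Moebius transformations of the upper half-plane\<close>

text \<open>Why the error term is harmless: a competitor with k self-intersections has trace at most
  (k + 1) c0, so the shortest geodesic has exp (v / 2) = O(k) and only O(sqrt k (log k)^2) stray
  intersections. Missing c0 means having at best the next value c1, which costs the fixed proportion
  1 - c0 / c1 of k. The cut-off exp (v / 4) is the height at which excursions of a curve of length v
  into two different horoballs would contradict the disjointness of horoballs.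

  Finite type is given only as finite generation of the fundamental group. What stands in for a
  compactification is a compact set whose full preimage in the half-plane is connected. Two
  horoballs, or two regions beyond an axis, that miss this preimage are disjoint unless they belong
  to the same cusp or axis: otherwise a Euclidean ray in their union would separate it. With
  compactness this gives finitely many cusps and a least translation length.

  Matrices of determinant 1 represent the transformations, so that entries and traces are numbers;
  the price is that each transformation occurs with both signs.\<close>

abbreviation UH :: "complex set" where "UH \<equiv> upper_half_plane"

lemma UH_iff [simp]: "z \<in> UH \<longleftrightarrow> 0 < Im z"
 by (simp add: upper_half_plane_def)

typedef sl2 = "{(a::real, b::real, c::real, d::real). a * d - b * c = 1}"
 by (rule exI [of _ "(1, 0, 0, 1)"]) simp

definition mA :: "sl2 \<Rightarrow> real" where "mA g = fst (Rep_sl2 g)"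
definition mB :: "sl2 \<Rightarrow> real" where "mB g = fst (snd (Rep_sl2 g))"
definition mC :: "sl2 \<Rightarrow> real" where "mC g = fst (snd (snd (Rep_sl2 g)))"
definition mD :: "sl2 \<Rightarrow> real" where "mD g = snd (snd (snd (Rep_sl2 g)))"

definition mk :: "real \<Rightarrow> real \<Rightarrow> real \<Rightarrow> real \<Rightarrow> sl2" where
 "mk a b c d = Abs_sl2 (a, b, c, d)"

lemma sl2_det: "mA g * mD g - mB g * mC g = 1"
 using Rep_sl2 [of g] by (auto simp: mA_def mB_def mC_def mD_def)

lemma sl2_eqI: "mA g = mA h \<Longrightarrow> mB g = mB h \<Longrightarrow> mC g = mC h \<Longrightarrow> mD g = mD h \<Longrightarrow> g = h"
 by (metis Rep_sl2_inject mA_def mB_def mC_def mD_def prod.collapse)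

lemma mk_sel:
 assumes "a * d - b * c = 1"
 shows "mA (mk a b c d) = a" "mB (mk a b c d) = b" "mC (mk a b c d) = c" "mD (mk a b c d) = d"
 using assms by (simp_all add: mA_def mB_def mC_def mD_def mk_def Abs_sl2_inverse)

instantiation sl2 :: "{monoid_mult, uminus}"
begin

definition one_sl2 :: sl2 where "1 = mk 1 0 0 1"

definition times_sl2 :: "sl2 \<Rightarrow> sl2 \<Rightarrow> sl2" where
 "g * h = mk (mA g * mA h + mB g * mC h) (mA g * mB h + mB g * mD h)
       (mC g * mA h + mD g * mC h) (mC g * mB h + mD g * mD h)"

definition uminus_sl2 :: "sl2 \<Rightarrow> sl2" where
 "- g = mk (- mA g) (- mB g) (- mC g) (- mD g)"

lemma sl2_one_sel: "mA 1 = 1" "mB 1 = 0" "mC 1 = 0" "mD 1 = 1"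
 by (simp_all add: one_sl2_def mk_sel)

lemma sl2_times_sel:
 "mA (g * h) = mA g * mA h + mB g * mC h" "mB (g * h) = mA g * mB h + mB g * mD h"
 "mC (g * h) = mC g * mA h + mD g * mC h" "mD (g * h) = mC g * mB h + mD g * mD h"
proof -
 have "(mA g * mA h + mB g * mC h) * (mC g * mB h + mD g * mD h)
   - (mA g * mB h + mB g * mD h) * (mC g * mA h + mD g * mC h)
   = (mA g * mD g - mB g * mC g) * (mA h * mD h - mB h * mC h)"
  by (simp add: algebra_simps)
 also have "\<dots> = 1" by (simp add: sl2_det)
 finally have *: "(mA g * mA h + mB g * mC h) * (mC g * mB h + mD g * mD h)
   - (mA g * mB h + mB g * mD h) * (mC g * mA h + mD g * mC h) = 1" .
 show "mA (g * h) = mA g * mA h + mB g * mC h" "mB (g * h) = mA g * mB h + mB g * mD h"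
 "mC (g * h) = mC g * mA h + mD g * mC h" "mD (g * h) = mC g * mB h + mD g * mD h"
  unfolding times_sl2_def by (rule mk_sel [OF *])+
qed

instance
 by standard (rule sl2_eqI; simp add: sl2_times_sel sl2_one_sel algebra_simps)+

end

lemma sl2_uminus_sel: "mA (- g) = - mA g" "mB (- g) = - mB g" "mC (- g) = - mC g" "mD (- g) = - mD g"
 unfolding uminus_sl2_def by (rule mk_sel; use sl2_det [of g] in simp)+

text \<open>The adjugate. The type is an instance of monoids only, so the inverse is a function of
  its own.\<close>

definition minv :: "sl2 \<Rightarrow> sl2" where "minv g = mk (mD g) (- mB g) (- mC g) (mA g)"

lemma minv_sel: "mA (minv g) = mD g" "mB (minv g) = - mB g" "mC (minv g) = - mC g" "mD (minv g) = mA g"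
 unfolding minv_def by (rule mk_sel; use sl2_det [of g] in \<open>simp add: algebra_simps\<close>)+

definition Tr :: "real \<Rightarrow> sl2" where "Tr x = mk 1 x 0 1"

lemma Tr_sel: "mA (Tr x) = 1" "mB (Tr x) = x" "mC (Tr x) = 0" "mD (Tr x) = 1"
 by (simp_all add: Tr_def mk_sel)

text \<open>It acts as multiplication by \<open>exp s\<close>, which is the translation by distance
  \<open>s\<close> along the imaginary axis; hence the halved exponents.\<close>

definition Dg :: "real \<Rightarrow> sl2" where "Dg s = mk (exp (s / 2)) 0 0 (exp (- s / 2))"

lemma Dg_sel: "mA (Dg s) = exp (s / 2)" "mB (Dg s) = 0" "mC (Dg s) = 0" "mD (Dg s) = exp (- (s / 2))"
proof -
 have "exp (s / 2) * exp (- s / 2) - 0 * 0 = (1::real)" by (simp flip: exp_add)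
 from mk_sel [OF this]
 show "mA (Dg s) = exp (s / 2)" "mB (Dg s) = 0" "mC (Dg s) = 0" "mD (Dg s) = exp (- (s / 2))"
  by (simp_all add: Dg_def)
qed

lemmas sl2_sel = sl2_one_sel sl2_times_sel sl2_uminus_sel minv_sel Tr_sel Dg_sel

definition trc :: "sl2 \<Rightarrow> real" where "trc g = mA g + mD g"

lemma minv_left [simp]: "minv g * g = 1"
 by (rule sl2_eqI; use sl2_det [of g] in \<open>simp add: sl2_sel algebra_simps\<close>)

lemma minv_right [simp]: "g * minv g = 1"
 by (rule sl2_eqI; use sl2_det [of g] in \<open>simp add: sl2_sel algebra_simps\<close>)

lemma minv_left2 [simp]: "minv g * (g * h) = h"
 by (metis minv_left mult.assoc mult.left_neutral)

lemma minv_right2 [simp]: "g * (minv g * h) = h"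
 by (metis minv_right mult.assoc mult.left_neutral)

lemma minv_minv [simp]: "minv (minv g) = g"
 by (rule sl2_eqI) (simp_all add: sl2_sel)

lemma minv_mult: "minv (g * h) = minv h * minv g"
 by (rule sl2_eqI) (simp_all add: sl2_sel algebra_simps)

lemma minv_one [simp]: "minv 1 = 1"
 by (rule sl2_eqI) (simp_all add: sl2_sel)

lemma sl2_mult_minus [simp]: "g * (- h) = - (g * h)" "(- g) * h = - (g * h)" for g h :: sl2
 by (rule sl2_eqI; simp add: sl2_sel algebra_simps)+

lemma sl2_minus_minus [simp]: "- (- g) = g" for g :: sl2
 by (rule sl2_eqI) (simp_all add: sl2_sel)

lemma minv_minus [simp]: "minv (- g) = - minv g"
 by (rule sl2_eqI) (simp_all add: sl2_sel)

lemma Tr_add: "Tr x * Tr y = Tr (x + y)"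
 by (rule sl2_eqI) (simp_all add: sl2_sel algebra_simps)

lemma minv_Tr [simp]: "minv (Tr x) = Tr (- x)"
 by (rule sl2_eqI) (simp_all add: sl2_sel)

lemma Tr_0 [simp]: "Tr 0 = 1"
 by (rule sl2_eqI) (simp_all add: sl2_sel)

lemma Dg_add: "Dg x * Dg y = Dg (x + y)"
 by (rule sl2_eqI) (simp_all add: sl2_sel add_divide_distrib flip: exp_add)

lemma minv_Dg [simp]: "minv (Dg x) = Dg (- x)"
 by (rule sl2_eqI) (simp_all add: sl2_sel)

lemma Dg_0 [simp]: "Dg 0 = 1"
 by (rule sl2_eqI) (simp_all add: sl2_sel)

lemma trc_conj: "trc (minv N * g * N) = trc g"
proof -
 have "trc (minv N * g * N) = trc g * (mA N * mD N - mB N * mC N)"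
  by (simp add: trc_def sl2_sel algebra_simps)
 thus ?thesis by (simp add: sl2_det)
qed

lemma trc_conj': "trc (N * g * minv N) = trc g"
 using trc_conj [of "minv N" g] by simp

section \<open>Action by linear fractional maps\<close>

definition mob :: "sl2 \<Rightarrow> complex \<Rightarrow> complex" where
 "mob g z = (of_real (mA g) * z + of_real (mB g)) / (of_real (mC g) * z + of_real (mD g))"

definition den :: "sl2 \<Rightarrow> complex \<Rightarrow> complex" where
 "den g z = of_real (mC g) * z + of_real (mD g)"

lemma mob_den: "mob g z = (of_real (mA g) * z + of_real (mB g)) / den g z"
 by (simp add: mob_def den_def)

lemma Im_den: "Im (den g z) = mC g * Im z" and Re_den: "Re (den g z) = mC g * Re z + mD g"
 by (simp_all add: den_def)

lemma den_nz: "z \<in> UH \<Longrightarrow> den g z \<noteq> 0"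
proof
 assume "z \<in> UH" "den g z = 0"
 hence "mC g * Im z = 0" "mC g * Re z + mD g = 0"
  using Im_den Re_den by (metis zero_complex.sel)+
 hence "mC g = 0" "mD g = 0" using \<open>z \<in> UH\<close> by auto
 thus False using sl2_det [of g] by simp
qed

lemma Im_mob: "Im (mob g z) = Im z / (cmod (den g z))\<^sup>2"
proof -
 have "Im (mob g z) = Im ((of_real (mA g) * z + of_real (mB g)) * cnj (den g z)) / (cmod (den g z))\<^sup>2"
  by (simp add: mob_den Im_complex_div_eq_0 complex_div_cnj [of _ "den g z"] flip: of_real_power)
 also have "Im ((of_real (mA g) * z + of_real (mB g)) * cnj (den g z)) = (mA g * mD g - mB g * mC g) * Im z"
  by (simp add: den_def algebra_simps)
 finally show ?thesis by (simp add: sl2_det)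
qed

lemma mob_in_UH [simp]: "z \<in> UH \<Longrightarrow> mob g z \<in> UH"
 using den_nz [of z g] by (simp add: Im_mob)

lemma Im_mob_pos [simp]: "0 < Im z \<Longrightarrow> 0 < Im (mob g z)"
 using mob_in_UH by auto

lemma mob_mult: "z \<in> UH \<Longrightarrow> mob (g * h) z = mob g (mob h z)"
proof -
 assume z: "z \<in> UH"
 have nz: "den h z \<noteq> 0" "den g (mob h z) \<noteq> 0" "den (g * h) z \<noteq> 0"
  using z den_nz mob_in_UH by blast+
 have d: "den (g * h) z = den g (mob h z) * den h z"
  using nz(1) by (simp add: den_def [of g] den_def [of "g * h"] mob_den sl2_sel field_simps)
   (simp add: den_def algebra_simps)
 have "mob g (mob h z) = ((of_real (mA g) * mob h z + of_real (mB g)) * den h z) / den (g * h) z"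
  using nz by (simp add: mob_den [of g] d)
 also have "(of_real (mA g) * mob h z + of_real (mB g)) * den h z = of_real (mA (g * h)) * z + of_real (mB (g * h))"
  using nz(1) by (simp add: mob_den sl2_sel field_simps) (simp add: den_def algebra_simps)
 finally show ?thesis by (simp add: mob_den [of "g * h"])
qed

lemma mob_1 [simp]: "mob 1 z = z"
 by (simp add: mob_def sl2_sel)

lemma mob_uminus [simp]: "mob (- g) z = mob g z"
proof -
 have "mob (- g) z = (- (of_real (mA g) * z + of_real (mB g))) / (- (of_real (mC g) * z + of_real (mD g)))"
  by (simp add: mob_def sl2_sel)
 thus ?thesis by (simp only: minus_divide_divide) (simp add: mob_def)
qed

lemma mob_Tr [simp]: "mob (Tr x) z = z + of_real x"
 by (simp add: mob_def sl2_sel)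

lemma mob_Dg [simp]: "mob (Dg s) z = of_real (exp s) * z"
proof -
 have "complex_of_real (exp (s / 2)) / complex_of_real (exp (- (s / 2))) = of_real (exp s)"
  by (simp flip: of_real_divide exp_diff)
 thus ?thesis by (simp add: mob_def sl2_sel) (metis (no_types) mult.commute times_divide_eq_right)
qed

lemma mob_minv [simp]: "z \<in> UH \<Longrightarrow> mob (minv g) (mob g z) = z" "z \<in> UH \<Longrightarrow> mob g (mob (minv g) z) = z"
 by (metis minv_left mob_1 mob_mult, metis minv_right mob_1 mob_mult)

lemma mob_diff:
 assumes "z \<in> UH" "w \<in> UH"
 shows "mob g z - mob g w = (z - w) / (den g z * den g w)"
proof -
 have nz: "den g z \<noteq> 0" "den g w \<noteq> 0" using assms den_nz by blast+
 have "mob g z - mob g w = ((of_real (mA g) * z + of_real (mB g)) * den g w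
   - (of_real (mA g) * w + of_real (mB g)) * den g z) / (den g z * den g w)"
  using nz by (simp add: mob_den field_simps)
 also have "(of_real (mA g) * z + of_real (mB g)) * den g w
   - (of_real (mA g) * w + of_real (mB g)) * den g z = of_real (mA g * mD g - mB g * mC g) * (z - w)"
  by (simp add: den_def algebra_simps)
 finally show ?thesis by (simp add: sl2_det)
qed

lemma continuous_on_mob: "continuous_on UH (mob g)"
 unfolding mob_den using den_nz by (auto intro!: continuous_intros simp: den_def)

lemma holomorphic_on_mob: "mob g holomorphic_on UH"
 unfolding mob_den [abs_def] den_def using den_nz [unfolded den_def] by (auto intro!: holomorphic_intros)

lemma open_UH [simp]: "open UH"
 using open_halfspace_Im_gt [of 0] by (simp add: upper_half_plane_def)

lemma convex_UH [simp]: "convex UH"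
 using convex_halfspace_Im_gt [of 0] by (simp add: upper_half_plane_def)

lemma isCont_mob: "z \<in> UH \<Longrightarrow> isCont (mob g) z"
 using continuous_on_mob continuous_on_eq_continuous_at open_UH by blast

text \<open>If the lower left entry is nonzero, the real and imaginary parts of the fixed-point
  equation determine \<open>Re z\<close> and the modulus of \<open>z\<close>, hence
  \<open>z\<close>. A second fixed point therefore forces that entry to vanish.\<close>

lemma mob_fix_two:
 assumes "z \<in> UH" "w \<in> UH" "z \<noteq> w" "mob g z = z" "mob g w = w"
 shows "g = 1 \<or> g = - 1"
proof -
 have fx: "of_real (mA g) * z + of_real (mB g) = z * den g z" if "z \<in> UH" "mob g z = z" for z
  using that den_nz [of z g] by (metis mob_den nonzero_divide_eq_eq)
 have im: "mA g * Im z = 2 * mC g * Re z * Im z + mD g * Im z"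
  and re: "mA g * Re z + mB g = mC g * ((Re z)\<^sup>2 - (Im z)\<^sup>2) + mD g * Re z" if "z \<in> UH" "mob g z = z" for z
  using arg_cong [OF fx [OF that], of Im] arg_cong [OF fx [OF that], of Re]
  by (simp_all add: den_def algebra_simps power2_eq_square)
 have im': "mA g - mD g = 2 * mC g * Re z" if "z \<in> UH" "mob g z = z" for z
  using im [OF that] that by (metis (no_types, lifting) UH_iff add_diff_cancel_right' mult_cancel_right mult.commute less_irrefl distrib_left)
 have re': "mB g = - mC g * ((Re z)\<^sup>2 + (Im z)\<^sup>2)" if "z \<in> UH" "mob g z = z" for z
 proof -
  have "mB g = mC g * ((Re z)\<^sup>2 - (Im z)\<^sup>2) - (mA g - mD g) * Re z"
   using re [OF that] by (simp add: algebra_simps)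
  thus ?thesis unfolding im' [OF that] by (simp add: algebra_simps power2_eq_square)
 qed
 have "mC g = 0"
 proof (rule ccontr)
  assume c: "mC g \<noteq> 0"
  hence "Re z = Re w" using im' [OF assms(1,4)] im' [OF assms(2,5)] by auto
  moreover have "(Im z)\<^sup>2 = (Im w)\<^sup>2" using re' [OF assms(1,4)] re' [OF assms(2,5)] c \<open>Re z = Re w\<close> by auto
  ultimately have "z = w" using assms(1,2) by (auto simp: complex_eq_iff power2_eq_iff)
  thus False using assms(3) by simp
 qed
 hence "mB g = 0" "mA g = mD g" using re' [OF assms(1,4)] im' [OF assms(1,4)] by auto
 with \<open>mC g = 0\<close> have "mA g * mA g = 1" using sl2_det [of g] by simp
 hence "mA g = 1 \<or> mA g = - 1" by (simp add: square_eq_1_iff)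
 thus ?thesis
 proof
  assume "mA g = 1"
  hence "g = 1" using \<open>mC g = 0\<close> \<open>mB g = 0\<close> \<open>mA g = mD g\<close> by (intro sl2_eqI) (auto simp: sl2_sel)
  thus ?thesis ..
 next
  assume "mA g = - 1"
  hence "g = - 1" using \<open>mC g = 0\<close> \<open>mB g = 0\<close> \<open>mA g = mD g\<close> by (intro sl2_eqI) (auto simp: sl2_sel)
  thus ?thesis ..
 qed
qed

section \<open>The hyperbolic distance\<close>

lemma cosh_hdist:
 assumes "z \<in> UH" "w \<in> UH"
 shows "cosh (hdist z w) = 1 + (cmod (z - w))\<^sup>2 / (2 * Im z * Im w)"
 unfolding hdist_def using assms by (intro cosh_arcosh_real) auto

lemma hdist_nonneg [simp]:
 assumes "z \<in> UH" "w \<in> UH" shows "0 \<le> hdist z w"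
 unfolding hdist_def using assms by (intro arcosh_nonneg_real) auto

lemma hdist_commute: "hdist z w = hdist w z"
 by (simp add: hdist_def norm_minus_commute mult.assoc mult.commute [of "Im z"])

lemma hdist_refl [simp]: "hdist z z = 0"
 by (simp add: hdist_def)

lemma hdist_eq_iff:
 assumes "z \<in> UH" "w \<in> UH" "z' \<in> UH" "w' \<in> UH"
 shows "hdist z w = hdist z' w' \<longleftrightarrow> (cmod (z - w))\<^sup>2 / (Im z * Im w) = (cmod (z' - w'))\<^sup>2 / (Im z' * Im w')"
proof -
 have half: "a / (2 * b * c) = a / (b * c) / 2" for a b c :: real by simp
 have "hdist z w = hdist z' w' \<longleftrightarrow> cosh (hdist z w) = cosh (hdist z' w')"
  using assms hdist_nonneg by (metis arcosh_cosh_real)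
 also have "\<dots> \<longleftrightarrow> (cmod (z - w))\<^sup>2 / (Im z * Im w) = (cmod (z' - w'))\<^sup>2 / (Im z' * Im w')"
  unfolding cosh_hdist [OF assms(1,2)] cosh_hdist [OF assms(3,4)] half by auto
 finally show ?thesis .
qed

lemma hdist_eq_0: "z \<in> UH \<Longrightarrow> w \<in> UH \<Longrightarrow> hdist z w = 0 \<longleftrightarrow> z = w"
 using hdist_eq_iff [of z w z z] by auto

lemma hdist_mob [simp]:
 assumes "z \<in> UH" "w \<in> UH" shows "hdist (mob g z) (mob g w) = hdist z w"
proof -
 have nz: "cmod (den g z) \<noteq> 0" "cmod (den g w) \<noteq> 0" using assms den_nz by auto
 have "(cmod (mob g z - mob g w))\<^sup>2 / (Im (mob g z) * Im (mob g w)) = (cmod (z - w))\<^sup>2 / (Im z * Im w)"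
  using nz assms
  by (simp add: mob_diff Im_mob norm_divide norm_mult power_divide power_mult_distrib divide_simps)
 thus ?thesis using assms hdist_eq_iff by simp
qed

text \<open>Replacing the Euclidean distance by the difference of heights turns the formula for the
  cosh of the distance into the cosh of the difference of log-heights. That log-height is
  1-Lipschitz serves throughout, first for the triangle inequality.\<close>

lemma ln_Im_le_hdist:
 assumes "z \<in> UH" "w \<in> UH"
 shows "\<bar>ln (Im z) - ln (Im w)\<bar> \<le> hdist z w"
proof -
 have pos: "0 < Im z" "0 < Im w" using assms by auto
 have "(Im z - Im w)\<^sup>2 \<le> (cmod (z - w))\<^sup>2"
  using abs_Im_le_cmod [of "z - w"] by (metis abs_le_square_iff abs_norm_cancel minus_complex.simps(2))
 hence "1 + (Im z - Im w)\<^sup>2 / (2 * Im z * Im w) \<le> cosh (hdist z w)"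
  using pos by (simp add: cosh_hdist assms divide_right_mono)
 moreover have "1 + (Im z - Im w)\<^sup>2 / (2 * Im z * Im w) = cosh (ln (Im z) - ln (Im w))"
  using pos by (simp add: cosh_def exp_diff exp_minus field_simps power2_eq_square)
 ultimately have "cosh (ln (Im z) - ln (Im w)) \<le> cosh (hdist z w)" by simp
 thus ?thesis
  by (metis abs_ge_zero assms cosh_real_abs cosh_real_nonneg_le_iff hdist_nonneg)
qed

lemma hdist_iaxis:
 assumes "0 < x" "0 < y"
 shows "hdist (\<i> * of_real x) (\<i> * of_real y) = \<bar>ln x - ln y\<bar>"
proof -
 have "cosh (hdist (\<i> * of_real x) (\<i> * of_real y)) = 1 + (x - y)\<^sup>2 / (2 * x * y)"
  using assms by (subst cosh_hdist) (auto simp: cmod_def)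
 also have "\<dots> = cosh (ln x - ln y)"
  using assms by (simp add: cosh_def exp_diff exp_minus field_simps power2_eq_square)
 finally show ?thesis
  using assms by (metis UH_iff abs_ge_zero arcosh_cosh_real cosh_real_abs hdist_nonneg complex_i_mult_minus Im_i_times Re_complex_of_real)
qed

text \<open>The geodesic through the two points is a vertical line or a semicircle with centre on
  the real line; either can be moved to the imaginary axis.\<close>

lemma sl2_to_iaxis:
 assumes "z \<in> UH" "w \<in> UH"
 obtains g x y where "0 < x" "0 < y" "mob g z = \<i> * of_real x" "mob g w = \<i> * of_real y"
proof (cases "Re z = Re w")
 case True
 show ?thesis
 proof
  show "mob (Tr (- Re z)) z = \<i> * of_real (Im z)" "mob (Tr (- Re z)) w = \<i> * of_real (Im w)"
   using True by (auto simp: complex_eq_iff)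
 qed (use assms in auto)
next
 case False
 \<comment> \<open>The real centre, and then the radius, of the semicircle through \<open>z\<close>
   and \<open>w\<close>.\<close>
 define c where "c = ((cmod z)\<^sup>2 - (cmod w)\<^sup>2) / (2 * (Re z - Re w))"
 define r where "r = sqrt ((Re z - c)\<^sup>2 + (Im z)\<^sup>2)"
 have pos: "(Re z - c)\<^sup>2 + (Im z)\<^sup>2 > 0" using assms by (simp add: sum_power2_gt_zero_iff)
 hence r: "0 < r" "r\<^sup>2 = (Re z - c)\<^sup>2 + (Im z)\<^sup>2" by (auto simp: r_def)
 have "2 * (Re z - Re w) * c = (cmod z)\<^sup>2 - (cmod w)\<^sup>2" using False by (simp add: c_def)
 hence r': "r\<^sup>2 = (Re w - c)\<^sup>2 + (Im w)\<^sup>2"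
  unfolding r(2) cmod_power2 by (simp add: algebra_simps power2_eq_square)
 define s where "s = sqrt (2 * r)"
 have s: "s \<noteq> 0" "s * s = 2 * r" using r by (auto simp: s_def)
 have det: "(1 / s) * ((c + r) / s) - (- (c - r) / s) * (- 1 / s) = 1"
 proof -
  have "(1 / s) * ((c + r) / s) - (- (c - r) / s) * (- 1 / s) = (2 * r) / (s * s)"
   by (simp add: algebra_simps add_divide_distrib diff_divide_distrib)
  thus ?thesis using s r(1) by simp
 qed
 \<comment> \<open>Sends \<open>c - r\<close> to 0 and \<open>c + r\<close> to infinity; the
   division by \<open>s\<close> makes the determinant 1.\<close>
 define g where "g = mk (1 / s) (- (c - r) / s) (- 1 / s) ((c + r) / s)"
 note gs = mk_sel [OF det, folded g_def]
 have *: "Re (mob g u) = 0" if "u \<in> UH" "r\<^sup>2 = (Re u - c)\<^sup>2 + (Im u)\<^sup>2" for u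
 proof -
  have "mob g u = ((u - of_real (c - r)) / of_real s) / ((of_real (c + r) - u) / of_real s)"
   unfolding mob_def gs by (simp add: diff_divide_distrib add_divide_distrib)
  also have "\<dots> = (u - of_real (c - r)) / (of_real (c + r) - u)" using s by simp
  finally have m: "mob g u = (u - of_real (c - r)) / (of_real (c + r) - u)" .
  have "Re ((u - of_real (c - r)) * cnj (of_real (c + r) - u)) = 0"
   using that(2) by (simp add: algebra_simps power2_eq_square)
  thus ?thesis unfolding m by (metis Re_complex_div_eq_0)
 qed
 show ?thesis
 proof
  show "mob g z = \<i> * of_real (Im (mob g z))" "mob g w = \<i> * of_real (Im (mob g w))"
   using * [OF assms(1) r(2)] * [OF assms(2) r'] by (auto simp: complex_eq_iff)
 qed (use assms in auto)
qed

text \<open>With the outer points on the imaginary axis their distance is the difference of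
  log-heights, and log-height is 1-Lipschitz.\<close>

lemma hdist_triangle:
 assumes "x \<in> UH" "y \<in> UH" "z \<in> UH"
 shows "hdist x z \<le> hdist x y + hdist y z"
proof -
 obtain g a b where g: "0 < a" "0 < b" "mob g x = \<i> * of_real a" "mob g z = \<i> * of_real b"
  using sl2_to_iaxis [OF assms(1,3)] by blast
 have "hdist x z = \<bar>ln a - ln b\<bar>"
  by (metis g hdist_iaxis hdist_mob assms(1,3))
 also have "\<dots> \<le> \<bar>ln a - ln (Im (mob g y))\<bar> + \<bar>ln (Im (mob g y)) - ln b\<bar>" by simp
 also have "\<dots> \<le> hdist (mob g x) (mob g y) + hdist (mob g y) (mob g z)"
  using ln_Im_le_hdist [of "mob g x" "mob g y"] ln_Im_le_hdist [of "mob g y" "mob g z"] assms g by simp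
 finally show ?thesis using assms by simp
qed

lemma hdist_less_iff:
 assumes "z \<in> UH" "w \<in> UH" "0 \<le> r"
 shows "hdist z w < r \<longleftrightarrow> (cmod (z - w))\<^sup>2 < 2 * Im z * Im w * (cosh r - 1)"
proof -
 have "hdist z w < r \<longleftrightarrow> cosh (hdist z w) < cosh r"
  using assms by (simp add: cosh_real_nonneg_less_iff)
 also have "\<dots> \<longleftrightarrow> (cmod (z - w))\<^sup>2 < 2 * Im z * Im w * (cosh r - 1)"
  using assms by (auto simp: cosh_hdist field_simps)
 finally show ?thesis .
qed

lemma continuous_on_hdist:
 "continuous_on UH (\<lambda>z. hdist z w)" if "w \<in> UH"
 unfolding hdist_def by (rule continuous_on_compose2 [OF continuous_on_arcosh [of "{1..}"]])
  (use that in \<open>auto intro!: continuous_intros\<close>)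

lemma isCont_hdist: "z \<in> UH \<Longrightarrow> w \<in> UH \<Longrightarrow> isCont (\<lambda>z. hdist z w) z"
 using continuous_on_hdist continuous_on_eq_continuous_at open_UH by blast

lemma open_hball: "w \<in> UH \<Longrightarrow> open {z \<in> UH. hdist z w < r}"
 using continuous_open_preimage [OF continuous_on_hdist [of w] open_UH open_lessThan [of r]]
 by (simp add: Int_def vimage_def)

text \<open>The heights converge because log-height is Lipschitz; the distance formula then returns
  Euclidean convergence.\<close>

lemma tendsto_hdist_0:
 assumes "w \<in> UH" "\<And>n. u n \<in> UH" "(\<lambda>n. hdist (u n) w) \<longlonglongrightarrow> 0"
 shows "u \<longlonglongrightarrow> w"
proof -
 have "(\<lambda>n. \<bar>ln (Im (u n)) - ln (Im w)\<bar>) \<longlonglongrightarrow> 0"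
  by (rule tendsto_sandwich [OF _ _ tendsto_const assms(3)])
   (use ln_Im_le_hdist [OF assms(2,1)] in auto)
 hence "(\<lambda>n. ln (Im (u n)) - ln (Im w)) \<longlonglongrightarrow> 0" using tendsto_rabs_zero_iff by blast
 hence "(\<lambda>n. ln (Im (u n))) \<longlonglongrightarrow> ln (Im w)" by (rule LIM_zero_cancel)
 hence "(\<lambda>n. exp (ln (Im (u n)))) \<longlonglongrightarrow> exp (ln (Im w))" by (rule tendsto_exp)
 hence im: "(\<lambda>n. Im (u n)) \<longlonglongrightarrow> Im w" using assms(1,2) by simp
 have "(\<lambda>n. 2 * Im (u n) * Im w * (cosh (hdist (u n) w) - 1)) \<longlonglongrightarrow> 2 * Im w * Im w * (cosh 0 - 1)"
  by (intro tendsto_mult tendsto_diff tendsto_const im tendsto_cosh assms(3))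
 moreover have "2 * Im (u n) * Im w * (cosh (hdist (u n) w) - 1) = (cmod (u n - w))\<^sup>2" for n
 proof -
  have "Im (u n) \<noteq> 0" "Im w \<noteq> 0" using assms(1) assms(2) [of n] by auto
  have *: "cosh (hdist (u n) w) - 1 = (cmod (u n - w))\<^sup>2 / (2 * Im (u n) * Im w)"
   using cosh_hdist [OF assms(2) [of n] assms(1)] by simp
  show ?thesis unfolding * using \<open>Im (u n) \<noteq> 0\<close> \<open>Im w \<noteq> 0\<close> by simp
 qed
 ultimately have "(\<lambda>n. (cmod (u n - w))\<^sup>2) \<longlonglongrightarrow> 0" by simp
 hence "(\<lambda>n. sqrt ((cmod (u n - w))\<^sup>2)) \<longlonglongrightarrow> sqrt 0" by (rule tendsto_real_sqrt)
 hence "(\<lambda>n. cmod (u n - w)) \<longlonglongrightarrow> 0" by simp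
 thus ?thesis by (rule LIM_zero_cancel [OF tendsto_norm_zero_cancel])
qed

text \<open>The hyperbolic metric is the Euclidean one divided by the height. The proof reduces to
  \<open>cosh x\<close> being at least 1 + x^2 / 2.\<close>

lemma hdist_le_Euclid:
 assumes "m > 0" "Im z \<ge> m" "Im w \<ge> m"
 shows "hdist z w \<le> cmod (z - w) / m"
proof -
 have U: "z \<in> UH" "w \<in> UH" using assms by auto
 define x where "x = cmod (z - w) / m"
 have x: "0 \<le> x" using assms by (simp add: x_def)
 have "m * m \<le> Im z * Im w" using assms by (intro mult_mono) auto
 hence "(cmod (z - w))\<^sup>2 / (2 * Im z * Im w) \<le> (cmod (z - w))\<^sup>2 / (2 * (m * m))"
  using assms by (intro divide_left_mono) auto
 also have "\<dots> = x\<^sup>2 / 2" by (simp add: x_def power2_eq_square)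
 finally have "cosh (hdist z w) \<le> 1 + x\<^sup>2 / 2" unfolding cosh_hdist [OF U] by linarith
 also have "\<dots> \<le> cosh x"
 proof -
  have "x / 2 \<le> sinh (x / 2)" using x using real_le_x_sinh [of "x / 2"] by (simp add: sinh_field_def exp_minus)
  hence "(x / 2)\<^sup>2 \<le> (sinh (x / 2))\<^sup>2" using x by (intro power_mono) auto
  moreover have "cosh x = 1 + 2 * (sinh (x / 2))\<^sup>2"
   using cosh_double [of "x / 2"] cosh_square_eq [of "x / 2"] by simp
  ultimately show ?thesis by (simp add: power_divide)
 qed
 finally show ?thesis unfolding x_def [symmetric]
  using x U by (simp add: cosh_real_nonneg_le_iff)
qed

section \<open>Holomorphic local isometries\<close>

lemma sl2_to_i:
 assumes "z \<in> UH" obtains g where "mob g z = \<i>"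
proof
 have "mob (Dg (- ln (Im z)) * Tr (- Re z)) z = of_real (exp (- ln (Im z))) * (z - of_real (Re z))"
  using assms by (subst mob_mult) auto
 also have "exp (- ln (Im z)) = 1 / Im z" using assms by (simp add: exp_minus divide_inverse)
 also have "of_real (1 / Im z) * (z - of_real (Re z)) = \<i>"
  using assms by (auto simp: complex_eq_iff)
 finally show "mob (Dg (- ln (Im z)) * Tr (- Re z)) z = \<i>" .
qed

definition cay :: "complex \<Rightarrow> complex" where "cay w = (w - \<i>) / (w + \<i>)"

definition cayinv :: "complex \<Rightarrow> complex" where "cayinv ze = \<i> * (1 + ze) / (1 - ze)"

lemma UH_plus_i_nz: "w \<in> UH \<Longrightarrow> w + \<i> \<noteq> 0"
 by (auto simp: complex_eq_iff)

lemma cayinv_cay: "w \<in> UH \<Longrightarrow> cayinv (cay w) = w"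
proof -
 assume "w \<in> UH"
 hence nz: "w + \<i> \<noteq> 0" by (rule UH_plus_i_nz)
 have "1 + cay w = 2 * w / (w + \<i>)" "1 - cay w = 2 * \<i> / (w + \<i>)"
  using nz by (simp_all add: cay_def field_simps)
 thus ?thesis using nz by (simp add: cayinv_def)
qed

lemma cay_inj: "w \<in> UH \<Longrightarrow> w' \<in> UH \<Longrightarrow> cay w = cay w' \<Longrightarrow> w = w'"
 by (metis cayinv_cay)

lemma cay_cayinv: "ze \<noteq> 1 \<Longrightarrow> cay (cayinv ze) = ze"
proof -
 assume "ze \<noteq> 1"
 hence nz: "1 - ze \<noteq> 0" by simp
 have "cayinv ze - \<i> = 2 * \<i> * ze / (1 - ze)" "cayinv ze + \<i> = 2 * \<i> / (1 - ze)"
  using nz by (simp_all add: cayinv_def field_simps)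
 thus ?thesis using nz by (simp add: cay_def)
qed

text \<open>In the disc model the distance from the centre depends on the modulus alone, so
  preserved distances become a preserved modulus, the equality case of the Schwarz lemma.\<close>

lemma cmod_cay:
 assumes "w \<in> UH"
 shows "(cmod (cay w))\<^sup>2 = 1 - 2 / (cosh (hdist w \<i>) + 1)"
proof -
 have i: "\<i> \<in> UH" by simp
 define A where "A = (cmod (w - \<i>))\<^sup>2"
 have A: "0 \<le> A" "0 < Im w" using assms by (auto simp: A_def)
 have c: "(cmod (w + \<i>))\<^sup>2 = A + 4 * Im w"
  unfolding A_def cmod_power2 by (simp add: power2_eq_square algebra_simps)
 have "(cmod (cay w))\<^sup>2 = A / (A + 4 * Im w)"
  unfolding cay_def norm_divide power_divide c by (simp add: A_def)
 also have "\<dots> = 1 - 4 * Im w / (A + 4 * Im w)" using A by (simp add: field_simps)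
 finally have 1: "(cmod (cay w))\<^sup>2 = 1 - 4 * Im w / (A + 4 * Im w)" .
 have "cosh (hdist w \<i>) = 1 + A / (2 * Im w)" using cosh_hdist [OF assms i] by (simp add: A_def)
 hence "cosh (hdist w \<i>) + 1 = (A + 4 * Im w) / (2 * Im w)" using A by (simp add: field_simps)
 hence "2 / (cosh (hdist w \<i>) + 1) = 4 * Im w / (A + 4 * Im w)" by simp
 with 1 show ?thesis by simp
qed

text \<open>The rotation of the disc by \<open>al\<close> comes from the element whose entries are,
  up to sign, the real and imaginary parts of a square root of \<open>al\<close>.\<close>

lemma rotation_cay:
 assumes "cmod al = 1"
 obtains R where "\<And>w. w \<in> UH \<Longrightarrow> cay (mob R w) = al * cay w"
proof
 define \<beta> where "\<beta> = csqrt al"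
 have \<beta>2: "\<beta>\<^sup>2 = al" by (simp add: \<beta>_def)
 hence "(cmod \<beta>)\<^sup>2 = 1\<^sup>2" using assms by (metis norm_power one_power2)
 hence "cmod \<beta> = 1" by (rule power2_eq_imp_eq) auto
 hence n: "Re \<beta> * Re \<beta> - Im \<beta> * (- Im \<beta>) = 1"
  by (metis (no_types, opaque_lifting) cmod_power2 diff_minus_eq_add mult_minus_right one_power2 power2_eq_square)
 define R where "R = mk (Re \<beta>) (Im \<beta>) (- Im \<beta>) (Re \<beta>)"
 note Rs = mk_sel [OF n, folded R_def]
 have \<beta>cnj: "\<beta> * cnj \<beta> = 1" using \<open>cmod \<beta> = 1\<close> by (simp add: complex_norm_square [symmetric])
 show "cay (mob R w) = al * cay w" if w: "w \<in> UH" for w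
 proof -
  have nz: "den R w \<noteq> 0" "w + \<i> \<noteq> 0" "cnj \<beta> \<noteq> 0"
   using w den_nz UH_plus_i_nz \<beta>cnj by auto
  have "mob R w - \<i> = ((of_real (Re \<beta>) * w + of_real (Im \<beta>)) - \<i> * den R w) / den R w"
   using nz by (simp add: mob_den Rs field_simps)
  also have "(of_real (Re \<beta>) * w + of_real (Im \<beta>)) - \<i> * den R w = \<beta> * (w - \<i>)"
   by (simp add: den_def Rs complex_eq_iff algebra_simps)
  finally have 1: "mob R w - \<i> = \<beta> * (w - \<i>) / den R w" .
  have "mob R w + \<i> = ((of_real (Re \<beta>) * w + of_real (Im \<beta>)) + \<i> * den R w) / den R w"
   using nz by (simp add: mob_den Rs field_simps)
  also have "(of_real (Re \<beta>) * w + of_real (Im \<beta>)) + \<i> * den R w = cnj \<beta> * (w + \<i>)"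
   by (simp add: den_def Rs complex_eq_iff algebra_simps)
  finally have 2: "mob R w + \<i> = cnj \<beta> * (w + \<i>) / den R w" .
  have "cay (mob R w) = (\<beta> / cnj \<beta>) * cay w"
   unfolding cay_def 1 2 using nz by simp
  also have "\<beta> / cnj \<beta> = al"
  proof -
   have "\<beta> = al * cnj \<beta>" using \<beta>cnj \<beta>2 by (metis mult.assoc mult.right_neutral power2_eq_square)
   thus ?thesis using nz(3) by (metis nonzero_mult_div_cancel_right)
  qed
  finally show ?thesis .
 qed
qed

text \<open>Preserved distances to the one point \<open>z\<close> suffice: between Cayley transforms
  the map fixes 0 and preserves the modulus, so by the Schwarz lemma it is a rotation.\<close>

lemma holomorphic_isometry_mob:
 assumes z: "z \<in> UH" and S: "open S" "z \<in> S" "S \<subseteq> UH"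
  and holF: "F holomorphic_on S" and FUH: "\<And>u. u \<in> S \<Longrightarrow> F u \<in> UH"
  and iso: "\<And>u. u \<in> S \<Longrightarrow> hdist (F u) (F z) = hdist u z"
 obtains r g where "0 < r" "ball z r \<subseteq> S" "\<And>u. u \<in> ball z r \<Longrightarrow> F u = mob g u"
proof -
 obtain g1 where g1: "mob g1 z = \<i>" using sl2_to_i z by blast
 obtain g2 where g2: "mob g2 (F z) = \<i>" using sl2_to_i FUH S by blast
 define k where "k = (\<lambda>ze. mob (minv g1) (cayinv ze))"
 define \<phi> where "\<phi> = (\<lambda>ze. cay (mob g2 (F (k ze))))"
 have cayinv_UH: "cayinv ze \<in> UH" if "cmod ze < 1" for ze
 proof -
  have nz: "1 - ze \<noteq> 0" using that by auto
  have "Im (cayinv ze) = Im (\<i> * (1 + ze) * cnj (1 - ze)) / (cmod (1 - ze))\<^sup>2"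
   by (simp add: cayinv_def complex_div_cnj [of _ "1 - ze"] flip: of_real_power)
  also have "Im (\<i> * (1 + ze) * cnj (1 - ze)) = 1 - (cmod ze)\<^sup>2"
   unfolding cmod_power2 by (simp add: algebra_simps power2_eq_square)
  finally show ?thesis using that nz by (simp add: abs_square_less_1)
 qed
 have holci: "cayinv holomorphic_on ball 0 1"
  unfolding cayinv_def by (intro holomorphic_intros) auto
 have holk: "k holomorphic_on ball 0 1"
  unfolding k_def using holomorphic_on_compose_gen [OF holci holomorphic_on_mob] cayinv_UH
  by (simp add: o_def image_subset_iff del: UH_iff)
 have k0: "k 0 = z" unfolding k_def using mob_minv(1) [OF z, of g1] g1 by (simp add: cayinv_def)
 have "isCont k 0"
  using holomorphic_on_imp_continuous_on [OF holk] by (simp add: continuous_on_eq_continuous_at)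
 moreover obtain e where "0 < e" "ball (k 0) e \<subseteq> S" using S k0 openE by metis
 ultimately obtain r0 where "0 < r0" "\<And>ze. dist ze 0 < r0 \<Longrightarrow> dist (k ze) (k 0) < e"
  unfolding continuous_at_eps_delta by metis
 hence r0: "0 < r0" "\<And>ze. cmod ze < r0 \<Longrightarrow> k ze \<in> S"
  using \<open>ball (k 0) e \<subseteq> S\<close> by (auto simp: dist_commute)
 define r where "r = min r0 (1/2)"
 have r: "0 < r" "r < 1" "\<And>ze. cmod ze < r \<Longrightarrow> k ze \<in> S" using r0 by (auto simp: r_def)
 have mod\<phi>: "cmod (\<phi> ze) = cmod ze" if "cmod ze < r" for ze
 proof -
  have kS: "k ze \<in> S" "k ze \<in> UH" using r that S by blast+
  have c: "cayinv ze \<in> UH" using cayinv_UH that r by auto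
  have "mob g1 (k ze) = cayinv ze" unfolding k_def using c by simp
  hence "hdist (cayinv ze) \<i> = hdist (k ze) z" using hdist_mob [OF kS(2) z, of g1] g1 by simp
  also have "\<dots> = hdist (mob g2 (F (k ze))) \<i>"
   using iso [OF kS(1)] hdist_mob [of "F (k ze)" "F z" g2] FUH kS S g2 by metis
  finally have "(cmod (cay (cayinv ze)))\<^sup>2 = (cmod (\<phi> ze))\<^sup>2"
   unfolding \<phi>_def using c FUH [OF kS(1)] by (simp add: cmod_cay)
  thus ?thesis using that r by (subst (asm) cay_cayinv) auto
 qed
 have hol\<phi>: "\<phi> holomorphic_on ball 0 r"
 proof -
  have hol1: "F \<circ> k holomorphic_on ball 0 r"
   by (rule holomorphic_on_compose_gen [OF holomorphic_on_subset [OF holk] holF]) (use r in auto)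
  have hol2: "mob g2 \<circ> (F \<circ> k) holomorphic_on ball 0 r"
   by (rule holomorphic_on_compose_gen [OF hol1 holomorphic_on_mob]) (use r FUH in auto)
  have "cay holomorphic_on UH" unfolding cay_def using UH_plus_i_nz by (intro holomorphic_intros) auto
  hence "cay \<circ> (mob g2 \<circ> (F \<circ> k)) holomorphic_on ball 0 r"
   by (rule holomorphic_on_compose_gen [OF hol2]) (use r FUH in \<open>auto simp del: UH_iff\<close>)
  thus ?thesis by (simp add: \<phi>_def o_def)
 qed
 \<comment> \<open>The modulus is known to be preserved on a disc of radius \<open>r\<close>,
   whereas the Schwarz lemma speaks of the unit disc.\<close>
 define \<psi> where "\<psi> = (\<lambda>ze. \<phi> (of_real r * ze) / of_real r)"
 have small: "cmod (of_real r * ze) < r" if "cmod ze < 1" for ze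
  using that r by (simp add: norm_mult)
 have hol\<psi>: "\<psi> holomorphic_on ball 0 1"
 proof -
  have "\<phi> \<circ> (\<lambda>ze. of_real r * ze) holomorphic_on ball 0 1"
   by (rule holomorphic_on_compose_gen [OF _ hol\<phi>]) (use small in \<open>auto intro!: holomorphic_intros\<close>)
  thus ?thesis unfolding \<psi>_def o_def using r by (intro holomorphic_intros) auto
 qed
 have mod\<psi>: "cmod (\<psi> ze) = cmod ze" if "cmod ze < 1" for ze
  using mod\<phi> [OF small [OF that]] r by (simp add: \<psi>_def norm_divide norm_mult)
 have "\<exists>al. (\<forall>ze. cmod ze < 1 \<longrightarrow> \<psi> ze = al * ze) \<and> cmod al = 1"
 proof (rule Schwarz_Lemma(3) [OF hol\<psi>])
  show "\<psi> 0 = 0" using mod\<psi> [of 0] by simp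
  show "cmod (\<psi> ze) < 1" if "cmod ze < 1" for ze using mod\<psi> [OF that] that by simp
  show "cmod (0::complex) < 1" by simp
  show "(\<exists>ze. cmod ze < 1 \<and> ze \<noteq> 0 \<and> cmod (\<psi> ze) = cmod ze) \<or> cmod (deriv \<psi> 0) = 1"
   using mod\<psi> [of "1/2"] by (intro disjI1 exI [of _ "1/2"]) auto
 qed
 then obtain al where al: "\<And>ze. cmod ze < 1 \<Longrightarrow> \<psi> ze = al * ze" "cmod al = 1" by blast
 have \<phi>al: "\<phi> ze = al * ze" if "cmod ze < r" for ze
 proof -
  have "cmod (ze / of_real r) < 1" using that r by (simp add: norm_divide)
  from al(1) [OF this] show ?thesis using r by (simp add: \<psi>_def field_simps)
 qed
 obtain R where R: "\<And>w. w \<in> UH \<Longrightarrow> cay (mob R w) = al * cay w" using rotation_cay al(2) by blast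
 have contc: "continuous_on UH (\<lambda>u. cay (mob g1 u))"
  unfolding cay_def
  by (intro continuous_intros continuous_on_mob) (use UH_plus_i_nz mob_in_UH in blast)
 hence "isCont (\<lambda>u. cay (mob g1 u)) z"
  using z continuous_on_eq_continuous_at open_UH by blast
 then obtain d where d: "0 < d" "\<And>u. dist u z < d \<Longrightarrow> dist (cay (mob g1 u)) (cay (mob g1 z)) < r"
  unfolding continuous_at_eps_delta using r(1) by metis
 obtain d' where d': "0 < d'" "ball z d' \<subseteq> S" using S openE by metis
 define r' where "r' = min d d'"
 have r': "0 < r'" "\<And>u. dist u z < r' \<Longrightarrow> u \<in> S \<and> cmod (cay (mob g1 u)) < r"
  using d d' g1 by (auto simp: r'_def dist_commute cay_def)
 show ?thesis
 proof
  show "0 < r'" by fact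
  show "ball z r' \<subseteq> S" using r'(2) by (auto simp: dist_commute)
  fix u assume "u \<in> ball z r'"
  hence u': "u \<in> S" "cmod (cay (mob g1 u)) < r" using r'(2) by (auto simp: dist_commute)
  hence u: "u \<in> S" "u \<in> UH" "cmod (cay (mob g1 u)) < r" using S(3) by blast+
  have "k (cay (mob g1 u)) = u" unfolding k_def using u(2) by (simp add: cayinv_cay del: UH_iff)
  hence "cay (mob g2 (F u)) = al * cay (mob g1 u)" using \<phi>al [OF u(3)] by (simp add: \<phi>_def)
  also have "\<dots> = cay (mob R (mob g1 u))" using R u(2) by simp
  finally have "mob g2 (F u) = mob R (mob g1 u)"
   by (rule cay_inj [rotated 2]) (use FUH u in \<open>simp_all del: UH_iff\<close>)
  hence "F u = mob (minv g2) (mob R (mob g1 u))"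
   using mob_minv(1) FUH [OF u(1)] by metis
  also have "\<dots> = mob (minv g2 * (R * g1)) u" using u(2) by (simp add: mob_mult del: UH_iff)
  finally show "F u = mob (minv g2 * (R * g1)) u" .
 qed
qed

section \<open>The developing map\<close>

lemma mob_agree:
 assumes "0 < e" "ball w e \<subseteq> UH" "\<And>u. u \<in> ball w e \<Longrightarrow> mob g u = mob h u" "z \<in> UH"
 shows "mob g z = mob h z"
proof -
 define w' where "w' = w + of_real (e / 2)"
 have w: "w \<in> ball w e" "w' \<in> ball w e" "w \<noteq> w'"
  using assms(1) by (auto simp: w'_def dist_norm)
 hence U: "w \<in> UH" "w' \<in> UH" using assms(2) by blast+
 have "mob (minv h * g) w = w" "mob (minv h * g) w' = w'"
  using assms(3) w U by (auto simp: mob_mult simp del: UH_iff)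
 hence "minv h * g = 1 \<or> minv h * g = - 1" using mob_fix_two U w by blast
 hence "g = h \<or> g = - h" by (metis minv_right2 mult.right_neutral sl2_mult_minus(1))
 thus ?thesis by auto
qed

lemma ball_in_ball:
 assumes "u \<in> ball x e" obtains r where "0 < r" "ball u r \<subseteq> ball x e"
 using assms openE [OF open_ball] by blast

text \<open>Connectedness in the form shared by Moebius transformations, developing maps and
  geodesics: the points near which \<open>Q\<close> holds form an open set, and \<open>far\<close>
  makes the remaining points of \<open>W\<close> open as well.\<close>

lemma connected_germ_induct:
 assumes "open W" "connected W" "a \<in> W" "z \<in> W" "0 < e" "\<And>u. u \<in> ball a e \<Longrightarrow> Q u"
  and far: "\<And>x. x \<in> W \<Longrightarrow> \<not> (\<exists>e>0. \<forall>u\<in>ball x e. Q u) \<Longrightarrow>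
   \<exists>e>0. \<forall>u\<in>ball x e. \<not> (\<exists>e>0. \<forall>v\<in>ball u e. Q v)"
 shows "\<exists>e>0. \<forall>u\<in>ball z e. Q u"
proof (rule ccontr)
 define P where "P = (\<lambda>z. \<exists>e>0. \<forall>u\<in>ball z e. Q u)"
 assume "\<not> ?thesis"
 hence nP: "\<not> P z" by (simp add: P_def)
 have near: "\<exists>e>0. \<forall>u\<in>ball x e. P u" if Px: "P x" for x
 proof -
  obtain e where e: "0 < e" "\<forall>u\<in>ball x e. Q u" using Px unfolding P_def by blast
  have "P u" if u: "u \<in> ball x e" for u
   using ball_in_ball [OF u] e(2) unfolding P_def by (metis subsetD)
  thus ?thesis using e(1) by blast
 qed
 have "open {x \<in> W. P x}"
 proof (subst open_contains_ball, intro ballI)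
  fix x assume x: "x \<in> {x \<in> W. P x}"
  obtain e1 where "0 < e1" "\<forall>u\<in>ball x e1. P u" using near x by blast
  moreover obtain e2 where "0 < e2" "ball x e2 \<subseteq> W" using x \<open>open W\<close> openE by blast
  ultimately show "\<exists>e>0. ball x e \<subseteq> {x \<in> W. P x}"
   by (intro exI [of _ "min e1 e2"]) (auto simp: subset_iff)
 qed
 moreover have "open {x \<in> W. \<not> P x}"
 proof (subst open_contains_ball, intro ballI)
  fix x assume x: "x \<in> {x \<in> W. \<not> P x}"
  obtain e1 where "0 < e1" "\<forall>u\<in>ball x e1. \<not> P u" using far [of x] x unfolding P_def by blast
  moreover obtain e2 where "0 < e2" "ball x e2 \<subseteq> W" using x \<open>open W\<close> openE by blast
  ultimately show "\<exists>e>0. ball x e \<subseteq> {x \<in> W. \<not> P x}"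
   by (intro exI [of _ "min e1 e2"]) (auto simp: subset_iff)
 qed
 moreover have "P a" using assms(5,6) by (auto simp: P_def)
 ultimately show False
  using connectedD [OF \<open>connected W\<close>, of "{x \<in> W. P x}" "{x \<in> W. \<not> P x}"] \<open>a \<in> W\<close> \<open>z \<in> W\<close> nP by auto
qed

lemma locally_mob_imp_mob:
 assumes "open W" "connected W" "a \<in> W" "ball a e \<subseteq> UH" "0 < e"
  and "\<And>u. u \<in> ball a e \<Longrightarrow> F u = mob g u"
  and loc: "\<And>z. z \<in> W \<Longrightarrow> \<exists>e>0. \<exists>h. ball z e \<subseteq> UH \<and> (\<forall>u\<in>ball z e. F u = mob h u)"
  and "z \<in> W"
 shows "\<exists>e>0. \<forall>u\<in>ball z e. F u = mob g u"
proof (rule connected_germ_induct [OF assms(1-3,8,5,6)])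
 fix x assume x: "x \<in> W" "\<not> (\<exists>e>0. \<forall>u\<in>ball x e. F u = mob g u)"
 obtain e h where e: "0 < e" "ball x e \<subseteq> UH" "\<forall>u\<in>ball x e. F u = mob h u" using loc [OF x(1)] by blast
 have False if u: "u \<in> ball x e" and ex: "\<exists>e>0. \<forall>v\<in>ball u e. F v = mob g v" for u
 proof -
  from ex obtain e1 where e1: "0 < e1" "\<forall>v\<in>ball u e1. F v = mob g v" by (elim exE conjE)
  obtain e2 where e2: "0 < e2" "ball u e2 \<subseteq> ball x e" using ball_in_ball [OF u] by blast
  have "mob h y = mob g y" if "y \<in> UH" for y
  proof (rule mob_agree [OF _ _ _ that])
   show "0 < min e1 e2" using e1 e2 by simp
   show "ball u (min e1 e2) \<subseteq> UH" using e2(2) e(2) by (meson ball_subset_ball_iff min.cobounded2 order_trans subset_ball)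
   fix v assume "v \<in> ball u (min e1 e2)"
   hence "v \<in> ball u e1" "v \<in> ball x e" using e2(2) by auto
   thus "mob h v = mob g v" using e1(2) e(3) by metis
  qed
  hence "\<forall>u\<in>ball x e. F u = mob g u" using e by (metis subsetD)
  thus False using x e(1) by blast
 qed
 thus "\<exists>e>0. \<forall>u\<in>ball x e. \<not> (\<exists>e>0. \<forall>v\<in>ball u e. F v = mob g v)" using e(1) by blast
qed

section \<open>Local developing maps\<close>

locale surface_atlas =
 fixes X :: "'a::metric_space set" and \<A> :: "('a set \<times> ('a \<Rightarrow> complex)) set"
 assumes atlas: "hyperbolic_atlas X \<A>"
begin

lemma chart:
 assumes "(U, f) \<in> \<A>"
 shows "openin (top_of_set X) U" "open (f ` U)" "f ` U \<subseteq> UH"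
  "\<And>x y. x \<in> U \<Longrightarrow> y \<in> U \<Longrightarrow> hdist (f x) (f y) = dist x y"
proof -
 have *: "\<forall>(U, f)\<in>\<A>. openin (top_of_set X) U \<and> open (f ` U) \<and> f ` U \<subseteq> upper_half_plane \<and>
    (\<forall>x\<in>U. \<forall>y\<in>U. hdist (f x) (f y) = dist x y)"
  using atlas unfolding hyperbolic_atlas_def by (elim conjE)
 show "openin (top_of_set X) U" "open (f ` U)" "f ` U \<subseteq> UH"
  "\<And>x y. x \<in> U \<Longrightarrow> y \<in> U \<Longrightarrow> hdist (f x) (f y) = dist x y"
  using bspec [OF * assms] by auto
qed

lemma chart_trans: "(U, f) \<in> \<A> \<Longrightarrow> (V, g) \<in> \<A> \<Longrightarrow> (g \<circ> inv_into U f) holomorphic_on f ` (U \<inter> V)"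
 using atlas unfolding hyperbolic_atlas_def by fast

lemma chart_cover: "x \<in> X \<Longrightarrow> \<exists>U f. (U, f) \<in> \<A> \<and> x \<in> U"
 using atlas unfolding hyperbolic_atlas_def by fast

lemma chart_subset: "(U, f) \<in> \<A> \<Longrightarrow> U \<subseteq> X"
 using chart(1) openin_imp_subset by blast

lemma chart_UH: "(U, f) \<in> \<A> \<Longrightarrow> x \<in> U \<Longrightarrow> f x \<in> UH"
 using chart(3) by blast

lemma chart_inj: "(U, f) \<in> \<A> \<Longrightarrow> x \<in> U \<Longrightarrow> y \<in> U \<Longrightarrow> f x = f y \<Longrightarrow> x = y"
 using chart(4) [of U f x y] by simp

lemma chart_inv: "(U, f) \<in> \<A> \<Longrightarrow> x \<in> U \<Longrightarrow> inv_into U f (f x) = x"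
 by (meson chart_inj inj_onI inv_into_f_f)

lemma chart_inv': "(U, f) \<in> \<A> \<Longrightarrow> w \<in> f ` U \<Longrightarrow> inv_into U f w \<in> U \<and> f (inv_into U f w) = w"
 by (simp add: f_inv_into_f inv_into_into)

text \<open>Developing maps are taken in the direction from the half-plane to the surface: near
  \<open>z\<close> the map is a Moebius transformation followed by the inverse of a chart. In this
  direction completeness of \<open>X\<close> yields continuation, and the final map is a
  covering.\<close>

definition dev :: "(complex \<Rightarrow> 'a) \<Rightarrow> complex \<Rightarrow> bool" where
 "dev pr z \<longleftrightarrow> (\<exists>e>0. \<exists>U f g. (U, f) \<in> \<A> \<and> ball z e \<subseteq> UH \<and> (\<forall>u\<in>ball z e. pr u \<in> U \<and> f (pr u) = mob g u))"

lemma dev_isometry: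
 assumes "dev pr z"
 obtains e where "0 < e" "ball z e \<subseteq> UH" "\<And>u. u \<in> ball z e \<Longrightarrow> pr u \<in> X"
  "\<And>u v. u \<in> ball z e \<Longrightarrow> v \<in> ball z e \<Longrightarrow> dist (pr u) (pr v) = hdist u v"
proof -
 obtain e U f g where *: "0 < e" "(U, f) \<in> \<A>" "ball z e \<subseteq> UH" "\<And>u. u \<in> ball z e \<Longrightarrow> pr u \<in> U \<and> f (pr u) = mob g u"
  using assms unfolding dev_def by blast
 show ?thesis
 proof
  fix u v assume "u \<in> ball z e" "v \<in> ball z e"
  thus "dist (pr u) (pr v) = hdist u v"
   using chart(4) [OF *(2), of "pr u" "pr v"] *(3,4) hdist_mob by (metis subsetD)
 qed (use * chart_subset in blast)+
qed

lemma dev_UH: "dev pr z \<Longrightarrow> z \<in> UH"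
 by (meson centre_in_ball dev_isometry subsetD)

lemma dev_in: "dev pr z \<Longrightarrow> pr z \<in> X"
 by (meson centre_in_ball dev_isometry)

lemma dev_cont:
 assumes "dev pr z" shows "isCont pr z"
proof -
 obtain e where e: "0 < e" "ball z e \<subseteq> UH" "\<And>u v. u \<in> ball z e \<Longrightarrow> v \<in> ball z e \<Longrightarrow> dist (pr u) (pr v) = hdist u v"
  using dev_isometry [OF assms] by metis
 have z: "z \<in> UH" using assms by (rule dev_UH)
 show ?thesis unfolding continuous_at_eps_delta
 proof (intro allI impI)
  fix r :: real assume "0 < r"
  then obtain d where d: "0 < d" "\<And>u. dist u z < d \<Longrightarrow> dist (hdist u z) (hdist z z) < r"
   using isCont_hdist [OF z z] unfolding continuous_at_eps_delta by metis
  show "\<exists>d>0. \<forall>u. dist u z < d \<longrightarrow> dist (pr u) (pr z) < r"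
  proof (intro exI [of _ "min d e"] conjI allI impI)
   fix u assume "dist u z < min d e"
   hence "dist (pr u) (pr z) = hdist u z" "dist (hdist u z) 0 < r"
    using e(3) [of u z] d(2) [of u] e(1) by (auto simp: dist_commute)
   thus "dist (pr u) (pr z) < r" by (simp add: dist_real_def)
  qed (use d e in auto)
 qed
qed

lemma dev_near:
 assumes "dev pr z" "0 < e" "\<And>u. u \<in> ball z e \<Longrightarrow> pr' u = pr u"
 shows "dev pr' z"
proof -
 obtain e' U f g where *: "0 < e'" "(U, f) \<in> \<A>" "ball z e' \<subseteq> UH" "\<And>u. u \<in> ball z e' \<Longrightarrow> pr u \<in> U \<and> f (pr u) = mob g u"
  using assms(1) unfolding dev_def by blast
 show ?thesis unfolding dev_def
 proof (intro exI conjI ballI)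
  show "0 < min e e'" using assms * by simp
  show "(U, f) \<in> \<A>" by fact
  show "ball z (min e e') \<subseteq> UH" using *(3) by (auto simp: subset_iff simp del: UH_iff)
  show "pr' u \<in> U" "f (pr' u) = mob g u" if "u \<in> ball z (min e e')" for u
   using *(4) [of u] assms(3) [of u] that by auto
 qed
qed

lemma mob_ball:
 assumes "z \<in> UH" "open V" "mob g z \<in> V"
 obtains e where "0 < e" "ball z e \<subseteq> UH" "\<And>u. u \<in> ball z e \<Longrightarrow> mob g u \<in> V"
proof -
 obtain r where r: "0 < r" "ball (mob g z) r \<subseteq> V" using assms openE by metis
 obtain d where d: "0 < d" "\<And>u. dist u z < d \<Longrightarrow> dist (mob g u) (mob g z) < r"
  using isCont_mob [OF assms(1), of g] r(1) unfolding continuous_at_eps_delta by metis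
 obtain e where e: "0 < e" "ball z e \<subseteq> UH" using assms(1) open_UH openE by metis
 show ?thesis
 proof
  show "0 < min d e" using d e by simp
  show "ball z (min d e) \<subseteq> UH" using e(2) by (auto simp: subset_iff simp del: UH_iff)
  show "mob g u \<in> V" if "u \<in> ball z (min d e)" for u
   using d(2) [of u] that r(2) by (auto simp: dist_commute)
 qed
qed

lemma dev_mob:
 assumes "dev pr (mob h z)" "z \<in> UH"
 shows "dev (\<lambda>u. pr (mob h u)) z"
proof -
 obtain e U f g where *: "0 < e" "(U, f) \<in> \<A>" "ball (mob h z) e \<subseteq> UH"
   "\<And>u. u \<in> ball (mob h z) e \<Longrightarrow> pr u \<in> U \<and> f (pr u) = mob g u"
  using assms(1) unfolding dev_def by blast
 obtain d where d: "0 < d" "ball z d \<subseteq> UH" "\<And>u. u \<in> ball z d \<Longrightarrow> mob h u \<in> ball (mob h z) e"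
  using mob_ball [OF assms(2) open_ball, of h "mob h z" e] *(1) centre_in_ball by blast
 have "pr (mob h u) \<in> U \<and> f (pr (mob h u)) = mob (g * h) u" if "u \<in> ball z d" for u
  using *(4) [OF d(3) [OF that]] d(2) that mob_mult by (metis subsetD)
 thus ?thesis unfolding dev_def using d(1,2) *(2) by blast
qed

lemma chart_dev:
 assumes "(U, f) \<in> \<A>" "z \<in> UH" "mob g z \<in> f ` U"
 shows "dev (\<lambda>u. inv_into U f (mob g u)) z"
proof -
 obtain e where e: "0 < e" "ball z e \<subseteq> UH" "\<And>u. u \<in> ball z e \<Longrightarrow> mob g u \<in> f ` U"
  using mob_ball [OF assms(2) chart(2) [OF assms(1)] assms(3)] by metis
 thus ?thesis unfolding dev_def using assms(1) chart_inv' [OF assms(1)] by blast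
qed

text \<open>The definition asks for one chart; here every chart at the image point works, since two
  charts differ by a holomorphic isometry. This is where the holomorphy of the transition maps
  enters.\<close>

lemma dev_chart:
 assumes "dev pr z" "(V, h) \<in> \<A>" "pr z \<in> V"
 obtains e g where "0 < e" "ball z e \<subseteq> UH" "\<And>u. u \<in> ball z e \<Longrightarrow> pr u \<in> V \<and> h (pr u) = mob g u"
proof -
 obtain e U f g where *: "0 < e" "(U, f) \<in> \<A>" "ball z e \<subseteq> UH" "\<And>u. u \<in> ball z e \<Longrightarrow> pr u \<in> U \<and> f (pr u) = mob g u"
  using assms(1) unfolding dev_def by blast
 have z: "z \<in> UH" using assms(1) by (rule dev_UH)
 obtain T where T: "open T" "V = X \<inter> T" using chart(1) [OF assms(2)] by (metis openin_open)
 have "pr z \<in> T" using assms(3) T by simp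
 then obtain r where r: "0 < r" "ball (pr z) r \<subseteq> T" using T(1) openE by metis
 obtain d where d: "0 < d" "\<And>u. dist u z < d \<Longrightarrow> dist (pr u) (pr z) < r"
  using dev_cont [OF assms(1)] r(1) unfolding continuous_at_eps_delta by metis
 define S where "S = ball z (min d e)"
 have S: "open S" "z \<in> S" "S \<subseteq> UH" using d(1) *(1) by (auto simp: S_def) (use *(3) in auto)
 have SV: "pr u \<in> V" "pr u \<in> U" "f (pr u) = mob g u" if "u \<in> S" for u
  using that *(4) [of u] d(2) [of u] r(2) chart_subset [OF *(2)] T(2) by (auto simp: S_def dist_commute)
 define F where "F = h \<circ> inv_into U f \<circ> mob g"
 have F: "F u = h (pr u)" if "u \<in> S" for u
 proof -
  have "inv_into U f (mob g u) = pr u" using chart_inv [OF *(2) SV(2) [OF that]] SV(3) [OF that] by simp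
  thus ?thesis by (simp add: F_def)
 qed
 have "\<exists>r' g'. 0 < r' \<and> ball z r' \<subseteq> S \<and> (\<forall>u. u \<in> ball z r' \<longrightarrow> F u = mob g' u)"
 proof (rule holomorphic_isometry_mob [OF z S])
  show "F holomorphic_on S" unfolding F_def
  proof (rule holomorphic_on_compose_gen [OF holomorphic_on_subset [OF holomorphic_on_mob S(3)] chart_trans [OF *(2) assms(2)]])
   show "mob g ` S \<subseteq> f ` (U \<inter> V)" using SV by (metis (no_types, lifting) IntI image_eqI image_subsetI)
  qed
  show "F u \<in> UH" if "u \<in> S" for u
   using F [OF that] SV(1) [OF that] chart_UH [OF assms(2)] by simp
  show "hdist (F u) (F z) = hdist u z" if "u \<in> S" for u
  proof -
   have "hdist (F u) (F z) = dist (pr u) (pr z)"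
    using F SV(1) that S(2) chart(4) [OF assms(2)] by metis
   also have "\<dots> = hdist (mob g u) (mob g z)" using SV that S(2) chart(4) [OF *(2)] by metis
   finally show ?thesis using hdist_mob that S by (metis subsetD)
  qed
 qed blast
 then obtain r' g' where r': "0 < r'" "ball z r' \<subseteq> S" "\<And>u. u \<in> ball z r' \<Longrightarrow> F u = mob g' u" by blast
 show ?thesis
 proof
  show "0 < r'" by fact
  show "ball z r' \<subseteq> UH" using r'(2) S(3) by blast
  show "pr u \<in> V \<and> h (pr u) = mob g' u" if "u \<in> ball z r'" for u
   using r' that SV F by (metis subsetD)
 qed
qed

lemma dev_chart_mob:
 assumes "open W" "connected W" "\<And>z. z \<in> W \<Longrightarrow> dev pr z" "(V, h) \<in> \<A>" "\<And>z. z \<in> W \<Longrightarrow> pr z \<in> V"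
 obtains g where "\<And>u. u \<in> W \<Longrightarrow> h (pr u) = mob g u"
proof (cases "W = {}")
 case False
 then obtain a where a: "a \<in> W" by blast
 obtain e g where e: "0 < e" "ball a e \<subseteq> UH" "\<And>u. u \<in> ball a e \<Longrightarrow> pr u \<in> V \<and> h (pr u) = mob g u"
  using dev_chart [OF assms(3) [OF a] assms(4) assms(5) [OF a]] by metis
 show ?thesis
 proof
  fix u assume "u \<in> W"
  have "\<exists>e>0. \<forall>v\<in>ball u e. h (pr v) = mob g v"
  proof (rule locally_mob_imp_mob [where F = "\<lambda>u. h (pr u)", OF assms(1,2) a e(2,1) _ _ \<open>u \<in> W\<close>])
   show "h (pr v) = mob g v" if "v \<in> ball a e" for v using e that by blast
   show "\<exists>e>0. \<exists>ha. ball z e \<subseteq> UH \<and> (\<forall>u\<in>ball z e. h (pr u) = mob ha u)" if "z \<in> W" for z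
    using dev_chart [OF assms(3) [OF that] assms(4) assms(5) [OF that]] by metis
  qed
  thus "h (pr u) = mob g u" by auto
 qed
qed (use that in auto)

text \<open>Where the values differ, they differ nearby by continuity. Where they agree, a chart at
  the common value turns both maps into Moebius transformations, and these agree everywhere once
  they agree on some disc.\<close>

lemma dev_unique:
 assumes "open W" "connected W" "\<And>z. z \<in> W \<Longrightarrow> dev pr z" "\<And>z. z \<in> W \<Longrightarrow> dev pr' z"
  and "a \<in> W" "0 < e" "\<And>u. u \<in> ball a e \<Longrightarrow> pr u = pr' u" "z \<in> W"
 shows "pr z = pr' z"
proof -
 define P where "P = (\<lambda>z. \<exists>e>0. \<forall>u\<in>ball z e. pr u = pr' u)"
 have far: "\<exists>e>0. \<forall>u\<in>ball x e. \<not> P u" if x: "x \<in> W" "\<not> P x" for x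
 proof (cases "pr x = pr' x")
  case False
  define r where "r = dist (pr x) (pr' x) / 2"
  have r: "0 < r" using False by (simp add: r_def)
  obtain d1 where d1: "0 < d1" "\<And>u. dist u x < d1 \<Longrightarrow> dist (pr u) (pr x) < r"
   using dev_cont [OF assms(3) [OF x(1)]] r unfolding continuous_at_eps_delta by metis
  obtain d2 where d2: "0 < d2" "\<And>u. dist u x < d2 \<Longrightarrow> dist (pr' u) (pr' x) < r"
   using dev_cont [OF assms(4) [OF x(1)]] r unfolding continuous_at_eps_delta by metis
  have "\<not> P u" if u: "u \<in> ball x (min d1 d2)" for u
  proof
   assume "P u"
   hence "pr u = pr' u" by (auto simp: P_def)
   hence "dist (pr x) (pr' x) < r + r"
    using d1(2) [of u] d2(2) [of u] u dist_triangle_less_add [of "pr x" "pr u" r "pr' x" r] by (simp add: dist_commute)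
   thus False by (simp add: r_def)
  qed
  thus ?thesis using d1 d2 by (intro exI [of _ "min d1 d2"]) auto
 next
  case True
  obtain V h where V: "(V, h) \<in> \<A>" "pr x \<in> V" using chart_cover dev_in [OF assms(3) [OF x(1)]] by blast
  obtain e1 g1 where e1: "0 < e1" "ball x e1 \<subseteq> UH" "\<And>u. u \<in> ball x e1 \<Longrightarrow> pr u \<in> V \<and> h (pr u) = mob g1 u"
   using dev_chart [OF assms(3) [OF x(1)] V] by metis
  obtain e2 g2 where e2: "0 < e2" "ball x e2 \<subseteq> UH" "\<And>u. u \<in> ball x e2 \<Longrightarrow> pr' u \<in> V \<and> h (pr' u) = mob g2 u"
   using dev_chart [OF assms(4) [OF x(1)] V(1)] V(2) True by metis
  define e where "e = min e1 e2"
  have e: "0 < e" "ball x e \<subseteq> ball x e1" "ball x e \<subseteq> ball x e2" using e1 e2 by (auto simp: e_def)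
  have "\<not> P u" if u: "u \<in> ball x e" for u
  proof
   assume "P u"
   then obtain e3 where e3: "0 < e3" "\<forall>v\<in>ball u e3. pr v = pr' v" by (auto simp: P_def)
   obtain e4 where e4: "0 < e4" "ball u e4 \<subseteq> ball x e" using ball_in_ball [OF u] by blast
   have eq: "mob g1 y = mob g2 y" if "y \<in> UH" for y
   proof (rule mob_agree [OF _ _ _ that])
    show "0 < min e3 e4" using e3 e4 by simp
    show "ball u (min e3 e4) \<subseteq> UH" using e4(2) e e1(2) by (meson min.cobounded2 order_trans subset_ball)
    fix v assume "v \<in> ball u (min e3 e4)"
    hence "v \<in> ball u e3" "v \<in> ball x e" using e4 by auto
    thus "mob g1 v = mob g2 v" using e3(2) e e1(3) e2(3) by (metis subsetD)
   qed
   have "pr v = pr' v" if "v \<in> ball x e" for v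
   proof (rule chart_inj [OF V(1)])
    have v: "v \<in> ball x e1" "v \<in> ball x e2" using that e by auto
    show "pr v \<in> V" "pr' v \<in> V" using v e1 e2 by auto
    show "h (pr v) = h (pr' v)" using v e1(2,3) e2(3) eq by (metis subsetD)
   qed
   hence "P x" unfolding P_def using e by blast
   thus False using x by simp
  qed
  thus ?thesis using e(1) by blast
 qed
 have "\<exists>e>0. \<forall>u\<in>ball z e. pr u = pr' u"
  using connected_germ_induct [OF assms(1,2,5,8,6), where Q = "\<lambda>u. pr u = pr' u"] assms(7) far
  unfolding P_def by blast
 thus ?thesis by auto
qed

end

section \<open>Extending a developing map by completeness\<close>

lemma lipschitz_from_local:
 fixes q :: "real \<Rightarrow> 'a::metric_space"
 assumes "a \<le> b" and loc: "\<And>t. a \<le> t \<Longrightarrow> t \<le> b \<Longrightarrow>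
  \<exists>d>0. \<forall>s. a \<le> s \<longrightarrow> s \<le> b \<longrightarrow> \<bar>s - t\<bar> < d \<longrightarrow> dist (q s) (q t) \<le> L * \<bar>s - t\<bar>"
 shows "dist (q a) (q b) \<le> L * (b - a)"
proof -
 have "a \<le> a \<longrightarrow> b \<le> b \<longrightarrow> dist (q a) (q b) \<le> L * (b - a)"
 proof (rule Bolzano [OF assms(1), where P = "\<lambda>x y. a \<le> x \<longrightarrow> y \<le> b \<longrightarrow> dist (q x) (q y) \<le> L * (y - x)"])
  fix x y z assume "a \<le> x \<longrightarrow> y \<le> b \<longrightarrow> dist (q x) (q y) \<le> L * (y - x)"
   "a \<le> y \<longrightarrow> z \<le> b \<longrightarrow> dist (q y) (q z) \<le> L * (z - y)" "x \<le> y" "y \<le> z"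
  thus "a \<le> x \<longrightarrow> z \<le> b \<longrightarrow> dist (q x) (q z) \<le> L * (z - x)"
   using dist_triangle [of "q x" "q z" "q y"] by (auto simp: algebra_simps)
 next
  fix t assume "a \<le> t" "t \<le> b"
  then obtain d where d: "d > 0" "\<And>s. a \<le> s \<Longrightarrow> s \<le> b \<Longrightarrow> \<bar>s - t\<bar> < d \<Longrightarrow> dist (q s) (q t) \<le> L * \<bar>s - t\<bar>"
   using loc by blast
  show "\<exists>d>0. \<forall>x y. x \<le> t \<and> t \<le> y \<and> y - x < d \<longrightarrow> a \<le> x \<longrightarrow> y \<le> b \<longrightarrow> dist (q x) (q y) \<le> L * (y - x)"
  proof (intro exI [of _ d] conjI allI impI)
   \<comment> \<open>The local estimate compares with \<open>t\<close> only, so an interval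
     containing \<open>t\<close> is split there.\<close>
   fix x y assume *: "x \<le> t \<and> t \<le> y \<and> y - x < d" "a \<le> x" "y \<le> b"
   hence "\<bar>x - t\<bar> = t - x" "\<bar>y - t\<bar> = y - t" by auto
   hence "dist (q x) (q t) \<le> L * (t - x)" "dist (q y) (q t) \<le> L * (y - t)"
    using d(2) [of x] d(2) [of y] * by auto
   thus "dist (q x) (q y) \<le> L * (y - x)"
    using dist_triangle2 [of "q x" "q y" "q t"] by (simp add: algebra_simps)
  qed (use d in auto)
 qed
 thus ?thesis by simp
qed

context surface_atlas
begin

text \<open>Integrates the local isometry along the segment from \<open>u\<close> to
  \<open>v\<close>, which convexity keeps inside \<open>B\<close>.\<close>

lemma dev_lipschitz:
 assumes "convex B" "\<And>z. z \<in> B \<Longrightarrow> dev pr z" "0 < m" "\<And>z. z \<in> B \<Longrightarrow> m \<le> Im z" "u \<in> B" "v \<in> B"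
 shows "dist (pr u) (pr v) \<le> cmod (u - v) / m"
proof -
 define w where "w = (\<lambda>s. u + of_real s * (v - u))"
 define c where "c = cmod (v - u)"
 have wB: "w s \<in> B" if "0 \<le> s" "s \<le> 1" for s
 proof -
  have "w s = (1 - s) *\<^sub>R u + s *\<^sub>R v" by (simp add: w_def scaleR_conv_of_real algebra_simps)
  thus ?thesis using assms(1,5,6) that by (simp add: convex_alt)
 qed
 have cw: "cmod (w s - w t) = \<bar>s - t\<bar> * c" for s t
 proof -
  have "w s - w t = of_real (s - t) * (v - u)" by (simp add: w_def algebra_simps)
  thus ?thesis by (simp add: norm_mult c_def del: of_real_diff)
 qed
 have "dist (pr (w 0)) (pr (w 1)) \<le> (c / m) * (1 - 0)"
 proof (rule lipschitz_from_local)
  fix t :: real assume t: "0 \<le> t" "t \<le> 1"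
  obtain e where e: "0 < e" "ball (w t) e \<subseteq> UH"
   "\<And>u v. u \<in> ball (w t) e \<Longrightarrow> v \<in> ball (w t) e \<Longrightarrow> dist (pr u) (pr v) = hdist u v"
   using dev_isometry [OF assms(2) [OF wB [OF t]]] by metis
  have c0: "0 \<le> c" by (simp add: c_def)
  show "\<exists>d>0. \<forall>s. 0 \<le> s \<longrightarrow> s \<le> 1 \<longrightarrow> \<bar>s - t\<bar> < d \<longrightarrow> dist (pr (w s)) (pr (w t)) \<le> c / m * \<bar>s - t\<bar>"
  proof (intro exI [of _ "e / (c + 1)"] conjI allI impI)
   show "0 < e / (c + 1)" using e c0 by simp
   fix s assume s: "0 \<le> s" "s \<le> 1" "\<bar>s - t\<bar> < e / (c + 1)"
   have "\<bar>s - t\<bar> * c \<le> \<bar>s - t\<bar> * (c + 1)" by (simp add: mult_left_mono)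
   also have "\<dots> < e" using s(3) c0 by (simp add: pos_less_divide_eq)
   finally have "w s \<in> ball (w t) e" using cw [of s t] by (simp add: dist_norm norm_minus_commute)
   hence "dist (pr (w s)) (pr (w t)) = hdist (w s) (w t)" using e by simp
   also have "\<dots> \<le> cmod (w s - w t) / m"
    using assms(3,4) wB s t by (intro hdist_le_Euclid) auto
   finally show "dist (pr (w s)) (pr (w t)) \<le> c / m * \<bar>s - t\<bar>" by (simp add: cw mult.commute)
  qed
 qed simp
 thus ?thesis by (simp add: w_def c_def norm_minus_commute)
qed

text \<open>Radial approach to \<open>b\<close> gives a Cauchy sequence in \<open>X\<close> by the
  Lipschitz bound, and completeness supplies the limit. In a chart around the limit
  \<open>pr\<close> is a single Moebius transformation near \<open>b\<close>; followed by the
  inverse chart, this continues beyond the disc.\<close>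

lemma dev_extend_boundary:
 assumes compl: "complete X" and r: "0 < r" and cb: "cball c r \<subseteq> UH"
  and dv: "\<And>z. z \<in> ball c r \<Longrightarrow> dev pr z" and b: "dist c b = r"
 obtains e pr' where "0 < e" "\<And>u. u \<in> ball b e \<Longrightarrow> dev pr' u" "\<And>u. u \<in> ball c r \<Longrightarrow> u \<in> ball b e \<Longrightarrow> pr' u = pr u"
proof -
 define m where "m = Im c - r"
 have "c - \<i> * of_real r \<in> cball c r" using r by (simp add: dist_norm norm_mult)
 hence "c - \<i> * of_real r \<in> UH" using cb by blast
 hence m: "0 < m" by (simp add: m_def)
 have Im: "m \<le> Im z" if "z \<in> ball c r" for z
  using abs_Im_le_cmod [of "c - z"] that by (simp add: m_def dist_norm)
 have lip: "dist (pr u) (pr v) \<le> cmod (u - v) / m" if "u \<in> ball c r" "v \<in> ball c r" for u v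
  by (rule dev_lipschitz [OF convex_ball dv m Im that])
 have bU: "b \<in> UH" using cb b by (metis mem_cball order_refl subsetD)
 \<comment> \<open>Points on the radius to \<open>b\<close>. The factor \<open>sg\<close> is 1/2 for
   finding the limit, and later small enough to keep the whole sequence in \<open>W\<close>.\<close>
 define zs where "zs = (\<lambda>sg n. b + of_real (sg / real (Suc n)) * (c - b))"
 have zs_b: "dist (zs sg n) b \<le> sg * r" "zs sg n \<in> ball c r" if "0 < sg" "sg < 1" for sg n
 proof -
  define x where "x = sg / real (Suc n)"
  have x: "0 < x" "x \<le> sg" using that by (simp_all add: x_def pos_divide_le_eq field_simps)
  have zx: "zs sg n = b + of_real x * (c - b)" by (simp add: zs_def x_def)
  have cb': "cmod (c - b) = r" using b by (simp add: dist_norm)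
  have "dist (zs sg n) b = x * r" using x by (simp add: zx dist_norm norm_mult cb')
  thus "dist (zs sg n) b \<le> sg * r" using x r by (simp add: mult_right_mono)
  have "c - zs sg n = of_real (1 - x) * (c - b)" by (simp add: zx algebra_simps)
  hence "dist c (zs sg n) = (1 - x) * r"
   using x that by (simp add: dist_norm norm_mult cb' del: of_real_diff)
  thus "zs sg n \<in> ball c r" using x r by simp
 qed
 have zs_lim: "zs sg \<longlonglongrightarrow> b" for sg
 proof -
  have "(\<lambda>n. b + of_real (sg / real (Suc n)) * (c - b)) \<longlonglongrightarrow> b + of_real 0 * (c - b)"
   by (intro tendsto_intros LIMSEQ_Suc [OF lim_const_over_n])
  thus ?thesis by (simp add: zs_def)
 qed
 have "Cauchy (\<lambda>n. pr (zs (1/2) n))"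
 proof (rule metric_CauchyI)
  fix e :: real assume "0 < e"
  then obtain M where M: "\<And>j k. j \<ge> M \<Longrightarrow> k \<ge> M \<Longrightarrow> dist (zs (1/2) j) (zs (1/2) k) < e * m"
   using metric_CauchyD [OF LIMSEQ_imp_Cauchy [OF zs_lim [of "1/2"]], of "e * m"] m by auto
  have "dist (pr (zs (1/2) j)) (pr (zs (1/2) k)) < e" if "j \<ge> M" "k \<ge> M" for j k
  proof -
   have "dist (pr (zs (1/2) j)) (pr (zs (1/2) k)) \<le> cmod (zs (1/2) j - zs (1/2) k) / m"
    by (intro lip zs_b(2)) auto
   also have "\<dots> < e" using M [OF that] m by (simp add: dist_norm pos_divide_less_eq)
   finally show ?thesis .
  qed
  thus "\<exists>M. \<forall>j\<ge>M. \<forall>k\<ge>M. dist (pr (zs (1/2) j)) (pr (zs (1/2) k)) < e"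
   by metis
 qed
 moreover have "pr (zs (1/2) n) \<in> X" for n using dev_in dv zs_b(2) [of "1/2"] by simp
 ultimately obtain p where p: "p \<in> X" "(\<lambda>n. pr (zs (1/2) n)) \<longlonglongrightarrow> p"
  using compl [unfolded complete_def, rule_format, of "\<lambda>n. pr (zs (1/2) n)"] by metis
 have lip_p: "dist (pr u) p \<le> dist u b / m" if "u \<in> ball c r" for u
 proof (rule LIMSEQ_le)
  show "(\<lambda>n. dist (pr u) (pr (zs (1/2) n))) \<longlonglongrightarrow> dist (pr u) p" by (intro tendsto_intros p)
  show "(\<lambda>n. dist u (zs (1/2) n) / m) \<longlonglongrightarrow> dist u b / m" using m by (intro tendsto_intros zs_lim) auto
  show "\<exists>N. \<forall>n\<ge>N. dist (pr u) (pr (zs (1/2) n)) \<le> dist u (zs (1/2) n) / m"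
   using lip that zs_b(2) [of "1/2"] by (auto simp: dist_norm)
 qed
 obtain U f where U: "(U, f) \<in> \<A>" "p \<in> U" using chart_cover p by blast
 obtain T where T: "open T" "U = X \<inter> T" using chart(1) [OF U(1)] by (metis openin_open)
 obtain eps where eps: "0 < eps" "ball p eps \<subseteq> T" using T U openE by (metis IntD2)
 define d where "d = eps * m"
 have d: "0 < d" using eps m by (simp add: d_def)
 define W where "W = ball c r \<inter> ball b d"
 have WU: "pr u \<in> U" if "u \<in> W" for u
 proof -
  have "dist (pr u) p < eps"
   using lip_p [of u] that m by (simp add: W_def d_def dist_commute pos_divide_less_eq order_le_less_trans)
  thus ?thesis using eps T dev_in dv that by (auto simp: W_def dist_commute)
 qed
 \<comment> \<open>\<open>W\<close> is convex, so one transformation serves for all of it.\<close>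
 obtain g where g: "\<And>u. u \<in> W \<Longrightarrow> f (pr u) = mob g u"
  using dev_chart_mob [of W pr U f] U(1) WU dv unfolding W_def
  by (metis IntD1 convex_Int convex_ball convex_connected open_Int open_ball)
 define sg where "sg = min (1/2) (d / (2 * r))"
 have sg: "0 < sg" "sg < 1" using d r by (auto simp: sg_def)
 have "sg * r \<le> d / (2 * r) * r" using r by (intro mult_right_mono) (auto simp: sg_def)
 hence sgr: "sg * r < d" using d r by simp
 have zW: "zs sg n \<in> W" for n
  using zs_b [OF sg, of n] sgr by (simp add: W_def dist_commute)
 have fpU: "f p \<in> UH" by (rule chart_UH [OF U])
 have "(\<lambda>n. hdist (f (pr (zs sg n))) (f p)) \<longlonglongrightarrow> 0"
 proof (rule tendsto_sandwich [OF _ _ tendsto_const])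
  have "(\<lambda>n. dist (zs sg n) b / m) \<longlonglongrightarrow> dist b b / m" using m by (intro tendsto_intros zs_lim) auto
  thus "(\<lambda>n. dist (zs sg n) b / m) \<longlonglongrightarrow> 0" by simp
  have "hdist (f (pr (zs sg n))) (f p) = dist (pr (zs sg n)) p" for n
   using chart(4) [OF U(1) WU [OF zW] U(2)] .
  thus "\<forall>\<^sub>F n in sequentially. hdist (f (pr (zs sg n))) (f p) \<le> dist (zs sg n) b / m"
    "\<forall>\<^sub>F n in sequentially. 0 \<le> hdist (f (pr (zs sg n))) (f p)"
   using lip_p zs_b(2) [OF sg] by auto
 qed
 hence "(\<lambda>n. mob g (zs sg n)) \<longlonglongrightarrow> f p"
  using tendsto_hdist_0 [OF fpU, of "\<lambda>n. f (pr (zs sg n))"] chart_UH [OF U(1) WU [OF zW]] g [OF zW] by simp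
 moreover have "(\<lambda>n. mob g (zs sg n)) \<longlonglongrightarrow> mob g b"
  by (rule isCont_tendsto_compose [OF isCont_mob [OF bU] zs_lim])
 ultimately have "f p = mob g b" by (rule LIMSEQ_unique)
 hence "mob g b \<in> f ` U" using U(2) by (metis imageI)
 then obtain e where e: "0 < e" "ball b e \<subseteq> UH" "\<And>u. u \<in> ball b e \<Longrightarrow> mob g u \<in> f ` U"
  using mob_ball [OF bU chart(2) [OF U(1)]] by metis
 show ?thesis
 proof
  show "0 < min e d" using e d by simp
  show "dev (\<lambda>u. inv_into U f (mob g u)) u" if "u \<in> ball b (min e d)" for u
  proof -
   have "u \<in> ball b e" using that by simp
   thus ?thesis using e chart_dev [OF U(1)] by (metis subsetD)
  qed
  fix u assume u: "u \<in> ball c r" "u \<in> ball b (min e d)"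
  hence "u \<in> W" by (simp add: W_def)
  thus "inv_into U f (mob g u) = pr u" using g WU chart_inv [OF U(1)] by metis
 qed
qed

text \<open>The boundary circle is compact, so a Lebesgue number gives the local extensions a common
  radius; it remains to see that they agree on overlaps.\<close>

lemma dev_extend:
 assumes compl: "complete X" and r: "0 < r" and cb: "cball c r \<subseteq> UH"
  and dv: "\<And>z. z \<in> ball c r \<Longrightarrow> dev pr z"
 obtains \<delta> pr' where "0 < \<delta>" "\<And>u. u \<in> ball c (r + \<delta>) \<Longrightarrow> dev pr' u" "\<And>u. u \<in> ball c r \<Longrightarrow> pr' u = pr u"
proof -
 have "\<forall>b\<in>sphere c r. \<exists>e pr'. 0 < e \<and> (\<forall>u\<in>ball b e. dev pr' u) \<and> (\<forall>u\<in>ball c r \<inter> ball b e. pr' u = pr u)"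
 proof
  fix b assume "b \<in> sphere c r"
  hence "dist c b = r" by simp
  from dev_extend_boundary [OF compl r cb dv this]
  show "\<exists>e pr'. 0 < e \<and> (\<forall>u\<in>ball b e. dev pr' u) \<and> (\<forall>u\<in>ball c r \<inter> ball b e. pr' u = pr u)"
   by (metis IntD1 IntD2)
 qed
 then obtain E P where E: "\<And>b. b \<in> sphere c r \<Longrightarrow> 0 < E b"
  "\<And>b u. b \<in> sphere c r \<Longrightarrow> u \<in> ball b (E b) \<Longrightarrow> dev (P b) u"
  "\<And>b u. b \<in> sphere c r \<Longrightarrow> u \<in> ball c r \<Longrightarrow> u \<in> ball b (E b) \<Longrightarrow> P b u = pr u"
  by (metis (no_types) IntI)
 have sub: "sphere c r \<subseteq> \<Union> ((\<lambda>b. ball b (E b)) ` sphere c r)" using E(1) by force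
 have op: "\<And>G. G \<in> (\<lambda>b. ball b (E b)) ` sphere c r \<Longrightarrow> open G" by auto
 obtain \<delta> where \<delta>: "0 < \<delta>" "\<And>b. b \<in> sphere c r \<Longrightarrow> \<exists>G\<in>(\<lambda>b. ball b (E b)) ` sphere c r. ball b \<delta> \<subseteq> G"
  using Heine_Borel_lemma [OF compact_sphere sub op] by metis
 have "\<forall>b\<in>sphere c r. \<exists>b'\<in>sphere c r. ball b \<delta> \<subseteq> ball b' (E b')" using \<delta>(2) by fast
 then obtain B where B: "\<And>b. b \<in> sphere c r \<Longrightarrow> B b \<in> sphere c r" "\<And>b. b \<in> sphere c r \<Longrightarrow> ball b \<delta> \<subseteq> ball (B b) (E (B b))"
  by metis
 define Q where "Q = (\<lambda>b. P (B b))"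
 have Q: "dev (Q b) u" if "b \<in> sphere c r" "u \<in> ball b \<delta>" for b u
  using E(2) B that unfolding Q_def by blast
 have Qpr: "Q b u = pr u" if "b \<in> sphere c r" "u \<in> ball b \<delta>" "u \<in> ball c r" for b u
  using E(3) B that unfolding Q_def by blast
 \<comment> \<open>Two overlapping discs of radius \<open>\<delta>\<close> contain the midpoint of
   their centres, which lies strictly inside the large disc as the centres are distinct points of
   its circle. Both extensions equal \<open>pr\<close> near it, and the overlap is convex, so
   uniqueness applies.\<close>
 have cons: "Q b u = Q b' u" if b: "b \<in> sphere c r" "b' \<in> sphere c r" and u: "u \<in> ball b \<delta>" "u \<in> ball b' \<delta>" for b b' u
 proof (cases "b = b'")
  case False
  define W where "W = ball b \<delta> \<inter> ball b' \<delta>"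
  define a where "a = (b + b') / 2"
  have par: "(cmod (a - c))\<^sup>2 = ((cmod (b - c))\<^sup>2 + (cmod (b' - c))\<^sup>2) / 2 - (cmod (b - b'))\<^sup>2 / 4"
   unfolding a_def cmod_power2 by (simp add: power2_eq_square field_simps)
  have bc: "cmod (b - c) = r" "cmod (b' - c) = r" using b by (simp_all add: dist_norm norm_minus_commute)
  have "0 < (cmod (b - b'))\<^sup>2" using False by simp
  hence "(cmod (a - c))\<^sup>2 < r\<^sup>2" using par unfolding bc by simp
  hence "cmod (a - c) < r" by (rule power2_less_imp_less) (use r in simp)
  hence ac: "a \<in> ball c r" by (simp add: dist_norm norm_minus_commute)
  have "dist b b' < \<delta> + \<delta>" using u dist_triangle_less_add [of b u \<delta> b' \<delta>] by (simp add: dist_commute)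
  moreover have "dist b a = dist b b' / 2" "dist b' a = dist b b' / 2"
  proof -
   have "b - a = (b - b') / 2" "b' - a = - ((b - b') / 2)" by (simp_all add: a_def field_simps)
   thus "dist b a = dist b b' / 2" "dist b' a = dist b b' / 2"
    by (simp_all only: dist_norm norm_minus_cancel) (simp_all add: norm_divide)
  qed
  ultimately have aW: "a \<in> W" by (simp add: W_def)
  have "open (W \<inter> ball c r)" by (auto simp: W_def)
  then obtain e where e: "0 < e" "ball a e \<subseteq> W \<inter> ball c r" using aW ac openE by (metis IntI)
  show ?thesis
  proof (rule dev_unique [of W "Q b" "Q b'" a e u])
   show "open W" by (auto simp: W_def)
   show "connected W" unfolding W_def by (intro convex_connected convex_Int convex_ball)
   show "dev (Q b) z" "dev (Q b') z" if "z \<in> W" for z using Q b that by (auto simp: W_def)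
   show "Q b v = Q b' v" if "v \<in> ball a e" for v
   proof -
    have "v \<in> ball b \<delta>" "v \<in> ball b' \<delta>" "v \<in> ball c r" using e(2) that by (auto simp: W_def)
    thus ?thesis using Qpr b by metis
   qed
   show "u \<in> W" using u by (simp add: W_def)
  qed fact+
 qed simp
 define pr' where "pr' = (\<lambda>u. if u \<in> ball c r then pr u else Q (SOME b. b \<in> sphere c r \<and> u \<in> ball b \<delta>) u)"
 have pr'Q: "pr' u = Q b u" if "b \<in> sphere c r" "u \<in> ball b \<delta>" for b u
 proof (cases "u \<in> ball c r")
  case False
  have "(SOME b. b \<in> sphere c r \<and> u \<in> ball b \<delta>) \<in> sphere c r \<and> u \<in> ball (SOME b. b \<in> sphere c r \<and> u \<in> ball b \<delta>) \<delta>"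
   using that by (intro someI [where P = "\<lambda>b. b \<in> sphere c r \<and> u \<in> ball b \<delta>"]) blast
  thus ?thesis using cons that False unfolding pr'_def by (metis (no_types, lifting))
 qed (use that Qpr in \<open>simp add: pr'_def\<close>)
 show ?thesis
 proof
  show "0 < \<delta>" by fact
  show "pr' u = pr u" if "u \<in> ball c r" for u using that by (simp add: pr'_def)
  fix u assume u: "u \<in> ball c (r + \<delta>)"
  show "dev pr' u"
  proof (cases "u \<in> ball c r")
   case True
   obtain e where "0 < e" "ball u e \<subseteq> ball c r" using ball_in_ball [OF True] by blast
   thus ?thesis using dv [OF True] by (intro dev_near [of pr u e pr']) (auto simp: pr'_def)
  next
   case False
   define l where "l = dist c u"
   have l: "r \<le> l" "l < r + \<delta>" "0 < l" using u False r by (auto simp: l_def)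
   define b where "b = c + of_real (r / l) * (u - c)"
   have cu: "cmod (u - c) = l" by (simp add: l_def dist_norm norm_minus_commute)
   have "dist c b = r" using l r by (simp add: b_def dist_norm norm_mult norm_divide cu)
   hence bs: "b \<in> sphere c r" by simp
   have "u - b = of_real (1 - r / l) * (u - c)" by (simp add: b_def algebra_simps)
   hence "dist b u = \<bar>1 - r / l\<bar> * l"
    by (metis cu dist_commute dist_norm norm_mult norm_of_real)
   also have "\<dots> = l - r" using l by (simp add: abs_if field_simps)
   finally have ub: "u \<in> ball b \<delta>" using l by simp
   obtain e where "0 < e" "ball u e \<subseteq> ball b \<delta>" using ball_in_ball [OF ub] by blast
   thus ?thesis using Q [OF bs ub] pr'Q [OF bs] by (intro dev_near [of "Q b" u e pr']) auto
  qed
 qed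
qed

end

text \<open>The hyperbolic disc of radius \<open>rh\<close> about i, which is a Euclidean disc with
  a higher centre.\<close>

definition hb :: "real \<Rightarrow> complex set" where
 "hb rh = ball (\<i> * of_real (cosh rh)) (sinh rh)"

lemma mem_hb:
 assumes "0 < rh"
 shows "z \<in> hb rh \<longleftrightarrow> (cmod z)\<^sup>2 + 1 < 2 * Im z * cosh rh"
proof -
 have "z \<in> hb rh \<longleftrightarrow> cmod (z - \<i> * of_real (cosh rh)) < sinh rh"
  by (simp add: hb_def dist_norm norm_minus_commute)
 also have "\<dots> \<longleftrightarrow> (cmod (z - \<i> * of_real (cosh rh)))\<^sup>2 < (sinh rh)\<^sup>2"
  using assms by (meson norm_ge_zero power2_less_imp_less power_strict_mono sinh_real_nonneg_iff less_imp_le zero_less_numeral)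
 also have "(cmod (z - \<i> * of_real (cosh rh)))\<^sup>2 = (cmod z)\<^sup>2 - 2 * Im z * cosh rh + (cosh rh)\<^sup>2"
  unfolding cmod_power2 by (simp add: power2_eq_square algebra_simps)
 also have "(cosh rh)\<^sup>2 = (sinh rh)\<^sup>2 + 1" by (rule cosh_square_eq)
 finally show ?thesis by auto
qed

lemma hb_mono:
 assumes "0 < rh" "rh \<le> rh'" shows "hb rh \<subseteq> hb rh'"
proof
 fix z assume "z \<in> hb rh"
 hence *: "(cmod z)\<^sup>2 + 1 < 2 * Im z * cosh rh" using mem_hb assms by blast
 have "0 < 2 * Im z * cosh rh" using * by (smt (verit) zero_le_power2)
 hence "0 < Im z" using cosh_real_pos [of rh] by (simp add: zero_less_mult_iff)
 hence "2 * Im z * cosh rh \<le> 2 * Im z * cosh rh'"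
  using assms by (intro mult_left_mono) (auto simp: cosh_real_nonneg_le_iff)
 thus "z \<in> hb rh'" using * mem_hb assms by auto
qed

lemma i_in_hb: "0 < rh \<Longrightarrow> \<i> \<in> hb rh"
 using cosh_real_nonneg_less_iff [of 0 rh] by (simp add: mem_hb)

lemma hb_cball_UH: "0 < rh \<Longrightarrow> cball (\<i> * of_real (cosh rh)) (sinh rh) \<subseteq> UH"
proof
 fix z assume "0 < rh" "z \<in> cball (\<i> * of_real (cosh rh)) (sinh rh)"
 hence "\<bar>Im (\<i> * of_real (cosh rh) - z)\<bar> \<le> sinh rh"
  using abs_Im_le_cmod [of "\<i> * of_real (cosh rh) - z"] by (simp add: dist_norm)
 thus "z \<in> UH" using sinh_less_cosh_real [of rh] by simp
qed

lemma hb_UH: "0 < rh \<Longrightarrow> hb rh \<subseteq> UH"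
 using hb_cball_UH ball_subset_cball unfolding hb_def by blast

lemma hb_exhaust:
 assumes "z \<in> UH" obtains rh where "0 < rh" "z \<in> hb rh"
proof -
 define rh where "rh = ((cmod z)\<^sup>2 + 1) / Im z"
 have rh: "0 < rh" using assms by (simp add: rh_def add_nonneg_pos)
 have "rh < 2 * cosh rh"
  using rh real_le_x_sinh [of rh] sinh_less_cosh_real [of rh] by (simp add: sinh_field_def exp_minus)
 hence "Im z * rh < Im z * (2 * cosh rh)" using assms by simp
 moreover have "Im z * rh = (cmod z)\<^sup>2 + 1" using assms by (simp add: rh_def)
 ultimately have "z \<in> hb rh" using rh by (simp add: mem_hb algebra_simps)
 thus ?thesis using rh that by blast
qed

context surface_atlas
begin

definition dev_germ :: "(complex \<Rightarrow> 'a) \<Rightarrow> real \<Rightarrow> (complex \<Rightarrow> 'a) \<Rightarrow> bool" where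
 "dev_germ pr0 rh pr \<longleftrightarrow> (\<forall>z\<in>hb rh. dev pr z) \<and> (\<exists>e>0. \<forall>u\<in>ball \<i> e. pr u = pr0 u)"

lemma dev_germ_unique:
 assumes "0 < rh" "rh \<le> rh'" "dev_germ pr0 rh pr" "dev_germ pr0 rh' pr'" "z \<in> hb rh"
 shows "pr z = pr' z"
proof -
 obtain e1 where e1: "0 < e1" "\<forall>u\<in>ball \<i> e1. pr u = pr0 u" using assms(3) by (auto simp: dev_germ_def)
 obtain e2 where e2: "0 < e2" "\<forall>u\<in>ball \<i> e2. pr' u = pr0 u" using assms(4) by (auto simp: dev_germ_def)
 show ?thesis
 proof (rule dev_unique [of "hb rh" pr pr' \<i> "min e1 e2" z])
  show "open (hb rh)" "connected (hb rh)" by (auto simp: hb_def)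
  show "dev pr z" "dev pr' z" if "z \<in> hb rh" for z
   using that subsetD [OF hb_mono [OF assms(1,2)] that] assms(3,4) unfolding dev_germ_def by blast+
  show "\<i> \<in> hb rh" using assms i_in_hb by blast
  show "0 < min e1 e2" using e1 e2 by simp
  show "pr u = pr' u" if "u \<in> ball \<i> (min e1 e2)" for u using e1 e2 that by simp
 qed fact
qed

text \<open>The discs are nested and share the germ at i, so uniqueness makes the maps on them
  compatible.\<close>

lemma dev_glue:
 assumes I: "\<And>rh. rh \<in> I \<Longrightarrow> 0 < rh \<and> (\<exists>pr. dev_germ pr0 rh pr)" and ne: "I \<noteq> {}"
 obtains pr where "\<And>z rh. rh \<in> I \<Longrightarrow> z \<in> hb rh \<Longrightarrow> dev pr z" "\<exists>e>0. \<forall>u\<in>ball \<i> e. pr u = pr0 u"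
proof -
 obtain P where P: "\<And>rh. rh \<in> I \<Longrightarrow> dev_germ pr0 rh (P rh)" using I by metis
 have cons: "P rh z = P rh' z" if "rh \<in> I" "rh' \<in> I" "z \<in> hb rh" "z \<in> hb rh'" for rh rh' z
  using dev_germ_unique P I that by (metis linear)
 define pr where "pr = (\<lambda>z. P (SOME rh. rh \<in> I \<and> z \<in> hb rh) z)"
 have prP: "pr z = P rh z" if "rh \<in> I" "z \<in> hb rh" for rh z
 proof -
  have "(SOME rh. rh \<in> I \<and> z \<in> hb rh) \<in> I \<and> z \<in> hb (SOME rh. rh \<in> I \<and> z \<in> hb rh)"
   using that by (intro someI [where P = "\<lambda>rh. rh \<in> I \<and> z \<in> hb rh"]) blast
  thus ?thesis using cons that unfolding pr_def by blast
 qed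
 have nb: "\<exists>e>0. \<forall>u\<in>ball z e. pr u = P rh u" if "rh \<in> I" "z \<in> hb rh" for rh z
  using ball_in_ball [of z] that prP unfolding hb_def by (metis subsetD)
 show ?thesis
 proof
  show "dev pr z" if "rh \<in> I" "z \<in> hb rh" for z rh
   using nb [OF that] P [OF that(1)] that(2) dev_near [of "P rh" z _ pr] unfolding dev_germ_def by metis
  obtain rh where rh: "rh \<in> I" using ne by blast
  obtain e1 where e1: "0 < e1" "\<forall>u\<in>ball \<i> e1. pr u = P rh u" using nb [OF rh] i_in_hb I rh by blast
  obtain e2 where e2: "0 < e2" "\<forall>u\<in>ball \<i> e2. P rh u = pr0 u" using P [OF rh] by (auto simp: dev_germ_def)
  show "\<exists>e>0. \<forall>u\<in>ball \<i> e. pr u = pr0 u"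
   using e1 e2 by (intro exI [of _ "min e1 e2"]) auto
 qed
qed

text \<open>The radii of the discs to which the germ of an inverse chart extends are unbounded: at a
  finite supremum the glued map lives on the disc of that radius and continues past its
  boundary.\<close>

lemma developing_map:
 assumes compl: "complete X" and "X \<noteq> {}"
 obtains pr where "\<And>z. z \<in> UH \<Longrightarrow> dev pr z"
proof -
 obtain x where x: "x \<in> X" using assms by blast
 obtain U f where U: "(U, f) \<in> \<A>" "x \<in> U" using chart_cover x by blast
 obtain g where g: "mob g (f x) = \<i>" using sl2_to_i chart_UH U by metis
 define pr0 where "pr0 = (\<lambda>u. inv_into U f (mob (minv g) u))"
 have "mob (minv g) \<i> = f x" using g chart_UH [OF U] by (metis mob_minv(1))
 then obtain e0 where e0: "0 < e0" "ball \<i> e0 \<subseteq> UH" "\<And>u. u \<in> ball \<i> e0 \<Longrightarrow> mob (minv g) u \<in> f ` U"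
  using mob_ball [of \<i> "f ` U" "minv g"] chart(2) [OF U(1)] U(2) by (metis UH_iff imageI imaginary_unit.sel(2) zero_less_one)
 have dev0: "dev pr0 u" if "u \<in> ball \<i> e0" for u
  unfolding pr0_def using chart_dev [OF U(1)] e0 that by (metis subsetD)
 \<comment> \<open>The disc of radius \<open>rh\<close> reaches up to height \<open>exp rh\<close>,
   so this choice keeps it within \<open>e0\<close> of i.\<close>
 define rh0 where "rh0 = ln (1 + e0 / 2)"
 have rh0: "0 < rh0" "exp rh0 = 1 + e0 / 2" using e0(1) by (simp_all add: rh0_def)
 have "hb rh0 \<subseteq> ball \<i> e0"
 proof -
  have "\<i> - \<i> * of_real (cosh rh0) = \<i> * of_real (1 - cosh rh0)" by (simp add: algebra_simps)
  hence "dist \<i> (\<i> * of_real (cosh rh0)) = cosh rh0 - 1"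
   using cosh_real_ge_1 [of rh0] by (simp add: dist_norm norm_mult del: of_real_diff of_real_1)
  moreover have "cosh rh0 - 1 + sinh rh0 \<le> e0" using cosh_plus_sinh [of rh0] rh0 e0(1) by simp
  ultimately show ?thesis unfolding hb_def by (simp add: ball_subset_ball_iff dist_commute)
 qed
 hence base: "dev_germ pr0 rh0 pr0" using dev0 by (auto simp: dev_germ_def intro: exI [of _ 1])
 define A where "A = {rh. 0 < rh \<and> (\<exists>pr. dev_germ pr0 rh pr)}"
 have A0: "rh0 \<in> A" using base rh0 by (auto simp: A_def)
 hence neA: "A \<noteq> {}" by blast
 have hA: "\<And>rh. rh \<in> A \<Longrightarrow> 0 < rh \<and> (\<exists>pr. dev_germ pr0 rh pr)" by (simp add: A_def)
 have down: "rh' \<in> A" if "rh \<in> A" "0 < rh'" "rh' \<le> rh" for rh rh'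
  using that hb_mono [of rh' rh] unfolding A_def dev_germ_def by blast
 have "\<not> bdd_above A"
 proof
  assume bdd: "bdd_above A"
  define s where "s = Sup A"
  have s0: "rh0 \<le> s" unfolding s_def using A0 bdd by (rule cSup_upper)
  have ub: "rh \<le> s" if "rh \<in> A" for rh unfolding s_def using that bdd by (rule cSup_upper)
  have inA: "rh \<in> A" if pos: "0 < rh" and less: "rh < s" for rh
  proof -
   obtain rh' where "rh' \<in> A" "rh < rh'" using less_cSupD [of A rh] A0 less unfolding s_def by blast
   thus ?thesis using down pos by (meson less_imp_le)
  qed
  have sA: "s > 0" using s0 rh0 by simp
  obtain pr where pr: "\<And>z rh. rh \<in> A \<Longrightarrow> z \<in> hb rh \<Longrightarrow> dev pr z" "\<exists>e>0. \<forall>u\<in>ball \<i> e. pr u = pr0 u"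
   using dev_glue [OF hA neA] by metis
  have dev_s: "dev pr z" if "z \<in> hb s" for z
  proof -
   have "(cmod z)\<^sup>2 + 1 < 2 * Im z * cosh s" using mem_hb [OF sA] that by blast
   moreover have "((\<lambda>rh. 2 * Im z * cosh rh) \<longlongrightarrow> 2 * Im z * cosh s) (at_left s)" by (intro tendsto_intros)
   ultimately have "\<forall>\<^sub>F rh in at_left s. (cmod z)\<^sup>2 + 1 < 2 * Im z * cosh rh" by (metis order_tendstoD(1))
   moreover have "\<forall>\<^sub>F rh in at_left s. rh \<in> {0<..<s}" using eventually_at_left_real [OF sA] .
   ultimately have "\<forall>\<^sub>F rh in at_left s. (cmod z)\<^sup>2 + 1 < 2 * Im z * cosh rh \<and> 0 < rh \<and> rh < s"
    by eventually_elim auto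
   then obtain rh where "(cmod z)\<^sup>2 + 1 < 2 * Im z * cosh rh" "0 < rh" "rh < s"
    using eventually_happens' [OF trivial_limit_at_left_real] by blast
   thus ?thesis using pr(1) inA mem_hb by blast
  qed
  obtain \<delta> pr' where \<delta>: "0 < \<delta>" "\<And>u. u \<in> ball (\<i> * of_real (cosh s)) (sinh s + \<delta>) \<Longrightarrow> dev pr' u"
    "\<And>u. u \<in> hb s \<Longrightarrow> pr' u = pr u"
   using dev_extend [OF compl _ hb_cball_UH [OF sA], of pr] dev_s sA unfolding hb_def
   by (metis sinh_real_pos_iff)
  \<comment> \<open>Raising the top of the disc, at height \<open>exp s\<close>, by
    \<open>\<delta>\<close> gives a larger disc that still fits into the extended domain.\<close>
  define rh' where "rh' = ln (exp s + \<delta>)"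
  have "ln (exp s) < ln (exp s + \<delta>)"
   using \<delta>(1) by (subst ln_less_cancel_iff) (auto simp: add_pos_pos)
  hence rh': "s < rh'" "exp rh' = exp s + \<delta>"
   unfolding rh'_def using \<delta>(1) by (auto simp: add_pos_pos)
  have "hb rh' \<subseteq> ball (\<i> * of_real (cosh s)) (sinh s + \<delta>)"
  proof -
   have "\<i> * of_real (cosh rh') - \<i> * of_real (cosh s) = \<i> * of_real (cosh rh' - cosh s)" by (simp add: algebra_simps)
   moreover have "cosh s \<le> cosh rh'" using rh' sA by (simp add: cosh_real_nonneg_le_iff)
   ultimately have "dist (\<i> * of_real (cosh rh')) (\<i> * of_real (cosh s)) = cosh rh' - cosh s"
    by (simp add: dist_norm norm_mult del: of_real_diff)
   moreover have "cosh rh' - cosh s + sinh rh' \<le> sinh s + \<delta>"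
    using cosh_plus_sinh [of rh'] cosh_plus_sinh [of s] rh' by simp
   ultimately show ?thesis unfolding hb_def by (simp add: ball_subset_ball_iff)
  qed
  moreover obtain e where e: "0 < e" "\<forall>u\<in>ball \<i> e. pr u = pr0 u" using pr(2) by blast
  moreover obtain e' where e': "0 < e'" "ball \<i> e' \<subseteq> hb s"
   using ball_in_ball [of \<i>] i_in_hb [OF sA] unfolding hb_def by metis
  ultimately have "dev_germ pr0 rh' pr'"
   unfolding dev_germ_def using \<delta>(2,3)
   by (intro conjI ballI exI [of _ "min e e'"]) (auto simp: subset_iff)
  hence "rh' \<in> A" using rh' sA by (auto simp: A_def)
  thus False using ub rh' by force
 qed
 hence all: "rh \<in> A" if "0 < rh" for rh
  using down that unfolding bdd_above_def by (meson linear)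
 obtain pr where pr: "\<And>z rh. rh \<in> A \<Longrightarrow> z \<in> hb rh \<Longrightarrow> dev pr z"
  using dev_glue [OF hA neA] by metis
 show ?thesis
  using that [of pr] pr all hb_exhaust by metis
qed

end

section \<open>The universal covering\<close>

text \<open>What is kept of the atlas from here on: the covering is locally isometric, and Moebius
  transformations that leave \<open>pr\<close> invariant act transitively on its fibres.\<close>

locale hyp_cover =
 fixes X :: "'a::metric_space set" and pr :: "complex \<Rightarrow> 'a"
 assumes cov: "covering_space UH pr X"
  and loc: "z \<in> UH \<Longrightarrow> \<exists>e>0. ball z e \<subseteq> UH \<and> (\<forall>u\<in>ball z e. \<forall>v\<in>ball z e. dist (pr u) (pr v) = hdist u v)"
  and trans: "z \<in> UH \<Longrightarrow> w \<in> UH \<Longrightarrow> pr z = pr w \<Longrightarrow> \<exists>g. mob g z = w \<and> (\<forall>u\<in>UH. pr (mob g u) = pr u)"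

lemma hball_in_open:
 assumes "open S" "w \<in> S" "w \<in> UH"
 obtains r where "0 < r" "\<And>z. z \<in> UH \<Longrightarrow> hdist z w < r \<Longrightarrow> z \<in> S"
proof (rule ccontr)
 assume "\<not> thesis"
 hence "\<exists>z. z \<in> UH \<and> hdist z w < inverse (real (Suc n)) \<and> z \<notin> S" for n
  using that by (metis inverse_positive_iff_positive of_nat_0_less_iff zero_less_Suc)
 then obtain u where u: "\<And>n. u n \<in> UH" "\<And>n. hdist (u n) w < inverse (real (Suc n))" "\<And>n. u n \<notin> S" by metis
 have "(\<lambda>n. hdist (u n) w) \<longlonglongrightarrow> 0"
  by (rule tendsto_sandwich [OF _ _ tendsto_const LIMSEQ_inverse_real_of_nat])
   (use u(2) hdist_nonneg [OF u(1) assms(3)] in \<open>auto intro!: always_eventually less_imp_le simp del: of_nat_Suc\<close>)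
 hence "u \<longlonglongrightarrow> w" by (rule tendsto_hdist_0 [OF assms(3) u(1)])
 hence "\<forall>\<^sub>F n in sequentially. u n \<in> S" using assms topological_tendstoD by blast
 thus False using u(3) by auto
qed

lemma hdist_i_hb:
 assumes "0 < r" "z \<in> UH" shows "hdist z \<i> < r \<longleftrightarrow> z \<in> hb r"
proof -
 have i: "\<i> \<in> UH" by simp
 have "cmod (z - \<i>) ^ 2 = (cmod z)\<^sup>2 + 1 - 2 * Im z"
  unfolding cmod_power2 by (simp add: power2_eq_square algebra_simps)
 thus ?thesis using hdist_less_iff [OF assms(2) i, of r] assms by (simp add: mem_hb algebra_simps)
qed

lemma connected_hball:
 assumes "w \<in> UH" "0 < r" shows "connected {z \<in> UH. hdist z w < r}"
proof -
 obtain g where g: "mob g w = \<i>" using sl2_to_i assms by blast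
 have *: "{z \<in> UH. hdist z w < r} = mob (minv g) ` hb r"
 proof (intro set_eqI iffI)
  fix z assume "z \<in> {z \<in> UH. hdist z w < r}"
  hence z: "z \<in> UH" "hdist z w < r" by auto
  hence "hdist (mob g z) \<i> < r" using hdist_mob [OF z(1) assms(1), of g] g by simp
  hence "mob g z \<in> hb r" using hdist_i_hb [OF assms(2) mob_in_UH [OF z(1)]] by blast
  thus "z \<in> mob (minv g) ` hb r" using z by (metis image_eqI mob_minv(1))
 next
  fix z assume "z \<in> mob (minv g) ` hb r"
  then obtain y where y: "y \<in> hb r" "z = mob (minv g) y" by blast
  hence yU: "y \<in> UH" using hb_UH assms by blast
  hence "hdist y \<i> < r" using hdist_i_hb [OF assms(2) yU] y by blast
  moreover have "hdist z w = hdist y \<i>"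
   using hdist_mob [of z w g] y yU g assms(1) by (metis mob_in_UH mob_minv(2))
  ultimately show "z \<in> {z \<in> UH. hdist z w < r}" using y yU by (simp del: UH_iff)
 qed
 show ?thesis unfolding *
  by (rule connected_continuous_image [OF continuous_on_subset [OF continuous_on_mob hb_UH [OF assms(2)]]])
   (simp add: hb_def)
qed

section \<open>Evenly covered neighbourhoods\<close>

abbreviation (input) evenly :: "'b::topological_space set \<Rightarrow> ('b \<Rightarrow> 'a::topological_space) \<Rightarrow> 'a set \<Rightarrow> bool" where
 "evenly C p T \<equiv> \<exists>v. \<Union>v = C \<inter> p -` T \<and> (\<forall>u\<in>v. openin (top_of_set C) u) \<and> pairwise disjnt v \<and>
   (\<forall>u\<in>v. \<exists>q. homeomorphism u T p q)"

context surface_atlas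
begin

lemma chart_continuous: "(U, f) \<in> \<A> \<Longrightarrow> continuous_on U f"
proof (rule continuous_on_sequentiallyI)
 fix x u assume U: "(U, f) \<in> \<A>" and u: "\<forall>n. u n \<in> U" "x \<in> U" "u \<longlonglongrightarrow> x"
 have eq: "hdist (f (u n)) (f x) = dist (u n) x" for n using u chart(4) [OF U] by simp
 have "(\<lambda>n. hdist (f (u n)) (f x)) \<longlonglongrightarrow> 0"
  unfolding eq using u(3) tendsto_dist_iff by blast
 thus "(\<lambda>n. f (u n)) \<longlonglongrightarrow> f x"
  using tendsto_hdist_0 [of "f x" "\<lambda>n. f (u n)"] chart_UH [OF U] u by blast
qed

lemma nice_chart:
 assumes "p \<in> X"
 obtains U f r where "(U, f) \<in> \<A>" "p \<in> U" "0 < r" "X \<inter> ball p r \<subseteq> U"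
  "{w \<in> UH. hdist w (f p) < r} \<subseteq> f ` U"
proof -
 obtain U f where U: "(U, f) \<in> \<A>" "p \<in> U" using chart_cover assms by blast
 obtain T where T: "open T" "U = X \<inter> T" using chart(1) [OF U(1)] by (metis openin_open)
 obtain r1 where r1: "0 < r1" "ball p r1 \<subseteq> T" using T U openE by (metis IntD2)
 obtain r2 where r2: "0 < r2" "\<And>z. z \<in> UH \<Longrightarrow> hdist z (f p) < r2 \<Longrightarrow> z \<in> f ` U"
  using hball_in_open [OF chart(2) [OF U(1)] _ chart_UH [OF U]] U(2) by (metis imageI)
 show ?thesis
  by (rule that [OF U, of "min r1 r2"]) (use r1 r2 T in \<open>auto simp del: UH_iff\<close>)
qed

context
 fixes pr :: "complex \<Rightarrow> 'a" and p U f r V B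
 assumes dv: "\<And>z. z \<in> UH \<Longrightarrow> dev pr z"
  and U: "(U, f) \<in> \<A>" "p \<in> U" "0 < r" "X \<inter> ball p r \<subseteq> U" "{w \<in> UH. hdist w (f p) < r} \<subseteq> f ` U"
 defines "V \<equiv> X \<inter> ball p r" and "B \<equiv> {w \<in> UH. hdist w (f p) < r}"
begin

lemma nice_VB: "f ` V = B" "x \<in> V \<Longrightarrow> f x \<in> B" "w \<in> B \<Longrightarrow> inv_into U f w \<in> V" "V \<subseteq> U" "B \<subseteq> UH"
 "w \<in> B \<Longrightarrow> f (inv_into U f w) = w"
proof -
 show VU: "V \<subseteq> U" and "B \<subseteq> UH" using U by (auto simp: V_def B_def)
 show 1: "f x \<in> B" if "x \<in> V" for x
  using that VU chart_UH [OF U(1)] chart(4) [OF U(1) _ U(2), of x] by (auto simp: B_def V_def dist_commute)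
 show 3: "f (inv_into U f w) = w" if "w \<in> B" for w
  using chart_inv' [OF U(1)] that U(5) by (auto simp: B_def)
 show 2: "inv_into U f w \<in> V" if "w \<in> B" for w
 proof -
  have "inv_into U f w \<in> U" using chart_inv' [OF U(1)] that U(5) by (auto simp: B_def)
  thus ?thesis
   using 3 [OF that] chart(4) [OF U(1) _ U(2), of "inv_into U f w"] chart_subset [OF U(1)] that
   by (auto simp: V_def B_def dist_commute)
 qed
 show "f ` V = B" using 1 2 3 by force
qed

lemma nice_B: "open B" "connected B"
 using open_hball connected_hball chart_UH [OF U(1,2)] U(3) unfolding B_def by blast+

text \<open>A local inverse found near \<open>z\<close> is valid on all of the hyperbolic disc
  \<open>B\<close>, because both sides are developing maps on a connected set. So every point above
  \<open>V\<close> lies in a complete sheet.\<close>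

lemma nice_section:
 assumes z: "z \<in> UH" "pr z \<in> V"
 obtains g where "mob g z = f (pr z)" "\<And>w. w \<in> B \<Longrightarrow> pr (mob (minv g) w) = inv_into U f w"
proof -
 have zU: "pr z \<in> U" using z nice_VB(4) by blast
 obtain e g where e: "0 < e" "ball z e \<subseteq> UH" "\<And>u. u \<in> ball z e \<Longrightarrow> pr u \<in> U \<and> f (pr u) = mob g u"
  using dev_chart [OF dv [OF z(1)] U(1) zU] by metis
 have gz: "mob g z = f (pr z)" using e by simp
 show ?thesis
 proof (rule that [OF gz])
  have "mob g z \<in> B" using gz nice_VB(2) z by simp
  have inv: "mob (minv g) (mob g z) = z" using z by simp
  obtain d where d: "0 < d" "ball (mob g z) d \<subseteq> UH" "\<And>u. u \<in> ball (mob g z) d \<Longrightarrow> mob (minv g) u \<in> ball z e"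
   using mob_ball [of "mob g z" "ball z e" "minv g"] mob_in_UH [OF z(1)] inv e(1) by (metis centre_in_ball open_ball)
  fix w assume w: "w \<in> B"
  have "pr (mob (minv g) w) = inv_into U f (mob 1 w)"
  proof (rule dev_unique [of B "\<lambda>w. pr (mob (minv g) w)" "\<lambda>w. inv_into U f (mob 1 w)" "mob g z" d w])
   show "open B" "connected B" by (rule nice_B)+
   show "dev (\<lambda>w. pr (mob (minv g) w)) u" if "u \<in> B" for u
    using that nice_VB(5) dv dev_mob mob_in_UH by blast
   show "dev (\<lambda>w. inv_into U f (mob 1 w)) u" if "u \<in> B" for u
    using that nice_VB(5) by (intro chart_dev [OF U(1)]) (use U(5) in \<open>auto simp: B_def\<close>)
   show "pr (mob (minv g) u) = inv_into U f (mob 1 u)" if "u \<in> ball (mob g z) d" for u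
   proof -
    have "u \<in> UH" using that d by blast
    hence "f (pr (mob (minv g) u)) = u" "pr (mob (minv g) u) \<in> U"
     using e(3) [OF d(3) [OF that]] mob_minv(2) by simp_all
    thus ?thesis using chart_inv [OF U(1)] by (metis mob_1)
   qed
  qed fact+
  thus "pr (mob (minv g) w) = inv_into U f w" by simp
 qed
qed

text \<open>One point of \<open>V\<close> in the image brings in all of \<open>V\<close>. This will
  make the image open and closed, hence all of \<open>X\<close>.\<close>

lemma nice_image: "z \<in> UH \<Longrightarrow> pr z \<in> V \<Longrightarrow> V \<subseteq> pr ` UH"
proof
 fix x assume "z \<in> UH" "pr z \<in> V" and x: "x \<in> V"
 then obtain g where "\<And>w. w \<in> B \<Longrightarrow> pr (mob (minv g) w) = inv_into U f w" using nice_section by metis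
 hence "pr (mob (minv g) (f x)) = inv_into U f (f x)" using nice_VB(2) x by blast
 also have "\<dots> = x" using chart_inv [OF U(1)] x nice_VB(4) by blast
 finally show "x \<in> pr ` UH" using nice_VB(2,5) x by (metis imageI mob_in_UH subsetD)
qed

text \<open>The sheets are the images of \<open>B\<close> under the inverses of the elements of
  \<open>M\<close>. Two sheets that meet come from transformations that agree near the common point,
  by local injectivity of \<open>pr\<close>, and therefore coincide.\<close>

lemma nice_evenly_covered: "evenly UH pr V"
proof -
 define M where "M = {g. \<forall>w\<in>B. pr (mob (minv g) w) = inv_into U f w}"
 have pre: "mob (minv g) ` B = UH \<inter> mob g -` B" for g
 proof (intro set_eqI iffI)
  fix z assume "z \<in> mob (minv g) ` B"
  then obtain w where "w \<in> B" "z = mob (minv g) w" by blast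
  thus "z \<in> UH \<inter> mob g -` B" using nice_VB(5) by (auto simp del: UH_iff simp: subset_iff)
 next
  fix z assume "z \<in> UH \<inter> mob g -` B"
  thus "z \<in> mob (minv g) ` B" by (intro image_eqI [of _ _ "mob g z"]) (auto simp del: UH_iff)
 qed
 show ?thesis
 proof (intro exI [of _ "(\<lambda>g. mob (minv g) ` B) ` M"] conjI ballI)
  show "\<Union> ((\<lambda>g. mob (minv g) ` B) ` M) = UH \<inter> pr -` V"
  proof (intro set_eqI iffI)
   fix z assume "z \<in> \<Union> ((\<lambda>g. mob (minv g) ` B) ` M)"
   then obtain g w where "g \<in> M" "w \<in> B" "z = mob (minv g) w" by blast
   thus "z \<in> UH \<inter> pr -` V" using nice_VB(3,5) by (auto simp: M_def subset_iff simp del: UH_iff)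
  next
   fix z assume "z \<in> UH \<inter> pr -` V"
   hence z: "z \<in> UH" "pr z \<in> V" by auto
   obtain g where g: "mob g z = f (pr z)" "\<And>w. w \<in> B \<Longrightarrow> pr (mob (minv g) w) = inv_into U f w"
    using nice_section [OF z] by metis
   have "z = mob (minv g) (f (pr z))" using g(1) mob_minv(1) [OF z(1), of g] by simp
   moreover have "f (pr z) \<in> B" using nice_VB(2) z by blast
   ultimately show "z \<in> \<Union> ((\<lambda>g. mob (minv g) ` B) ` M)" using g(2) by (auto simp: M_def)
  qed
  show "openin (top_of_set UH) u" if "u \<in> (\<lambda>g. mob (minv g) ` B) ` M" for u
  proof -
   have "open (UH \<inter> mob g -` B)" for g
    by (rule continuous_open_preimage [OF continuous_on_mob open_UH nice_B(1)])
   thus ?thesis using that pre by (auto intro!: open_subset)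
  qed
  show "pairwise disjnt ((\<lambda>g. mob (minv g) ` B) ` M)"
  proof (intro pairwiseI, rule ccontr)
   fix u u' assume u: "u \<in> (\<lambda>g. mob (minv g) ` B) ` M" "u' \<in> (\<lambda>g. mob (minv g) ` B) ` M" "u \<noteq> u'" "\<not> disjnt u u'"
   then obtain g g' where g: "g \<in> M" "g' \<in> M" "u = mob (minv g) ` B" "u' = mob (minv g') ` B" by blast
   obtain w w' where w: "w \<in> B" "w' \<in> B" "mob (minv g) w = mob (minv g') w'"
    using u(4) g by (auto simp: disjnt_def)
   hence "inv_into U f w = inv_into U f w'" using g(1,2) by (auto simp: M_def)
   hence ww: "w = w'" using nice_VB(6) w by metis
   define z where "z = mob (minv g) w"
   have wU: "w \<in> UH" using w nice_VB(5) by blast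
   have zU: "z \<in> UH" using wU by (simp add: z_def)
   obtain e where e: "0 < e" "ball z e \<subseteq> UH" "\<And>u v. u \<in> ball z e \<Longrightarrow> v \<in> ball z e \<Longrightarrow> dist (pr u) (pr v) = hdist u v"
    using dev_isometry [OF dv [OF zU]] by metis
   obtain d1 where d1: "0 < d1" "ball w d1 \<subseteq> UH" "\<And>y. y \<in> ball w d1 \<Longrightarrow> mob (minv g) y \<in> ball z e"
    using mob_ball [OF wU open_ball, of "minv g" z e] e(1) by (auto simp: z_def)
   obtain d2 where d2: "0 < d2" "ball w d2 \<subseteq> UH" "\<And>y. y \<in> ball w d2 \<Longrightarrow> mob (minv g') y \<in> ball z e"
    using mob_ball [OF wU open_ball, of "minv g'" z e] e(1) w(3) ww by (auto simp: z_def)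
   obtain d3 where d3: "0 < d3" "ball w d3 \<subseteq> B" using w(1) nice_B(1) openE by blast
   define d where "d = min d1 (min d2 d3)"
   have d: "0 < d" "ball w d \<subseteq> UH" using d1 d2 d3 by (auto simp: d_def subset_iff simp del: UH_iff)
   have "mob (minv g) y = mob (minv g') y" if "y \<in> ball w d" for y
   proof -
    have y: "y \<in> ball w d1" "y \<in> ball w d2" "y \<in> B" using that d3(2) by (auto simp: d_def)
    have "pr (mob (minv g) y) = pr (mob (minv g') y)" using g(1,2) y(3) by (simp add: M_def)
    hence "hdist (mob (minv g) y) (mob (minv g') y) = 0" using e(3) d1(3) d2(3) y by (metis dist_self)
    thus ?thesis using hdist_eq_0 mob_in_UH d1(2) y(1) by (metis subsetD)
   qed
   hence "mob (minv g) y = mob (minv g') y" if "y \<in> UH" for y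
    using mob_agree [OF d] that by blast
   hence "mob (minv g) ` B = mob (minv g') ` B" using nice_VB(5) by (intro image_cong refl) blast
   thus False using u(3) g by simp
  qed
  fix u assume "u \<in> (\<lambda>g. mob (minv g) ` B) ` M"
  then obtain g where g: "g \<in> M" "u = mob (minv g) ` B" by blast
  have uU: "u \<subseteq> UH" using g nice_VB(5) by (auto simp del: UH_iff simp: subset_iff)
  have "homeomorphism u V pr (\<lambda>x. mob (minv g) (f x))"
  proof (rule homeomorphismI)
   show "continuous_on u pr"
    using dv dev_cont uU by (meson continuous_at_imp_continuous_on subsetD)
   show "continuous_on V (\<lambda>x. mob (minv g) (f x))"
    by (rule continuous_on_compose2 [OF continuous_on_mob continuous_on_subset [OF chart_continuous [OF U(1)] nice_VB(4)]])
     (use nice_VB(1,5) in blast)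
   show "pr ` u \<subseteq> V" using g nice_VB(3) by (auto simp: M_def)
   show "(\<lambda>x. mob (minv g) (f x)) ` V \<subseteq> u" using g nice_VB(1) by blast
   show "mob (minv g) (f (pr x)) = x" if "x \<in> u" for x
    using that g nice_VB(6) by (auto simp: M_def)
   show "pr (mob (minv g) (f y)) = y" if "y \<in> V" for y
    using that g(1) nice_VB(2,4) chart_inv [OF U(1)] by (auto simp: M_def)
  qed
  thus "\<exists>q. homeomorphism u V pr q" by blast
 qed
qed

end

text \<open>In one chart around the common image the map reads \<open>g1\<close> near
  \<open>z\<close> and \<open>g2\<close> near \<open>w\<close>. Then \<open>g1\<close> followed by
  the inverse of \<open>g2\<close> leaves \<open>pr\<close> invariant near \<open>z\<close>, and by
  uniqueness everywhere.\<close>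

lemma dev_transitive:
 assumes dv: "\<And>z. z \<in> UH \<Longrightarrow> dev pr z" and zw: "z \<in> UH" "w \<in> UH" "pr z = pr w"
 shows "\<exists>g. mob g z = w \<and> (\<forall>u\<in>UH. pr (mob g u) = pr u)"
proof -
 obtain U f where U: "(U, f) \<in> \<A>" "pr z \<in> U" using chart_cover dev_in [OF dv [OF zw(1)]] by blast
 obtain e1 g1 where e1: "0 < e1" "ball z e1 \<subseteq> UH" "\<And>u. u \<in> ball z e1 \<Longrightarrow> pr u \<in> U \<and> f (pr u) = mob g1 u"
  using dev_chart [OF dv [OF zw(1)] U] by metis
 have wU: "pr w \<in> U" using U zw by simp
 obtain e2 g2 where e2: "0 < e2" "ball w e2 \<subseteq> UH" "\<And>u. u \<in> ball w e2 \<Longrightarrow> pr u \<in> U \<and> f (pr u) = mob g2 u"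
  using dev_chart [OF dv [OF zw(2)] U(1) wU] by metis
 define m where "m = minv g2 * g1"
 have g12: "mob g1 z = mob g2 w" using e1 e2 zw by (metis centre_in_ball)
 have mz: "mob m z = w" unfolding m_def mob_mult [OF zw(1)] g12 using zw(2) by simp
 obtain d where d: "0 < d" "ball z d \<subseteq> UH" "\<And>u. u \<in> ball z d \<Longrightarrow> mob m u \<in> ball w e2"
  using mob_ball [OF zw(1) open_ball, of m w e2] mz e2(1) by auto
 have "pr (mob m u) = pr u" if "u \<in> UH" for u
 proof (rule dev_unique [of UH "\<lambda>u. pr (mob m u)" pr z "min d e1" u])
  show "open UH" "connected UH" by (auto simp: convex_connected)
  show "dev (\<lambda>u. pr (mob m u)) v" if "v \<in> UH" for v using dev_mob dv that mob_in_UH by blast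
  show "pr (mob m v) = pr v" if "v \<in> ball z (min d e1)" for v
  proof (rule chart_inj [OF U(1)])
   have v: "v \<in> ball z d" "v \<in> ball z e1" "v \<in> UH" using that d by auto
   show "pr (mob m v) \<in> U" "pr v \<in> U" using v e1(3) e2(3) d(3) by blast+
   have "f (pr (mob m v)) = mob g2 (mob m v)" using e2(3) d(3) v by blast
   also have "\<dots> = mob g1 v" using v(3) unfolding m_def by (simp add: mob_mult del: UH_iff)
   finally show "f (pr (mob m v)) = f (pr v)" using e1(3) v by simp
  qed
 qed (use that zw d e1 dv in auto)
 thus ?thesis using mz by blast
qed

theorem hyp_cover_exists:
 assumes "complete X" "connected X" "X \<noteq> {}"
 shows "\<exists>pr. hyp_cover X pr"
proof -
 obtain pr where dv: "\<And>z. z \<in> UH \<Longrightarrow> dev pr z" using developing_map assms by blast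
 have sub: "pr ` UH \<subseteq> X" using dev_in dv by blast
 have dich: "\<exists>T. openin (top_of_set X) T \<and> p \<in> T \<and> (T \<subseteq> pr ` UH \<or> T \<inter> pr ` UH = {}) \<and> evenly UH pr T" if p: "p \<in> X" for p
 proof -
  obtain U f r where U: "(U, f) \<in> \<A>" "p \<in> U" "0 < r" "X \<inter> ball p r \<subseteq> U" "{w \<in> UH. hdist w (f p) < r} \<subseteq> f ` U"
   using p by (rule nice_chart)
  have ni: "X \<inter> ball p r \<subseteq> pr ` UH \<or> (X \<inter> ball p r) \<inter> pr ` UH = {}"
   using nice_image [OF _ U, of pr] dv by blast
  have op: "openin (top_of_set X) (X \<inter> ball p r)" by (simp add: openin_open_Int)
  have pin: "p \<in> X \<inter> ball p r" using p U(3) by simp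
  have ev: "evenly UH pr (X \<inter> ball p r)"
   by (rule nice_evenly_covered [OF _ U]) (rule dv)
  show ?thesis
   by (rule exI [of _ "X \<inter> ball p r"], rule conjI [OF op conjI [OF pin conjI [OF ni ev]]])
 qed
 have dich': "\<exists>T. openin (top_of_set X) T \<and> p \<in> T \<and> (T \<subseteq> pr ` UH \<or> T \<inter> pr ` UH = {})" if "p \<in> X" for p
  using dich [OF that] by (elim exE conjE) (intro exI conjI, assumption+)
 have "openin (top_of_set X) (pr ` UH)"
 proof (subst openin_subopen, intro ballI)
  fix x assume x: "x \<in> pr ` UH"
  hence "x \<in> X" using sub by blast
  thus "\<exists>T. openin (top_of_set X) T \<and> x \<in> T \<and> T \<subseteq> pr ` UH" using dich' x by blast
 qed
 moreover have "openin (top_of_set X) (X - pr ` UH)"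
 proof (subst openin_subopen, intro ballI)
  fix x assume x: "x \<in> X - pr ` UH"
  then obtain T where T: "openin (top_of_set X) T" "x \<in> T" "T \<subseteq> pr ` UH \<or> T \<inter> pr ` UH = {}"
   using dich' by blast
  hence "T \<subseteq> X - pr ` UH" using x openin_imp_subset by blast
  thus "\<exists>T. openin (top_of_set X) T \<and> x \<in> T \<and> T \<subseteq> X - pr ` UH" using T by blast
 qed
 ultimately have "pr ` UH = {} \<or> pr ` UH = X"
  using \<open>connected X\<close> sub unfolding connected_clopen by (metis closedin_def double_diff openin_closedin_eq topspace_euclidean_subtopology order_refl)
 moreover have "\<i> \<in> UH" by simp
 ultimately have im: "pr ` UH = X" by blast
 have "hyp_cover X pr"
 proof
  show "covering_space UH pr X"
  proof
   show "continuous_on UH pr" using dv dev_cont by (meson continuous_at_imp_continuous_on)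
   show "pr ` UH = X" by (rule im)
   show "\<exists>T. x \<in> T \<and> openin (top_of_set X) T \<and> evenly UH pr T" if "x \<in> X" for x
    using dich [OF that] by blast
  qed
  show "\<exists>e>0. ball z e \<subseteq> UH \<and> (\<forall>u\<in>ball z e. \<forall>v\<in>ball z e. dist (pr u) (pr v) = hdist u v)" if "z \<in> UH" for z
   using dev_isometry [OF dv [OF that]] by metis
  show "\<exists>g. mob g z = w \<and> (\<forall>u\<in>UH. pr (mob g u) = pr u)" if "z \<in> UH" "w \<in> UH" "pr z = pr w" for z w
   using dev_transitive dv that by blast
 qed
 thus ?thesis by blast
qed

end

theorem hyperbolic_surface_cover:
 assumes "hyperbolic_surface X" "complete X"
 shows "\<exists>pr. hyp_cover X pr"
proof -
 obtain \<A> where "hyperbolic_atlas X \<A>" using assms by (auto simp: hyperbolic_surface_def)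
 then interpret surface_atlas X \<A> by unfold_locales
 show ?thesis using hyp_cover_exists assms by (auto simp: hyperbolic_surface_def)
qed

text \<open>Used twice: to replace the base by its image under an isometric embedding, and to
  precompose the covering with a Moebius transformation.\<close>

lemma covering_space_homeomorphism:
 assumes cov: "covering_space C p S" and h: "homeomorphism S S' h k" and m: "homeomorphism C' C m n"
 shows "covering_space C' (h \<circ> p \<circ> m) S'"
proof
 have im: "p ` C = S" and cp: "continuous_on C p"
  using cov covering_space_imp_surjective covering_space_imp_continuous by blast+
 have mn: "m ` C' = C" "n ` C = C'" "\<And>x. x \<in> C' \<Longrightarrow> n (m x) = x" "\<And>x. x \<in> C \<Longrightarrow> m (n x) = x"
  using m by (auto simp: homeomorphism_def)
 have hS: "h ` S = S'" "\<And>a b. a \<in> S \<Longrightarrow> b \<in> S \<Longrightarrow> h a = h b \<Longrightarrow> a = b"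
  using h by (auto simp: homeomorphism_def) metis
 have "continuous_on C (h \<circ> p)"
  by (rule continuous_on_compose [OF cp]) (use h im in \<open>simp add: homeomorphism_def\<close>)
 moreover have "continuous_on C' m" using m by (simp add: homeomorphism_def)
 ultimately show "continuous_on C' (h \<circ> p \<circ> m)" unfolding mn(1) [symmetric] by (intro continuous_on_compose [of C' m])
 show "(h \<circ> p \<circ> m) ` C' = S'" using im mn(1) hS(1) by (metis image_comp)
 fix x assume "x \<in> S'"
 hence x: "k x \<in> S" "h (k x) = x" using h by (auto simp: homeomorphism_def)
 obtain T v where T: "k x \<in> T" "openin (top_of_set S) T" "\<Union>v = C \<inter> p -` T" "\<forall>u\<in>v. openin (top_of_set C) u"
   "pairwise disjnt v" "\<forall>u\<in>v. \<exists>q. homeomorphism u T p q"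
  using cov [unfolded covering_space_def, THEN conjunct2, THEN conjunct2, rule_format, OF x(1)] by (elim exE conjE)
 have TS: "T \<subseteq> S" using T(2) openin_imp_subset by blast
 have hT: "homeomorphism T (h ` T) h k" using h TS by (rule homeomorphism_of_subsets) auto
 have vC: "u \<subseteq> C" if "u \<in> v" for u using T(4) that openin_imp_subset by blast
 have n: "homeomorphism C C' n m" using m homeomorphism_symD by blast
 have "evenly C' (h \<circ> p \<circ> m) (h ` T)"
 proof (intro exI [of _ "(`) n ` v"] conjI ballI)
  have "\<Union> ((`) n ` v) = n ` (C \<inter> p -` T)" unfolding T(3) [symmetric] by blast
  also have "\<dots> = C' \<inter> (h \<circ> p \<circ> m) -` (h ` T)"
  proof (intro set_eqI iffI)
   fix y assume "y \<in> n ` (C \<inter> p -` T)"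
   then obtain c where "c \<in> C" "p c \<in> T" "y = n c" by blast
   thus "y \<in> C' \<inter> (h \<circ> p \<circ> m) -` (h ` T)" using mn(2,4) by auto
  next
   fix y assume "y \<in> C' \<inter> (h \<circ> p \<circ> m) -` (h ` T)"
   then obtain t where t: "y \<in> C'" "t \<in> T" "h (p (m y)) = h t" by auto
   moreover have "m y \<in> C" "p (m y) \<in> S" using t(1) mn(1) im by blast+
   ultimately have "m y \<in> C \<inter> p -` T" using hS(2) [of "p (m y)" t] TS by auto
   thus "y \<in> n ` (C \<inter> p -` T)" using mn(3) [OF t(1)] by (intro image_eqI [of _ _ "m y"]) simp_all
  qed
  finally show "\<Union> ((`) n ` v) = C' \<inter> (h \<circ> p \<circ> m) -` (h ` T)" .
  show "openin (top_of_set C') u" if "u \<in> (`) n ` v" for u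
   using that T(4) homeomorphism_imp_open_map [OF n] by blast
  show "pairwise disjnt ((`) n ` v)"
  proof (intro pairwiseI)
   fix a b assume "a \<in> (`) n ` v" "b \<in> (`) n ` v" "a \<noteq> b"
   then obtain a' b' where ab: "a' \<in> v" "b' \<in> v" "a = n ` a'" "b = n ` b'" "a' \<noteq> b'" by blast
   hence "disjnt a' b'" using T(5) by (simp add: pairwise_def)
   moreover have "inj_on n C" using mn(4) by (metis inj_onI)
   ultimately show "disjnt a b"
    using inj_on_image_Int [of n C a' b'] ab vC unfolding disjnt_def by simp
  qed
  fix u assume "u \<in> (`) n ` v"
  then obtain u' where u': "u' \<in> v" "u = n ` u'" by blast
  obtain q where q: "homeomorphism u' T p q" using T(6) u' by blast
  have "homeomorphism u u' m n"
   using homeomorphism_of_subsets [OF n] vC u' homeomorphism_symD by (metis order_refl)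
  thus "\<exists>q. homeomorphism u (h ` T) (h \<circ> p \<circ> m) q"
   using homeomorphism_compose [OF homeomorphism_compose [OF _ q] hT] unfolding o_assoc by blast
 qed
 moreover have "x \<in> h ` T" using x T(1) by (metis imageI)
 moreover have "openin (top_of_set S') (h ` T)" using homeomorphism_imp_open_map [OF h T(2)] .
 ultimately show "\<exists>T. x \<in> T \<and> openin (top_of_set S') T \<and> evenly C' (h \<circ> p \<circ> m) T" by (intro exI [of _ "h ` T"] conjI)
qed

lemma homeomorphism_id: "homeomorphism S S id id"
 by (simp add: homeomorphism_def)

lemma homeomorphism_mob: "homeomorphism UH UH (mob M) (mob (minv M))"
 by (rule homeomorphismI) (auto simp: continuous_on_mob simp del: UH_iff)

text \<open>The lifting theorems of the library require the base to lie in a normed space, so they are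
 transported along the Kuratowski embedding into the bounded continuous functions.\<close>

lemma Kuratowski_embedding:
 obtains \<iota> :: "'a::metric_space \<Rightarrow> ('a \<Rightarrow>\<^sub>C real)" where "\<And>x y. dist (\<iota> x) (\<iota> y) = dist x y"
proof
 define o' where "o' = (undefined :: 'a)"
 define \<iota> where "\<iota> = (\<lambda>a::'a. Bcontfun (\<lambda>x. dist a x - dist o' x))"
 have app: "apply_bcontfun (\<iota> a) x = dist a x - dist o' x" for a x
 proof -
  have "(\<lambda>x. dist a x - dist o' x) \<in> bcontfun"
   unfolding bcontfun_def
  proof (intro CollectI conjI)
   show "continuous_on UNIV (\<lambda>x. dist a x - dist o' x)" by (intro continuous_intros)
   have "\<bar>dist a x - dist o' x\<bar> \<le> dist a o'" for x
    using dist_triangle [of a x o'] dist_triangle [of o' x a] by (simp add: dist_commute abs_if)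
   thus "bounded (range (\<lambda>x. dist a x - dist o' x))"
    by (intro boundedI [of _ "dist a o'"]) auto
  qed
  thus ?thesis by (simp add: \<iota>_def Bcontfun_inverse)
 qed
 show "dist (\<iota> a) (\<iota> b) = dist a b" for a b
 proof (rule antisym)
  show "dist (\<iota> a) (\<iota> b) \<le> dist a b"
  proof (rule dist_bound)
   fix x show "dist (apply_bcontfun (\<iota> a) x) (apply_bcontfun (\<iota> b) x) \<le> dist a b"
    using dist_triangle [of a x b] dist_triangle [of b x a] by (simp add: app dist_real_def dist_commute abs_if)
  qed
  show "dist a b \<le> dist (\<iota> a) (\<iota> b)"
   using dist_bounded [of "\<iota> a" b "\<iota> b"] by (simp add: app dist_real_def)
 qed
qed

lemma isometry_continuous: "continuous_on S f" if "\<And>x y. x \<in> S \<Longrightarrow> y \<in> S \<Longrightarrow> dist (f x) (f y) = dist x y"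
 unfolding continuous_on_iff using that by metis

lemma isometry_homeomorphism:
 assumes iso: "\<And>x y. dist (f x) (f y) = dist x y"
 obtains k where "homeomorphism S (f ` S) f k" "\<And>x. k (f x) = x"
proof -
 have inj: "inj f" using iso by (metis dist_eq_0_iff injI)
 show ?thesis
 proof
  show "inv f (f x) = x" for x using inj by simp
  show "homeomorphism S (f ` S) f (inv f)"
   by (rule homeomorphismI) (use inj iso in \<open>auto intro!: isometry_continuous\<close>)
 qed
qed

section \<open>Deck transformations and change of coordinates\<close>

definition deck :: "(complex \<Rightarrow> 'a) \<Rightarrow> sl2 \<Rightarrow> bool" where
 "deck pr g \<longleftrightarrow> (\<forall>u\<in>UH. pr (mob g u) = pr u)"

text \<open>Statements about a cusp are proved with the cusp at infinity and transferred by this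
  change of coordinates, under which deck transformations are conjugated.\<close>

abbreviation (input) pull :: "(complex \<Rightarrow> 'a) \<Rightarrow> sl2 \<Rightarrow> complex \<Rightarrow> 'a" where
 "pull pr M \<equiv> \<lambda>z. pr (mob M z)"

lemma deckD: "deck pr g \<Longrightarrow> z \<in> UH \<Longrightarrow> pr (mob g z) = pr z"
 by (simp add: deck_def del: UH_iff)

lemma deck_1 [simp]: "deck pr 1"
 by (simp add: deck_def)

lemma deck_mult: "deck pr g \<Longrightarrow> deck pr h \<Longrightarrow> deck pr (g * h)"
 unfolding deck_def by (metis mob_in_UH mob_mult)

lemma deck_minv: "deck pr g \<Longrightarrow> deck pr (minv g)"
 unfolding deck_def by (metis mob_in_UH mob_minv(2))

lemma deck_uminus [simp]: "deck pr (- g) \<longleftrightarrow> deck pr g"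
 by (simp add: deck_def)

lemma deck_conj: "deck (pull pr M) g \<longleftrightarrow> deck pr (M * g * minv M)"
proof
 assume *: "deck (pull pr M) g"
 show "deck pr (M * g * minv M)" unfolding deck_def
 proof
  fix u assume u: "u \<in> UH"
  hence "pr (mob M (mob g (mob (minv M) u))) = pr (mob M (mob (minv M) u))"
   using * unfolding deck_def by (metis mob_in_UH)
  thus "pr (mob (M * g * minv M) u) = pr u" using u by (simp add: mob_mult del: UH_iff)
 qed
next
 assume *: "deck pr (M * g * minv M)"
 show "deck (pull pr M) g" unfolding deck_def
 proof
  fix u assume u: "u \<in> UH"
  have "mob (M * g * minv M) (mob M u) = mob M (mob g u)" using u by (simp add: mob_mult del: UH_iff)
  thus "pr (mob M (mob g u)) = pr (mob M u)" using * u unfolding deck_def by (metis mob_in_UH)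
 qed
qed

lemma hyp_cover_mob:
 assumes "hyp_cover X pr" shows "hyp_cover X (pull pr M)"
proof -
 interpret hyp_cover X pr by fact
 show ?thesis
 proof
  show "covering_space UH (pull pr M) X"
   using covering_space_homeomorphism [OF cov homeomorphism_id homeomorphism_mob] by (simp add: o_def)
  show "\<exists>e>0. ball z e \<subseteq> UH \<and> (\<forall>u\<in>ball z e. \<forall>v\<in>ball z e. dist (pr (mob M u)) (pr (mob M v)) = hdist u v)"
   if z: "z \<in> UH" for z
  proof -
   obtain e where e: "0 < e" "ball (mob M z) e \<subseteq> UH"
    "\<forall>u\<in>ball (mob M z) e. \<forall>v\<in>ball (mob M z) e. dist (pr u) (pr v) = hdist u v"
    using loc [OF mob_in_UH [OF z, of M]] by blast
   obtain d1 where d1: "0 < d1" "\<And>u. dist u z < d1 \<Longrightarrow> dist (mob M u) (mob M z) < e"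
    using isCont_mob [OF z, of M] e(1) unfolding continuous_at_eps_delta by metis
   obtain d2 where d2: "0 < d2" "ball z d2 \<subseteq> UH" using z open_UH openE by metis
   have "dist (pr (mob M u)) (pr (mob M v)) = hdist u v"
    if uv: "u \<in> ball z (min d1 d2)" "v \<in> ball z (min d1 d2)" for u v
   proof -
    have "u \<in> UH" "v \<in> UH" using uv d2(2) by auto
    moreover have "mob M u \<in> ball (mob M z) e" "mob M v \<in> ball (mob M z) e"
     using uv d1(2) by (auto simp: dist_commute)
    ultimately show ?thesis using e(3) hdist_mob by metis
   qed
   moreover have "ball z (min d1 d2) \<subseteq> UH" using d2(2) by auto
   ultimately show ?thesis using d1(1) d2(1) by (intro exI [of _ "min d1 d2"]) auto
  qed
  show "\<exists>g. mob g z = w \<and> (\<forall>u\<in>UH. pr (mob M (mob g u)) = pr (mob M u))"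
   if zw: "z \<in> UH" "w \<in> UH" "pr (mob M z) = pr (mob M w)" for z w
  proof -
   obtain g where g: "mob g (mob M z) = mob M w" "deck pr g"
    using trans [OF mob_in_UH [OF zw(1)] mob_in_UH [OF zw(2)] zw(3)] unfolding deck_def by blast
   have "mob (minv M * g * M) z = w" using zw g(1) by (simp add: mob_mult del: UH_iff)
   moreover have "deck (pull pr M) (minv M * g * M)"
    using g(2) by (simp add: deck_conj mult.assoc)
   ultimately show ?thesis unfolding deck_def by blast
  qed
 qed
qed

context hyp_cover
begin

lemma cont: "continuous_on UH pr"
 using cov covering_space_imp_continuous by blast

lemma image: "pr ` UH = X"
 using cov covering_space_imp_surjective by blast

lemma in_X: "z \<in> UH \<Longrightarrow> pr z \<in> X"
 using image by blast

lemma deck_trans: "z \<in> UH \<Longrightarrow> w \<in> UH \<Longrightarrow> pr z = pr w \<Longrightarrow> \<exists>g. deck pr g \<and> mob g z = w"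
 using trans unfolding deck_def by blast

section \<open>Lifting of paths and homotopies\<close>

lemma lift:
 fixes f :: "'c::real_normed_vector \<Rightarrow> 'a"
 assumes "convex U" "continuous_on U f" "f ` U \<subseteq> X" "z \<in> U" "a \<in> UH" "f z = pr a"
 obtains g where "continuous_on U g" "\<And>y. y \<in> U \<Longrightarrow> g y \<in> UH" "g z = a" "\<And>y. y \<in> U \<Longrightarrow> pr (g y) = f y"
proof -
 obtain \<iota> :: "'a \<Rightarrow> ('a \<Rightarrow>\<^sub>C real)" where \<iota>: "\<And>x y. dist (\<iota> x) (\<iota> y) = dist x y"
  using Kuratowski_embedding by blast
 obtain k where k: "homeomorphism X (\<iota> ` X) \<iota> k" "\<And>x. k (\<iota> x) = x" using isometry_homeomorphism [OF \<iota>] by metis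
 have cov': "covering_space UH (\<iota> \<circ> pr) (\<iota> ` X)"
  using covering_space_homeomorphism [OF cov k(1) homeomorphism_id] by simp
 have "continuous_on X \<iota>" using k(1) by (simp add: homeomorphism_def)
 hence "continuous_on U (\<iota> \<circ> f)" using assms(2,3) continuous_on_compose continuous_on_subset by blast
 moreover have "(\<iota> \<circ> f) \<in> U \<rightarrow> \<iota> ` X" using assms(3) by auto
 moreover have "(\<iota> \<circ> f) z = (\<iota> \<circ> pr) a" using assms(6) by simp
 ultimately obtain g where g: "continuous_on U g" "g \<in> U \<rightarrow> UH" "g z = a" "\<And>y. y \<in> U \<Longrightarrow> (\<iota> \<circ> pr) (g y) = (\<iota> \<circ> f) y"
  using covering_space_lift_strong [OF cov' assms(5,4) convex_imp_simply_connected [OF assms(1)]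
    convex_imp_locally_path_connected [OF assms(1)]] by metis
 show ?thesis
 proof
  show "pr (g y) = f y" if "y \<in> U" for y using g(4) [OF that] k(2) by (metis comp_apply)
 qed (use g in auto)
qed

lemma lift_unique:
 fixes g1 g2 :: "'c::topological_space \<Rightarrow> complex"
 assumes "connected T" "continuous_on T g1" "continuous_on T g2"
  "\<And>x. x \<in> T \<Longrightarrow> g1 x \<in> UH" "\<And>x. x \<in> T \<Longrightarrow> g2 x \<in> UH" "\<And>x. x \<in> T \<Longrightarrow> pr (g1 x) = pr (g2 x)"
  "a \<in> T" "g1 a = g2 a" "x \<in> T"
 shows "g1 x = g2 x"
proof (rule covering_space_lift_unique [OF cov, of g1 a g2 T "pr \<circ> g1"])
 show "continuous_on T (pr \<circ> g1)"
  using assms(2,4) cont by (intro continuous_on_compose continuous_on_subset [OF cont]) (auto simp del: UH_iff)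
qed (use assms in_X in \<open>auto simp del: UH_iff\<close>)

lemma homotopic_loops_lift:
 assumes p: "path p" "path_image p \<subseteq> UH" "pathfinish p = mob h (pathstart p)"
  and q: "path q" "path_image q \<subseteq> UH" "pathfinish q = mob h (pathstart q)"
  and h: "deck pr h"
 shows "homotopic_loops X (pr \<circ> p) (pr \<circ> q)"
proof -
 \<comment> \<open>straight-line homotopy in the coordinates (Re, ln Im), corrected so that it stays equivariant\<close>
 define \<psi> where "\<psi> = (\<lambda>z. Complex (Re z) (ln (Im z)))"
 define \<psi>' where "\<psi>' = (\<lambda>z. Complex (Re z) (exp (Im z)))"
 have inv: "\<psi>' (\<psi> z) = z" if "z \<in> UH" for z using that by (simp add: \<psi>_def \<psi>'_def)
 have c\<psi>: "continuous_on UH \<psi>" unfolding \<psi>_def Complex_eq by (intro continuous_intros) auto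
 have c\<psi>': "continuous_on UNIV \<psi>'" unfolding \<psi>'_def Complex_eq by (intro continuous_intros)
 have \<psi>'U: "\<psi>' z \<in> UH" for z by (simp add: \<psi>'_def)
 have pU: "p t \<in> UH" "q t \<in> UH" if "t \<in> {0..1}" for t
  using p(2) q(2) that unfolding path_image_def by blast+
 define sg where "sg = (\<lambda>s::real. \<psi>' (of_real (1 - s) * \<psi> (p 0) + of_real s * \<psi> (q 0)))"
 define G where "G = (\<lambda>(s::real, t::real). \<psi>' (of_real (1 - s) * \<psi> (p t) + of_real s * \<psi> (q t)
   + of_real t * (\<psi> (mob h (sg s)) - of_real (1 - s) * \<psi> (p 1) - of_real s * \<psi> (q 1))))"
 have c\<psi>p: "continuous_on {0..1} (\<lambda>t. \<psi> (p t))" "continuous_on {0..1} (\<lambda>t. \<psi> (q t))"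
  using p(1) q(1) pU unfolding path_def by (auto intro!: continuous_on_compose2 [OF c\<psi>] simp del: UH_iff)
 have csg: "continuous_on {0..1} (\<lambda>s. \<psi> (mob h (sg s)))"
  unfolding sg_def
  by (rule continuous_on_compose2 [OF c\<psi>], rule continuous_on_compose2 [OF continuous_on_mob],
    rule continuous_on_compose2 [OF c\<psi>'], intro continuous_intros)
    (use \<psi>'U mob_in_UH in \<open>auto simp del: UH_iff\<close>)
 have cG: "continuous_on ({0..1} \<times> {0..1}) G"
  unfolding G_def split_beta
  by (intro continuous_on_compose2 [OF c\<psi>'] continuous_intros
    continuous_on_compose2 [OF c\<psi>p(1)] continuous_on_compose2 [OF c\<psi>p(2)] continuous_on_compose2 [OF csg]) auto
 have GU: "G x \<in> UH" for x unfolding G_def split_beta by (rule \<psi>'U)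
 have G0: "G (s, 0) = sg s" for s by (simp add: G_def sg_def)
 have G1: "G (s, 1) = mob h (sg s)" for s
  using inv mob_in_UH \<psi>'U unfolding G_def sg_def by (simp del: UH_iff)
 have h01: "p 1 = mob h (p 0)" "q 1 = mob h (q 0)"
  using p(3) q(3) by (auto simp: pathstart_def pathfinish_def)
 have G0t: "G (0, t) = p t" "G (1, t) = q t" if "t \<in> {0..1}" for t
  using pU [OF that] pU [of 0] inv h01 by (simp_all add: G_def sg_def del: UH_iff)
 have "pr (G (s, 1)) = pr (G (s, 0))" for s
  unfolding G0 G1 sg_def using deckD [OF h \<psi>'U] .
 moreover have "continuous_on ({0..1} \<times> {0..1}) (pr \<circ> G)"
  using GU by (intro continuous_on_compose cG continuous_on_subset [OF cont]) auto
 ultimately show ?thesis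
  unfolding homotopic_loops using G0t GU in_X
  by (intro exI [of _ "pr \<circ> G"]) (auto simp: pathstart_def pathfinish_def simp del: UH_iff)
qed

lemma lift_square:
 fixes k :: "real \<times> real \<Rightarrow> 'a"
 assumes k: "continuous_on ({0..1} \<times> {0..1}) k" "k \<in> {0..1} \<times> {0..1} \<rightarrow> X" "\<And>t. t \<in> {0..1} \<Longrightarrow> k (0, t) = pr (p t)"
  and p: "path p" "path_image p \<subseteq> UH"
 obtains K where "\<And>s t. s \<in> {0..1} \<Longrightarrow> t \<in> {0..1} \<Longrightarrow> K (s, t) \<in> UH" "\<And>s t. s \<in> {0..1} \<Longrightarrow> t \<in> {0..1} \<Longrightarrow> pr (K (s, t)) = k (s, t)"
  "\<And>s. s \<in> {0..1} \<Longrightarrow> continuous_on {0..1} (\<lambda>t. K (s, t))" "\<And>t. t \<in> {0..1} \<Longrightarrow> continuous_on {0..1} (\<lambda>s. K (s, t))"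
  "\<And>t. t \<in> {0..1} \<Longrightarrow> K (0, t) = p t"
proof -
 have pU: "p t \<in> UH" if "t \<in> {0..1}" for t using p(2) that unfolding path_image_def by blast
 have z: "0 \<in> {0..1::real}" by simp
 have 1: "k ` ({0..1} \<times> {0..1}) \<subseteq> X" "convex ({0..1::real} \<times> {0..1::real})" "(0::real, 0::real) \<in> {0..1} \<times> {0..1}"
  using k(2) by (blast, intro convex_Times, auto)
 obtain K where K: "continuous_on ({0..1} \<times> {0..1}) K" "\<And>y. y \<in> {0..1} \<times> {0..1} \<Longrightarrow> K y \<in> UH"
  "K (0, 0) = p 0" "\<And>y. y \<in> {0..1} \<times> {0..1} \<Longrightarrow> pr (K y) = k y"
  by (rule lift [OF 1(2) k(1) 1(1,3) pU [OF z] k(3) [OF z]]) blast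
 have cK: "continuous_on {0..1} (\<lambda>t. K (s, t))" "continuous_on {0..1} (\<lambda>t. K (t, s))" if "s \<in> {0..1}" for s
  using that by (auto intro!: continuous_on_compose2 [OF K(1)] continuous_intros)
 show ?thesis
 proof (rule that [of K])
  show "K (s, t) \<in> UH" "pr (K (s, t)) = k (s, t)" if "s \<in> {0..1}" "t \<in> {0..1}" for s t
   using K(2) [of "(s, t)"] K(4) [of "(s, t)"] that by blast+
  show "K (0, t) = p t" if t: "t \<in> {0..1}" for t
  proof (rule lift_unique [OF connected_Icc cK(1) [OF z] p(1) [unfolded path_def] _ _ _ z K(3) t])
   show "K (0, x) \<in> UH" "p x \<in> UH" "pr (K (0, x)) = pr (p x)" if "x \<in> {0..1}" for x
    using K(2) [of "(0, x)"] K(4) [of "(0, x)"] that pU k(3) z by (blast, blast, metis SigmaI)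
  qed
 qed (use cK in blast)+
qed

text \<open>The homotopy lifts to a square with \<open>p\<close> as its edge s = 0. The edges t = 0
  and t = 1 stay related by \<open>h\<close> because up to \<open>h\<close> they lift the same
  path.\<close>

lemma homotopic_loops_lift_conv:
 assumes hom: "homotopic_loops X (pr \<circ> p) c"
  and p: "path p" "path_image p \<subseteq> UH" "pathfinish p = mob h (pathstart p)" and h: "deck pr h"
 obtains q where "path q" "path_image q \<subseteq> UH" "pathfinish q = mob h (pathstart q)"
  "\<And>t. t \<in> {0..1} \<Longrightarrow> pr (q t) = c t"
proof -
 obtain k where k: "continuous_on ({0..1} \<times> {0..1}) k" "k \<in> ({0..1::real} \<times> {0..1::real}) \<rightarrow> X"
  "\<And>t. t \<in> {0..1} \<Longrightarrow> k (0, t) = pr (p t)" "\<And>t. t \<in> {0..1} \<Longrightarrow> k (1, t) = c t"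
  "\<And>s. s \<in> {0..1} \<Longrightarrow> k (s, 1) = k (s, 0)"
  using hom unfolding homotopic_loops by (auto simp: pathstart_def pathfinish_def)
 obtain K where K: "\<And>s t. s \<in> {0..1} \<Longrightarrow> t \<in> {0..1} \<Longrightarrow> K (s, t) \<in> UH" "\<And>s t. s \<in> {0..1} \<Longrightarrow> t \<in> {0..1} \<Longrightarrow> pr (K (s, t)) = k (s, t)"
  "\<And>s. s \<in> {0..1} \<Longrightarrow> continuous_on {0..1} (\<lambda>t. K (s, t))" "\<And>t. t \<in> {0..1} \<Longrightarrow> continuous_on {0..1} (\<lambda>s. K (s, t))"
  "\<And>t. t \<in> {0..1} \<Longrightarrow> K (0, t) = p t"
  by (rule lift_square [OF k(1-3) p(1,2) that])
 have z: "0 \<in> {0..1::real}" "1 \<in> {0..1::real}" by simp_all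
 have "K (1, 1) = mob h (K (1, 0))"
 proof (rule lift_unique [of "{0..1}" "\<lambda>s. K (s, 1)" "\<lambda>s. mob h (K (s, 0))" 0])
  show "continuous_on {0..1} (\<lambda>s. mob h (K (s, 0)))"
   using K(4) [OF z(1)] K(1) z(1) by (intro continuous_on_compose2 [OF continuous_on_mob]) blast+
  show "K (0, 1) = mob h (K (0, 0))" using K(5) z p(3) by (simp add: pathstart_def pathfinish_def)
  show "K (x, 1) \<in> UH" "mob h (K (x, 0)) \<in> UH" "pr (K (x, 1)) = pr (mob h (K (x, 0)))" if "x \<in> {0..1}" for x
   using K(1,2) that z mob_in_UH deckD [OF h] k(5) by metis+
 qed (use z K(4) in simp_all)
 moreover have "path_image (\<lambda>t. K (1, t)) \<subseteq> UH" using K(1) z unfolding path_image_def by blast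
 ultimately show ?thesis
  using that [of "\<lambda>t. K (1, t)"] K(2,3) k(4) z by (simp add: path_def pathstart_def pathfinish_def)
qed

end

section \<open>Discreteness of the deck group\<close>

lemma compact_hball:
 assumes "w \<in> UH" shows "compact {z \<in> UH. hdist z w \<le> D}"
proof -
 obtain g where g: "mob g w = \<i>" using sl2_to_i assms by blast
 define r where "r = max D 0 + 1"
 have r: "0 < r" "D < r" by (auto simp: r_def)
 have i: "\<i> \<in> UH" by simp
 define K where "K = cball (\<i> * of_real (cosh r)) (sinh r) \<inter> {z. hdist z \<i> \<le> D}"
 have KU: "cball (\<i> * of_real (cosh r)) (sinh r) \<subseteq> UH" using hb_cball_UH r by blast
 have "closed (cball (\<i> * of_real (cosh r)) (sinh r) \<inter> (\<lambda>z. hdist z \<i>) -` {..D})"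
  by (rule continuous_closed_preimage [OF continuous_on_subset [OF continuous_on_hdist [OF i] KU] closed_cball closed_atMost])
 hence "closed K" by (simp add: K_def vimage_def)
 moreover have "bounded K" unfolding K_def by (rule bounded_subset [OF bounded_cball]) auto
 ultimately have cK: "compact K" by (simp add: compact_eq_bounded_closed)
 have "{z \<in> UH. hdist z w \<le> D} = mob (minv g) ` K"
 proof (intro set_eqI iffI)
  fix z assume "z \<in> {z \<in> UH. hdist z w \<le> D}"
  hence z: "z \<in> UH" "hdist z w \<le> D" by auto
  hence d: "hdist (mob g z) \<i> \<le> D" using hdist_mob [OF z(1) assms, of g] g by simp
  hence "mob g z \<in> hb r" using hdist_i_hb [OF r(1) mob_in_UH [OF z(1)], of g] r by auto
  hence "mob g z \<in> K" using d unfolding K_def hb_def by auto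
  thus "z \<in> mob (minv g) ` K" using z by (metis image_eqI mob_minv(1))
 next
  fix z assume "z \<in> mob (minv g) ` K"
  then obtain y where y: "y \<in> K" "z = mob (minv g) y" by blast
  hence yU: "y \<in> UH" using KU by (auto simp: K_def simp del: UH_iff)
  moreover have "hdist z w = hdist y \<i>"
   using hdist_mob [of z w g] y yU g assms(1) by (metis mob_in_UH mob_minv(2))
  ultimately show "z \<in> {z \<in> UH. hdist z w \<le> D}" using y by (simp add: K_def del: UH_iff)
 qed
 moreover have "K \<subseteq> UH" using KU by (auto simp: K_def simp del: UH_iff)
 ultimately show ?thesis
  using compact_continuous_image [OF continuous_on_subset [OF continuous_on_mob] cK] by metis
qed

text \<open>The imaginary part of the denominator is \<open>mC g * Im z\<close>. Points high up are
  thus sent low by every element that moves infinity.\<close>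

lemma Im_mob_le:
 assumes "z \<in> UH" "mC g \<noteq> 0"
 shows "Im (mob g z) \<le> 1 / ((mC g)\<^sup>2 * Im z)"
proof -
 have z: "0 < Im z" using assms by simp
 have "(mC g * Im z)\<^sup>2 \<le> (cmod (den g z))\<^sup>2"
  unfolding cmod_power2 Im_den by simp
 moreover have "0 < (mC g * Im z)\<^sup>2" using assms z by simp
 ultimately have "Im z / (cmod (den g z))\<^sup>2 \<le> Im z / (mC g * Im z)\<^sup>2"
  using z by (intro divide_left_mono mult_pos_pos) (auto intro: less_le_trans)
 also have "\<dots> = 1 / ((mC g)\<^sup>2 * Im z)" using z assms by (simp add: power2_eq_square)
 finally show ?thesis by (simp add: Im_mob)
qed

lemma Im_mob_upper:
 assumes "mC g = 0" shows "Im (mob g z) = (mA g)\<^sup>2 * Im z"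
proof -
 have ad: "mA g * mD g = 1" using sl2_det [of g] assms by simp
 have "mA g = 1 / mD g" using ad by (metis mult_zero_right nonzero_eq_divide_eq zero_neq_one)
 thus ?thesis by (simp add: Im_mob den_def assms power_divide)
qed

lemma upper_conj_Tr:
 assumes "mC k = 0" shows "k * Tr x * minv k = Tr ((mA k)\<^sup>2 * x)"
proof -
 have ad: "mA k * mD k = 1" using sl2_det [of k] assms by simp
 show ?thesis
  by (rule sl2_eqI; use assms ad in \<open>simp add: sl2_sel algebra_simps power2_eq_square\<close>)
qed

text \<open>A change of frame carries the unit translation of one cusp to a deck transformation seen
  from another, with the entry squared; bounds on \<open>cspec\<close> thereby become bounds on
  changes of frame.\<close>

lemma conj_Tr_C: "mC (B * Tr 1 * minv B) = - (mC B)\<^sup>2"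
 by (simp add: sl2_sel power2_eq_square algebra_simps)

text \<open>A positive element within \<open>r\<close> of the infimum of all positive ones is
  already the least, since differences smaller than \<open>r\<close> vanish.\<close>

lemma discrete_subgroup:
 fixes S :: "real set"
 assumes add: "\<And>x y. x \<in> S \<Longrightarrow> y \<in> S \<Longrightarrow> x + y \<in> S" and neg: "\<And>x. x \<in> S \<Longrightarrow> - x \<in> S"
  and r: "0 < r" "\<And>x. x \<in> S \<Longrightarrow> \<bar>x\<bar> < r \<Longrightarrow> x = 0" and b: "b \<in> S" "b \<noteq> 0"
 obtains m where "0 < m" "m \<in> S" "\<And>x. x \<in> S \<Longrightarrow> \<exists>n::int. x = of_int n * m"
proof -
 define P where "P = {x \<in> S. 0 < x}"
 have Pne: "P \<noteq> {}" using b neg [of b] by (cases "0 < b") (auto simp: P_def)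
 have bdd: "bdd_below P" by (intro bdd_belowI [of _ 0]) (auto simp: P_def)
 obtain m where m: "m \<in> P" "m < Inf P + r"
  using cInf_lessD [OF Pne, of "Inf P + r"] r(1) by auto
 have min: "m \<le> x" if "x \<in> P" for x
 proof (rule ccontr)
  assume "\<not> m \<le> x"
  moreover have "Inf P \<le> x" using that bdd by (rule cInf_lower)
  ultimately have "\<bar>m - x\<bar> < r" "m - x \<noteq> 0" using m by auto
  moreover have "m - x \<in> S" using add [of m "- x"] neg m that by (auto simp: P_def)
  ultimately show False using r(2) by blast
 qed
 have m0: "0 < m" "m \<in> S" using m by (auto simp: P_def)
 have nat: "of_nat n * m \<in> S" if "0 < n" for n
  using that by (induction n rule: nat_induct_non_zero) (auto simp: algebra_simps m0 intro: add)
 have int: "of_int n * m \<in> S" for n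
 proof -
  consider "n = 0" | k where "0 < k" "n = int k" | k where "0 < k" "n = - int k"
   by (metis int_cases neq0_conv of_nat_0 zero_less_Suc)
  thus ?thesis
  proof cases
   case 1 thus ?thesis using add [of m "- m"] neg m0 by simp
  next
   case 2 thus ?thesis using nat by simp
  next
   case 3 thus ?thesis using neg [OF nat [of k]] by simp
  qed
 qed
 show ?thesis
 proof (rule that [OF m0])
  fix x assume x: "x \<in> S"
  define y where "y = x - of_int \<lfloor>x / m\<rfloor> * m"
  have "y \<in> S" using add [OF x, of "of_int (- \<lfloor>x / m\<rfloor>) * m"] int [of "- \<lfloor>x / m\<rfloor>"] by (simp add: y_def)
  moreover have "0 \<le> y" "y < m"
  proof -
   have "of_int \<lfloor>x / m\<rfloor> * m \<le> x" "x < (of_int \<lfloor>x / m\<rfloor> + 1) * m"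
    using floor_divide_lower [OF m0(1), of x] floor_divide_upper [OF m0(1), of x] by auto
   thus "0 \<le> y" "y < m" by (simp_all add: y_def algebra_simps)
  qed
  ultimately have "y = 0" using min by (force simp: P_def)
  thus "\<exists>n::int. x = of_int n * m" unfolding y_def by (intro exI [of _ "\<lfloor>x / m\<rfloor>"]) simp
 qed
qed

lemma Tr_eq_one:
 assumes "Tr x = 1 \<or> Tr x = - 1" shows "x = 0"
proof -
 have "mB (Tr x) = 0" using assms by (elim disjE) (simp_all add: sl2_one_sel sl2_uminus_sel)
 thus ?thesis by (simp add: sl2_sel)
qed

text \<open>The cusp sits at infinity, and the stabiliser of infinity is generated, up to sign, by
  the unit translation. A \<open>frame\<close> is then a matrix that carries infinity to a cusp with
  this normalisation.\<close>

definition cusp_frame :: "(complex \<Rightarrow> 'a) \<Rightarrow> bool" where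
 "cusp_frame pr \<longleftrightarrow> deck pr (Tr 1) \<and>
   (\<forall>g. deck pr g \<and> mC g = 0 \<longrightarrow> (\<exists>n::int. g = Tr (of_int n) \<or> g = - Tr (of_int n)))"

abbreviation (input) frame :: "(complex \<Rightarrow> 'a) \<Rightarrow> sl2 \<Rightarrow> bool" where
 "frame pr M \<equiv> cusp_frame (pull pr M)"

text \<open>The reciprocals of the radii of the isometric circles. Multiplication by translations on
  either side leaves the value unchanged.\<close>

definition cspec :: "(complex \<Rightarrow> 'a) \<Rightarrow> real set" where
 "cspec pr = {\<bar>mC g\<bar> | g. deck pr g \<and> mC g \<noteq> 0}"

lemma hdist_Tr:
 assumes "z \<in> UH"
 shows "cosh (hdist z (z + of_real x)) = 1 + x\<^sup>2 / (2 * (Im z)\<^sup>2)"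
proof -
 have "z + of_real x \<in> UH" using assms by simp
 thus ?thesis using cosh_hdist [OF assms, of "z + of_real x"] by (simp add: power2_eq_square)
qed

context hyp_cover
begin

lemma inj_nbhd:
 assumes "z \<in> UH"
 obtains r where "0 < r" "\<And>u v. u \<in> UH \<Longrightarrow> v \<in> UH \<Longrightarrow> hdist u z < r \<Longrightarrow> hdist v z < r \<Longrightarrow> pr u = pr v \<Longrightarrow> u = v"
proof -
 obtain e where e: "0 < e" "ball z e \<subseteq> UH" "\<forall>u\<in>ball z e. \<forall>v\<in>ball z e. dist (pr u) (pr v) = hdist u v"
  using loc [OF assms] by blast
 obtain r where r: "0 < r" "\<And>u. u \<in> UH \<Longrightarrow> hdist u z < r \<Longrightarrow> u \<in> ball z e"
  using hball_in_open [OF open_ball _ assms, of z e] e(1) by (metis centre_in_ball)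
 show ?thesis
 proof (rule that [OF r(1)])
  fix u v assume uv: "u \<in> UH" "v \<in> UH" "hdist u z < r" "hdist v z < r" "pr u = pr v"
  hence "u \<in> ball z e" "v \<in> ball z e" using r(2) by blast+
  hence "hdist u v = 0" using e(3) uv(5) by (metis dist_self)
  thus "u = v" using hdist_eq_0 uv by blast
 qed
qed

text \<open>An element fixing \<open>z\<close> preserves the hyperbolic discs about
  \<open>z\<close>, and on a small one \<open>pr\<close> is injective; so it is the identity
  there.\<close>

lemma deck_free:
 assumes g: "deck pr g" and z: "z \<in> UH" "mob g z = z"
 shows "g = 1 \<or> g = - 1"
proof -
 obtain r where r: "0 < r" "\<And>u v. u \<in> UH \<Longrightarrow> v \<in> UH \<Longrightarrow> hdist u z < r \<Longrightarrow> hdist v z < r \<Longrightarrow> pr u = pr v \<Longrightarrow> u = v"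
  using inj_nbhd [OF z(1)] by metis
 have fx: "mob g u = u" if u: "u \<in> UH" "hdist u z < r" for u
 proof (rule r(2))
  show "hdist (mob g u) z < r" using hdist_mob [OF u(1) z(1), of g] u z by simp
  show "pr (mob g u) = pr u" using deckD g u by blast
 qed (use u mob_in_UH in blast)+
 have "open {u \<in> UH. hdist u z < r}" by (rule open_hball [OF z(1)])
 moreover have "z \<in> {u \<in> UH. hdist u z < r}" using z r by simp
 ultimately obtain e where e: "0 < e" "ball z e \<subseteq> {u \<in> UH. hdist u z < r}" using openE by blast
 have "z + of_real (e/2) \<in> ball z e" using e(1) by (simp add: dist_norm)
 hence w: "z + of_real (e/2) \<in> UH" "hdist (z + of_real (e/2)) z < r" using e(2) by blast+
 show ?thesis
  using mob_fix_two [OF z(1) w(1) _ z(2) fx [OF w]] e(1) by auto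
qed

text \<open>Half of each local radius is spent on the distance to a centre of the finite cover, the
  other half on the displacement.\<close>

lemma inj_radius_compact:
 assumes "compact K" "K \<subseteq> UH"
 obtains r where "0 < r" "\<And>z g. z \<in> K \<Longrightarrow> deck pr g \<Longrightarrow> hdist z (mob g z) < r \<Longrightarrow> g = 1 \<or> g = - 1"
proof -
 have "\<forall>z\<in>K. \<exists>r>0. \<forall>u\<in>UH. \<forall>v\<in>UH. hdist u z < r \<longrightarrow> hdist v z < r \<longrightarrow> pr u = pr v \<longrightarrow> u = v"
  using inj_nbhd assms(2) by (metis subsetD)
 then obtain R where R: "\<And>z. z \<in> K \<Longrightarrow> 0 < R z"
  "\<And>z u v. z \<in> K \<Longrightarrow> u \<in> UH \<Longrightarrow> v \<in> UH \<Longrightarrow> hdist u z < R z \<Longrightarrow> hdist v z < R z \<Longrightarrow> pr u = pr v \<Longrightarrow> u = v"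
  by metis
 define N where "N = (\<lambda>z. {u \<in> UH. hdist u z < R z / 2})"
 have "K \<subseteq> (\<Union>z\<in>K. N z)" using R(1) assms(2) by (force simp: N_def)
 moreover have "open (N z)" if "z \<in> K" for z using that assms(2) open_hball unfolding N_def by blast
 ultimately obtain F where F: "F \<subseteq> K" "finite F" "K \<subseteq> (\<Union>z\<in>F. N z)"
  using compactE_image [OF assms(1), of K N] by metis
 define r where "r = Min (insert 1 ((\<lambda>z. R z / 2) ` F))"
 have r: "0 < r" using F R(1) by (auto simp: r_def)
 have rF: "r \<le> R z / 2" if "z \<in> F" for z unfolding r_def using F(2) that by (intro Min_le) auto
 show ?thesis
 proof (rule that [OF r])
  fix z g assume z: "z \<in> K" and g: "deck pr g" and d: "hdist z (mob g z) < r"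
  obtain y where y: "y \<in> F" "z \<in> N y" using F(3) z by blast
  have U: "y \<in> UH" "z \<in> UH" "mob g z \<in> UH" using y z F assms(2) mob_in_UH by blast+
  have zy: "hdist z y < R y / 2" using y by (simp add: N_def)
  have "hdist (mob g z) y \<le> hdist (mob g z) z + hdist z y" by (rule hdist_triangle [OF U(3,2,1)])
  also have "\<dots> < R y" using zy d rF [OF y(1)] by (simp add: hdist_commute)
  finally have "hdist (mob g z) y < R y" .
  moreover have "hdist z y < R y" using zy R(1) y F by (smt (verit) field_sum_of_halves subsetD)
  ultimately have "mob g z = z"
   using R(2) [of y "mob g z" z] deckD [OF g U(2)] y F U by blast
  thus "g = 1 \<or> g = - 1" using deck_free g U by blast
 qed
qed

lemma inj_radius:
 assumes "z \<in> UH"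
 obtains r where "0 < r" "\<And>g. deck pr g \<Longrightarrow> hdist z (mob g z) < r \<Longrightarrow> g = 1 \<or> g = - 1"
proof -
 have c: "compact {z}" "{z} \<subseteq> UH" using assms by simp_all
 show ?thesis by (rule inj_radius_compact [OF c]) (use that in blast)
qed

text \<open>A smaller trace belongs to an elliptic element, whose fixed point in the half-plane
  contradicts freeness.\<close>

lemma deck_trace:
 assumes g: "deck pr g" shows "2 \<le> \<bar>trc g\<bar>"
proof (rule ccontr)
 assume "\<not> 2 \<le> \<bar>trc g\<bar>"
 hence "\<bar>trc g\<bar>\<^sup>2 < 2\<^sup>2" by (intro power_strict_mono) auto
 hence t4: "(trc g)\<^sup>2 < 4" by simp
 have det: "mA g * mD g = 1 + mB g * mC g" using sl2_det [of g] by simp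
 have c: "mC g \<noteq> 0"
 proof
  assume "mC g = 0"
  hence "(trc g)\<^sup>2 = (mA g - mD g)\<^sup>2 + 4" using det by (simp add: trc_def power2_eq_square algebra_simps)
  thus False using t4 by (smt (verit) zero_le_power2)
 qed
 \<comment> \<open>With \<open>y\<close>, the root of c z^2 + (d - a) z - b that lies in the
   half-plane.\<close>
 define x where "x = (mA g - mD g) / (2 * mC g)"
 define y where "y = sqrt (4 - (trc g)\<^sup>2) / (2 * \<bar>mC g\<bar>)"
 have y: "0 < y" using t4 c by (simp add: y_def)
 have y2: "y\<^sup>2 = (4 - (trc g)\<^sup>2) / (4 * (mC g)\<^sup>2)"
  using t4 by (simp add: y_def power_divide power_mult_distrib)
 have x2: "x\<^sup>2 = (mA g - mD g)\<^sup>2 / (4 * (mC g)\<^sup>2)" by (simp add: x_def power_divide power_mult_distrib)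
 have "x\<^sup>2 + y\<^sup>2 = ((mA g - mD g)\<^sup>2 + (4 - (trc g)\<^sup>2)) / (4 * (mC g)\<^sup>2)"
  unfolding x2 y2 by (simp add: add_divide_distrib)
 also have "(mA g - mD g)\<^sup>2 + (4 - (trc g)\<^sup>2) = - 4 * (mB g * mC g)"
  using det by (simp add: trc_def power2_eq_square algebra_simps)
 also have "- 4 * (mB g * mC g) / (4 * (mC g)\<^sup>2) = - mB g / mC g" using c by (simp add: power2_eq_square)
 finally have xy: "mC g * (x\<^sup>2 + y\<^sup>2) = - mB g" using c by (simp add: field_simps)
 have xc: "2 * mC g * x = mA g - mD g" using c by (simp add: x_def)
 define z where "z = Complex x y"
 have z: "z \<in> UH" using y by (simp add: z_def)
 have bb: "mB g = - mC g * (x\<^sup>2 + y\<^sup>2)" using xy by simp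
 have aa: "mA g = 2 * mC g * x + mD g" using xc by simp
 have "of_real (mA g) * z + of_real (mB g) = z * den g z"
  unfolding den_def aa bb by (simp add: z_def complex_eq_iff power2_eq_square algebra_simps)
 hence "mob g z = z" unfolding mob_den using den_nz [OF z, of g] by simp
 hence "g = 1 \<or> g = - 1" using deck_free g z by blast
 thus False using t4 by (auto simp: trc_def sl2_sel)
qed

text \<open>The orbit of \<open>w\<close> cannot accumulate, since \<open>pr\<close> is injective
  near any accumulation point; and a point of the orbit determines the element up to sign.\<close>

lemma finite_deck_hdist:
 assumes w: "w \<in> UH"
 shows "finite {g. deck pr g \<and> hdist (mob g w) w \<le> D}"
proof -
 define E where "E = (\<lambda>g. mob g w) ` {g. deck pr g \<and> hdist (mob g w) w \<le> D}"
 have EK: "E \<subseteq> {z \<in> UH. hdist z w \<le> D}" using w mob_in_UH by (auto simp: E_def simp del: UH_iff)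
 have prE: "pr y = pr w" if "y \<in> E" for y using that deckD w by (auto simp: E_def simp del: UH_iff)
 have "finite E"
 proof (rule ccontr)
  assume "infinite E"
  then obtain x where x: "x \<in> UH" "x islimpt E"
   using compact_hball [OF w, of D] EK unfolding compact_eq_Bolzano_Weierstrass by blast
  obtain r where r: "0 < r" "\<And>u v. u \<in> UH \<Longrightarrow> v \<in> UH \<Longrightarrow> hdist u x < r \<Longrightarrow> hdist v x < r \<Longrightarrow> pr u = pr v \<Longrightarrow> u = v"
   using inj_nbhd [OF x(1)] by metis
  have xin: "x \<in> {u \<in> UH. hdist u x < r}" using x r by simp
  from x(2) [unfolded islimpt_def] obtain y where y: "y \<in> E" "y \<in> {u \<in> UH. hdist u x < r}" "y \<noteq> x"
   using open_hball [OF x(1)] xin by meson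
  have "open ({u \<in> UH. hdist u x < r} - {y})" using open_hball [OF x(1)] by (simp add: open_delete)
  moreover have "x \<in> {u \<in> UH. hdist u x < r} - {y}" using xin y by blast
  ultimately obtain y' where y': "y' \<in> E" "y' \<in> {u \<in> UH. hdist u x < r} - {y}"
   using x(2) [unfolded islimpt_def] by meson
  thus False using r(2) [of y y'] y prE by auto
 qed
 have "finite {g. deck pr g \<and> mob g w = y}" for y
 proof (cases "\<exists>g. deck pr g \<and> mob g w = y")
  case True
  then obtain g where g: "deck pr g" "mob g w = y" by blast
  have "{g. deck pr g \<and> mob g w = y} \<subseteq> {g, - g}"
  proof
   fix h assume "h \<in> {g. deck pr g \<and> mob g w = y}"
   hence h: "deck pr h" "mob h w = y" by auto
   have "mob (minv g * h) w = w" using g h w by (simp add: mob_mult del: UH_iff) (metis mob_minv(1))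
   hence "minv g * h = 1 \<or> minv g * h = - 1"
    using deck_free [OF deck_mult [OF deck_minv [OF g(1)] h(1)] w] by blast
   thus "h \<in> {g, - g}" by (metis insertCI minv_right2 mult.right_neutral sl2_mult_minus(1))
  qed
  thus ?thesis using finite_subset by blast
 next
  case False
  hence em: "{g. deck pr g \<and> mob g w = y} = {}" by blast
  show ?thesis unfolding em by (rule finite.emptyI)
 qed
 hence "finite (\<Union>y\<in>E. {g. deck pr g \<and> mob g w = y})" using \<open>finite E\<close> by blast
 moreover have "{g. deck pr g \<and> hdist (mob g w) w \<le> D} \<subseteq> (\<Union>y\<in>E. {g. deck pr g \<and> mob g w = y})"
  by (auto simp: E_def)
 ultimately show ?thesis using finite_subset by blast
qed

text \<open>The cosh of the distance from i to its image is half the sum of the squares of the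
  entries.\<close>

lemma finite_deck_bounded:
 "finite {g. deck pr g \<and> \<bar>mA g\<bar> \<le> b \<and> \<bar>mB g\<bar> \<le> b \<and> \<bar>mC g\<bar> \<le> b \<and> \<bar>mD g\<bar> \<le> b}"
proof -
 have i: "\<i> \<in> UH" by simp
 define D where "D = arcosh (2 * b\<^sup>2 + 1)"
 have D: "0 \<le> D" "cosh D = 2 * b\<^sup>2 + 1" by (auto simp: D_def)
 have "hdist (mob g \<i>) \<i> \<le> D" if "\<bar>mA g\<bar> \<le> b" "\<bar>mB g\<bar> \<le> b" "\<bar>mC g\<bar> \<le> b" "\<bar>mD g\<bar> \<le> b" for g
 proof -
  have sq: "(mA g)\<^sup>2 \<le> b\<^sup>2" "(mB g)\<^sup>2 \<le> b\<^sup>2" "(mC g)\<^sup>2 \<le> b\<^sup>2" "(mD g)\<^sup>2 \<le> b\<^sup>2"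
   using that by (auto simp: abs_le_square_iff [symmetric])
  have nz: "den g \<i> \<noteq> 0" using den_nz i by blast
  have "mob g \<i> - \<i> = ((of_real (mA g) * \<i> + of_real (mB g)) - \<i> * den g \<i>) / den g \<i>"
   using nz by (simp add: mob_den field_simps)
  also have "(of_real (mA g) * \<i> + of_real (mB g)) - \<i> * den g \<i> = Complex (mB g + mC g) (mA g - mD g)"
   by (simp add: den_def complex_eq_iff)
  finally have "(cmod (mob g \<i> - \<i>))\<^sup>2 = ((mB g + mC g)\<^sup>2 + (mA g - mD g)\<^sup>2) / (cmod (den g \<i>))\<^sup>2"
   by (simp add: norm_divide power_divide cmod_power2)
  moreover have "Im (mob g \<i>) = 1 / (cmod (den g \<i>))\<^sup>2" by (simp add: Im_mob)
  ultimately have "cosh (hdist (mob g \<i>) \<i>) = 1 + ((mB g + mC g)\<^sup>2 + (mA g - mD g)\<^sup>2) / 2"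
   using nz by (subst cosh_hdist [OF mob_in_UH [OF i] i]) simp
  also have "\<dots> = ((mA g)\<^sup>2 + (mB g)\<^sup>2 + (mC g)\<^sup>2 + (mD g)\<^sup>2) / 2 + (1 - (mA g * mD g - mB g * mC g))"
   by (simp add: power2_eq_square field_simps)
  also have "\<dots> \<le> cosh D" using sq by (simp add: D sl2_det)
  finally show ?thesis using D(1) hdist_nonneg [OF mob_in_UH [OF i] i] cosh_real_nonneg_le_iff by blast
 qed
 thus ?thesis by (intro finite_subset [OF _ finite_deck_hdist [OF i, of D]]) auto
qed

text \<open>Multiplication by an integer translation changes the trace by that multiple of the entry
  c. Some multiple brings the trace down to at most |c| / 2 in absolute value, while
  \<open>deck_trace\<close> bounds it below by 2.\<close>

lemma cusp_c_ge4:
 assumes cf: "cusp_frame pr" and g: "deck pr g" "mC g \<noteq> 0"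
 shows "4 \<le> \<bar>mC g\<bar>"
proof (rule ccontr)
 assume lt: "\<not> 4 \<le> \<bar>mC g\<bar>"
 define c where "c = mC g"
 have c: "c \<noteq> 0" "\<bar>c\<bar> < 4" using g lt by (auto simp: c_def)
 have Tn: "deck pr (Tr (of_int n))" for n
 proof -
  have nat: "deck pr (Tr (of_nat k))" for k
   by (induction k) (use cf in \<open>auto simp: cusp_frame_def Tr_add [symmetric] intro: deck_mult\<close>)
  show ?thesis using nat [of "nat n"] deck_minv [OF nat [of "nat (- n)"]] by (cases "0 \<le> n") auto
 qed
 define n where "n = - round (trc g / c)"
 have "deck pr (g * Tr (of_int n))" using g Tn deck_mult by blast
 hence "2 \<le> \<bar>trc (g * Tr (of_int n))\<bar>" by (rule deck_trace)
 also have "trc (g * Tr (of_int n)) = trc g + of_int n * c" by (simp add: trc_def sl2_sel c_def)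
 also have "\<dots> = c * (trc g / c - of_int (round (trc g / c)))" using c by (simp add: n_def field_simps)
 also have "\<bar>\<dots>\<bar> \<le> \<bar>c\<bar> * (1/2)"
  unfolding abs_mult by (intro mult_left_mono) (use of_int_round_abs_le [of "trc g / c"] in \<open>auto simp: abs_minus_commute\<close>)
 finally show False using c by simp
qed

lemma deck_Tr_int:
 assumes "cusp_frame pr" shows "deck pr (Tr (of_int n))"
proof -
 have nat: "deck pr (Tr (of_nat k))" for k
  by (induction k) (use assms in \<open>auto simp: cusp_frame_def Tr_add [symmetric] intro: deck_mult\<close>)
 show ?thesis using nat [of "nat n"] deck_minv [OF nat [of "nat (- n)"]] by (cases "0 \<le> n") auto
qed

lemma cusp_stabiliser:
 assumes "cusp_frame pr" "deck pr g" "mC g = 0"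
 obtains n :: int where "\<And>z. mob g z = z + of_int n" "g = Tr (of_int n) \<or> g = - Tr (of_int n)"
 using assms unfolding cusp_frame_def by (metis mob_Tr mob_uminus of_real_of_int_eq)

text \<open>Translations on both sides reduce the diagonal entries modulo c, and the determinant
  then bounds the upper right entry. So finitely many matrices represent all values up to
  \<open>b\<close>.\<close>

lemma cspec_finite:
 assumes cf: "cusp_frame pr" shows "finite {x \<in> cspec pr. x \<le> b}"
proof -
 define b' where "b' = b + (b * b + 1)"
 define F where "F = {g. deck pr g \<and> \<bar>mA g\<bar> \<le> b' \<and> \<bar>mB g\<bar> \<le> b' \<and> \<bar>mC g\<bar> \<le> b' \<and> \<bar>mD g\<bar> \<le> b'}"
 have "{x \<in> cspec pr. x \<le> b} \<subseteq> (\<lambda>g. \<bar>mC g\<bar>) ` F"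
 proof
  fix x assume "x \<in> {x \<in> cspec pr. x \<le> b}"
  then obtain g where g: "deck pr g" "mC g \<noteq> 0" "x = \<bar>mC g\<bar>" "x \<le> b" by (auto simp: cspec_def)
  define c where "c = mC g"
  have c4: "4 \<le> \<bar>c\<bar>" "c \<noteq> 0" "\<bar>c\<bar> \<le> b" using cusp_c_ge4 [OF cf g(1,2)] g by (auto simp: c_def)
  have red: "\<bar>y - of_int \<lfloor>y / c\<rfloor> * c\<bar> \<le> b" for y
  proof -
   have "y - of_int \<lfloor>y / c\<rfloor> * c = (y / c - of_int \<lfloor>y / c\<rfloor>) * c" using c4 by (simp add: algebra_simps)
   also have "\<bar>\<dots>\<bar> \<le> 1 * \<bar>c\<bar>" unfolding abs_mult by (intro mult_right_mono) linarith+
   finally show ?thesis using c4 by simp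
  qed
  define h where "h = Tr (of_int (- \<lfloor>mA g / c\<rfloor>)) * g * Tr (of_int (- \<lfloor>mD g / c\<rfloor>))"
  have h: "deck pr h" unfolding h_def by (intro deck_mult deck_Tr_int cf g)
  have C: "mC h = c" by (simp add: h_def sl2_sel c_def)
  have A: "\<bar>mA h\<bar> \<le> b" using red [of "mA g"] by (simp add: h_def sl2_sel c_def algebra_simps)
  have D: "\<bar>mD h\<bar> \<le> b" using red [of "mD g"] by (simp add: h_def sl2_sel c_def algebra_simps)
  have "mB h * c = mA h * mD h - 1" using sl2_det [of h] C by simp
  hence "\<bar>mB h\<bar> * \<bar>c\<bar> = \<bar>mA h * mD h - 1\<bar>" by (metis abs_mult)
  also have "\<dots> \<le> \<bar>mA h\<bar> * \<bar>mD h\<bar> + 1" by (simp add: abs_mult [symmetric])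
  also have "\<dots> \<le> b * b + 1" using A D by (intro add_mono mult_mono) auto
  finally have "\<bar>mB h\<bar> * \<bar>c\<bar> \<le> b * b + 1" .
  moreover have "\<bar>mB h\<bar> * 1 \<le> \<bar>mB h\<bar> * \<bar>c\<bar>" using c4 by (intro mult_left_mono) auto
  ultimately have B: "\<bar>mB h\<bar> \<le> b * b + 1" by simp
  have b0: "0 \<le> b" "0 \<le> b * b" using c4 by auto
  have "h \<in> F" unfolding F_def b'_def using h A B D C c4 b0 by auto
  moreover have "x = \<bar>mC h\<bar>" using C g by (simp add: c_def)
  ultimately show "x \<in> (\<lambda>g. \<bar>mC g\<bar>) ` F" by blast
 qed
 thus ?thesis using finite_deck_bounded unfolding F_def by (meson finite_imageI finite_subset)
qed

text \<open>Otherwise conjugation by the element or its inverse would shrink the translation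
  \<open>Tr b\<close> again and again, against the positive injectivity radius at i.\<close>

lemma upper_stabiliser_unipotent:
 assumes "deck pr (Tr b)" "b \<noteq> 0" "deck pr k" "mC k = 0"
 shows "(mA k)\<^sup>2 = 1"
proof -
 have i: "\<i> \<in> UH" by simp
 obtain r where r: "0 < r" "\<And>g. deck pr g \<Longrightarrow> hdist \<i> (mob g \<i>) < r \<Longrightarrow> g = 1 \<or> g = - 1"
  using inj_radius [OF i] by metis
 have no: "\<not> (mA k)\<^sup>2 < 1" if k: "deck pr k" "mC k = 0" for k
 proof
  assume lt: "(mA k)\<^sup>2 < 1"
  define q where "q = (mA k)\<^sup>2"
  have ad: "mA k * mD k = 1" using sl2_det [of k] k by simp
  hence q: "0 < q" "q < 1" using lt by (auto simp: q_def)
  have Tn: "deck pr (Tr (q ^ n * b))" for n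
  proof (induction n)
   case (Suc n)
   have "deck pr (k * Tr (q ^ n * b) * minv k)" using Suc k deck_mult deck_minv by blast
   hence "deck pr (Tr ((mA k)\<^sup>2 * (q ^ n * b)))" by (simp only: upper_conj_Tr [OF k(2)])
   thus ?case by (simp add: q_def mult.assoc)
  qed (use assms in simp)
  have "(\<lambda>n. 1 + (q ^ n * b)\<^sup>2 / 2) \<longlonglongrightarrow> 1 + (0 * b)\<^sup>2 / 2"
   using q by (intro tendsto_intros LIMSEQ_realpow_zero) auto
  moreover have "1 + (0 * b)\<^sup>2 / 2 < cosh r" using r(1) cosh_real_nonneg_less_iff [of 0 r] by simp
  ultimately have "\<forall>\<^sub>F n in sequentially. 1 + (q ^ n * b)\<^sup>2 / 2 < cosh r" by (rule order_tendstoD(2))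
  then obtain n where n: "1 + (q ^ n * b)\<^sup>2 / 2 < cosh r"
   using eventually_happens' sequentially_bot by blast
  have iU: "\<i> + of_real (q ^ n * b) \<in> UH" by simp
  have "cosh (hdist \<i> (\<i> + of_real (q ^ n * b))) < cosh r"
   using hdist_Tr [OF i, of "q ^ n * b"] n by simp
  hence "hdist \<i> (mob (Tr (q ^ n * b)) \<i>) < r"
   using r(1) hdist_nonneg [OF i iU] by (simp add: cosh_real_nonneg_less_iff)
  hence "Tr (q ^ n * b) = 1 \<or> Tr (q ^ n * b) = - 1" using r(2) Tn by blast
  hence "q ^ n * b = 0" by (rule Tr_eq_one)
  thus False using q assms(2) by simp
 qed
 have ad: "mA k * mD k = 1" using sl2_det [of k] assms by simp
 have "\<not> (mD k)\<^sup>2 < 1" using no [OF deck_minv [OF assms(3)]] assms(4) by (simp add: sl2_sel)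
 moreover have "\<not> (mA k)\<^sup>2 < 1" using no assms by blast
 moreover have "(mA k)\<^sup>2 * (mD k)\<^sup>2 = 1" using ad by (metis one_power2 power_mult_distrib)
 ultimately show ?thesis
  by (smt (verit) mult_less_cancel_left2 mult_left_le_one_le mult_le_cancel_left1)
qed

text \<open>The translations among the deck transformations form a discrete group; the dilation by
  its generator normalises it to the integers.\<close>

lemma parabolic_frame_infinity:
 assumes "deck pr (Tr b)" "b \<noteq> 0"
 obtains x where "0 < x" "frame pr (Dg (ln x))"
proof -
 define S where "S = {x. deck pr (Tr x)}"
 have i: "\<i> \<in> UH" by simp
 obtain r where r: "0 < r" "\<And>g. deck pr g \<Longrightarrow> hdist \<i> (mob g \<i>) < r \<Longrightarrow> g = 1 \<or> g = - 1"
  using inj_radius [OF i] by metis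
 define r' where "r' = sqrt (2 * (cosh r - 1))"
 have cr: "1 < cosh r" using r(1) cosh_real_nonneg_less_iff [of 0 r] by simp
 have r': "0 < r'" "r'\<^sup>2 = 2 * (cosh r - 1)" using cr by (auto simp: r'_def)
 obtain m where m: "0 < m" "m \<in> S" "\<And>x. x \<in> S \<Longrightarrow> \<exists>n::int. x = of_int n * m"
 proof (rule discrete_subgroup [of S r' b])
  show "x + y \<in> S" if "x \<in> S" "y \<in> S" for x y
   using that deck_mult [of pr "Tr x" "Tr y"] by (simp add: S_def Tr_add)
  show "- x \<in> S" if "x \<in> S" for x using that deck_minv [of pr "Tr x"] by (simp add: S_def)
  show "x = 0" if "x \<in> S" "\<bar>x\<bar> < r'" for x
  proof -
   have "x\<^sup>2 < r'\<^sup>2" using that(2) r'(1) by (metis abs_ge_zero power2_abs power_strict_mono zero_less_numeral)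
   hence "cosh (hdist \<i> (\<i> + of_real x)) < cosh r" unfolding hdist_Tr [OF i] r'(2) by simp
   moreover have "\<i> + of_real x \<in> UH" by simp
   ultimately have "hdist \<i> (mob (Tr x) \<i>) < r"
    using r(1) hdist_nonneg [OF i, of "\<i> + of_real x"] by (simp add: cosh_real_nonneg_less_iff)
   hence "Tr x = 1 \<or> Tr x = - 1" using r(2) that by (auto simp: S_def)
   thus "x = 0" by (rule Tr_eq_one)
  qed
 qed (use r' assms in \<open>auto simp: S_def\<close>)
 have conj: "Dg (ln m) * Tr y * minv (Dg (ln m)) = Tr (m * y)" for y
 proof -
  have "(exp (ln m / 2))\<^sup>2 = m" using m(1) by (metis exp_double exp_ln field_sum_of_halves mult_2)
  thus ?thesis using upper_conj_Tr [of "Dg (ln m)" y] by (simp add: sl2_sel)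
 qed
 show ?thesis
 proof (rule that [OF m(1)])
  show "frame pr (Dg (ln m))"
   unfolding cusp_frame_def
  proof (intro conjI allI impI)
   show "deck (pull pr (Dg (ln m))) (Tr 1)"
    unfolding deck_conj conj using m(2) by (simp add: S_def)
   fix g assume g: "deck (pull pr (Dg (ln m))) g \<and> mC g = 0"
   define k where "k = Dg (ln m) * g * minv (Dg (ln m))"
   have "deck pr k" using g deck_conj [of pr "Dg (ln m)" g] unfolding k_def by blast
   moreover have "mC k = 0" using g by (simp add: k_def sl2_sel)
   ultimately have k: "deck pr k" "mC k = 0" by auto
   have "(mA k)\<^sup>2 = 1" using upper_stabiliser_unipotent assms k by blast
   hence a: "mA k = 1 \<or> mA k = - 1" by (simp add: power2_eq_1_iff)
   moreover have ad: "mA k * mD k = 1" using sl2_det [of k] k by simp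
   ultimately have "mA k = 1 \<and> mD k = 1 \<or> mA k = - 1 \<and> mD k = - 1" by auto
   then obtain y where y: "k = Tr y \<or> k = - Tr y"
   proof
    assume "mA k = 1 \<and> mD k = 1"
    hence "k = Tr (mB k)" using k by (intro sl2_eqI) (auto simp: sl2_sel)
    thus ?thesis using that by blast
   next
    assume "mA k = - 1 \<and> mD k = - 1"
    hence "k = - Tr (- mB k)" using k by (intro sl2_eqI) (auto simp: sl2_sel)
    thus ?thesis using that by blast
   qed
   hence "y \<in> S" using k by (auto simp: S_def)
   then obtain n :: int where n: "y = of_int n * m" using m(3) by blast
   have "g = minv (Dg (ln m)) * k * Dg (ln m)" by (simp add: k_def mult.assoc del: minv_Dg)
   moreover have "minv (Dg (ln m)) * Tr y * Dg (ln m) = Tr (of_int n)"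
    using conj [of "of_int n"] n by (metis minv_left minv_left2 mult.assoc mult.commute mult.right_neutral)
   ultimately show "\<exists>n::int. g = Tr (of_int n) \<or> g = - Tr (of_int n)"
    using y by (intro exI [of _ n]) (auto simp del: minv_Dg)
  qed
 qed
qed

end

lemma parabolic_frame:
 assumes hc: "hyp_cover X pr" and g: "deck pr g" "g \<noteq> 1" "g \<noteq> - 1" "\<bar>trc g\<bar> = 2"
 obtains M n where "frame pr M" "n \<noteq> (0::int)"
  "\<And>z. z \<in> UH \<Longrightarrow> mob g (mob M z) = mob M (z + of_int n)"
proof -
 have "\<exists>M0. mC (minv M0 * g * M0) = 0"
 proof (cases "mC g = 0")
  case True thus ?thesis by (intro exI [of _ 1]) simp
 next
  case False
  \<comment> \<open>The double root of the fixed-point equation; \<open>mk x (- 1) 1 0\<close>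
    carries infinity to it.\<close>
  define x where "x = (mA g - mD g) / (2 * mC g)"
  have "x * 0 - (- 1) * 1 = (1::real)" by simp
  note sel = mk_sel [OF this]
  have "(trc g)\<^sup>2 = 4" using g(4) by (metis power2_abs power2_eq_square mult_2 numeral_Bit0)
  hence t: "(mA g - mD g)\<^sup>2 + 4 * mB g * mC g = 0"
   using sl2_det [of g] by (simp add: trc_def power2_eq_square algebra_simps)
  have "mC (minv (mk x (- 1) 1 0) * g * mk x (- 1) 1 0) = mC g * x\<^sup>2 + (mD g - mA g) * x - mB g"
   by (simp add: sl2_sel sel power2_eq_square algebra_simps)
  also have "\<dots> = - ((mA g - mD g)\<^sup>2 + 4 * mB g * mC g) / (4 * mC g)"
   using False by (simp add: x_def power2_eq_square field_simps)
  finally show ?thesis using t by auto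
 qed
 then obtain M0 where M0: "mC (minv M0 * g * M0) = 0" by blast
 define h where "h = minv M0 * g * M0"
 interpret h1: hyp_cover X "pull pr M0" by (rule hyp_cover_mob [OF hc])
 have gh: "g = M0 * h * minv M0" by (simp add: h_def mult.assoc)
 have hd: "deck (pull pr M0) h" using g(1) by (simp add: deck_conj gh [symmetric])
 have h0: "mC h = 0" using M0 by (simp add: h_def)
 have "\<bar>trc h\<bar> = 2" using g(4) by (simp add: h_def trc_conj)
 moreover have ad: "mA h * mD h = 1" using sl2_det [of h] h0 by simp
 moreover have "(mA h - mD h)\<^sup>2 = \<bar>trc h\<bar>\<^sup>2 - 4 * (mA h * mD h)"
  by (simp add: trc_def power2_eq_square algebra_simps)
 ultimately have "(mA h - mD h)\<^sup>2 = 0" by simp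
 hence "mA h = mD h" by simp
 hence "mA h = 1 \<or> mA h = - 1" using ad by (metis power2_eq_1_iff power2_eq_square)
 then obtain b where b: "h = Tr b \<or> h = - Tr b"
 proof
  assume "mA h = 1"
  hence "h = Tr (mB h)" using h0 \<open>mA h = mD h\<close> by (intro sl2_eqI) (auto simp: sl2_sel)
  thus ?thesis using that by blast
 next
  assume "mA h = - 1"
  hence "h = - Tr (- mB h)" using h0 \<open>mA h = mD h\<close> by (intro sl2_eqI) (auto simp: sl2_sel)
  thus ?thesis using that by blast
 qed
 have b0: "b \<noteq> 0"
 proof
  assume "b = 0"
  hence "h = 1 \<or> h = - 1" using b by auto
  thus False using g(2,3) gh by auto
 qed
 have "deck (pull pr M0) (Tr b)" using hd b by auto
 then obtain x where x: "0 < x" "cusp_frame (\<lambda>z. pr (mob M0 (mob (Dg (ln x)) z)))"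
  using h1.parabolic_frame_infinity b0 by metis
 define M where "M = M0 * Dg (ln x)"
 have cfM: "frame pr M"
 proof -
  have "deck (pull pr M) k = deck (\<lambda>z. pr (mob M0 (mob (Dg (ln x)) z))) k" for k
   unfolding M_def deck_def by (simp add: mob_mult del: UH_iff mob_Dg)
  thus ?thesis using x(2) unfolding cusp_frame_def by simp
 qed
 define k where "k = minv M * g * M"
 have gk: "g = M * k * minv M" by (simp add: k_def mult.assoc)
 have kd: "deck (pull pr M) k" using g(1) by (simp add: deck_conj gk [symmetric])
 have "k = minv (Dg (ln x)) * h * Dg (ln x)" by (simp add: k_def h_def M_def minv_mult mult.assoc del: minv_Dg)
 hence kC: "mC k = 0" using h0 by (simp add: sl2_sel)
 obtain n :: int where n: "k = Tr (of_int n) \<or> k = - Tr (of_int n)"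
  using cfM kd kC unfolding cusp_frame_def by blast
 show ?thesis
 proof (rule that [OF cfM, of n])
  show "n \<noteq> 0"
  proof
   assume "n = 0"
   hence "k = 1 \<or> k = - 1" using n by auto
   thus False using g(2,3) gk by auto
  qed
  fix z assume z: "z \<in> UH"
  have "g * M = M * k" by (simp add: k_def mult.assoc)
  hence "mob g (mob M z) = mob M (mob k z)" using z by (metis mob_mult)
  also have "mob k z = z + of_int n" using n by auto
  finally show "mob g (mob M z) = mob M (z + of_int n)" .
 qed
qed

text \<open>The unit translation of one frame is, in the other, the translation by the square of the
  diagonal entry, which is thus an integer. Exchanging the frames shows the same for the inverse of
  that square.\<close>

lemma frames_upper:
 assumes hc: "hyp_cover X pr" and M: "frame pr M" and N: "frame pr N"
  and C: "mC (minv M * N) = 0"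
 shows "(mA (minv M * N))\<^sup>2 = 1"
proof -
 have int: "\<exists>n::int. (mA (minv M * N))\<^sup>2 = of_int n"
  if M: "frame pr M" and N: "frame pr N" and C: "mC (minv M * N) = 0" for M N
 proof -
  define B where "B = minv M * N"
  have "deck pr (N * Tr 1 * minv N)" using N by (simp add: cusp_frame_def deck_conj)
  moreover have "M * (B * Tr 1 * minv B) * minv M = N * Tr 1 * minv N"
   by (simp add: B_def minv_mult mult.assoc)
  ultimately have d: "deck (pull pr M) (B * Tr 1 * minv B)" by (simp add: deck_conj)
  have e: "B * Tr 1 * minv B = Tr ((mA B)\<^sup>2)" using upper_conj_Tr [of B 1] C by (simp add: B_def)
  have "mC (Tr ((mA B)\<^sup>2)) = 0" by (simp add: sl2_sel)
  then obtain n :: int where "Tr ((mA B)\<^sup>2) = Tr (of_int n) \<or> Tr ((mA B)\<^sup>2) = - Tr (of_int n)"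
   using M d unfolding e cusp_frame_def by blast
  hence "(mA B)\<^sup>2 = of_int n"
  proof
   assume "Tr ((mA B)\<^sup>2) = Tr (of_int n)"
   from arg_cong [OF this, of mB] show ?thesis by (simp add: sl2_sel)
  next
   assume "Tr ((mA B)\<^sup>2) = - Tr (of_int n)"
   from arg_cong [OF this, of mA] show ?thesis by (simp add: sl2_sel)
  qed
  thus ?thesis unfolding B_def by blast
 qed
 have inv: "minv N * M = minv (minv M * N)" by (simp add: minv_mult)
 have C': "mC (minv N * M) = 0" unfolding inv using C by (simp only: minv_sel)
 obtain n where n: "(mA (minv M * N))\<^sup>2 = of_int n" using int [OF M N C] by blast
 obtain n' where n': "(mA (minv N * M))\<^sup>2 = of_int n'" using int [OF N M C'] by blast
 have "mA (minv N * M) = mD (minv M * N)" unfolding inv by (simp only: minv_sel)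
 moreover have "mA (minv M * N) * mD (minv M * N) = 1" using sl2_det [of "minv M * N"] C by simp
 ultimately have "of_int n * of_int n' = (1::real)" using n n' by (metis one_power2 power_mult_distrib)
 hence "n * n' = 1" by (metis of_int_eq_1_iff of_int_mult)
 moreover have "0 \<le> n" using n by (metis of_int_0_le_iff zero_le_power2)
 ultimately have "n = 1" by (simp add: zmult_eq_1_iff)
 thus ?thesis using n by simp
qed

text \<open>Seen from \<open>M\<close>, the unit translation of \<open>N\<close> has as lower left
  entry minus the square of the one in question; \<open>cusp_c_ge4\<close> makes this square at
  least 4.\<close>

lemma frames_C_ge2:
 assumes hc: "hyp_cover X pr" and M: "frame pr M" and N: "frame pr N"
  and C: "mC (minv M * N) \<noteq> 0"
 shows "2 \<le> \<bar>mC (minv M * N)\<bar>"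
proof -
 define B where "B = minv M * N"
 interpret M: hyp_cover X "pull pr M" by (rule hyp_cover_mob [OF hc])
 have "deck pr (N * Tr 1 * minv N)" using N by (simp add: cusp_frame_def deck_conj)
 moreover have "M * (B * Tr 1 * minv B) * minv M = N * Tr 1 * minv N"
  by (simp add: B_def minv_mult mult.assoc)
 ultimately have d: "deck (pull pr M) (B * Tr 1 * minv B)" by (simp add: deck_conj)
 have "4 \<le> \<bar>mC (B * Tr 1 * minv B)\<bar>"
  using M.cusp_c_ge4 [OF M d] C by (simp add: conj_Tr_C B_def)
 hence "2\<^sup>2 \<le> \<bar>mC B\<bar>\<^sup>2" by (simp add: conj_Tr_C)
 thus ?thesis unfolding B_def by (rule power2_le_imp_le) simp
qed

text \<open>Quantitative disjointness of horoballs: no point is high above two different parabolic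
  fixed points. It is \<open>Im_mob_le\<close> with an entry of absolute value at least 2.\<close>

lemma frames_horoball:
 assumes hc: "hyp_cover X pr" and M: "frame pr M" and N: "frame pr N"
  and C: "mC (minv M * N) \<noteq> 0" and z: "z \<in> UH"
 shows "Im (mob (minv M) z) * Im (mob (minv N) z) \<le> 1 / 4"
proof -
 define w where "w = mob (minv N) z"
 have w: "w \<in> UH" using z by (simp add: w_def)
 have "mob (minv M * N) w = mob (minv M) z" using z w by (simp add: mob_mult w_def del: UH_iff)
 hence "Im (mob (minv M) z) \<le> 1 / ((mC (minv M * N))\<^sup>2 * Im w)" using Im_mob_le [OF w C] by simp
 hence "Im (mob (minv M) z) * Im w \<le> 1 / ((mC (minv M * N))\<^sup>2 * Im w) * Im w"
  using w by (intro mult_right_mono) auto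
 also have "\<dots> = 1 / (mC (minv M * N))\<^sup>2" using w by simp
 also have "\<dots> \<le> 1 / 2\<^sup>2"
  using power_mono [OF frames_C_ge2 [OF assms(1-4)], of 2] by (intro divide_left_mono) auto
 finally show ?thesis by (simp add: w_def)
qed

section \<open>Geodesics\<close>

text \<open>Its axis is the image of the imaginary axis under \<open>N\<close>. The curve
  \<open>gl N v\<close> runs along this axis at speed \<open>v\<close>, so that the translation
  advances it by time 1.\<close>

abbreviation (input) trl :: "sl2 \<Rightarrow> real \<Rightarrow> sl2" where
 "trl N v \<equiv> N * Dg v * minv N"

definition gl :: "sl2 \<Rightarrow> real \<Rightarrow> real \<Rightarrow> complex" where
 "gl M v t = mob M (\<i> * of_real (exp (v * t)))"

lemma iexp_UH: "\<i> * of_real (exp x) \<in> UH"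
 by simp

lemma gl_UH: "gl M v t \<in> UH"
 unfolding gl_def using iexp_UH mob_in_UH by blast

lemma hdist_iexp: "hdist (\<i> * of_real (exp x)) (\<i> * of_real (exp y)) = \<bar>x - y\<bar>"
 using hdist_iaxis [of "exp x" "exp y"] by simp

lemma hdist_gl: "hdist (gl M v s) (gl M v t) = \<bar>v * s - v * t\<bar>"
 unfolding gl_def hdist_mob [OF iexp_UH iexp_UH] by (rule hdist_iexp)

lemma continuous_on_gl: "continuous_on S (gl M v)"
 unfolding gl_def
 by (rule continuous_on_compose2 [OF continuous_on_mob]) (auto intro!: continuous_intros)

lemma mob_Dg_iexp: "mob (Dg w) (\<i> * of_real (exp x)) = \<i> * of_real (exp (x + w))"
 by (simp add: exp_add)

lemma gl_mult: "gl (M * Dg w) v t = mob M (\<i> * of_real (exp (v * t + w)))"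
 unfolding gl_def using mob_mult [OF iexp_UH, of M "Dg w" "v * t"] mob_Dg_iexp by metis

lemma mob_gl: "mob g (gl M v t) = gl (g * M) v t"
 unfolding gl_def by (rule mob_mult [OF iexp_UH, symmetric])

lemma mob_eq_two:
 assumes "z \<in> UH" "w \<in> UH" "z \<noteq> w" "mob g z = mob h z" "mob g w = mob h w"
 shows "g = h \<or> g = - h"
proof -
 have "mob (minv h * g) z = z" "mob (minv h * g) w = w"
  using assms by (simp_all add: mob_mult del: UH_iff)
 hence "minv h * g = 1 \<or> minv h * g = - 1" using mob_fix_two assms by blast
 thus ?thesis by (metis minv_right2 mult.right_neutral sl2_mult_minus(1))
qed

lemma gl_inj: "0 < v \<Longrightarrow> gl M v s = gl M v t \<longleftrightarrow> s = t"
 using hdist_gl [of M v s t] by auto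

lemma gl_eq_two:
 assumes "0 < v" "s \<noteq> t" "gl M v s = gl N v s" "gl M v t = gl N v t"
 shows "M = N \<or> M = - N"
 by (rule mob_eq_two [OF iexp_UH iexp_UH, of "v * s" "v * t"]) (use assms in \<open>auto simp: gl_def complex_eq_iff\<close>)

text \<open>The distances to i and to a second point of the axis determine height and modulus of
  \<open>z\<close>, and here they are those of a point on the axis.\<close>

lemma three_point:
 assumes z: "z \<in> UH" and d: "hdist z \<i> = \<bar>al\<bar>" "hdist z (\<i> * of_real (exp \<beta>)) = \<bar>al - \<beta>\<bar>" and \<beta>: "\<beta> \<noteq> 0"
 shows "z = \<i> * of_real (exp al)"
proof -
 define w n where "w = Im z" and "n = (cmod z)\<^sup>2"
 have w: "0 < w" using z by (simp add: w_def)
 have c: "cosh (hdist z (\<i> * of_real y)) = (n + y\<^sup>2) / (2 * y * w)" if "0 < y" for y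
 proof -
  have "\<i> * of_real y \<in> UH" using that by simp
  moreover have "(cmod (z - \<i> * of_real y))\<^sup>2 = n + y\<^sup>2 - 2 * y * w"
   unfolding n_def w_def cmod_power2 by (simp add: power2_eq_square algebra_simps)
  ultimately show ?thesis
   using cosh_hdist [OF z, of "\<i> * of_real y"] that w by (simp add: w_def field_simps)
 qed
 define y a where "y = exp \<beta>" and "a = exp al"
 have ya: "0 < y" "0 < a" "y \<noteq> 1" using \<beta> by (auto simp: y_def a_def)
 have "cosh (hdist z \<i>) = cosh al" "cosh (hdist z (\<i> * of_real y)) = cosh (al - \<beta>)"
  unfolding y_def d by simp_all
 moreover have "cosh al = (a + 1 / a) / 2" by (simp add: cosh_field_def a_def exp_minus inverse_eq_divide)
 moreover have "cosh (al - \<beta>) = (a / y + y / a) / 2" by (simp add: cosh_field_def a_def y_def exp_diff)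
 ultimately have e1: "(n + 1) / (2 * w) = (a + 1 / a) / 2" and e2: "(n + y\<^sup>2) / (2 * y * w) = (a / y + y / a) / 2"
  using c [of 1] c [of y] ya by simp_all
 have "n + 1 = (n + 1) / (2 * w) * (2 * w)" using w by simp
 also have "\<dots> = w * (a + 1 / a)" unfolding e1 by simp
 finally have 1: "n + 1 = w * (a + 1 / a)" .
 have "n + y\<^sup>2 = (n + y\<^sup>2) / (2 * y * w) * (2 * y * w)" using w ya by simp
 also have "\<dots> = w * (a + y\<^sup>2 / a)" unfolding e2 using ya by (simp add: field_simps power2_eq_square)
 finally have 2: "n + y\<^sup>2 = w * (a + y\<^sup>2 / a)" .
 from 1 2 have "(y\<^sup>2 - 1) * (a - w) = 0" using ya by (simp add: field_simps)
 moreover have "y\<^sup>2 \<noteq> 1" using ya by (simp add: power2_eq_1_iff)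
 ultimately have wa: "w = a" by simp
 hence "n = w\<^sup>2" using 1 ya by (simp add: field_simps power2_eq_square)
 hence "(Re z)\<^sup>2 = 0" unfolding n_def w_def cmod_power2 by simp
 thus ?thesis using wa by (simp add: complex_eq_iff w_def a_def)
qed

definition Sm :: sl2 where "Sm = mk 0 (- 1) 1 0"

lemma Sm_sel: "mA Sm = 0" "mB Sm = - 1" "mC Sm = 1" "mD Sm = 0"
 unfolding Sm_def by (rule mk_sel; simp)+

lemma mob_Sm_iexp: "mob Sm (\<i> * of_real (exp x)) = \<i> * of_real (exp (- x))"
 by (simp add: mob_def Sm_sel exp_minus field_simps)

text \<open>\<open>J\<close> may be any set of reals, so this covers small intervals as well as the
  pair 0, 1. Once two of the points are on the imaginary axis, the distances to them locate all the
  others.\<close>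

lemma geodesic_local_gl:
 assumes "s0 \<in> J" "s1 \<in> J" "s0 < s1" "0 < v" "\<And>s. s \<in> J \<Longrightarrow> c s \<in> UH"
  and iso: "\<And>r s. r \<in> J \<Longrightarrow> s \<in> J \<Longrightarrow> hdist (c r) (c s) = v * \<bar>r - s\<bar>"
 obtains M where "\<And>s. s \<in> J \<Longrightarrow> c s = gl M v s"
proof -
 obtain g x y where g: "0 < x" "0 < y" "mob g (c s0) = \<i> * of_real x" "mob g (c s1) = \<i> * of_real y"
  using sl2_to_iaxis assms by metis
 have lnd: "\<bar>ln x - ln y\<bar> = v * (s1 - s0)"
  using hdist_iaxis [OF g(1,2)] g iso [OF assms(1,2)] hdist_mob assms(1,2,3,5) by (metis abs_minus_commute abs_of_pos diff_gt_0_iff_gt)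
 \<comment> \<open>The two points may be in descending order on the axis; the half-turn
   \<open>Sm\<close> about i reverses it.\<close>
 have "\<exists>h a. mob h (c s0) = \<i> * of_real (exp a) \<and> mob h (c s1) = \<i> * of_real (exp (a + v * (s1 - s0)))"
 proof (cases "ln x \<le> ln y")
  case True
  hence "ln y = ln x + v * (s1 - s0)" using lnd by simp
  hence "exp (ln x) = x" "exp (ln x + v * (s1 - s0)) = y" using g(1,2) by (simp, metis exp_ln)
  thus ?thesis using g by metis
 next
  case False
  hence "ln y = ln x - v * (s1 - s0)" using lnd by simp
  hence e: "- ln y = - ln x + v * (s1 - s0)" by simp
  have "mob (Sm * g) (c s0) = mob Sm (\<i> * of_real (exp (ln x)))" "mob (Sm * g) (c s1) = mob Sm (\<i> * of_real (exp (ln y)))"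
   using g assms by (simp_all add: mob_mult del: UH_iff)
  thus ?thesis unfolding mob_Sm_iexp e by blast
 qed
 then obtain h a where h: "mob h (c s0) = \<i> * of_real (exp a)" "mob h (c s1) = \<i> * of_real (exp (a + v * (s1 - s0)))"
  by blast
 define k where "k = Dg (- a) * h"
 have k: "mob k (c s0) = \<i>" "mob k (c s1) = \<i> * of_real (exp (v * (s1 - s0)))"
  unfolding k_def using assms h
  by (simp_all add: mob_mult mob_Dg_iexp del: UH_iff mob_Dg)
 show ?thesis
 proof
  fix s assume s: "s \<in> J"
  have "hdist (mob k (c s)) \<i> = hdist (c s) (c s0)" using k(1) hdist_mob assms(1,5) s by metis
  also have "\<dots> = v * \<bar>s - s0\<bar>" by (rule iso [OF s assms(1)])
  finally have 1: "hdist (mob k (c s)) \<i> = \<bar>v * (s - s0)\<bar>" using assms(4) by (simp add: abs_mult)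
  have "hdist (mob k (c s)) (\<i> * of_real (exp (v * (s1 - s0)))) = hdist (c s) (c s1)"
   using k(2) hdist_mob assms(2,5) s by metis
  also have "\<dots> = v * \<bar>s - s1\<bar>" by (rule iso [OF s assms(2)])
  also have "\<dots> = \<bar>v * (s - s0) - v * (s1 - s0)\<bar>" using assms(4) by (simp add: abs_mult flip: right_diff_distrib)
  finally have 2: "hdist (mob k (c s)) (\<i> * of_real (exp (v * (s1 - s0)))) = \<bar>v * (s - s0) - v * (s1 - s0)\<bar>" .
  have "mob k (c s) = \<i> * of_real (exp (v * (s - s0)))"
   by (rule three_point [OF mob_in_UH [OF assms(5) [OF s]] 1 2]) (use assms in simp)
  hence "c s = mob (minv k) (\<i> * of_real (exp (v * (s - s0))))" using assms(5) s by (metis mob_minv(1))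
  also have "\<dots> = gl (minv k * Dg (- v * s0)) v s" unfolding gl_mult by (simp add: algebra_simps)
  finally show "c s = gl (minv k * Dg (- v * s0)) v s" .
 qed
qed

lemma geodesic_gl:
 fixes c :: "real \<Rightarrow> complex"
 assumes J: "open J" "connected J" "t0 \<in> J" and v: "0 < v" and cU: "\<And>t. t \<in> J \<Longrightarrow> c t \<in> UH"
  and iso: "\<And>t. t \<in> J \<Longrightarrow> \<exists>e>0. \<forall>r\<in>ball t e. \<forall>s\<in>ball t e. hdist (c r) (c s) = v * \<bar>r - s\<bar>"
 obtains M where "\<And>t. t \<in> J \<Longrightarrow> c t = gl M v t"
proof -
 have local: "\<exists>e>0. \<exists>M. \<forall>s\<in>ball t e. c s = gl M v s" if t: "t \<in> J" for t
 proof -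
  obtain e1 where e1: "0 < e1" "\<forall>r\<in>ball t e1. \<forall>s\<in>ball t e1. hdist (c r) (c s) = v * \<bar>r - s\<bar>" using iso [OF t] by blast
  obtain e2 where e2: "0 < e2" "ball t e2 \<subseteq> J" using J(1) t open_contains_ball by blast
  define e where "e = min e1 e2"
  have e: "0 < e" "\<And>r s. r \<in> ball t e \<Longrightarrow> s \<in> ball t e \<Longrightarrow> hdist (c r) (c s) = v * \<bar>r - s\<bar>" "ball t e \<subseteq> J"
   using e1 e2 by (auto simp: e_def)
  have in_ball: "t \<in> ball t e" "t + e / 2 \<in> ball t e" "t < t + e / 2" using e(1) by (simp_all add: dist_real_def)
  have "c s \<in> UH" if "s \<in> ball t e" for s using cU e(3) that by blast
  from geodesic_local_gl [OF in_ball v this e(2)] obtain M where "\<And>s. s \<in> ball t e \<Longrightarrow> c s = gl M v s" by blast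
  thus ?thesis using e(1) by blast
 qed
 obtain e0 M where e0: "0 < e0" "\<And>s. s \<in> ball t0 e0 \<Longrightarrow> c s = gl M v s" using local [OF J(3)] by blast
 have "\<exists>e>0. \<forall>s\<in>ball t e. c s = gl M v s" if t: "t \<in> J" for t
 proof (rule connected_germ_induct [OF J(1,2,3) t e0(1), of "\<lambda>s. c s = gl M v s"])
  fix x assume xJ: "x \<in> J" and x: "\<not> (\<exists>e>0. \<forall>s\<in>ball x e. c s = gl M v s)"
  obtain e N where e: "0 < e" "\<forall>s\<in>ball x e. c s = gl N v s" using local [OF xJ] by blast
  have False if u: "u \<in> ball x e" and ex: "\<exists>e>0. \<forall>s\<in>ball u e. c s = gl M v s" for u
  proof -
   from ex obtain e1 where e1: "0 < e1" "\<forall>s\<in>ball u e1. c s = gl M v s" by (elim exE conjE)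
   obtain e2 where e2: "0 < e2" "ball u e2 \<subseteq> ball x e" using ball_in_ball [OF u] by blast
   define u' where "u' = u + min e1 e2 / 2"
   have u': "u' \<in> ball u e1" "u' \<in> ball x e" "u \<noteq> u'"
    using e1 e2 by (auto simp: u'_def dist_real_def subset_iff)
   have "gl M v u = gl N v u" "gl M v u' = gl N v u'" using e(2) e1 u u' by (metis centre_in_ball)+
   hence "M = N \<or> M = - N" using gl_eq_two [OF v u'(3)] by blast
   hence "gl M v s = gl N v s" for s by (auto simp: gl_def)
   thus False using x e by auto
  qed
  thus "\<exists>e>0. \<forall>u\<in>ball x e. \<not> (\<exists>e>0. \<forall>s\<in>ball u e. c s = gl M v s)" using e(1) by blast
 qed (use e0 in auto)
 thus ?thesis using that [of M] by (metis centre_in_ball)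
qed

section \<open>Closed geodesics as projections of axes\<close>

lemma local_isometry_length:
 fixes c :: "real \<Rightarrow> 'a::metric_space"
 assumes v: "0 \<le> v" and loc: "\<And>t. \<exists>e>0. \<forall>r\<in>ball t e. \<forall>s\<in>ball t e. dist (c r) (c s) = v * \<bar>r - s\<bar>"
 shows "curve_length c = ereal v"
proof (rule antisym)
 have lip: "dist (c a) (c b) \<le> v * (b - a)" if "a \<le> b" for a b
 proof (rule lipschitz_from_local [OF that])
  fix t obtain e where e: "0 < e" "\<forall>r\<in>ball t e. \<forall>s\<in>ball t e. dist (c r) (c s) = v * \<bar>r - s\<bar>" using loc by blast
  show "\<exists>d>0. \<forall>s. a \<le> s \<longrightarrow> s \<le> b \<longrightarrow> \<bar>s - t\<bar> < d \<longrightarrow> dist (c s) (c t) \<le> v * \<bar>s - t\<bar>"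
   by (intro exI [of _ e]) (use e in \<open>auto simp: dist_real_def abs_minus_commute\<close>)
 qed
 show "curve_length c \<le> ereal v"
  unfolding curve_length_def
 proof (rule SUP_least, clarify)
  fix n and t :: "nat \<Rightarrow> real" assume t: "mono t" "range t \<subseteq> {0..1}"
  have "(\<Sum>i<n. dist (c (t i)) (c (t (Suc i)))) \<le> (\<Sum>i<n. v * (t (Suc i) - t i))"
   using t(1) by (intro sum_mono lip) (simp add: mono_def)
  also have "\<dots> = v * (t n - t 0)" unfolding sum_distrib_left [symmetric] by (simp add: sum_lessThan_telescope)
  also have "\<dots> \<le> v * 1"
  proof -
   have "t n \<in> {0..1}" "t 0 \<in> {0..1}" using t(2) by blast+
   thus ?thesis using v by (intro mult_left_mono) auto
  qed
  finally show "ereal (\<Sum>i<n. dist (c (t i)) (c (t (Suc i)))) \<le> ereal v" by simp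
 qed
 define G where "G = {ball t e | t e. 0 < e \<and> (\<forall>r\<in>ball t e. \<forall>s\<in>ball t e. dist (c r) (c s) = v * \<bar>r - s\<bar>)}"
 have cov: "{0..1} \<subseteq> \<Union>G"
 proof
  fix t :: real
  obtain e where "0 < e" "\<forall>r\<in>ball t e. \<forall>s\<in>ball t e. dist (c r) (c s) = v * \<bar>r - s\<bar>" using loc by blast
  hence "ball t e \<in> G" "t \<in> ball t e" unfolding G_def by auto
  thus "t \<in> \<Union>G" by blast
 qed
 have op: "\<And>B. B \<in> G \<Longrightarrow> open B" by (auto simp: G_def)
 obtain eps where eps: "0 < eps" "\<And>x. x \<in> {0..1} \<Longrightarrow> \<exists>B\<in>G. ball x eps \<subseteq> B"
  using Heine_Borel_lemma [OF compact_Icc cov op] by metis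
 obtain n where n: "inverse (real (Suc n)) < eps" using reals_Archimedean [OF eps(1)] by blast
 define N where "N = Suc n"
 have N: "0 < real N" "1 / real N < eps" using n by (auto simp: N_def inverse_eq_divide)
 \<comment> \<open>Equally spaced points, cut off at 1 because the definition of length takes
   monotone sequences on all natural numbers with values in the unit interval.\<close>
 define t where "t = (\<lambda>i. min 1 (real i / real N))"
 have mono: "mono t" using N(1) by (intro monoI) (auto simp: t_def divide_right_mono min_le_iff_disj)
 have rng: "range t \<subseteq> {0..1}" by (auto simp: t_def)
 have step: "dist (c (t i)) (c (t (Suc i))) = v / real N" if "i < N" for i
 proof -
  have ti: "t i = real i / real N" "t (Suc i) = real (Suc i) / real N" using that N by (auto simp: t_def min_def field_simps)
  have d: "t (Suc i) - t i = 1 / real N" unfolding ti by (simp add: diff_divide_distrib [symmetric])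
  have ab: "\<bar>t i - t (Suc i)\<bar> = 1 / real N" by (subst abs_minus_commute) (simp add: d)
  obtain B where B: "B \<in> G" "ball (t i) eps \<subseteq> B" using eps(2) [of "t i"] rng by blast
  have "t i \<in> ball (t i) eps" "t (Suc i) \<in> ball (t i) eps" using eps(1) N(2) ab by (simp_all add: dist_real_def)
  hence "t i \<in> B" "t (Suc i) \<in> B" using B(2) by blast+
  hence "dist (c (t i)) (c (t (Suc i))) = v * \<bar>t i - t (Suc i)\<bar>" using B(1) by (auto simp: G_def)
  also have "\<bar>t i - t (Suc i)\<bar> = 1 / real N" by (rule ab)
  finally show ?thesis by simp
 qed
 have "(\<Sum>i<N. dist (c (t i)) (c (t (Suc i)))) = (\<Sum>i<N. v / real N)" by (rule sum.cong) (simp_all add: step)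
 also have "\<dots> = v" using N by simp
 finally have "ereal v = (case (N, t) of (n, t) \<Rightarrow> ereal (\<Sum>i<n. dist (c (t i)) (c (t (Suc i)))))" by simp
 also have "\<dots> \<le> curve_length c"
  unfolding curve_length_def by (rule SUP_upper) (use mono rng in auto)
 finally show "ereal v \<le> curve_length c" .
qed

context hyp_cover
begin

lemma local_isometry_gl:
 assumes v: "0 < v"
 shows "\<exists>e>0. \<forall>r\<in>ball t e. \<forall>s\<in>ball t e. dist (pr (gl M v r)) (pr (gl M v s)) = v * \<bar>r - s\<bar>"
proof -
 obtain e where e: "0 < e" "\<forall>u\<in>ball (gl M v t) e. \<forall>w\<in>ball (gl M v t) e. dist (pr u) (pr w) = hdist u w"
  using loc [OF gl_UH] by blast
 have "isCont (gl M v) t" using continuous_on_gl [of UNIV] by (simp add: continuous_on_eq_continuous_at)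
 then obtain d where d: "0 < d" "\<And>s. dist s t < d \<Longrightarrow> dist (gl M v s) (gl M v t) < e"
  unfolding continuous_at_eps_delta using e(1) by metis
 have "dist (pr (gl M v r)) (pr (gl M v s)) = v * \<bar>r - s\<bar>" if "r \<in> ball t d" "s \<in> ball t d" for r s
 proof -
  have "gl M v r \<in> ball (gl M v t) e" "gl M v s \<in> ball (gl M v t) e"
   using d(2) [of r] d(2) [of s] that by (auto simp: dist_commute)
  hence "dist (pr (gl M v r)) (pr (gl M v s)) = hdist (gl M v r) (gl M v s)" using e(2) by blast
  also have "\<dots> = v * \<bar>r - s\<bar>" unfolding hdist_gl using v by (simp add: abs_mult flip: right_diff_distrib)
  finally show ?thesis .
 qed
 thus ?thesis using d(1) by blast
qed

lemma gl_length: "0 < v \<Longrightarrow> curve_length (\<lambda>t. pr (gl M v t)) = ereal v"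
 by (rule local_isometry_length) (auto intro: local_isometry_gl)

lemma deck_gl_period:
 assumes "deck pr (trl M v)"
 shows "mob (trl M v) (gl M v t) = gl M v (t + 1)" "pr (gl M v (t + 1)) = pr (gl M v t)"
proof -
 have "mob (trl M v) (gl M v t) = gl (M * Dg v) v t" by (simp add: mob_gl mult.assoc del: minv_Dg)
 also have "\<dots> = gl M v (t + 1)" unfolding gl_mult by (simp add: gl_def algebra_simps)
 finally show 1: "mob (trl M v) (gl M v t) = gl M v (t + 1)" .
 show "pr (gl M v (t + 1)) = pr (gl M v t)" using deckD [OF assms gl_UH, of M v t] 1 by simp
qed

lemma closed_geodesic_gl:
 assumes "0 < v" "deck pr (trl M v)"
 shows "closed_geodesic X (\<lambda>t. pr (gl M v t))"
 unfolding closed_geodesic_def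
 using assms deck_gl_period(2) local_isometry_gl in_X [OF gl_UH] by (intro conjI exI [of _ v]) auto

text \<open>The lift is locally isometric, hence a geodesic of the half-plane. Periodicity gives a
  deck transformation that advances it by time 1; it agrees with the translation along the axis at
  two points, hence up to sign.\<close>

lemma closed_geodesic_lift:
 assumes "closed_geodesic X \<gamma>"
 obtains M v where "0 < v" "deck pr (trl M v)" "\<gamma> = (\<lambda>t. pr (gl M v t))"
proof -
 obtain v where v: "0 < v" "\<And>t. \<exists>e>0. \<forall>r\<in>ball t e. \<forall>s\<in>ball t e. dist (\<gamma> r) (\<gamma> s) = v * \<bar>r - s\<bar>"
  and per: "\<And>t. \<gamma> (t + 1) = \<gamma> t" and rng: "range \<gamma> \<subseteq> X"
  using assms unfolding closed_geodesic_def by blast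
 have "isCont \<gamma> t" for t unfolding continuous_at_eps_delta
 proof (intro allI impI)
  fix eps :: real assume "0 < eps"
  obtain e where e: "0 < e" "\<forall>r\<in>ball t e. \<forall>s\<in>ball t e. dist (\<gamma> r) (\<gamma> s) = v * \<bar>r - s\<bar>" using v(2) by blast
  show "\<exists>d>0. \<forall>s. dist s t < d \<longrightarrow> dist (\<gamma> s) (\<gamma> t) < eps"
  proof (intro exI [of _ "min e (eps / v)"] conjI allI impI)
   show "0 < min e (eps / v)" using e \<open>0 < eps\<close> v by simp
   fix s assume "dist s t < min e (eps / v)"
   hence s: "s \<in> ball t e" "t \<in> ball t e" "\<bar>s - t\<bar> < eps / v" by (auto simp: dist_real_def abs_minus_commute)
   hence "dist (\<gamma> s) (\<gamma> t) = v * \<bar>s - t\<bar>" using e(2) by blast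
   also have "\<dots> < eps" using s(3) v(1) by (simp add: pos_less_divide_eq mult.commute)
   finally show "dist (\<gamma> s) (\<gamma> t) < eps" .
  qed
 qed
 hence c\<gamma>: "continuous_on UNIV \<gamma>" by (simp add: continuous_on_eq_continuous_at)
 have "\<gamma> 0 \<in> pr ` UH" using rng image by blast
 then obtain a where a: "a \<in> UH" "\<gamma> 0 = pr a" by blast
 obtain c where c: "continuous_on UNIV c" "\<And>t. c t \<in> UH" "c 0 = a" "\<And>t. pr (c t) = \<gamma> t"
  using lift [OF convex_UNIV c\<gamma> rng UNIV_I a] by (metis UNIV_I)
 have iso: "\<exists>e>0. \<forall>r\<in>ball t e. \<forall>s\<in>ball t e. hdist (c r) (c s) = v * \<bar>r - s\<bar>" for t
 proof -
  obtain e1 where e1: "0 < e1" "\<forall>r\<in>ball t e1. \<forall>s\<in>ball t e1. dist (\<gamma> r) (\<gamma> s) = v * \<bar>r - s\<bar>" using v(2) by blast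
  obtain e2 where e2: "0 < e2" "\<forall>u\<in>ball (c t) e2. \<forall>w\<in>ball (c t) e2. dist (pr u) (pr w) = hdist u w"
   using loc [OF c(2)] by blast
  have "isCont c t" using c(1) by (simp add: continuous_on_eq_continuous_at)
  then obtain d where d: "0 < d" "\<And>s. dist s t < d \<Longrightarrow> dist (c s) (c t) < e2"
   unfolding continuous_at_eps_delta using e2(1) by metis
  have "hdist (c r) (c s) = v * \<bar>r - s\<bar>" if "r \<in> ball t (min d e1)" "s \<in> ball t (min d e1)" for r s
  proof -
   have "c r \<in> ball (c t) e2" "c s \<in> ball (c t) e2" using d(2) [of r] d(2) [of s] that by (auto simp: dist_commute)
   hence "hdist (c r) (c s) = dist (pr (c r)) (pr (c s))" using e2(2) by simp
   also have "\<dots> = v * \<bar>r - s\<bar>" unfolding c(4) using e1(2) that by simp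
   finally show ?thesis .
  qed
  thus ?thesis using d(1) e1(1) by (intro exI [of _ "min d e1"]) auto
 qed
 obtain M where M: "\<And>t. c t = gl M v t" by (rule geodesic_gl [OF open_UNIV connected_UNIV UNIV_I v(1) c(2) iso]) blast
 have "pr (c 0) = pr (c 1)" unfolding c(4) using per [of 0] by simp
 then obtain h where h: "deck pr h" "mob h (c 0) = c 1" using deck_trans c(2) by metis
 have "mob h (c t) = c (t + 1)" for t
 proof (rule lift_unique [of UNIV "\<lambda>t. mob h (c t)" "\<lambda>t. c (t + 1)" 0])
  show "continuous_on UNIV (\<lambda>t. mob h (c t))"
   by (rule continuous_on_compose2 [OF continuous_on_mob c(1)]) (use c(2) in blast)
  show "continuous_on UNIV (\<lambda>t. c (t + 1))"
   by (rule continuous_on_compose2 [OF c(1)]) (auto intro!: continuous_intros)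
  show "pr (mob h (c x)) = pr (c (x + 1))" for x
   using deckD [OF h(1) c(2)] by (simp add: c(4) per)
 qed (use h c(2) mob_in_UH in auto)
 hence "gl (h * M) v t = gl M v (t + 1)" for t using mob_gl [of h M v t] by (simp add: M)
 moreover have "gl (M * Dg v) v t = gl M v (t + 1)" for t
  unfolding gl_mult by (simp add: gl_def algebra_simps)
 ultimately have "gl (h * M) v t = gl (M * Dg v) v t" for t by simp
 hence "h * M = M * Dg v \<or> h * M = - (M * Dg v)" using gl_eq_two [OF v(1), of 0 1] by (metis zero_neq_one)
 hence "h = trl M v \<or> h = - (trl M v)"
  by (metis minv_right mult.assoc mult.right_neutral sl2_mult_minus(2))
 hence "deck pr (trl M v)" using h(1) by auto
 moreover have "\<gamma> = (\<lambda>t. pr (gl M v t))" using c(4) M by (intro ext) metis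
 ultimately show ?thesis using that v(1) by blast
qed

text \<open>An isometry that maps two points of the axis into the axis translates it or reverses it.
  A reversal has trace 0, which \<open>deck_trace\<close> excludes.\<close>

lemma axis_deck:
 assumes v: "0 < v" and h: "deck pr h" and s: "s \<noteq> s'"
  and hs: "mob h (gl M v s) = gl M v t" "mob h (gl M v s') = gl M v t'"
 shows "h = trl M (v * (t - s)) \<or> h = - (trl M (v * (t - s)))"
proof -
 have "hdist (gl M v t) (gl M v t') = hdist (gl M v s) (gl M v s')"
  unfolding hs [symmetric] by (rule hdist_mob [OF gl_UH gl_UH])
 hence "\<bar>v * (t - t')\<bar> = \<bar>v * (s - s')\<bar>" unfolding hdist_gl by (simp add: right_diff_distrib)
 hence "\<bar>t - t'\<bar> = \<bar>s - s'\<bar>" using v by (simp add: abs_mult)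
 then consider "t - s = t' - s'" | "t + s = t' + s'" by linarith
 thus ?thesis
 proof cases
  case 1
  have "v * s + v * (t - s) = v * t" by (simp add: algebra_simps)
  moreover have "v * s' + v * (t - s) = v * t'" unfolding 1 by (simp add: algebra_simps)
  ultimately have "gl (M * Dg (v * (t - s))) v s = gl M v t" "gl (M * Dg (v * (t - s))) v s' = gl M v t'"
   unfolding gl_mult by (simp_all add: gl_def)
  moreover have "gl (h * M) v s = gl M v t" "gl (h * M) v s' = gl M v t'" using hs mob_gl by metis+
  ultimately have "gl (h * M) v s = gl (M * Dg (v * (t - s))) v s" "gl (h * M) v s' = gl (M * Dg (v * (t - s))) v s'"
   by simp_all
  hence "h * M = M * Dg (v * (t - s)) \<or> h * M = - (M * Dg (v * (t - s)))" using gl_eq_two [OF v s] by blast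
  thus ?thesis by (metis minv_right mult.assoc mult.right_neutral sl2_mult_minus(2))
 next
  case 2
  define k where "k = Dg (v * (t + s)) * Sm"
  have kx: "mob k (\<i> * of_real (exp x)) = \<i> * of_real (exp (v * (t + s) - x))" for x
   unfolding k_def mob_mult [OF iexp_UH] mob_Sm_iexp mob_Dg_iexp by simp
  have "gl (M * k) v s = mob M (mob k (\<i> * of_real (exp (v * s))))"
   "gl (M * k) v s' = mob M (mob k (\<i> * of_real (exp (v * s'))))"
   unfolding gl_def by (rule mob_mult [OF iexp_UH])+
  moreover have "v * (t + s) - v * s = v * t" by (simp add: algebra_simps)
  moreover have "v * (t + s) - v * s' = v * t'" unfolding 2 by (simp add: algebra_simps)
  ultimately have "gl (M * k) v s = gl M v t" "gl (M * k) v s' = gl M v t'"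
   unfolding kx by (simp_all add: gl_def)
  moreover have "gl (h * M) v s = gl M v t" "gl (h * M) v s' = gl M v t'" using hs mob_gl by metis+
  ultimately have "gl (h * M) v s = gl (M * k) v s" "gl (h * M) v s' = gl (M * k) v s'"
   by simp_all
  hence "h * M = M * k \<or> h * M = - (M * k)" using gl_eq_two [OF v s] by blast
  hence "h = M * k * minv M \<or> h = - (M * k * minv M)"
   by (metis minv_right mult.assoc mult.right_neutral sl2_mult_minus(2))
  moreover have "trc (- (M * k * minv M)) = - trc k" "trc (M * k * minv M) = trc k"
   using trc_conj' [of M k] by (simp_all add: trc_def sl2_uminus_sel)
  moreover have "trc k = 0" by (simp add: trc_def k_def sl2_sel Sm_sel)
  ultimately show ?thesis using deck_trace [OF h] by auto
 qed
qed

lemma deck_axis_discrete: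
 assumes v: "v \<noteq> 0" "deck pr (trl M v)"
 obtains m where "0 < m" "deck pr (trl M m)" "\<And>w. deck pr (trl M w) \<Longrightarrow> \<exists>n::int. w = of_int n * m"
proof -
 define S where "S = {w. deck pr (trl M w)}"
 have i: "mob M \<i> \<in> UH" by (rule mob_in_UH) simp
 obtain r where r: "0 < r" "\<And>g. deck pr g \<Longrightarrow> hdist (mob M \<i>) (mob g (mob M \<i>)) < r \<Longrightarrow> g = 1 \<or> g = - 1"
  using inj_radius [OF i] by metis
 obtain m where "0 < m" "m \<in> S" "\<And>x. x \<in> S \<Longrightarrow> \<exists>n::int. x = of_int n * m"
 proof (rule discrete_subgroup [of S r v])
  show "x + y \<in> S" if "x \<in> S" "y \<in> S" for x y
  proof -
   have "deck pr ((trl M x) * (trl M y))" using that deck_mult by (auto simp: S_def)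
   moreover have "(trl M x) * (trl M y) = M * (Dg x * Dg y) * minv M"
    by (simp add: mult.assoc)
   ultimately show ?thesis by (simp add: S_def Dg_add)
  qed
  show "- x \<in> S" if "x \<in> S" for x
  proof -
   have "deck pr (minv (trl M x))" using that deck_minv by (auto simp: S_def)
   thus ?thesis by (simp add: S_def minv_mult mult.assoc)
  qed
  show "x = 0" if "x \<in> S" "\<bar>x\<bar> < r" for x
  proof -
   have "mob (trl M x) (gl M 1 0) = gl (M * Dg x) 1 0"
    by (simp add: mob_gl mult.assoc del: minv_Dg)
   also have "\<dots> = gl M 1 x" unfolding gl_mult by (simp add: gl_def)
   finally have i1: "mob M \<i> = gl M 1 0" "mob (trl M x) (gl M 1 0) = gl M 1 x"
    by (simp_all add: gl_def)
   hence "hdist (mob M \<i>) (mob (trl M x) (mob M \<i>)) = \<bar>x\<bar>"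
    by (simp add: hdist_gl)
   hence "trl M x = 1 \<or> M * Dg x * minv M = - 1" using r(2) that by (simp add: S_def)
   hence "gl M 1 x = gl M 1 0" using i1(2) by (metis mob_1 mob_uminus)
   thus "x = 0" using gl_inj [of 1] by auto
  qed
 qed (use r v in \<open>auto simp: S_def\<close>)
 thus ?thesis using that by (auto simp: S_def)
qed

lemma primitive_gl:
 assumes prim: "primitive_closed_geodesic X (\<lambda>t. pr (gl M v t))" and v: "0 < v" "deck pr (trl M v)"
  and w: "deck pr (trl M w)"
 shows "\<exists>n::int. w = of_int n * v"
proof -
 obtain m where m: "0 < m" "deck pr (trl M m)" "\<And>w. deck pr (trl M w) \<Longrightarrow> \<exists>n::int. w = of_int n * m"
  using deck_axis_discrete [OF _ v(2)] v(1) by (metis less_irrefl)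
 obtain n :: int where n: "v = of_int n * m" using m(3) v(2) by blast
 have "0 < n" using n v(1) m(1) by (metis mult.commute of_int_0_less_iff zero_less_mult_pos)
 moreover have "\<not> n \<ge> 2"
 proof
  assume "2 \<le> n"
  have "closed_geodesic X (\<lambda>t. pr (gl M m t))" by (rule closed_geodesic_gl [OF m(1,2)])
  moreover have "(\<lambda>t. pr (gl M v t)) = (\<lambda>t. pr (gl M m (real (nat n) * t)))"
   using \<open>2 \<le> n\<close> by (simp add: gl_def n mult_ac)
  moreover have "2 \<le> nat n" using \<open>2 \<le> n\<close> by linarith
  ultimately show False using prim unfolding primitive_closed_geodesic_def by blast
 qed
 ultimately have "n = 1" by linarith
 thus ?thesis using n m(3) [OF w] by simp
qed

text \<open>If the curve were an n-fold power, the translation belonging to the shorter geodesic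
  would be conjugate to one along the same axis of length v / n, against \<open>gen\<close>.\<close>

lemma primitive_glI:
 assumes v: "0 < v" "deck pr (trl M v)"
  and gen: "\<And>w. deck pr (trl M w) \<Longrightarrow> \<exists>n::int. w = of_int n * v"
 shows "primitive_closed_geodesic X (\<lambda>t. pr (gl M v t))"
 unfolding primitive_closed_geodesic_def
proof (intro conjI notI)
 show "closed_geodesic X (\<lambda>t. pr (gl M v t))" by (rule closed_geodesic_gl [OF v])
 assume "\<exists>\<delta> n. closed_geodesic X \<delta> \<and> 2 \<le> n \<and> (\<lambda>t. pr (gl M v t)) = (\<lambda>t. \<delta> (real n * t))"
 then obtain \<delta> n where \<delta>: "closed_geodesic X \<delta>" "2 \<le> n" "(\<lambda>t. pr (gl M v t)) = (\<lambda>t. \<delta> (real n * t))" by blast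
 obtain N u where N: "0 < u" "deck pr (trl N u)" "\<delta> = (\<lambda>t. pr (gl N u t))"
  using closed_geodesic_lift [OF \<delta>(1)] by metis
 have eq: "pr (gl M v t) = pr (gl N (u * real n) t)" for t
  using fun_cong [OF \<delta>(3), of t] by (simp add: N(3) gl_def mult_ac)
 obtain k where k: "deck pr k" "mob k (gl M v 0) = gl N (u * real n) 0"
  using deck_trans [OF gl_UH gl_UH eq] by blast
 have kt: "mob k (gl M v t) = gl N (u * real n) t" for t
 proof (rule lift_unique [of UNIV "\<lambda>t. mob k (gl M v t)" "gl N (u * real n)" 0])
  show "continuous_on UNIV (\<lambda>t. mob k (gl M v t))" unfolding mob_gl by (rule continuous_on_gl)
  show "pr (mob k (gl M v x)) = pr (gl N (u * real n) x)" for x using deckD [OF k(1) gl_UH] eq by simp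
 qed (use k continuous_on_gl gl_UH mob_in_UH in auto)
 have "hdist (gl M v 0) (gl M v 1) = hdist (gl N (u * real n) 0) (gl N (u * real n) 1)"
  unfolding kt [symmetric] by (rule hdist_mob [OF gl_UH gl_UH, symmetric])
 hence vu: "v = u * real n" unfolding hdist_gl using v N by simp
 have "gl (k * M) v t = gl N v t" for t using kt unfolding mob_gl vu .
 hence "k * M = N \<or> k * M = - N" using gl_eq_two [OF v(1), of 0 1] by (metis zero_neq_one)
 hence "trl N u = k * (trl M u) * minv k"
 proof
  assume "k * M = N"
  thus ?thesis by (simp add: minv_mult mult.assoc flip: \<open>k * M = N\<close>)
 next
  assume "k * M = - N"
  hence "N = - (k * M)" by simp
  thus ?thesis by (simp add: minv_mult mult.assoc)
 qed
 hence "trl M u = minv k * (trl N u) * k" by (simp add: mult.assoc)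
 hence "deck pr (trl M u)" using N(2) k(1) deck_mult deck_minv by metis
 then obtain j :: int where "u = of_int j * v" using gen by blast
 hence "u = of_int j * (u * real n)" using vu by simp
 hence "of_int (j * int n) = (1::real)" using N(1) by simp
 hence "j * int n = 1" by (metis of_int_eq_1_iff)
 thus False using \<delta>(2) by (metis abs_zmult_eq_1 mult.commute of_nat_1 of_nat_le_iff abs_of_nat numeral_le_one_iff of_nat_numeral semiring_norm(69))
qed

end

text \<open>A shift permutes parameters modulo 1, and sorting the resulting pairs is injective,
  which gives one inequality; the opposite shift gives the other. It allows the period to be centred
  at the apex of a semicircle.\<close>

lemma self_intersection_shift:
 fixes \<gamma> :: "real \<Rightarrow> 'a::metric_space" and a :: real
 assumes per: "\<And>t. \<gamma> (t + 1) = \<gamma> t"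
 shows "self_intersection_number (\<lambda>t. \<gamma> (t + a)) = self_intersection_number \<gamma>"
proof -
 have int: "\<gamma> (t + of_int n) = \<gamma> t" if per: "\<And>t. \<gamma> (t + 1) = \<gamma> t" for \<gamma> :: "real \<Rightarrow> 'a" and t n
 proof -
  have nat: "\<gamma> (t + of_nat k) = \<gamma> t" for k t
  proof (induction k)
   case (Suc k)
   have "t + of_nat (Suc k) = (t + of_nat k) + 1" by simp
   thus ?case using per [of "t + of_nat k"] Suc by metis
  qed simp
  show ?thesis
  proof (cases "0 \<le> n")
   case True thus ?thesis using nat [of t "nat n"] by simp
  next
   case False thus ?thesis using nat [of "t + of_int n" "nat (- n)"] by simp
  qed
 qed
 define F where "F = (\<lambda>(a :: real) (s :: real, t :: real). (min (frac (s + a)) (frac (t + a)), max (frac (s + a)) (frac (t + a))))"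
 have finj: "s = t" if "frac (s + a) = frac (t + a)" "0 \<le> s" "s < 1" "0 \<le> t" "t < 1" for s t a :: real
 proof -
  have "s - t = of_int (\<lfloor>s + a\<rfloor> - \<lfloor>t + a\<rfloor>)" using that(1) by (simp add: frac_def)
  moreover have "\<bar>s - t\<bar> < 1" using that by auto
  ultimately have "\<bar>of_int (\<lfloor>s + a\<rfloor> - \<lfloor>t + a\<rfloor>) :: real\<bar> < 1" by metis
  hence "\<lfloor>s + a\<rfloor> - \<lfloor>t + a\<rfloor> = 0" by linarith
  thus ?thesis using \<open>s - t = _\<close> by simp
 qed
 have inj: "inj_on (F a) (self_intersections (\<lambda>t. \<gamma> (t + a)))" for \<gamma> :: "real \<Rightarrow> 'a" and a :: real
 proof (rule inj_onI, clarify)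
  fix s t u w assume st: "(s, t) \<in> self_intersections (\<lambda>t. \<gamma> (t + a))" "(u, w) \<in> self_intersections (\<lambda>t. \<gamma> (t + a))"
   and "F a (s, t) = F a (u, w)"
  hence "frac (s + a) = frac (u + a) \<and> frac (t + a) = frac (w + a) \<or>
    frac (s + a) = frac (w + a) \<and> frac (t + a) = frac (u + a)"
   by (auto simp: F_def min_def max_def split: if_splits)
  thus "s = u \<and> t = w"
   using st finj unfolding self_intersections_def by (smt (verit, best) case_prodD mem_Collect_eq)
 qed
 have sub: "F a ` self_intersections (\<lambda>t. \<gamma> (t + a)) \<subseteq> self_intersections \<gamma>"
  if per: "\<And>t. \<gamma> (t + 1) = \<gamma> t" for \<gamma> :: "real \<Rightarrow> 'a" and a :: real
 proof (rule image_subsetI)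
  fix x assume "x \<in> self_intersections (\<lambda>t. \<gamma> (t + a))"
  then obtain s t where x: "x = (s, t)" "0 \<le> s" "s < t" "t < 1" "\<gamma> (s + a) = \<gamma> (t + a)"
   by (auto simp: self_intersections_def)
  have fr: "\<gamma> (frac y) = \<gamma> y" for y
  proof -
   have "\<gamma> (frac y + of_int \<lfloor>y\<rfloor>) = \<gamma> (frac y)" by (rule int) (rule per)
   thus ?thesis by (simp add: frac_def)
  qed
  have "frac (s + a) \<noteq> frac (t + a)" using finj [of s a t] x by auto
  thus "F a x \<in> self_intersections \<gamma>"
   using x fr frac_lt_1 frac_ge_0 by (auto simp: F_def self_intersections_def min_def max_def)
 qed
 have le: "(finite (self_intersections \<gamma>) \<longrightarrow> finite (self_intersections (\<lambda>t. \<gamma> (t + a))) \<and>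
   card (self_intersections (\<lambda>t. \<gamma> (t + a))) \<le> card (self_intersections \<gamma>))"
  if per: "\<And>t. \<gamma> (t + 1) = \<gamma> t" for \<gamma> :: "real \<Rightarrow> 'a" and a :: real
 proof -
  have "F a ` self_intersections (\<lambda>t. \<gamma> (t + a)) \<subseteq> self_intersections \<gamma>" by (rule sub) (rule per)
  thus ?thesis using inj [of a \<gamma>] by (meson card_inj_on_le inj_on_finite)
 qed
 have "(finite (self_intersections (\<lambda>t. \<gamma> (t + a))) \<longrightarrow> finite (self_intersections (\<lambda>t. \<gamma> (t + - a + a))) \<and>
   card (self_intersections (\<lambda>t. \<gamma> (t + - a + a))) \<le> card (self_intersections (\<lambda>t. \<gamma> (t + a))))"
  by (rule le [where \<gamma> = "\<lambda>t. \<gamma> (t + a)" and a = "- a"]) (use per in \<open>metis add.assoc add.commute\<close>)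
 moreover have "(finite (self_intersections \<gamma>) \<longrightarrow> finite (self_intersections (\<lambda>t. \<gamma> (t + a))) \<and>
   card (self_intersections (\<lambda>t. \<gamma> (t + a))) \<le> card (self_intersections \<gamma>))"
  by (rule le) (rule per)
 ultimately show ?thesis unfolding self_intersection_number_def by auto
qed

section \<open>Geodesics in a cusp frame\<close>

text \<open>The semicircle of radius \<open>R\<close> about \<open>x0\<close>, run through at
  hyperbolic speed \<open>v\<close> in the direction \<open>sg\<close>. The apex is at parameter
  1/2, so that the period from 0 to 1 is symmetric about it.\<close>

definition arc_pt :: "real \<Rightarrow> real \<Rightarrow> real \<Rightarrow> real \<Rightarrow> real \<Rightarrow> complex" where
 "arc_pt x0 R sg v t = Complex (x0 + sg * R * tanh (v * (t - 1/2))) (R / cosh (v * (t - 1/2)))"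

lemma tanh_exp2: "tanh (x::real) = (exp (2 * x) - 1) / (exp (2 * x) + 1)"
proof -
 have "tanh x = (1 - exp (- 2 * x)) / (1 + exp (- 2 * x))" by (rule tanh_real_altdef)
 also have "\<dots> = (exp (2 * x) * (1 - exp (- 2 * x))) / (exp (2 * x) * (1 + exp (- 2 * x)))" by simp
 also have "exp (2 * x) * (1 - exp (- 2 * x)) = exp (2 * x) - 1"
  by (simp add: right_diff_distrib flip: exp_add)
 also have "exp (2 * x) * (1 + exp (- 2 * x)) = exp (2 * x) + 1"
  by (simp add: distrib_left flip: exp_add)
 finally show ?thesis .
qed

lemma inverse_cosh_exp: "1 / cosh (x::real) = 2 * exp x / (exp (2 * x) + 1)"
proof -
 have "cosh x = (exp x + exp (- x)) / 2" by (simp add: cosh_field_def)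
 also have "\<dots> = (exp (2 * x) + 1) / (2 * exp x)"
  unfolding exp_double by (simp add: exp_minus field_simps power2_eq_square)
 finally show ?thesis by simp
qed

text \<open>The image of the imaginary axis ends at \<open>mB N / mD N\<close> and
  \<open>mA N / mC N\<close>; \<open>\<tau>\<close> is the parameter at which it reaches its
  apex.\<close>

lemma semicircle:
 assumes r: "mC N \<noteq> 0" and s: "mD N \<noteq> 0"
 defines "\<tau> \<equiv> ln \<bar>mD N / mC N\<bar>" and "rs \<equiv> mC N * mD N"
 shows "mob N (\<i> * of_real (exp x)) =
  Complex ((mB N / mD N + mA N / mC N) / 2 + tanh (x - \<tau>) / (2 * rs)) (1 / (2 * \<bar>rs\<bar>) / cosh (x - \<tau>))"
proof -
 define y where "y = exp x"
 define E where "E = exp (x - \<tau>)"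
 have y: "0 < y" by (simp add: y_def)
 have E: "E = y * \<bar>mC N\<bar> / \<bar>mD N\<bar>" using r s by (simp add: E_def y_def exp_diff \<tau>_def abs_divide)
 have E2: "exp (2 * (x - \<tau>)) = (mC N * y / mD N)\<^sup>2"
 proof -
  have "exp (2 * (x - \<tau>)) = E\<^sup>2" by (simp only: E_def exp_double)
  thus ?thesis by (simp add: E power_divide power_mult_distrib mult.commute)
 qed
 define Q where "Q = (mD N)\<^sup>2 + (mC N * y)\<^sup>2"
 have Q: "0 < Q" using s by (simp add: Q_def add_pos_nonneg)
 have rs0: "rs \<noteq> 0" using r s by (simp add: rs_def)
 have E21: "exp (2 * (x - \<tau>)) + 1 = Q / (mD N)\<^sup>2" "exp (2 * (x - \<tau>)) - 1 = ((mC N * y)\<^sup>2 - (mD N)\<^sup>2) / (mD N)\<^sup>2"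
  unfolding E2 Q_def using s by (simp_all add: power_divide field_simps)
 have th: "tanh (x - \<tau>) = ((mC N * y)\<^sup>2 - (mD N)\<^sup>2) / Q"
  unfolding tanh_exp2 E21 using s Q by simp
 have ch: "1 / cosh (x - \<tau>) = 2 * (y * \<bar>rs\<bar>) / Q"
 proof -
  have "1 / cosh (x - \<tau>) = 2 * E / (Q / (mD N)\<^sup>2)" unfolding inverse_cosh_exp E21 E_def ..
  also have "\<dots> = 2 * (y * \<bar>mC N\<bar> * ((mD N)\<^sup>2 / \<bar>mD N\<bar>)) / Q" by (simp add: E)
  also have "(mD N)\<^sup>2 / \<bar>mD N\<bar> = \<bar>mD N\<bar>" using s by (simp add: power2_eq_square abs_if)
  finally show ?thesis by (simp add: rs_def abs_mult mult_ac)
 qed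
 have den2: "(cmod (den N (\<i> * of_real y)))\<^sup>2 = Q"
  unfolding cmod_power2 Im_den Re_den Q_def by simp
 have "Im (mob N (\<i> * of_real y)) = y / Q" unfolding Im_mob den2 by simp
 also have "\<dots> = 1 / (2 * \<bar>rs\<bar>) * (1 / cosh (x - \<tau>))" unfolding ch using rs0 by simp
 finally have im: "Im (mob N (\<i> * of_real y)) = 1 / (2 * \<bar>rs\<bar>) / cosh (x - \<tau>)" by simp
 have "Re (mob N (\<i> * of_real y)) = Re ((of_real (mA N) * (\<i> * of_real y) + of_real (mB N)) * cnj (den N (\<i> * of_real y))) / Q"
  unfolding den2 [symmetric] by (simp add: mob_den complex_div_cnj [of _ "den N (\<i> * of_real y)"] flip: of_real_power)
 also have "Re ((of_real (mA N) * (\<i> * of_real y) + of_real (mB N)) * cnj (den N (\<i> * of_real y)))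
   = mA N * mC N * y\<^sup>2 + mB N * mD N"
  by (simp add: den_def power2_eq_square algebra_simps)
 also have "(mA N * mC N * y\<^sup>2 + mB N * mD N) / Q
   = (mB N / mD N + mA N / mC N) / 2 + tanh (x - \<tau>) / (2 * rs)"
 proof -
  have e: "mA N / mC N - mB N / mD N = 1 / rs"
   using r s sl2_det [of N] by (simp add: rs_def field_simps)
  have "tanh (x - \<tau>) / (2 * rs) = ((mC N * y)\<^sup>2 - (mD N)\<^sup>2) / Q / 2 * (1 / rs)" unfolding th by simp
  also have "\<dots> = ((mC N * y)\<^sup>2 - (mD N)\<^sup>2) / Q / 2 * (mA N / mC N - mB N / mD N)" unfolding e ..
  finally have t: "tanh (x - \<tau>) / (2 * rs) = ((mC N * y)\<^sup>2 - (mD N)\<^sup>2) * (mA N / mC N - mB N / mD N) / (2 * Q)"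
   by simp
  have u: "U / 2 = U * Q / (2 * Q)" for U using Q by simp
  have hc: "2 * W / (2 * Q) = W / Q" for W by simp
  have "(mB N / mD N + mA N / mC N) / 2 + tanh (x - \<tau>) / (2 * rs)
    = ((mB N / mD N + mA N / mC N) * Q + ((mC N * y)\<^sup>2 - (mD N)\<^sup>2) * (mA N / mC N - mB N / mD N)) / (2 * Q)"
   unfolding t u by (rule add_divide_distrib [symmetric])
  also have "(mB N / mD N + mA N / mC N) * Q + ((mC N * y)\<^sup>2 - (mD N)\<^sup>2) * (mA N / mC N - mB N / mD N)
    = 2 * (mA N / mC N * (mC N * y)\<^sup>2 + mB N / mD N * (mD N)\<^sup>2)"
   unfolding Q_def by (simp add: algebra_simps)
  also have "\<dots> = 2 * (mA N * mC N * y\<^sup>2 + mB N * mD N)" using r s by (simp add: power2_eq_square)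
  finally show ?thesis unfolding hc by (rule sym)
 qed
 finally show ?thesis using im by (simp add: y_def complex_eq_iff)
qed

lemma conj_Dg_sel:
 shows "mC (trl N v) = 2 * (mC N * mD N) * sinh (v / 2)"
  "mA (trl N v) - mD (trl N v) = 2 * (mA N * mD N + mB N * mC N) * sinh (v / 2)"
  "trc (trl N v) = 2 * cosh (v / 2)"
proof -
 have s: "2 * sinh (v / 2) = exp (v / 2) - exp (- (v / 2))" by (simp add: sinh_field_def)
 have "mC (trl N v) = (mC N * mD N) * (exp (v / 2) - exp (- (v / 2)))"
  by (simp add: sl2_sel algebra_simps)
 thus "mC (trl N v) = 2 * (mC N * mD N) * sinh (v / 2)" unfolding s [symmetric] by simp
 have "mA (trl N v) - mD (trl N v) = (mA N * mD N + mB N * mC N) * (exp (v / 2) - exp (- (v / 2)))"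
  by (simp add: sl2_sel algebra_simps)
 thus "mA (trl N v) - mD (trl N v) = 2 * (mA N * mD N + mB N * mC N) * sinh (v / 2)"
  unfolding s [symmetric] by simp
 show "trc (trl N v) = 2 * cosh (v / 2)"
  unfolding trc_conj' by (simp add: trc_def sl2_sel cosh_field_def)
qed

context hyp_cover
begin

lemma frame_hyperbolic_C:
 assumes cf: "cusp_frame pr" and v: "0 < v" and d: "deck pr (trl N v)"
 shows "mC (trl N v) \<noteq> 0"
proof
 assume "mC (trl N v) = 0"
 then obtain n :: int where "trl N v = Tr (of_int n) \<or> N * Dg v * minv N = - Tr (of_int n)"
  using cusp_stabiliser [OF cf d] by metis
 moreover have "trc (Tr x) = 2" "trc (- Tr x) = - 2" for x by (simp_all add: trc_def sl2_sel)
 ultimately have "\<bar>trc (trl N v)\<bar> = 2" by (metis abs_minus_cancel abs_numeral)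
 hence "\<bar>2 * cosh (v / 2)\<bar> = 2" unfolding conj_Dg_sel .
 moreover have "1 < cosh (v / 2)" using cosh_real_nonneg_less_iff [of 0 "v / 2"] v by simp
 ultimately show False by simp
qed

lemma frame_arc:
 assumes cf: "cusp_frame pr" and v: "0 < v" and d: "deck pr (trl N v)"
 defines "g \<equiv> N * Dg v * minv N"
 obtains N' a x0 sg where "\<And>t. gl N v (t + a) = gl N' v t" "trl N' v = g"
  "sg = 1 \<or> sg = - 1" "\<And>t. gl N' v t = arc_pt x0 (sinh (v / 2) / \<bar>mC g\<bar>) sg v t"
  "sg * \<bar>mC g\<bar> = mC g" "2 * mC g * x0 = mA g - mD g"
proof -
 have C: "mC g \<noteq> 0" using frame_hyperbolic_C [OF cf v d] by (simp add: g_def)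
 have gC: "mC g = 2 * (mC N * mD N) * sinh (v / 2)" unfolding g_def by (rule conj_Dg_sel)
 hence rs: "mC N \<noteq> 0" "mD N \<noteq> 0" using C by auto
 define \<tau> where "\<tau> = ln \<bar>mD N / mC N\<bar>"
 \<comment> \<open>The shift that brings the apex to parameter 1/2.\<close>
 define a where "a = \<tau> / v - 1/2"
 define N' where "N' = N * Dg (v * a)"
 define sg where "sg = sgn (mC N * mD N)"
 define x0 where "x0 = (mB N / mD N + mA N / mC N) / 2"
 have sv: "0 < sinh (v / 2)" using v by simp
 have sg: "sg = 1 \<or> sg = - 1" using rs by (simp add: sg_def sgn_if)
 have gl': "gl N v (t + a) = gl N' v t" for t unfolding N'_def gl_mult by (simp add: gl_def algebra_simps)
 show ?thesis
 proof (rule that [OF gl' _ sg])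
  show "trl N' v = g"
  proof -
   have "trl N' v = N * (Dg (v * a) * Dg v * Dg (- (v * a))) * minv N"
    by (simp add: N'_def minv_mult mult.assoc)
   also have "Dg (v * a) * Dg v * Dg (- (v * a)) = Dg v" by (simp add: Dg_add)
   finally show ?thesis by (simp add: g_def)
  qed
  show "gl N' v t = arc_pt x0 (sinh (v / 2) / \<bar>mC g\<bar>) sg v t" for t
  proof -
   have R: "sinh (v / 2) / \<bar>mC g\<bar> = 1 / (2 * \<bar>mC N * mD N\<bar>)"
    unfolding gC using sv by (simp add: abs_mult)
   have sgR: "sg * (1 / (2 * \<bar>mC N * mD N\<bar>)) = 1 / (2 * (mC N * mD N))"
    using rs by (simp add: sg_def sgn_if abs_if)
   have e: "v * t + v * a - \<tau> = v * (t - 1/2)" using v by (simp add: a_def algebra_simps)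
   have "gl N' v t = mob N (\<i> * of_real (exp (v * t + v * a)))" unfolding N'_def by (rule gl_mult)
   also have "\<dots> = Complex (x0 + tanh (v * t + v * a - \<tau>) / (2 * (mC N * mD N)))
     (1 / (2 * \<bar>mC N * mD N\<bar>) / cosh (v * t + v * a - \<tau>))"
    unfolding x0_def \<tau>_def by (rule semicircle [OF rs])
   finally show ?thesis unfolding e R arc_pt_def sgR by simp
  qed
  have "sg * \<bar>mC N * mD N\<bar> = mC N * mD N" by (simp add: sg_def sgn_mult_abs)
  moreover have "\<bar>mC g\<bar> = 2 * \<bar>mC N * mD N\<bar> * sinh (v / 2)" unfolding gC using sv by (simp add: abs_mult)
  ultimately show "sg * \<bar>mC g\<bar> = mC g" unfolding gC by (metis mult.assoc mult.left_commute)
  have "2 * (mC N * mD N) * x0 = mA N * mD N + mB N * mC N" using rs by (simp add: x0_def field_simps)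
  moreover have "mA g - mD g = 2 * (mA N * mD N + mB N * mC N) * sinh (v / 2)" unfolding g_def by (rule conj_Dg_sel)
  moreover have "2 * (2 * (mC N * mD N) * sinh (v / 2)) * x0 = 2 * (2 * (mC N * mD N) * x0) * sinh (v / 2)" by simp
  ultimately show "2 * mC g * x0 = mA g - mD g" unfolding gC by simp
 qed
qed

text \<open>The point z lies on a semicircle orthogonal to the isometric circle of k, at horizontal
 distance E from its centre; the two relations on E say that it is above that circle and closer to it
 than to the one of the inverse. If c is the smallest entry of the spectrum, z is then in the Ford domain.\<close>

lemma ford_domain:
 assumes cf: "cusp_frame pr" and k: "deck pr k" and c: "0 < c" "\<bar>mC k\<bar> = c" "\<And>x. x \<in> cspec pr \<Longrightarrow> c \<le> x"
  and T: "9 \<le> T" and E: "2 / (c * T) \<le> E" "E \<le> T / (2 * c)" "\<bar>Re z + mD k / mC k\<bar> = E"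
  and Ey: "E\<^sup>2 + (Im z)\<^sup>2 = T / c * E - 1 / c\<^sup>2" and z: "z \<in> UH"
  and h: "deck pr h" "mC h \<noteq> 0"
 shows "1 \<le> cmod (den h z)" "2 / (c * T) < E \<Longrightarrow> 1 < cmod (den h z)"
proof -
 define ch q y where "ch = \<bar>mC h\<bar>" and "q = - mD h / mC h" and "y = Im z"
 have y: "0 < y" using z by (simp add: y_def)
 have ch: "0 < ch" "c \<le> ch" using h c(3) by (auto simp: ch_def cspec_def)
 have "mC h * (Re z - q) = mC h * Re z + mD h" using h(2) by (simp add: q_def field_simps)
 hence Re: "\<bar>mC h * Re z + mD h\<bar> = ch * \<bar>Re z - q\<bar>"
  unfolding ch_def abs_mult [symmetric] by simp
 have "(cmod (den h z))\<^sup>2 = (mC h * Re z + mD h)\<^sup>2 + (mC h * y)\<^sup>2"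
  by (simp add: cmod_power2 Re_den Im_den y_def)
 also have "\<dots> = \<bar>mC h * Re z + mD h\<bar>\<^sup>2 + (ch * y)\<^sup>2" by (simp add: ch_def power_mult_distrib)
 also have "\<dots> = ch\<^sup>2 * ((Re z - q)\<^sup>2 + y\<^sup>2)" unfolding Re by (simp add: power_mult_distrib algebra_simps)
 finally have den: "(cmod (den h z))\<^sup>2 = ch\<^sup>2 * ((Re z - q)\<^sup>2 + y\<^sup>2)" .
 have strictI: "1 < cmod (den h z)" if "1 / ch\<^sup>2 < (Re z - q)\<^sup>2 + y\<^sup>2"
 proof -
  have "1 < ch\<^sup>2 * ((Re z - q)\<^sup>2 + y\<^sup>2)" using that ch by (simp add: pos_divide_less_eq mult.commute)
  hence "1\<^sup>2 < (cmod (den h z))\<^sup>2" by (simp add: den)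
  thus ?thesis by (rule power2_less_imp_less) simp
 qed
 have E0: "0 < E" using E(1) c T by (smt (verit) divide_pos_pos mult_pos_pos)
 have "1 \<le> cmod (den h z) \<and> (2 / (c * T) < E \<longrightarrow> 1 < cmod (den h z))"
 proof (cases "1 / ch < y")
  \<comment> \<open>A point higher than the radius of the isometric circle of \<open>h\<close> is
    outside that circle wherever the centre lies.\<close>
  case True
  hence "(1 / ch)\<^sup>2 < y\<^sup>2" using ch by (intro power_strict_mono) auto
  hence "1 / ch\<^sup>2 < y\<^sup>2" by (simp add: power_divide)
  hence "1 / ch\<^sup>2 < (Re z - q)\<^sup>2 + y\<^sup>2" using zero_le_power2 [of "Re z - q"] by linarith
  thus ?thesis using strictI by force
 next
  case False
  have chc: "1 / ch \<le> 1 / c" using ch c by (simp add: frac_le)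
  hence yc: "y \<le> 1 / c" using False by simp
  hence "y\<^sup>2 \<le> (1 / c)\<^sup>2" using y by (intro power_mono) auto
  hence y2: "y\<^sup>2 \<le> 1 / c\<^sup>2" by (simp add: power_divide)
  \<comment> \<open>A low point is close to the centre belonging to \<open>k\<close>:
    \<open>E * c\<close> is at most 4 / T, and \<open>9 \<le> T\<close> makes this smaller than
    1/2.\<close>
  have "E * (T / (2 * c)) \<le> E * (T / c - E)"
  proof (rule mult_left_mono)
   have "T / (2 * c) = T / c / 2" by simp
   thus "T / (2 * c) \<le> T / c - E" using E(2) by simp
  qed (use E0 in simp)
  also have "\<dots> \<le> 2 / c\<^sup>2" using Ey y2 by (simp add: y_def power2_eq_square algebra_simps)
  finally have "E * T * c \<le> 4" using c by (simp add: field_simps power2_eq_square)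
  hence EcT: "E * c * T \<le> 4" by (simp add: mult_ac)
  have "E * c * 9 \<le> E * c * T" using E0 c T by (intro mult_left_mono) auto
  hence Ec: "E * c \<le> 4 / 9" using EcT by simp
  have TE: "2 \<le> T * E * c" using E(1) c T by (simp add: pos_divide_le_eq mult_ac)
  have yE: "1 / c\<^sup>2 \<le> E\<^sup>2 + y\<^sup>2"
  proof -
   have "2 / c\<^sup>2 \<le> T * E * c / c\<^sup>2" using TE c by (intro divide_right_mono) auto
   also have "\<dots> = T / c * E" using c by (simp add: power2_eq_square)
   finally show ?thesis using Ey by (simp add: y_def)
  qed
  show ?thesis
  proof (cases "q = - mD k / mC k")
   case True
   have "\<bar>Re z - q\<bar> = E" using E(3) unfolding True by simp
   hence eq: "(Re z - q)\<^sup>2 + y\<^sup>2 = T / c * E - 1 / c\<^sup>2" using Ey unfolding y_def by (metis power2_abs)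
   have cc: "1 / ch\<^sup>2 \<le> 1 / c\<^sup>2" using ch c by (intro divide_left_mono power_mono) auto
   have "1 \<le> cmod (den h z)"
   proof -
    have "1 / c\<^sup>2 \<le> (Re z - q)\<^sup>2 + y\<^sup>2" using yE unfolding eq Ey [folded y_def] .
    hence "1 / ch\<^sup>2 \<le> (Re z - q)\<^sup>2 + y\<^sup>2" using cc by simp
    hence "1 \<le> ch\<^sup>2 * ((Re z - q)\<^sup>2 + y\<^sup>2)" using ch by (simp add: pos_divide_le_eq mult.commute)
    hence "1\<^sup>2 \<le> (cmod (den h z))\<^sup>2" by (simp add: den)
    thus ?thesis by (rule power2_le_imp_le) simp
   qed
   moreover have "1 < cmod (den h z)" if "2 / (c * T) < E"
   proof (rule strictI)
    have "2 < T * E * c" using that c T by (simp add: pos_divide_less_eq mult_ac)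
    hence "2 / c\<^sup>2 < T * E * c / c\<^sup>2" using c by (intro divide_strict_right_mono) auto
    also have "\<dots> = T / c * E" using c by (simp add: power2_eq_square)
    finally show "1 / ch\<^sup>2 < (Re z - q)\<^sup>2 + y\<^sup>2" unfolding eq using cc by simp
   qed
   ultimately show ?thesis by blast
  next
   case False
   \<comment> \<open>The distance of the two centres. It is the lower left entry of
     \<open>k * minv h\<close>, in absolute value, divided by \<open>c * ch\<close>; minimality of
     \<open>c\<close> keeps distinct centres at least 1 / ch apart.\<close>
   define Q where "Q = \<bar>q + mD k / mC k\<bar>"
   have kC: "mC k \<noteq> 0" using c by auto
   have mm: "mC (k * minv h) = mC k * mD h - mD k * mC h" by (simp add: sl2_sel)
   have "q + mD k / mC k = - (mC k * mD h - mD k * mC h) / (mC k * mC h)"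
    using kC h(2) by (simp add: q_def field_simps)
   hence Qe: "Q = \<bar>mC (k * minv h)\<bar> / (c * ch)"
    unfolding Q_def mm abs_divide abs_minus_cancel abs_mult c(2) ch_def by (simp only: abs_divide abs_minus_cancel abs_mult c(2))
   have "mC (k * minv h) \<noteq> 0"
   proof
    assume "mC (k * minv h) = 0"
    hence "Q = 0" using Qe by simp
    thus False using False unfolding Q_def by simp
   qed
   hence "c \<le> \<bar>mC (k * minv h)\<bar>"
    using c(3) deck_mult [OF k deck_minv [OF h(1)]] by (auto simp: cspec_def)
   hence "c / (c * ch) \<le> Q" unfolding Qe using c ch by (intro divide_right_mono) auto
   hence Q: "1 / ch \<le> Q" using c by simp
   have "Q \<le> \<bar>Re z - q\<bar> + E" unfolding Q_def E(3) [symmetric] by linarith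
   hence RQ: "1 / ch - E \<le> \<bar>Re z - q\<bar>" using Q by simp
   have "1 < cmod (den h z)"
   proof (rule strictI, cases "1 / ch \<le> E")
    case True
    have "(E * c)\<^sup>2 \<le> (4/9)\<^sup>2" using Ec E0 c by (intro power_mono) auto
    hence "2 * (E * c)\<^sup>2 < 1" by (simp add: power2_eq_square)
    hence "2 * E\<^sup>2 < 1 / c\<^sup>2" using c by (simp add: pos_less_divide_eq power_mult_distrib mult_ac)
    hence "E\<^sup>2 < y\<^sup>2" using yE by simp
    moreover have "(1 / ch)\<^sup>2 \<le> E\<^sup>2" using True ch by (intro power_mono) auto
    ultimately show "1 / ch\<^sup>2 < (Re z - q)\<^sup>2 + y\<^sup>2"
     by (simp add: power_divide) (smt (verit) zero_le_power2)
   next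
    case False
    hence "(1 / ch - E)\<^sup>2 \<le> \<bar>Re z - q\<bar>\<^sup>2" using RQ by (intro power_mono) auto
    hence "(1 / ch - E)\<^sup>2 \<le> (Re z - q)\<^sup>2" by simp
    moreover have "(1 / ch - E)\<^sup>2 = 1 / ch\<^sup>2 - 2 * (E * (1 / ch)) + E\<^sup>2"
     by (simp add: power2_diff power_divide)
    moreover have "2 * (E * (1 / ch)) < E\<^sup>2 + y\<^sup>2"
    proof -
     have "2 * (E * (1 / ch)) \<le> 2 * (E * (1 / c))" using chc E0 by (intro mult_left_mono) auto
     also have "\<dots> = 2 * (E * c) / c\<^sup>2" using c by (simp add: power2_eq_square)
     also have "\<dots> < 1 / c\<^sup>2" using Ec c by (intro divide_strict_right_mono) auto
     finally show ?thesis using yE by simp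
    qed
    ultimately show "1 / ch\<^sup>2 < (Re z - q)\<^sup>2 + y\<^sup>2" by linarith
   qed
   thus ?thesis by simp
  qed
 qed
 thus "1 \<le> cmod (den h z)" "2 / (c * T) < E \<Longrightarrow> 1 < cmod (den h z)" by blast+
qed

text \<open>Removing as many translations as the integer part of trace / c allows leaves an element
  of trace f c; removing one more leaves f c - c. Both are at least 2 in absolute value. So trace /
  c keeps away from the integers, which settles the boundary cases of the intersection
  count.\<close>

lemma trace_gap:
 assumes cf: "cusp_frame pr" and g: "deck pr g" "mC g \<noteq> 0"
 defines "f \<equiv> trc g / \<bar>mC g\<bar> - of_int \<lfloor>trc g / \<bar>mC g\<bar>\<rfloor>"
 shows "2 \<le> f * \<bar>mC g\<bar>" "f * \<bar>mC g\<bar> \<le> \<bar>mC g\<bar> - 2"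
  "mC g = sg * \<bar>mC g\<bar> \<Longrightarrow> sg = 1 \<or> sg = -1 \<Longrightarrow>
   trc (g * Tr (- sg * of_int \<lfloor>trc g / \<bar>mC g\<bar>\<rfloor>)) = f * \<bar>mC g\<bar>"
proof -
 define c where "c = \<bar>mC g\<bar>"
 define j where "j = \<lfloor>trc g / c\<rfloor>"
 have c: "0 < c" using g by (simp add: c_def)
 have f: "f * c = trc g - of_int j * c" using c by (simp add: f_def c_def [symmetric] j_def left_diff_distrib)
 have f01: "0 \<le> f" "f < 1" unfolding f_def by linarith+
 have tr: "trc (g * Tr x) = trc g + x * mC g" for x by (simp add: trc_def sl2_sel)
 define sg' where "sg' = sgn (mC g)"
 have sg': "sg' = 1 \<or> sg' = - 1" "mC g = sg' * c" using g by (auto simp: sg'_def c_def sgn_if abs_if)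
 have t1: "trc (g * Tr (- sg * of_int j)) = f * c" if "mC g = sg * c" "sg = 1 \<or> sg = - 1" for sg
  unfolding tr that(1) f using that(2) by auto
 have dT: "deck pr (g * Tr (- sg' * of_int j))" for j
 proof (cases "sg' = 1")
  case True
  thus ?thesis using deck_mult [OF g(1) deck_Tr_int [OF cf, of "- j"]] by simp
 next
  case False
  thus ?thesis using sg' deck_mult [OF g(1) deck_Tr_int [OF cf, of j]] by simp
 qed
 have "2 \<le> \<bar>f * c\<bar>" using deck_trace [OF dT [of j]] t1 [OF sg'(2,1)] by simp
 thus "2 \<le> f * \<bar>mC g\<bar>" using f01 c by (simp add: c_def)
 have "trc (g * Tr (- sg' * of_int (j + 1))) = f * c - c"
  unfolding tr sg'(2) f using sg'(1) by (auto simp: algebra_simps)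
 hence "2 \<le> \<bar>f * c - c\<bar>" using deck_trace [OF dT [of "j + 1"]] by metis
 moreover have "f * c \<le> 1 * c" using f01 c by (intro mult_right_mono) auto
 ultimately show "f * \<bar>mC g\<bar> \<le> \<bar>mC g\<bar> - 2" by (simp add: c_def [symmetric])
 show "mC g = sg * \<bar>mC g\<bar> \<Longrightarrow> sg = 1 \<or> sg = -1 \<Longrightarrow>
   trc (g * Tr (- sg * of_int \<lfloor>trc g / \<bar>mC g\<bar>\<rfloor>)) = f * \<bar>mC g\<bar>"
  using t1 by (simp add: c_def j_def)
qed

end

lemma arc_pt_UH: "0 < R \<Longrightarrow> arc_pt x0 R sg v t \<in> UH"
 by (simp add: arc_pt_def)

lemma Re_arc_pt: "Re (arc_pt x0 R sg v t) = x0 + sg * R * tanh (v * (t - 1/2))"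
 and Im_arc_pt: "Im (arc_pt x0 R sg v t) = R / cosh (v * (t - 1/2))"
 by (simp_all add: arc_pt_def)

lemma arc_pt_same_height:
 assumes "0 < v" "0 < R" "s < t" "Im (arc_pt x0 R sg v s) = Im (arc_pt x0 R sg v t)"
 shows "t = 1 - s"
proof -
 have "cosh (v * (s - 1/2)) = cosh (v * (t - 1/2))"
  using assms(2,4) cosh_real_pos [of "v * (s - 1/2)"] cosh_real_pos [of "v * (t - 1/2)"]
  by (simp add: Im_arc_pt frac_eq_eq)
 hence "\<bar>v * (s - 1/2)\<bar> = \<bar>v * (t - 1/2)\<bar>" by simp
 hence "\<bar>s - 1/2\<bar> = \<bar>t - 1/2\<bar>" using assms(1) by (simp add: abs_mult del: right_diff_distrib)
 thus ?thesis using assms(3) by linarith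
qed

lemma arc_pt_opposite:
 "arc_pt x0 R sg v (1 - s) = arc_pt x0 R sg v s + of_real (sg * (2 * R * tanh (v * (1/2 - s))))"
proof -
 have e: "v * ((1 - s) - 1/2) = v * (1/2 - s)" "v * (s - 1/2) = - (v * (1/2 - s))" by (simp_all add: algebra_simps)
 show ?thesis unfolding arc_pt_def e by (simp add: complex_eq_iff)
qed

context hyp_cover
begin

text \<open>Points before the apex are compared with the isometric circle of \<open>g\<close>,
  points after it with that of the inverse. The two ends of the arc lie on these circles, whence the
  weak inequality there.\<close>

lemma arc_ford:
 assumes cf: "cusp_frame pr" and v: "0 < v" and g: "deck pr g" "trc g = 2 * cosh (v / 2)" "mC g \<noteq> 0"
  and min: "\<And>x. x \<in> cspec pr \<Longrightarrow> \<bar>mC g\<bar> \<le> x" and T: "9 \<le> 2 * cosh (v / 2)"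
  and sg: "sg = 1 \<or> sg = - 1" "sg * \<bar>mC g\<bar> = mC g" and x0: "2 * mC g * x0 = mA g - mD g"
  and s: "0 \<le> s" "s \<le> 1" and h: "deck pr h" "mC h \<noteq> 0"
 defines "z \<equiv> arc_pt x0 (sinh (v / 2) / \<bar>mC g\<bar>) sg v s"
 shows "1 \<le> cmod (den h z)" "0 < s \<Longrightarrow> s < 1 \<Longrightarrow> 1 < cmod (den h z)"
proof -
 define c T where "c = \<bar>mC g\<bar>" and "T = 2 * cosh (v / 2)"
 define R where "R = sinh (v / 2) / c"
 define w where "w = v * (s - 1/2)"
 \<comment> \<open>The horizontal distance to the nearer centre; both centres are at distance
   \<open>T / (2 * c)\<close> from the centre of the arc.\<close>
 define E where "E = T / (2 * c) - R * tanh \<bar>w\<bar>"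
 have c: "0 < c" using g by (simp add: c_def)
 have T9: "9 \<le> T" using T by (simp add: T_def)
 have R: "0 < R" using v c by (simp add: R_def)
 have sh: "(sinh (v / 2))\<^sup>2 = T\<^sup>2 / 4 - 1" unfolding sinh_square_eq by (simp add: T_def)
 have R2: "R\<^sup>2 = T\<^sup>2 / (4 * c\<^sup>2) - 1 / c\<^sup>2"
  unfolding R_def power_divide sh by (simp add: diff_divide_distrib)
 have Rt: "R * tanh (v / 2) = T / (2 * c) - 2 / (c * T)"
 proof -
  have "R * tanh (v / 2) = (sinh (v / 2))\<^sup>2 / (c * cosh (v / 2))"
   by (simp add: R_def tanh_def power2_eq_square)
  also have "cosh (v / 2) = T / 2" by (simp add: T_def)
  finally show ?thesis unfolding sh using c T9 by (simp add: field_simps power2_eq_square)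
 qed
 have wv: "\<bar>w\<bar> = v * \<bar>s - 1/2\<bar>" using v by (simp add: w_def abs_mult)
 have "\<bar>s - 1/2\<bar> \<le> 1/2" using s by linarith
 hence "\<bar>w\<bar> \<le> v * (1/2)" unfolding wv using v by (intro mult_left_mono) auto
 hence "R * tanh \<bar>w\<bar> \<le> R * tanh (v / 2)" using R by (intro mult_left_mono) (auto simp del: tanh_real_abs)
 hence E1: "2 / (c * T) \<le> E" unfolding Rt E_def by simp
 have E2: "E \<le> T / (2 * c)" unfolding E_def using R by (simp del: tanh_real_abs)
 have E3: "2 / (c * T) < E" if "0 < s" "s < 1"
 proof -
  have "\<bar>s - 1/2\<bar> < 1/2" using that by linarith
  hence "\<bar>w\<bar> < v * (1/2)" unfolding wv using v by (intro mult_strict_left_mono) auto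
  hence "R * tanh \<bar>w\<bar> < R * tanh (v / 2)" using R by (intro mult_strict_left_mono) (auto simp del: tanh_real_abs)
  thus ?thesis unfolding Rt E_def by simp
 qed
 have E0: "0 \<le> E" using E1 c T9 by (smt (verit) divide_nonneg_pos mult_pos_pos)
 have zR: "z = arc_pt x0 R sg v s" by (simp add: z_def R_def c_def)
 have zU: "z \<in> UH" unfolding zR by (rule arc_pt_UH [OF R])
 have th: "(tanh w)\<^sup>2 + 1 / (cosh w)\<^sup>2 = 1"
 proof -
  have "cosh w \<noteq> 0" using cosh_real_pos [of w] by linarith
  hence "(tanh w)\<^sup>2 + 1 / (cosh w)\<^sup>2 = ((sinh w)\<^sup>2 + 1) / (cosh w)\<^sup>2"
   by (simp add: tanh_def power_divide add_divide_distrib)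
  thus ?thesis using \<open>cosh w \<noteq> 0\<close> by (simp flip: cosh_square_eq)
 qed
 have Ey: "E\<^sup>2 + (Im z)\<^sup>2 = T / c * E - 1 / c\<^sup>2"
 proof -
  have y: "(Im z)\<^sup>2 = R\<^sup>2 * (1 / (cosh w)\<^sup>2)" by (simp add: zR Im_arc_pt w_def power_divide)
  have "E\<^sup>2 = (T / (2 * c))\<^sup>2 - T / c * (R * tanh \<bar>w\<bar>) + R\<^sup>2 * (tanh w)\<^sup>2"
   by (simp add: E_def power2_diff power_mult_distrib)
  hence "E\<^sup>2 + (Im z)\<^sup>2 = (T / (2 * c))\<^sup>2 - T / c * (R * tanh \<bar>w\<bar>) + R\<^sup>2 * ((tanh w)\<^sup>2 + 1 / (cosh w)\<^sup>2)"
   unfolding y by (simp add: distrib_left)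
  also have "\<dots> = (T / (2 * c))\<^sup>2 - T / c * (R * tanh \<bar>w\<bar>) + (T\<^sup>2 / (4 * c\<^sup>2) - 1 / c\<^sup>2)" unfolding th R2 by simp
  also have "\<dots> = T / c * (T / (2 * c) - R * tanh \<bar>w\<bar>) - 1 / c\<^sup>2"
   using c by (simp add: right_diff_distrib power_divide power_mult_distrib power2_eq_square field_simps del: tanh_real_abs)
  finally show ?thesis by (simp add: E_def)
 qed
 have sg2: "sg * sg = 1" "sg \<noteq> 0" "\<bar>sg\<bar> = 1" using sg(1) by auto
 have gC: "mC g = sg * c" using sg(2) by (simp add: c_def)
 have tr: "mA g + mD g = T" using g(2) by (simp add: trc_def T_def)
 have x0': "x0 = (mA g - mD g) / (2 * mC g)" unfolding x0 [symmetric] using g(3) by simp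
 have invsg: "X / (sg * c) = sg * (X / c)" for X using sg(1) by auto
 have "\<exists>k. deck pr k \<and> \<bar>mC k\<bar> = c \<and> \<bar>Re z + mD k / mC k\<bar> = E"
 proof (cases "s \<le> 1/2")
  case True
  have w0: "\<bar>w\<bar> = - w" using True v by (simp add: w_def mult_le_0_iff)
  have "x0 + mD g / mC g = (mA g + mD g) / (2 * mC g)" unfolding x0' using g(3) by (simp add: field_simps)
  also have "\<dots> = sg * (T / (2 * c))" unfolding tr gC using invsg [of "T / 2"] by simp
  finally have "Re z + mD g / mC g = sg * E"
   unfolding E_def w0 zR Re_arc_pt w_def [symmetric] by (simp add: algebra_simps)
  hence "\<bar>Re z + mD g / mC g\<bar> = E" using E0 sg2 by (simp add: abs_mult)
  thus ?thesis using g(1) c_def by blast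
 next
  case False
  have w0: "\<bar>w\<bar> = w" using False v by (simp add: w_def)
  have "x0 - mA g / mC g = - ((mA g + mD g) / (2 * mC g))" unfolding x0' using g(3) by (simp add: field_simps)
  also have "\<dots> = - (sg * (T / (2 * c)))" unfolding tr gC using invsg [of "T / 2"] by simp
  finally have "Re z + mD (minv g) / mC (minv g) = - (sg * E)"
   unfolding E_def w0 zR Re_arc_pt w_def [symmetric] by (simp add: minv_sel algebra_simps)
  hence "\<bar>Re z + mD (minv g) / mC (minv g)\<bar> = E" using E0 sg2 by (simp add: abs_mult)
  moreover have "\<bar>mC (minv g)\<bar> = c" by (simp add: minv_sel c_def)
  ultimately show ?thesis using deck_minv [OF g(1)] by blast
 qed
 then obtain k where k: "deck pr k" "\<bar>mC k\<bar> = c" "\<bar>Re z + mD k / mC k\<bar> = E" by blast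
 have min': "c \<le> x" if "x \<in> cspec pr" for x using min [OF that] by (simp add: c_def)
 note F = ford_domain [OF cf k(1) c k(2) min' T9 E1 E2 k(3) Ey zU h]
 show "1 \<le> cmod (den h z)" by (rule F(1))
 show "1 < cmod (den h z)" if "0 < s" "s < 1" using F(2) E3 [OF that] by blast
qed

text \<open>Points of the Ford domain have maximal height in their orbit, so two points of the arc
  with the same projection are equally high, that is, mirror images in the apex. The intersections
  then correspond to the positive integers below the width of the arc.\<close>

theorem minimal_self_intersections:
 assumes cf: "cusp_frame pr" and v: "0 < v" and d: "deck pr (trl N v)"
 defines "c \<equiv> \<bar>mC (trl N v)\<bar>"
 assumes min: "\<And>x. x \<in> cspec pr \<Longrightarrow> c \<le> x" and T: "9 \<le> 2 * cosh (v / 2)"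
 shows "self_intersection_number (\<lambda>t. pr (gl N v t)) = enat (nat \<lfloor>2 * cosh (v / 2) / c\<rfloor>)"
proof -
 define g where "g = trl N v"
 have C: "mC g \<noteq> 0" using frame_hyperbolic_C [OF cf v d] by (simp add: g_def)
 have gd: "deck pr g" using d by (simp add: g_def)
 have tr: "trc g = 2 * cosh (v / 2)" unfolding g_def by (rule conj_Dg_sel)
 obtain N' a x0 sg where N': "\<And>t. gl N v (t + a) = gl N' v t" "trl N' v = g"
  and sg: "sg = 1 \<or> sg = - 1" and arc: "\<And>t. gl N' v t = arc_pt x0 (sinh (v / 2) / \<bar>mC g\<bar>) sg v t"
  and sgC: "sg * \<bar>mC g\<bar> = mC g" and x0: "2 * mC g * x0 = mA g - mD g"
  using frame_arc [OF cf v d] unfolding g_def by metis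
 define R where "R = sinh (v / 2) / \<bar>mC g\<bar>"
 have c: "0 < c" "c = \<bar>mC g\<bar>" using C by (simp_all add: c_def g_def)
 have R: "0 < R" using v c by (simp add: R_def)
 define P where "P = arc_pt x0 R sg v"
 have PU: "P t \<in> UH" for t unfolding P_def by (rule arc_pt_UH [OF R])
 have min': "\<bar>mC g\<bar> \<le> x" if "x \<in> cspec pr" for x using min [OF that] c by simp
 have ford: "1 \<le> cmod (den h (P s))" "0 < s \<Longrightarrow> s < 1 \<Longrightarrow> 1 < cmod (den h (P s))"
  if "0 \<le> s" "s \<le> 1" "deck pr h" "mC h \<noteq> 0" for s h
  unfolding P_def R_def using arc_ford [OF cf v gd tr C min' T sg sgC x0 that] by blast+
 \<comment> \<open>The horizontal distance between the points at parameters s and 1 - s.\<close>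
 define f where "f = (\<lambda>s. 2 * R * tanh (v * (1/2 - s)))"
 have finj: "s = s'" if "f s = f s'" for s s' using that R v by (simp add: f_def)
 define J where "J = nat \<lfloor>2 * cosh (v / 2) / c\<rfloor>"
 define SI where "SI = self_intersections (\<lambda>t. pr (P t))"
 define T' where "T' = 2 * cosh (v / 2)"
 have T'9: "9 \<le> T'" using T by (simp add: T'_def)
 have f0: "f 0 = T' / c - 4 / (c * T')"
 proof -
  have "f 0 = 2 * ((sinh (v / 2))\<^sup>2 / (c * cosh (v / 2)))" unfolding f_def R_def c(2) [symmetric]
   by (simp add: tanh_def power2_eq_square)
  also have "(sinh (v / 2))\<^sup>2 = T'\<^sup>2 / 4 - 1" unfolding sinh_square_eq by (simp add: T'_def)
  also have "cosh (v / 2) = T' / 2" by (simp add: T'_def)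
  finally show ?thesis using c T'9 by (simp add: field_simps power2_eq_square)
 qed
 define fr where "fr = T' / c - of_int \<lfloor>T' / c\<rfloor>"
 have fr: "2 \<le> fr * c" "fr < 1"
  using trace_gap(1) [OF cf gd C] unfolding fr_def tr c(2) T'_def by (simp_all, linarith)
 \<comment> \<open>The width \<open>f 0\<close> falls short of T' / c by 4 / (c T'). By
   \<open>trace_gap\<close> the fractional part of T' / c is at least 2 / c, so the shortfall loses
   no integer.\<close>
 have "4 / (c * T') < fr"
 proof -
  have "4 / (c * T') = (4 / T') / c" by simp
  also have "\<dots> < 2 / c"
  proof -
   have "4 / T' < 2" using T'9 by (simp add: divide_less_eq)
   thus ?thesis using c(1) by (rule divide_strict_right_mono)
  qed
  also have "\<dots> \<le> fr" using fr c by (simp add: pos_divide_le_eq)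
  finally show ?thesis .
 qed
 moreover have "0 < 4 / (c * T')" using c T'9 by simp
 ultimately have f0J: "of_int \<lfloor>T' / c\<rfloor> < f 0" "f 0 < of_int \<lfloor>T' / c\<rfloor> + 1"
  using f0 fr unfolding fr_def by linarith+
 have J0: "0 \<le> \<lfloor>T' / c\<rfloor>" using c T'9 by simp
 have Jr: "real J = of_int \<lfloor>T' / c\<rfloor>" using J0 by (simp add: J_def T'_def)
 have nJ: "real n < f 0 \<longleftrightarrow> n \<le> J" for n :: nat
 proof
  assume "real n < f 0"
  hence "real n < real J + 1" using f0J Jr by linarith
  thus "n \<le> J" by linarith
 next
  assume "n \<le> J"
  hence "real n \<le> real J" by simp
  thus "real n < f 0" using f0J Jr by linarith
 qed
 have "\<exists>s. 0 < s \<and> s < 1/2 \<and> f s = real n" if n: "n \<in> {1..J}" for n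
 proof -
  have "\<exists>s. 0 \<le> s \<and> s \<le> 1/2 \<and> f s = real n"
  proof (rule IVT2')
   show "f (1/2) \<le> real n" by (simp add: f_def)
   show "real n \<le> f 0" using nJ [of n] n by (simp add: less_imp_le)
   show "continuous_on {0..1/2} f" unfolding f_def by (intro continuous_intros) (auto simp: cosh_real_pos [THEN less_imp_neq, symmetric])
  qed simp
  then obtain s where s: "0 \<le> s" "s \<le> 1/2" "f s = real n" by blast
  moreover have "s \<noteq> 0" using nJ [of n] n s(3) by auto
  moreover have "s \<noteq> 1/2"
  proof
   assume e: "s = 1/2"
   have "f s = 0" unfolding e by (simp add: f_def)
   thus False using s(3) n by simp
  qed
  ultimately show ?thesis by (intro exI [of _ s]) auto
 qed
 then obtain p where p: "\<And>n. n \<in> {1..J} \<Longrightarrow> 0 < p n \<and> p n < 1/2 \<and> f (p n) = real n" by metis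
 have opp: "P (1 - s) = P s + of_real (sg * f s)" for s
  unfolding P_def f_def by (rule arc_pt_opposite)
 have SI_eq: "SI = (\<lambda>n. (p n, 1 - p n)) ` {1..J}"
 proof (intro set_eqI iffI)
  fix x assume "x \<in> SI"
  then obtain s t where st: "x = (s, t)" "0 \<le> s" "s < t" "t < 1" "pr (P s) = pr (P t)"
   by (auto simp: SI_def self_intersections_def)
  obtain h where h: "deck pr h" "mob h (P s) = P t" using deck_trans [OF PU PU st(5)] by blast
  have h': "mob (minv h) (P t) = P s" using h(2) PU by (metis mob_minv(1))
  have le: "Im (mob h' (P s')) \<le> Im (P s')" if "1 \<le> cmod (den h' (P s'))" for h' s'
  proof -
   have "1 \<le> (cmod (den h' (P s')))\<^sup>2" using that by (simp add: one_le_power)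
   thus ?thesis unfolding Im_mob using PU [of s'] by (simp add: divide_le_eq mult_le_cancel_left1)
  qed
  have eqh: "Im (P s) = Im (P t)"
  proof (cases "mC h = 0")
   case True
   obtain n :: int where "\<And>z. mob h z = z + of_int n" using cusp_stabiliser [OF cf h(1) True] by metis
   hence "P t = P s + of_int n" using h(2) by metis
   thus ?thesis by simp
  next
   case False
   have "mC (minv h) \<noteq> 0" using False by (simp add: minv_sel)
   hence "Im (P s) \<le> Im (P t)" using le [OF ford(1), of t "minv h"] h' st deck_minv [OF h(1)] by simp
   moreover have "Im (P t) \<le> Im (P s)" using le [OF ford(1), of s h] h st False by simp
   ultimately show ?thesis by simp
  qed
  hence t: "t = 1 - s" using arc_pt_same_height [OF v R st(3)] unfolding P_def by blast
  hence s: "0 < s" "s < 1/2" using st by auto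
  \<comment> \<open>The parameter is now known to be interior, where the strict Ford inequality
    holds: an element with a nonzero entry would lower the point.\<close>
  have h0: "mC h = 0"
  proof (rule ccontr)
   assume "mC h \<noteq> 0"
   hence "1 < cmod (den h (P s))" using ford(2) [of s h] h s by simp
   hence "1 < (cmod (den h (P s)))\<^sup>2" by (simp add: one_less_power)
   hence "Im (mob h (P s)) < Im (P s)" unfolding Im_mob using PU [of s] by (simp add: divide_less_eq mult_less_cancel_left1)
   thus False using h(2) eqh by simp
  qed
  obtain n :: int where n: "\<And>z. mob h z = z + of_int n" using cusp_stabiliser [OF cf h(1) h0] by metis
  have "P s + of_real (sg * f s) = P s + of_int n" using opp [of s] h(2) n t by metis
  hence "complex_of_real (sg * f s) = of_real (of_int n)" by simp
  hence sf: "sg * f s = of_int n" using of_real_eq_iff by blast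
  have fpos: "0 < f s" using R v s by (simp add: f_def)
  have "f s = \<bar>sg * f s\<bar>" using sg fpos by auto
  hence fn: "f s = real (nat \<bar>n\<bar>)" unfolding sf by simp
  have "f s < f 0" using R v s by (simp add: f_def)
  hence "real (nat \<bar>n\<bar>) < f 0" unfolding fn .
  hence "nat \<bar>n\<bar> \<le> J" by (rule nJ [THEN iffD1])
  moreover have "real (nat \<bar>n\<bar>) > 0" using fpos unfolding fn .
  hence "1 \<le> nat \<bar>n\<bar>" by linarith
  ultimately have nJ': "nat \<bar>n\<bar> \<in> {1..J}" by simp
  hence "s = p (nat \<bar>n\<bar>)" using finj p fn by metis
  thus "x \<in> (\<lambda>n. (p n, 1 - p n)) ` {1..J}" using nJ' st(1) t by blast
 next
  fix x assume "x \<in> (\<lambda>n. (p n, 1 - p n)) ` {1..J}"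
  then obtain n where n: "n \<in> {1..J}" "x = (p n, 1 - p n)" by blast
  have pn: "0 < p n" "p n < 1/2" "f (p n) = real n" using p [OF n(1)] by auto
  define m where "m = (if sg = 1 then int n else - int n)"
  have m: "sg * real n = of_int m" using sg by (auto simp: m_def)
  have "P (1 - p n) = mob (Tr (of_int m)) (P (p n))" unfolding opp pn(3) m by simp
  hence "pr (P (1 - p n)) = pr (P (p n))" by (simp only: deckD [OF deck_Tr_int [OF cf] PU])
  thus "x \<in> SI" using pn n(2) by (auto simp: SI_def self_intersections_def)
 qed
 have "inj_on (\<lambda>n. (p n, 1 - p n)) {1..J}" using p by (intro inj_onI) (metis Pair_inject of_nat_eq_iff)
 hence "card SI = J" unfolding SI_eq by (simp add: card_image)
 moreover have "finite SI" unfolding SI_eq by simp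
 ultimately have "self_intersection_number (\<lambda>t. pr (P t)) = enat J"
  by (simp add: self_intersection_number_def SI_def)
 moreover have "(\<lambda>t. pr (P t)) = (\<lambda>t. pr (gl N v (t + a)))"
  unfolding N'(1) arc P_def R_def ..
 moreover have "self_intersection_number (\<lambda>t. pr (gl N v (t + a))) = self_intersection_number (\<lambda>t. pr (gl N v t))"
  by (rule self_intersection_shift [where \<gamma> = "\<lambda>t. pr (gl N v t)"]) (rule deck_gl_period(2) [OF d])
 ultimately show ?thesis by (simp add: J_def)
qed

end

section \<open>A compact core\<close>

lemma reversepath_apply: "reversepath p t = p (1 - t)"
 by (simp add: reversepath_def)

context hyp_cover
begin

lemma path_lift:
 assumes "path c" "path_image c \<subseteq> X" "a \<in> UH" "pathstart c = pr a"
 obtains q where "path q" "path_image q \<subseteq> UH" "pathstart q = a" "\<And>t. t \<in> {0..1} \<Longrightarrow> pr (q t) = c t"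
proof -
 have c: "continuous_on {0..1} c" "c ` {0..1} \<subseteq> X" "c 0 = pr a"
  using assms by (auto simp: path_def path_image_def pathstart_def)
 obtain q where q: "continuous_on {0..1} q" "\<And>t. t \<in> {0..1} \<Longrightarrow> q t \<in> UH" "q 0 = a" "\<And>t. t \<in> {0..1} \<Longrightarrow> pr (q t) = c t"
  using lift [of "{0..1::real}" c 0 a] c assms(3) by auto
 show ?thesis
  by (rule that [of q]) (use q in \<open>auto simp: path_def path_image_def pathstart_def simp del: UH_iff\<close>)
qed

lemma homotopic_paths_lift_end:
 assumes hom: "homotopic_paths X c c'"
  and p: "path p" "path_image p \<subseteq> UH" "\<And>t. t \<in> {0..1} \<Longrightarrow> pr (p t) = c t"
  and q: "path q" "path_image q \<subseteq> UH" "\<And>t. t \<in> {0..1} \<Longrightarrow> pr (q t) = c' t"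
  and start: "pathstart p = pathstart q"
 shows "pathfinish p = pathfinish q"
proof -
 obtain k where k: "continuous_on ({0..1} \<times> {0..1}) k" "k \<in> ({0..1::real} \<times> {0..1::real}) \<rightarrow> X"
  "\<And>t. t \<in> {0..1} \<Longrightarrow> k (0, t) = c t" "\<And>t. t \<in> {0..1} \<Longrightarrow> k (1, t) = c' t"
  "\<And>s. s \<in> {0..1} \<Longrightarrow> k (s, 0) = c 0" "\<And>s. s \<in> {0..1} \<Longrightarrow> k (s, 1) = c 1"
  using hom unfolding homotopic_paths by (auto simp: pathstart_def pathfinish_def)
 have pU: "p t \<in> UH" "q t \<in> UH" if "t \<in> {0..1}" for t using p(2) q(2) that unfolding path_image_def by blast+
 have k0: "k (0, t) = pr (p t)" if "t \<in> {0..1}" for t using k(3) p(3) that by simp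
 obtain K where K: "\<And>s t. s \<in> {0..1} \<Longrightarrow> t \<in> {0..1} \<Longrightarrow> K (s, t) \<in> UH" "\<And>s t. s \<in> {0..1} \<Longrightarrow> t \<in> {0..1} \<Longrightarrow> pr (K (s, t)) = k (s, t)"
  "\<And>s. s \<in> {0..1} \<Longrightarrow> continuous_on {0..1} (\<lambda>t. K (s, t))" "\<And>t. t \<in> {0..1} \<Longrightarrow> continuous_on {0..1} (\<lambda>s. K (s, t))"
  "\<And>t. t \<in> {0..1} \<Longrightarrow> K (0, t) = p t"
  by (rule lift_square [OF k(1,2) k0 p(1,2) that])
 have z: "0 \<in> {0..1::real}" "1 \<in> {0..1::real}" by simp_all
 have edge: "K (1, t) = p t" if t: "t \<in> {0..1}" and kt: "\<And>s. s \<in> {0..1} \<Longrightarrow> k (s, t) = c t" for t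
 proof (rule lift_unique [OF connected_Icc K(4) [OF t] continuous_on_const _ _ _ z(1) K(5) [OF t] z(2)])
  show "K (x, t) \<in> UH" "p t \<in> UH" "pr (K (x, t)) = pr (p t)" if x: "x \<in> {0..1}" for x
   using K(1,2) [OF x t] pU(1) [OF t] kt [OF x] p(3) [OF t] by (simp_all only:)
 qed
 have q0: "K (1, 0) = q 0" using edge [OF z(1) k(5)] start by (simp add: pathstart_def)
 have "K (1, 1) = q 1"
 proof (rule lift_unique [OF connected_Icc K(3) [OF z(2)] q(1) [unfolded path_def] _ _ _ z(1) q0 z(2)])
  show "K (1, x) \<in> UH" "q x \<in> UH" "pr (K (1, x)) = pr (q x)" if x: "x \<in> {0..1}" for x
   using K(1,2) [OF z(2) x] pU(2) [OF x] k(4) [OF x] q(3) [OF x] by (simp_all only:)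
 qed
 thus ?thesis using edge [OF z(2) k(6)] by (simp add: pathfinish_def)
qed

text \<open>The word is lifted letter by letter, each time with a translate of the chosen lift
  \<open>L f\<close> by a deck transformation; invariance of \<open>G\<close> keeps the result in
  \<open>G\<close>.\<close>

lemma loop_words_lift:
 assumes F: "\<And>f. f \<in> F \<Longrightarrow> path (L f) \<and> path_image (L f) \<subseteq> G \<and> (\<forall>t\<in>{0..1}. pr (L f t) = f t)"
  and loops: "\<And>f. f \<in> F \<Longrightarrow> f 0 = p \<and> f 1 = p"
  and G: "G \<subseteq> UH" "\<And>g z. deck pr g \<Longrightarrow> z \<in> G \<Longrightarrow> mob g z \<in> G" "\<And>z. z \<in> UH \<Longrightarrow> pr z = p \<Longrightarrow> z \<in> G"
  and h: "h \<in> loop_words p F"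
 shows "z \<in> UH \<Longrightarrow> pr z = p \<Longrightarrow>
  \<exists>q. path q \<and> path_image q \<subseteq> G \<and> pathstart q = z \<and> (\<forall>t\<in>{0..1}. pr (q t) = h t)"
 using h
proof (induction arbitrary: z rule: loop_words.induct)
 case const
 hence "z \<in> G" using G(3) by blast
 thus ?case using const by (intro exI [of _ "\<lambda>_. z"]) (auto simp: path_image_def pathstart_def path_def)
next
 have join: "\<exists>q. path q \<and> path_image q \<subseteq> G \<and> pathstart q = z \<and> (\<forall>t\<in>{0..1}. pr (q t) = (f +++ g) t)"
  if l: "path l" "path_image l \<subseteq> G" "\<And>t. t \<in> {0..1} \<Longrightarrow> pr (l t) = f t" and f: "f 0 = p" "f 1 = p"
   and IH: "\<And>z. z \<in> UH \<Longrightarrow> pr z = p \<Longrightarrow> \<exists>q. path q \<and> path_image q \<subseteq> G \<and> pathstart q = z \<and> (\<forall>t\<in>{0..1}. pr (q t) = g t)"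
   and z: "z \<in> UH" "pr z = p" for f g l z
 proof -
  have lG: "l t \<in> G" "l t \<in> UH" if "t \<in> {0..1}" for t using l(2) G(1) that unfolding path_image_def by blast+
  have "pr (l 0) = pr z" using l(3) [of 0] f z by simp
  then obtain k where k: "deck pr k" "mob k (l 0) = z" using deck_trans [OF lG(2) [of 0] z(1)] by auto
  define q1 where "q1 = (\<lambda>t. mob k (l t))"
  have q1: "path q1" "path_image q1 \<subseteq> G" "pathstart q1 = z"
  proof -
   show "path q1" unfolding q1_def path_def
    by (rule continuous_on_compose2 [OF continuous_on_mob]) (use l(1) lG in \<open>auto simp: path_def simp del: UH_iff\<close>)
   show "path_image q1 \<subseteq> G" using G(2) [OF k(1)] lG by (auto simp: q1_def path_image_def)
   show "pathstart q1 = z" using k by (simp add: q1_def pathstart_def)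
  qed
  have q1f: "pr (q1 t) = f t" if "t \<in> {0..1}" for t using deckD [OF k(1) lG(2) [OF that]] l(3) that by (simp add: q1_def)
  have "pathfinish q1 \<in> UH" using q1(2) G(1) pathfinish_in_path_image by blast
  moreover have "pr (pathfinish q1) = p" using q1f [of 1] f by (simp add: pathfinish_def)
  ultimately obtain q2 where q2: "path q2" "path_image q2 \<subseteq> G" "pathstart q2 = pathfinish q1" "\<forall>t\<in>{0..1}. pr (q2 t) = g t"
   using IH by blast
  show ?thesis
  proof (intro exI [of _ "q1 +++ q2"] conjI ballI)
   fix t :: real assume "t \<in> {0..1}"
   thus "pr ((q1 +++ q2) t) = (f +++ g) t" using q1f [of "2 * t"] q2(4) by (simp add: joinpaths_def)
  qed (use q1 q2 in \<open>simp_all add: subset_path_image_join\<close>)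
 qed
 {
  case step: (forward f g)
  show ?case by (rule join [OF _ _ _ _ _ step(3-5), of "L f"]) (use F [OF step(1)] loops [OF step(1)] in auto)
 next
  case step: (backward f g)
  show ?case by (rule join [OF _ _ _ _ _ step(3-5), of "reversepath (L f)"])
   (use F [OF step(1)] loops [OF step(1)] in \<open>simp_all add: reversepath_apply\<close>)
 }
qed

lemma connected_core_frame:
 assumes "connected {z \<in> UH. pr z \<in> S}"
 shows "connected {z \<in> UH. pr (mob M z) \<in> S}"
proof -
 have "{z \<in> UH. pr (mob M z) \<in> S} = mob (minv M) ` {z \<in> UH. pr z \<in> S}"
 proof (intro set_eqI iffI)
  fix z assume "z \<in> {z \<in> UH. pr (mob M z) \<in> S}"
  thus "z \<in> mob (minv M) ` {z \<in> UH. pr z \<in> S}"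
   using mob_in_UH [of z M] mob_minv(1) [of z M] by (intro image_eqI [of _ _ "mob M z"]) simp_all
 next
  fix z assume "z \<in> mob (minv M) ` {z \<in> UH. pr z \<in> S}"
  then obtain w where w: "w \<in> UH" "pr w \<in> S" "z = mob (minv M) w" by blast
  thus "z \<in> {z \<in> UH. pr (mob M z) \<in> S}" using mob_in_UH [OF w(1), of "minv M"] mob_minv(2) [OF w(1), of M] by simp
 qed
 moreover have "connected (mob (minv M) ` {z \<in> UH. pr z \<in> S})"
  by (rule connected_continuous_image [OF continuous_on_subset [OF continuous_on_mob] assms]) blast
 ultimately show ?thesis by simp
qed

text \<open>\<open>K\<close> is made of lifts of the generating loops. The full preimage joins i to
  each of its translates: a path between them projects to a loop homotopic to a word in the
  generators, and the word lifts inside the preimage to the same end point. Finite generation enters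
  the whole proof through this theorem.\<close>

theorem compact_core:
 assumes ft: "finite_type X"
 obtains K where "compact K" "K \<subseteq> UH" "K \<noteq> {}" "connected {z \<in> UH. pr z \<in> pr ` K}"
proof -
 have i: "\<i> \<in> UH" by simp
 define p where "p = pr \<i>"
 have pX: "p \<in> X" unfolding p_def by (rule in_X [OF i])
 obtain F where F: "finite F" "F \<subseteq> loops_at X p" "\<And>g. g \<in> loops_at X p \<Longrightarrow> \<exists>h\<in>loop_words p F. homotopic_paths X g h"
  using bspec [OF ft [unfolded finite_type_def] pX] by blast
 have loops: "path f" "path_image f \<subseteq> X" "f 0 = p" "f 1 = p" if "f \<in> F" for f
  using F(2) that by (auto simp: loops_at_def curves_between_def pathstart_def pathfinish_def)
 have "\<exists>q. path q \<and> path_image q \<subseteq> UH \<and> pathstart q = \<i> \<and> (\<forall>t\<in>{0..1}. pr (q t) = f t)" if f: "f \<in> F" for f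
  by (rule path_lift [of f "\<i>"]) (use loops [OF f] i in \<open>auto simp: pathstart_def p_def\<close>)
 then obtain L where L: "\<And>f. f \<in> F \<Longrightarrow> path (L f) \<and> path_image (L f) \<subseteq> UH \<and> pathstart (L f) = \<i> \<and> (\<forall>t\<in>{0..1}. pr (L f t) = f t)"
  by metis
 define K where "K = insert \<i> (\<Union>f\<in>F. path_image (L f))"
 define G where "G = {z \<in> UH. pr z \<in> pr ` K}"
 have cK: "compact K" unfolding K_def using F(1) L by (intro compact_insert compact_UN) (auto simp: compact_path_image)
 have KU: "K \<subseteq> UH" using L i by (auto simp: K_def simp del: UH_iff)
 have KG: "K \<subseteq> G" using KU by (auto simp: G_def simp del: UH_iff)
 have GU: "G \<subseteq> UH" by (auto simp: G_def)
 have Ginv: "mob g z \<in> G" if "deck pr g" "z \<in> G" for g z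
  using that deckD [OF that(1), of z] mob_in_UH by (auto simp: G_def simp del: UH_iff)
 have GP: "z \<in> G" if "z \<in> UH" "pr z = p" for z using that by (auto simp: G_def K_def p_def simp del: UH_iff)
 have orbit: "path_component G \<i> (mob k \<i>)" if k: "deck pr k" for k
 proof -
  define c where "c = linepath \<i> (mob k \<i>)"
  have cU: "path_image c \<subseteq> UH" unfolding c_def path_image_linepath
   by (rule closed_segment_subset) (use i mob_in_UH in auto)
  have "path (pr \<circ> c)" unfolding c_def by (rule path_continuous_image) (use cU continuous_on_subset [OF cont] c_def in auto)
  hence "pr \<circ> c \<in> loops_at X p"
   using cU in_X deckD [OF k i] by (auto simp: loops_at_def curves_between_def pathstart_def pathfinish_def path_image_compose c_def linepath_def p_def simp del: UH_iff)
  then obtain h where h: "h \<in> loop_words p F" "homotopic_paths X (pr \<circ> c) h" using F(3) by blast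
  obtain q where q: "path q" "path_image q \<subseteq> G" "pathstart q = \<i>" "\<forall>t\<in>{0..1}. pr (q t) = h t"
  proof -
   have "\<exists>q. path q \<and> path_image q \<subseteq> G \<and> pathstart q = \<i> \<and> (\<forall>t\<in>{0..1}. pr (q t) = h t)"
   proof (rule loop_words_lift [OF _ _ GU Ginv GP h(1) i])
    show "path (L f) \<and> path_image (L f) \<subseteq> G \<and> (\<forall>t\<in>{0..1}. pr (L f t) = f t)" if "f \<in> F" for f
     using L [OF that] KG that unfolding K_def by blast
    show "f 0 = p \<and> f 1 = p" if "f \<in> F" for f using loops that by blast
   qed (auto simp: p_def)
   thus ?thesis using that by blast
  qed
  have "pathfinish c = pathfinish q"
   by (rule homotopic_paths_lift_end [OF h(2)]) (use q GU cU c_def in auto)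
  hence "pathfinish q = mob k \<i>" by (simp add: c_def)
  thus ?thesis unfolding path_component_def using q(1-3) by blast
 qed
 have "path_component G \<i> z" if z: "z \<in> G" for z
 proof -
  obtain y where y: "y \<in> K" "pr z = pr y" using z by (auto simp: G_def)
  have yU: "y \<in> UH" "z \<in> UH" using y KU z GU by blast+
  obtain k where k: "deck pr k" "mob k y = z" using deck_trans [OF yU(1) yU(2)] y by metis
  have "path_component G (mob k \<i>) z"
  proof (cases "y = \<i>")
   case True
   thus ?thesis using k z by (simp add: path_component_refl)
  next
   case False
   then obtain f where f: "f \<in> F" "y \<in> path_image (L f)" using y by (auto simp: K_def)
   have "path_component (path_image (L f)) \<i> y"
    using L [OF f(1)] f(2) path_connected_path_image [of "L f"] pathstart_in_path_image [of "L f"]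
    unfolding path_connected_component by metis
   hence "path_component K \<i> y" by (rule path_component_of_subset [rotated]) (use f(1) in \<open>auto simp: K_def\<close>)
   then obtain r where r: "path r" "path_image r \<subseteq> K" "pathstart r = \<i>" "pathfinish r = y"
    unfolding path_component_def by blast
   have "path (mob k \<circ> r)"
    by (rule path_continuous_image [OF r(1) continuous_on_subset [OF continuous_on_mob]]) (use r(2) KU in blast)
   moreover have "path_image (mob k \<circ> r) \<subseteq> G" using r(2) KG Ginv [OF k(1)] by (auto simp: path_image_compose)
   ultimately show ?thesis unfolding path_component_def using r k by (intro exI [of _ "mob k \<circ> r"]) (auto simp: pathstart_compose pathfinish_compose)
  qed
  thus ?thesis using orbit [OF k(1)] path_component_trans by metis
 qed
 hence "path_connected G" unfolding path_connected_component by (meson path_component_sym path_component_trans)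
 hence "connected G" by (rule path_connected_imp_connected)
 thus ?thesis using that [of K] cK KU by (auto simp: G_def K_def)
qed

end

section \<open>Finitely many cusps\<close>

text \<open>The segment from the real point \<open>u\<close> to \<open>p\<close> misses
  \<open>G\<close> by \<open>seg\<close>. At \<open>p\<close> and beyond, the affine function is
  negative, so \<open>G\<close> has no points there either. The whole ray misses \<open>G\<close>,
  yet \<open>G\<close> has points on both sides.\<close>

lemma line_separation:
 fixes u :: real
 assumes G: "connected G" "G \<subseteq> UH" and L: "\<And>z. z \<in> G \<Longrightarrow> 0 \<le> al * Re z + \<beta> * Im z + \<gamma>"
  and u: "0 < al * u + \<gamma>" and p: "p \<in> UH" "al * Re p + \<beta> * Im p + \<gamma> < 0"
  and seg: "\<And>l. 0 < l \<Longrightarrow> l < 1 \<Longrightarrow> of_real u + of_real l * (p - of_real u) \<notin> G"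
  and xy: "x \<in> G" "y \<in> G"
  and sgn: "0 < Im ((x - of_real u) * cnj (p - of_real u))" "Im ((y - of_real u) * cnj (p - of_real u)) < 0"
 shows False
proof -
 define f where "f = (\<lambda>z. Im ((z - of_real u) * cnj (p - of_real u)))"
 have "connected (f ` G)"
  by (rule connected_continuous_image [OF _ G(1)]) (unfold f_def, intro continuous_intros)
 hence "is_interval (f ` G)" by (simp add: is_interval_connected_1)
 moreover have "f x \<in> f ` G" "f y \<in> f ` G" "f y \<le> 0" "0 \<le> f x" using xy sgn by (auto simp: f_def)
 ultimately have "0 \<in> f ` G" unfolding is_interval_1 by blast
 then obtain z where z: "z \<in> G" "f z = 0" by auto
 define l where "l = Im z / Im p"
 have pz: "0 < Im p" "0 < Im z" using p z G(2) by auto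
 have l: "0 < l" using pz by (simp add: l_def)
 have "Im z * (Re p - u) = (Re z - u) * Im p" using z(2) by (simp add: f_def algebra_simps)
 hence "Re z - u = l * (Re p - u)" using pz by (simp add: l_def field_simps)
 moreover have "Im z = l * Im p" using pz by (simp add: l_def)
 ultimately have zl: "z = of_real u + of_real l * (p - of_real u)" by (simp add: complex_eq_iff)
 have "al * Re z + \<beta> * Im z + \<gamma> = (1 - l) * (al * u + \<gamma>) + l * (al * Re p + \<beta> * Im p + \<gamma>)"
  unfolding zl by (simp add: algebra_simps)
 hence "0 \<le> (1 - l) * (al * u + \<gamma>) + l * (al * Re p + \<beta> * Im p + \<gamma>)" using L [OF z(1)] by simp
 moreover have "l * (al * Re p + \<beta> * Im p + \<gamma>) < 0" using l p(2) by (simp add: mult_less_0_iff)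
 ultimately have "0 < (1 - l) * (al * u + \<gamma>)" by linarith
 hence "l < 1" using u by (simp add: zero_less_mult_iff)
 thus False using seg [OF l] z(1) zl by simp
qed

text \<open>Let two horoballs with different base points miss \<open>G\<close> and have a common
  point \<open>p\<close>. The ray through \<open>p\<close> from the base point \<open>u\<close> of
  the second lies in the second up to \<open>p\<close> and in the first beyond. Integer translations
  put points of \<open>G\<close> on both sides of it.\<close>

lemma horoball_separation:
 assumes G: "connected G" "G \<subseteq> UH" "G \<noteq> {}" and inv: "\<And>z n. z \<in> G \<Longrightarrow> z + of_int n \<in> G"
  and s: "0 < s" "\<And>z. z \<in> G \<Longrightarrow> Im z \<le> s"
  and B: "mC B \<noteq> 0" and s': "\<And>z. z \<in> G \<Longrightarrow> Im (mob (minv B) z) \<le> s'"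
  and p: "p \<in> UH" "s < Im p" "s' < Im (mob (minv B) p)"
 shows False
proof -
 define u where "u = mA B / mC B"
 obtain x where x: "x \<in> G" using G by blast
 define f where "f = (\<lambda>z. Im ((z - of_real u) * cnj (p - of_real u)))"
 have fn: "f (x + of_int n) = f x - of_int n * Im p" for n by (simp add: f_def algebra_simps)
 have pI: "0 < Im p" using p by simp
 define n where "n = \<lceil>\<bar>f x\<bar> / Im p\<rceil> + 1"
 have "\<bar>f x\<bar> / Im p < of_int n" unfolding n_def by linarith
 hence n: "\<bar>f x\<bar> < of_int n * Im p" using pI by (simp add: pos_divide_less_eq)
 have pos: "0 < f (x + of_int (- n))" and neg: "f (x + of_int n) < 0" unfolding fn using n by auto
 show False
 proof (rule line_separation [OF G(1,2), where al = 0 and \<beta> = "-1" and \<gamma> = s and u = u and p = p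
    and x = "x + of_int (- n)" and y = "x + of_int n"])
  fix l :: real assume l: "0 < l" "l < 1"
  define z where "z = of_real u + of_real l * (p - of_real u)"
  have zI: "Im z = l * Im p" by (simp add: z_def)
  have d: "den (minv B) z = of_real l * den (minv B) p"
   using B by (simp add: den_def minv_sel z_def u_def complex_eq_iff field_simps)
  have "Im (mob (minv B) z) = Im (mob (minv B) p) / l"
   unfolding Im_mob d zI using l by (simp add: norm_mult power2_eq_square)
  moreover have "Im (mob (minv B) p) \<le> Im (mob (minv B) p) / l"
   using l Im_mob_pos [of p "minv B"] pI by (simp add: le_divide_eq mult_left_le)
  ultimately have "s' < Im (mob (minv B) z)" using p(3) by linarith
  thus "of_real u + of_real l * (p - of_real u) \<notin> G" using s' unfolding z_def by force
 qed (use s p inv [OF x, of n] inv [OF x, of "- n"] pos neg in \<open>auto simp: f_def\<close>)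
qed

section \<open>Finiteness from compactness of the core\<close>

lemma finite_representatives:
 assumes C: "compact C" "C \<subseteq> UH" and Y: "\<And>a. a \<in> P \<Longrightarrow> Y a \<in> C"
  and R: "\<And>a b. a \<in> P \<Longrightarrow> b \<in> P \<Longrightarrow> hdist (Y a) (Y b) < 1 \<Longrightarrow> R a b"
 obtains F where "finite F" "F \<subseteq> P" "\<And>a. a \<in> P \<Longrightarrow> \<exists>b\<in>F. R a b"
proof -
 define N where "N = (\<lambda>w. {z \<in> UH. hdist z w < 1/2})"
 have "C \<subseteq> (\<Union>w\<in>C. N w)" using C(2) by (force simp: N_def)
 moreover have "open (N w)" if "w \<in> C" for w using that C(2) open_hball unfolding N_def by blast
 ultimately obtain W where W: "W \<subseteq> C" "finite W" "C \<subseteq> (\<Union>w\<in>W. N w)" using compactE_image [OF C(1), of C N] by metis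
 define r where "r = (\<lambda>w. SOME a. a \<in> P \<and> Y a \<in> N w)"
 define F where "F = r ` {w \<in> W. \<exists>a\<in>P. Y a \<in> N w}"
 have r: "r w \<in> P \<and> Y (r w) \<in> N w" if "\<exists>a\<in>P. Y a \<in> N w" for w
  unfolding r_def using that by (intro someI_ex [where P = "\<lambda>a. a \<in> P \<and> Y a \<in> N w"]) blast
 show ?thesis
 proof (rule that [of F])
  show "finite F" using W(2) by (simp add: F_def)
  show "F \<subseteq> P" using r by (auto simp: F_def)
  fix a assume a: "a \<in> P"
  then obtain w where w: "w \<in> W" "Y a \<in> N w" using Y W(3) by blast
  have rw: "r w \<in> P" "Y (r w) \<in> N w" using r w a by blast+
  have U: "Y a \<in> UH" "Y (r w) \<in> UH" "w \<in> UH" using w rw W(1) C(2) by (auto simp: N_def)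
  have "hdist (Y a) (Y (r w)) \<le> hdist (Y a) w + hdist w (Y (r w))" by (rule hdist_triangle [OF U(1,3,2)])
  also have "\<dots> < 1" using w(2) rw(2) by (simp add: N_def hdist_commute)
  finally have "R a (r w)" using R a rw by blast
  thus "\<exists>b\<in>F. R a b" using w a by (auto simp: F_def)
 qed
qed

lemma compact_hdist_bounded:
 assumes "compact K" "K \<subseteq> UH" "k0 \<in> UH"
 obtains D where "\<And>k. k \<in> K \<Longrightarrow> hdist k k0 \<le> D"
proof -
 have "compact ((\<lambda>z. hdist z k0) ` K)"
  by (rule compact_continuous_image [OF continuous_on_subset [OF continuous_on_hdist [OF assms(3)] assms(2)] assms(1)])
 hence "bounded ((\<lambda>z. hdist z k0) ` K)" by (rule compact_imp_bounded)
 then obtain D where "\<And>x. x \<in> (\<lambda>z. hdist z k0) ` K \<Longrightarrow> norm x \<le> D" unfolding bounded_iff by blast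
 thus ?thesis using that [of D] by force
qed

text \<open>\<open>y M\<close> is a witness within distance 2 of a point that \<open>M\<close> sends
  into \<open>K\<close>. If the witnesses of \<open>M\<close> and \<open>N\<close> are close on the
  common half-plane, then \<open>p\<close> is the second one in the coordinates of \<open>M\<close>;
  the separation lemmas supply \<open>R\<close> from such a point.\<close>

lemma finite_frames:
 assumes K: "compact K" "K \<subseteq> UH" and x: "\<And>M. M \<in> P \<Longrightarrow> x M \<in> UH" "\<And>M. M \<in> P \<Longrightarrow> mob M (x M) \<in> K"
  and y: "\<And>M. M \<in> P \<Longrightarrow> y M \<in> UH" "\<And>M. M \<in> P \<Longrightarrow> hdist (y M) (x M) \<le> 2"
  and R: "\<And>M N p. M \<in> P \<Longrightarrow> N \<in> P \<Longrightarrow> p \<in> UH \<Longrightarrow> hdist p (y M) < 1 \<Longrightarrow> mob (minv (minv M * N)) p = y N \<Longrightarrow> R M N"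
 obtains F where "finite F" "F \<subseteq> P" "\<And>M. M \<in> P \<Longrightarrow> \<exists>N\<in>F. R M N"
proof -
 have i: "\<i> \<in> UH" by simp
 obtain D where D: "\<And>k. k \<in> K \<Longrightarrow> hdist k \<i> \<le> D" using compact_hdist_bounded [OF K i] by metis
 define Y where "Y = (\<lambda>M. mob M (y M))"
 have YU: "Y M \<in> UH" if "M \<in> P" for M unfolding Y_def by (rule mob_in_UH [OF y(1) [OF that]])
 show ?thesis
 proof (rule finite_representatives [OF compact_hball [OF i, of "D + 2"], of P Y R])
  show "Y M \<in> {z \<in> UH. hdist z \<i> \<le> D + 2}" if M: "M \<in> P" for M
  proof -
   have "hdist (Y M) \<i> \<le> hdist (Y M) (mob M (x M)) + hdist (mob M (x M)) \<i>"
    by (rule hdist_triangle [OF YU [OF M] mob_in_UH [OF x(1) [OF M]] i])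
   also have "hdist (Y M) (mob M (x M)) = hdist (y M) (x M)" unfolding Y_def by (rule hdist_mob [OF y(1) [OF M] x(1) [OF M]])
   finally show ?thesis using y(2) [OF M] D [OF x(2) [OF M]] YU [OF M] by simp
  qed
  show "R M N" if M: "M \<in> P" and N: "N \<in> P" and d: "hdist (Y M) (Y N) < 1" for M N
  proof (rule R [OF M N])
   show pU: "mob (minv M) (Y N) \<in> UH" by (rule mob_in_UH [OF YU [OF N]])
   have "hdist (mob (minv M) (Y N)) (y M) = hdist (Y N) (Y M)"
    using hdist_mob [OF pU y(1) [OF M], of M] mob_minv(2) [OF YU [OF N], of M] by (simp add: Y_def)
   thus "hdist (mob (minv M) (Y N)) (y M) < 1" using d by (simp add: hdist_commute)
   show "mob (minv (minv M * N)) (mob (minv M) (Y N)) = y N"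
    using mob_mult [OF pU, of "minv N" M] mob_minv(2) [OF YU [OF N], of M] mob_minv(1) [OF y(1) [OF N], of N]
    by (simp add: minv_mult Y_def)
  qed
 qed (use that in auto)
qed

context hyp_cover
begin

lemma core_compact_Int:
 assumes K: "compact K" "K \<subseteq> UH" and C: "compact C" "C \<subseteq> UH"
 shows "compact (C \<inter> {z \<in> UH. pr z \<in> pr ` K})"
proof -
 have "compact (pr ` K)" by (rule compact_continuous_image [OF continuous_on_subset [OF cont K(2)] K(1)])
 hence "closed (pr ` K)" by (rule compact_imp_closed)
 hence "closed (C \<inter> pr -` (pr ` K))"
  by (rule continuous_closed_preimage [OF continuous_on_subset [OF cont C(2)] compact_imp_closed [OF C(1)]])
 hence "compact (C \<inter> (C \<inter> pr -` (pr ` K)))" by (rule compact_Int_closed [OF C(1)])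
 moreover have "C \<inter> (C \<inter> pr -` (pr ` K)) = C \<inter> {z \<in> UH. pr z \<in> pr ` K}" using C(2) by blast
 ultimately show ?thesis by simp
qed

text \<open>Heights in the preimage are bounded: elements fixing infinity keep the height, and the
  others send points of \<open>K\<close> to height at most 1 / Im m by \<open>Im_mob_le\<close>.
  Integer translations bring the search for the maximum into a compact rectangle.\<close>

lemma cusp_top:
 assumes cf: "cusp_frame pr" and K: "compact K" "K \<subseteq> UH" "K \<noteq> {}"
 defines "G \<equiv> {z \<in> UH. pr z \<in> pr ` K}"
 obtains x where "x \<in> G" "\<And>z. z \<in> G \<Longrightarrow> Im z \<le> Im x"
proof -
 have cI: "compact (Im ` K)" by (intro compact_continuous_image K(1) continuous_intros)
 obtain m where m: "m \<in> K" "\<And>y. y \<in> K \<Longrightarrow> Im m \<le> Im y"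
  using compact_attains_inf [OF cI] K(3) by auto
 obtain M where M: "M \<in> K" "\<And>y. y \<in> K \<Longrightarrow> Im y \<le> Im M"
  using compact_attains_sup [OF cI] K(3) by auto
 have mp: "0 < Im m" using m K(2) by auto
 define b where "b = max (Im M) (1 / Im m)"
 have bound: "Im z \<le> b" if z: "z \<in> G" for z
 proof -
  obtain y where y: "y \<in> K" "pr z = pr y" using z by (auto simp: G_def)
  have U: "y \<in> UH" "z \<in> UH" using y K(2) z by (auto simp: G_def simp del: UH_iff)
  obtain h where h: "deck pr h" "mob h y = z" using deck_trans [OF U] y by metis
  show ?thesis
  proof (cases "mC h = 0")
   case True
   obtain n :: int where "\<And>z. mob h z = z + of_int n" using cusp_stabiliser [OF cf h(1) True] by metis
   hence "Im z = Im y" using h(2) by auto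
   thus ?thesis using M(2) [OF y(1)] by (simp add: b_def)
  next
   case False
   have "Im z \<le> 1 / ((mC h)\<^sup>2 * Im y)" using Im_mob_le [OF U(1) False] h(2) by simp
   also have "\<dots> \<le> 1 / Im m"
   proof (rule divide_left_mono)
    have "1\<^sup>2 \<le> \<bar>mC h\<bar>\<^sup>2" using cusp_c_ge4 [OF cf h(1) False] by (intro power_mono) auto
    hence "1 * Im m \<le> (mC h)\<^sup>2 * Im y" using m(2) [OF y(1)] mp by (intro mult_mono) auto
    thus "Im m \<le> (mC h)\<^sup>2 * Im y" by simp
    show "0 < (mC h)\<^sup>2 * Im y * Im m" using False U mp by simp
   qed simp
   finally show ?thesis by (simp add: b_def)
  qed
 qed
 have tr: "\<exists>z'\<in>G. 0 \<le> Re z' \<and> Re z' \<le> 1 \<and> Im z' = Im z" if z: "z \<in> G" for z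
 proof -
  define z' where "z' = z + of_int (- \<lfloor>Re z\<rfloor>)"
  have zU: "z \<in> UH" using z by (auto simp: G_def)
  have "z' = mob (Tr (of_int (- \<lfloor>Re z\<rfloor>))) z" by (simp add: z'_def)
  hence "pr z' = pr z" using deckD [OF deck_Tr_int [OF cf] zU] by metis
  hence "z' \<in> G" using z by (simp add: G_def z'_def)
  moreover have "0 \<le> Re z'" "Re z' \<le> 1" unfolding z'_def by simp_all linarith+
  ultimately show ?thesis by (intro bexI [of _ z']) (auto simp: z'_def)
 qed
 define C where "C = cbox (Complex 0 (Im m)) (Complex 1 b)"
 have C: "compact C" "C \<subseteq> UH" using mp by (auto simp: C_def in_cbox_complex_iff)
 have mG: "m \<in> G" using m K by (auto simp: G_def simp del: UH_iff)
 obtain m' where m': "m' \<in> G" "0 \<le> Re m'" "Re m' \<le> 1" "Im m' = Im m" using tr [OF mG] by blast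
 have "compact (C \<inter> G)" unfolding G_def by (rule core_compact_Int [OF K(1,2) C])
 hence cG: "compact (Im ` (C \<inter> G))" by (intro compact_continuous_image continuous_intros)
 have m'C: "m' \<in> C \<inter> G" using m' bound [OF m'(1)] by (auto simp: C_def in_cbox_complex_iff)
 obtain x where x: "x \<in> C \<inter> G" "\<And>y. y \<in> C \<inter> G \<Longrightarrow> Im y \<le> Im x"
  using compact_attains_sup [OF cG] m'C by auto
 show ?thesis
 proof (rule that)
  show "x \<in> G" using x by simp
  fix z assume z: "z \<in> G"
  obtain z' where z': "z' \<in> G" "0 \<le> Re z'" "Re z' \<le> 1" "Im z' = Im z" using tr [OF z] by blast
  show "Im z \<le> Im x"
  proof (cases "Im m \<le> Im z")
   case True
   hence "z' \<in> C \<inter> G" using z' bound [OF z] by (auto simp: C_def in_cbox_complex_iff)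
   thus ?thesis using x(2) z'(4) by metis
  next
   case False
   thus ?thesis using x(2) [OF m'C] m'(4) by simp
  qed
 qed
qed

end

text \<open>The spectrum belongs to the cusp rather than to the chosen frame.\<close>

lemma cspec_upper:
 assumes "mC B = 0" "(mA B)\<^sup>2 = 1"
 shows "cspec (pull pr (M * B)) \<subseteq> cspec (pull pr M)"
proof
 fix x assume "x \<in> cspec (pull pr (M * B))"
 then obtain h where h: "deck (pull pr (M * B)) h" "mC h \<noteq> 0" "x = \<bar>mC h\<bar>" by (auto simp: cspec_def)
 have "M * B * h * minv (M * B) = M * (B * h * minv B) * minv M" by (simp add: minv_mult mult.assoc)
 hence d: "deck (pull pr M) (B * h * minv B)" using h(1) by (simp add: deck_conj)
 have ad: "mA B * mD B = 1" using sl2_det [of B] assms(1) by simp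
 hence "(mA B)\<^sup>2 * (mD B)\<^sup>2 = 1" by (metis one_power2 power_mult_distrib)
 hence D2: "(mD B)\<^sup>2 = 1" using assms(2) by simp
 have "mC (B * h * minv B) = (mD B)\<^sup>2 * mC h" using assms(1) by (simp add: sl2_sel power2_eq_square)
 hence "mC (B * h * minv B) = mC h" unfolding D2 by simp
 thus "x \<in> cspec (pull pr M)" using d h unfolding cspec_def by (metis (mono_tags, lifting) mem_Collect_eq)
qed

text \<open>The horoball above the highest point of the preimage misses the preimage. After a deck
  transformation that point is sent into \<open>K\<close>. Horoballs with nearby witnesses meet, so
  by separation they have the same base point; compactness leaves finitely many cusps, each with
  finitely many values up to \<open>b\<close>.\<close>

theorem finitely_many_cusps:
 assumes hc: "hyp_cover X pr" and ft: "finite_type X"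
 shows "finite {x. x \<le> b \<and> (\<exists>M. frame pr M \<and> x \<in> cspec (pull pr M))}"
proof -
 interpret hyp_cover X pr by fact
 obtain K where K: "compact K" "K \<subseteq> UH" "K \<noteq> {}" "connected {z \<in> UH. pr z \<in> pr ` K}"
  by (rule compact_core [OF ft])
 define G where "G = (\<lambda>M. {z \<in> UH. pr (mob M z) \<in> pr ` K})"
 define P where "P = {M. frame pr M \<and> (\<exists>x\<in>G M. mob M x \<in> K \<and> (\<forall>z\<in>G M. Im z \<le> Im x))}"
 have Gconn: "connected (G M)" for M unfolding G_def by (rule connected_core_frame [OF K(4)])
 have GUH: "G M \<subseteq> UH" for M by (auto simp: G_def)
 have red: "\<exists>g. deck pr g \<and> g * M \<in> P" if cf: "frame pr M" for M
 proof -
  interpret M: hyp_cover X "pull pr M" by (rule hyp_cover_mob [OF hc])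
  define K' where "K' = mob (minv M) ` K"
  have K': "compact K'" "K' \<subseteq> UH" "K' \<noteq> {}"
   unfolding K'_def using K(2,3) mob_in_UH
   by (blast intro: compact_continuous_image [OF continuous_on_subset [OF continuous_on_mob K(2)] K(1)])+
  have im: "(pull pr M) ` K' = pr ` K" unfolding K'_def image_image
   using K(2) by (intro image_cong refl) (metis mob_minv(2) subsetD)
  obtain x where x: "x \<in> G M" "\<And>z. z \<in> G M \<Longrightarrow> Im z \<le> Im x"
   by (rule M.cusp_top [OF cf K', unfolded im]) (unfold G_def, blast)
  have xU: "x \<in> UH" using x GUH by blast
  obtain y where y: "y \<in> K" "pr (mob M x) = pr y" using x by (auto simp: G_def)
  obtain g where g: "deck pr g" "mob g (mob M x) = y"
   using deck_trans [OF mob_in_UH [OF xU] _ y(2)] y(1) K(2) by blast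
  have eq: "pr (mob (g * M) z) = pr (mob M z)" if "z \<in> UH" for z
   unfolding mob_mult [OF that] by (rule deckD [OF g(1) mob_in_UH [OF that]])
  have Gg: "G (g * M) = G M" using eq by (auto simp: G_def simp del: UH_iff)
  have "deck (pull pr (g * M)) k = deck (pull pr M) k" for k
   unfolding deck_def using eq mob_in_UH by simp
  hence "frame pr (g * M)" using cf unfolding cusp_frame_def by simp
  moreover have "mob (g * M) x \<in> K" unfolding mob_mult [OF xU] using g y by simp
  ultimately have "g * M \<in> P" unfolding P_def mem_Collect_eq Gg using x by (intro conjI bexI [of _ x] ballI) simp_all
  thus ?thesis using g by blast
 qed
 have "\<forall>M\<in>P. \<exists>x\<in>G M. mob M x \<in> K \<and> (\<forall>z\<in>G M. Im z \<le> Im x)" by (auto simp: P_def)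
 then obtain xx where xx: "\<And>M. M \<in> P \<Longrightarrow> xx M \<in> G M" "\<And>M. M \<in> P \<Longrightarrow> mob M (xx M) \<in> K"
   "\<And>M z. M \<in> P \<Longrightarrow> z \<in> G M \<Longrightarrow> Im z \<le> Im (xx M)" by metis
 \<comment> \<open>Raising the highest point by the factor \<open>exp 1\<close> moves it by distance
   1, so every point at distance less than 1 from \<open>yy M\<close> is still in the
   horoball.\<close>
 define yy where "yy = (\<lambda>M. Complex (Re (xx M)) (exp 1 * Im (xx M)))"
 have xU: "xx M \<in> UH" if "M \<in> P" for M using xx(1) [OF that] GUH by blast
 have yU: "yy M \<in> UH" if "M \<in> P" for M using xU [OF that] by (simp add: yy_def)
 have dxy: "hdist (yy M) (xx M) \<le> 2" if "M \<in> P" for M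
 proof -
  have I: "0 < Im (xx M)" using xU [OF that] by simp
  have "yy M - xx M = \<i> * of_real ((exp 1 - 1) * Im (xx M))" by (simp add: yy_def complex_eq_iff algebra_simps)
  hence "cmod (yy M - xx M) = (exp 1 - 1) * Im (xx M)"
   using I by (simp only: norm_mult norm_of_real) (simp add: abs_mult)
  moreover have "Im (xx M) \<le> exp 1 * Im (xx M)" using I by (simp add: mult_le_cancel_right1)
  hence "hdist (yy M) (xx M) \<le> cmod (yy M - xx M) / Im (xx M)"
   using I by (intro hdist_le_Euclid) (auto simp: yy_def)
  ultimately have "hdist (yy M) (xx M) \<le> exp 1 - 1" using I by simp
  thus ?thesis using exp_le by simp
 qed
 define R where "R = (\<lambda>M N. mC (minv M * N) = 0)"
 obtain F where F: "finite F" "F \<subseteq> P" "\<And>M. M \<in> P \<Longrightarrow> \<exists>N\<in>F. R M N"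
 proof (rule finite_frames [OF K(1,2) xU xx(2) yU dxy, of P R])
  show "R M N" if M: "M \<in> P" and N: "N \<in> P" and pU: "p \<in> UH" and dp: "hdist p (yy M) < 1"
   and pN: "mob (minv (minv M * N)) p = yy N" for M N p
  proof (rule ccontr)
   assume "\<not> R M N"
   hence C: "mC (minv M * N) \<noteq> 0" by (simp add: R_def)
   have cfM: "frame pr M" using M by (simp add: P_def)
   interpret M: hyp_cover X "pull pr M" by (rule hyp_cover_mob [OF hc])
   have mi: "minv (minv M * N) = minv N * M" by (simp add: minv_mult)
   have xI: "0 < Im (xx M)" "0 < Im (xx N)" using xU M N by auto
   have "\<bar>ln (Im p) - ln (Im (yy M))\<bar> < 1" using ln_Im_le_hdist [OF pU yU [OF M]] dp by simp
   moreover have "ln (Im (yy M)) = 1 + ln (Im (xx M))" using xI by (simp add: yy_def ln_mult)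
   ultimately have "ln (Im (xx M)) < ln (Im p)" by linarith
   hence pM: "Im (xx M) < Im p" using xI pU by simp
   have "Im (xx N) < exp 1 * Im (xx N)" using xI by simp
   hence pN': "Im (xx N) < Im (mob (minv (minv M * N)) p)" unfolding pN by (simp add: yy_def)
   show False
   proof (rule horoball_separation [OF Gconn [of M] GUH _ _ xI(1) xx(3) [OF M] C _ pU pM pN'])
    show "G M \<noteq> {}" using xx(1) [OF M] by blast
    show "z + of_int n \<in> G M" if "z \<in> G M" for z n
    proof -
     have zU: "z \<in> UH" using that GUH by blast
     have "pr (mob M (mob (Tr (of_int n)) z)) = pr (mob M z)"
      using deckD [OF M.deck_Tr_int [OF cfM] zU] .
     thus ?thesis using that by (simp add: G_def)
    qed
    show "Im (mob (minv (minv M * N)) z) \<le> Im (xx N)" if "z \<in> G M" for z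
    proof (rule xx(3) [OF N])
     have zU: "z \<in> UH" using that GUH by blast
     show "mob (minv (minv M * N)) z \<in> G N"
      unfolding mi using that zU by (simp add: G_def mob_mult del: UH_iff)
    qed
   qed
  qed
 qed auto
 have "{x. x \<le> b \<and> (\<exists>M. frame pr M \<and> x \<in> cspec (pull pr M))}
   \<subseteq> (\<Union>N\<in>F. {x \<in> cspec (pull pr N). x \<le> b})"
 proof clarify
  fix x M assume x: "x \<le> b" "frame pr M" "x \<in> cspec (pull pr M)"
  obtain g where g: "deck pr g" "g * M \<in> P" using red x by blast
  obtain N where N: "N \<in> F" "R (g * M) N" using F(3) [OF g(2)] by blast
  have cfN: "frame pr N" "frame pr (g * M)" using N(1) F(2) g by (auto simp: P_def)
  have "deck (pull pr (g * M)) k = deck (pull pr M) k" for k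
   unfolding deck_def using deckD [OF g(1) mob_in_UH] mob_in_UH by (simp add: mob_mult del: UH_iff)
  hence xg: "x \<in> cspec (pull pr (g * M))" using x(3) by (simp add: cspec_def)
  define B where "B = minv N * (g * M)"
  have "minv (g * M) * N = minv B" by (simp add: B_def minv_mult)
  hence B0: "mC B = 0" using N(2) by (simp add: R_def minv_sel)
  have "(mA B)\<^sup>2 = 1" unfolding B_def by (rule frames_upper [OF hc cfN(1,2)]) (use B0 in \<open>simp add: B_def\<close>)
  hence "x \<in> cspec (pull pr N)"
   using cspec_upper [OF B0, of pr N] xg by (auto simp: B_def)
  thus "x \<in> (\<Union>N\<in>F. {x \<in> cspec (pull pr N). x \<le> b})" using N(1) x(1) by blast
 qed
 moreover have "finite (\<Union>N\<in>F. {x \<in> cspec (pull pr N). x \<le> b})"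
 proof (rule finite_UN_I [OF F(1)])
  fix N assume "N \<in> F"
  hence "frame pr N" using F(2) by (auto simp: P_def)
  thus "finite {x \<in> cspec (pull pr N). x \<le> b}"
   using hyp_cover.cspec_finite [OF hyp_cover_mob [OF hc]] by blast
 qed
 ultimately show ?thesis using finite_subset by blast
qed

section \<open>Translation lengths are bounded below\<close>

lemma Re_mob:
 assumes "z \<in> UH"
 shows "Re (mob g z) = (mA g * mC g * (cmod z)\<^sup>2 + (mA g * mD g + mB g * mC g) * Re z + mB g * mD g) / (cmod (den g z))\<^sup>2"
proof -
 have "mob g z = (of_real (mA g) * z + of_real (mB g)) / den g z" by (simp add: mob_def den_def)
 thus ?thesis
  by (simp add: Re_divide cmod_power2 den_def)
   (simp add: algebra_simps power2_eq_square)
qed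

lemma quadratic_leading_nonneg:
 fixes al :: real
 assumes L: "1 < L" and q: "\<And>n. 0 \<le> al * (L ^ n)\<^sup>2 + \<beta> * L ^ n + \<gamma>"
 shows "0 \<le> al"
proof (rule ccontr)
 assume "\<not> 0 \<le> al"
 hence a: "al < 0" by simp
 define b where "b = (\<bar>\<beta>\<bar> + \<bar>\<gamma>\<bar>) / (- al)"
 obtain n where "b < L ^ n" using real_arch_pow [OF L] by blast
 hence "\<bar>\<beta>\<bar> + \<bar>\<gamma>\<bar> < L ^ n * (- al)" using a by (simp only: b_def pos_divide_less_eq neg_0_less_iff_less)
 hence "al * L ^ n + \<bar>\<beta>\<bar> + \<bar>\<gamma>\<bar> < 0" by (simp add: mult.commute)
 moreover have L1: "1 \<le> L ^ n" using L by simp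
 ultimately have "L ^ n * (al * L ^ n + \<bar>\<beta>\<bar> + \<bar>\<gamma>\<bar>) < 0" by (simp add: mult_less_0_iff)
 moreover have "\<beta> * L ^ n \<le> \<bar>\<beta>\<bar> * L ^ n" using L1 by (intro mult_right_mono) auto
 moreover have "\<gamma> \<le> \<bar>\<gamma>\<bar> * L ^ n" using L1 mult_left_mono [OF L1, of "\<bar>\<gamma>\<bar>"] by simp
 moreover have "al * (L ^ n)\<^sup>2 + \<bar>\<beta>\<bar> * L ^ n + \<bar>\<gamma>\<bar> * L ^ n = L ^ n * (al * L ^ n + \<bar>\<beta>\<bar> + \<bar>\<gamma>\<bar>)"
  by (simp add: algebra_simps power2_eq_square)
 ultimately show False using q [of n] by linarith
qed

text \<open>The analogue of \<open>horoball_separation\<close> for axes; each region contains the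
  far side of its axis. Unless the axes coincide, the second one has a positive real end
  \<open>u\<close>, and the ray from \<open>u\<close> through \<open>p\<close> lies in the second
  region up to \<open>p\<close> and in the first beyond.\<close>

lemma hypercycle_separation:
 assumes G: "connected G" "G \<subseteq> UH" "x \<in> G"
  and L: "1 < L" "\<And>z. z \<in> G \<Longrightarrow> of_real L * z \<in> G" "\<And>z. z \<in> G \<Longrightarrow> of_real (1 / L) * z \<in> G"
  and \<kappa>: "0 \<le> \<kappa>" "\<And>z. z \<in> G \<Longrightarrow> \<kappa> * Im z \<le> Re z"
  and L': "1 < L'" "\<And>w. w \<in> UH \<Longrightarrow> mob B w \<in> G \<Longrightarrow> mob B (of_real L' * w) \<in> G"
    "\<And>w. w \<in> UH \<Longrightarrow> mob B w \<in> G \<Longrightarrow> mob B (of_real (1 / L') * w) \<in> G"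
  and \<kappa>': "0 \<le> \<kappa>'" "\<And>w. w \<in> UH \<Longrightarrow> mob B w \<in> G \<Longrightarrow> \<kappa>' * Im w \<le> Re w"
  and p: "p \<in> UH" "Re p < \<kappa> * Im p" "Re (mob (minv B) p) < \<kappa>' * Im (mob (minv B) p)"
 shows "(mB B = 0 \<and> mC B = 0) \<or> (mA B = 0 \<and> mD B = 0)"
proof (rule ccontr)
 assume not: "\<not> ?thesis"
 define a b c d where "a = mA B" and "b = mB B" and "c = mC B" and "d = mD B"
 have det: "a * d - b * c = 1" using sl2_det [of B] by (simp add: a_def b_def c_def d_def)
 define q where "q = (\<lambda>z::complex. - (c * d) * (cmod z)\<^sup>2 + (a * d + b * c) * Re z - a * b)"
 have q: "Re (mob (minv B) z) = q z / (cmod (den (minv B) z))\<^sup>2" if "z \<in> UH" for z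
  unfolding Re_mob [OF that] by (simp add: q_def minv_sel a_def b_def c_def d_def algebra_simps)
 have dpos: "0 < (cmod (den g z))\<^sup>2" if "z \<in> UH" for g z using den_nz [OF that] by simp
 have qI: "(Re (mob (minv B) z) < k * Im (mob (minv B) z)) \<longleftrightarrow> q z < k * Im z"
    "(k * Im (mob (minv B) z) \<le> Re (mob (minv B) z)) \<longleftrightarrow> k * Im z \<le> q z" if "z \<in> UH" for z k
  unfolding q [OF that] Im_mob using dpos [OF that, of "minv B"] by (simp_all add: divide_less_cancel divide_le_cancel)
 have xU: "x \<in> UH" using G by blast
 have xI: "0 < Im x" using xU by simp
 have qG: "\<kappa>' * Im z \<le> q z" if z: "z \<in> G" for z
 proof -
  have zU: "z \<in> UH" using z G by blast
  have "mob B (mob (minv B) z) \<in> G" using z mob_minv(2) [OF zU] by simp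
  from \<kappa>'(2) [OF mob_in_UH [OF zU] this] show ?thesis using qI(2) [OF zU] by simp
 qed
 have scale: "of_real (L ^ n) * z \<in> G" "of_real (1 / L ^ n) * z \<in> G" if "z \<in> G" for z n
 proof -
  show "of_real (L ^ n) * z \<in> G"
  proof (induction n)
   case (Suc n) thus ?case using L(2) by (simp add: mult.assoc)
  qed (use that in simp)
  show "of_real (1 / L ^ n) * z \<in> G"
  proof (induction n)
   case (Suc n) thus ?case using L(3) [OF Suc] by (simp add: mult.assoc)
  qed (use that in simp)
 qed
 have UHscale: "of_real r * z \<in> UH" if "z \<in> UH" "0 < r" for r :: real and z using that by simp
 define y where "y = mob (minv B) x"
 have yU: "y \<in> UH" "mob B y \<in> G" unfolding y_def using mob_in_UH [OF xU] mob_minv(2) [OF xU] G(3) by auto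
 have scale': "mob B (of_real (L' ^ n) * y) \<in> G" "mob B (of_real (1 / L' ^ n) * y) \<in> G" for n
 proof -
  show "mob B (of_real (L' ^ n) * y) \<in> G"
  proof (induction n)
   case (Suc n)
   have "of_real (L' ^ n) * y \<in> UH" using L'(1) yU(1) by (intro UHscale) auto
   from L'(2) [OF this Suc] show ?case by (simp add: mult.assoc)
  qed (use yU in simp)
  show "mob B (of_real (1 / L' ^ n) * y) \<in> G"
  proof (induction n)
   case (Suc n)
   have "of_real (1 / L' ^ n) * y \<in> UH" using L'(1) yU(1) by (intro UHscale) auto
   from L'(3) [OF this Suc] show ?case by (simp add: mult.assoc)
  qed (use yU in simp)
 qed
 have Re0: "0 \<le> Re z" if "z \<in> G" for z
 proof -
  have "0 \<le> \<kappa> * Im z" using \<kappa>(1) that G(2) by (intro mult_nonneg_nonneg) auto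
  thus ?thesis using \<kappa>(2) [OF that] by linarith
 qed
 have ReB: "0 \<le> a * c * (cmod w)\<^sup>2 + (a * d + b * c) * Re w + b * d" if "w \<in> UH" "mob B w \<in> G" for w
  using Re0 [OF that(2)] dpos [OF that(1), of B] unfolding Re_mob [OF that(1)]
  by (simp add: a_def b_def c_def d_def zero_le_divide_iff)
 have q0: "0 \<le> q z" if "z \<in> G" for z
 proof -
  have "0 \<le> \<kappa>' * Im z" using \<kappa>'(1) that G(2) by (intro mult_nonneg_nonneg) auto
  thus ?thesis using qG [OF that] by linarith
 qed
 have n0: "0 < (cmod z)\<^sup>2" if "z \<in> UH" for z using that by auto
 \<comment> \<open>Powers of the invariant dilations let one term of a quadratic dominate, which
   fixes the sign of this product of entries and of the two following ones.\<close>
 have cd: "0 \<le> - (c * d)"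
 proof -
  have "0 \<le> - (c * d) * (cmod x)\<^sup>2"
  proof (rule quadratic_leading_nonneg [OF L(1)])
   fix n
   show "0 \<le> - (c * d) * (cmod x)\<^sup>2 * (L ^ n)\<^sup>2 + (a * d + b * c) * Re x * L ^ n + (- a * b)"
    using q0 [OF scale(1) [OF G(3), of n]] L(1)
    by (simp add: q_def norm_mult norm_power power_mult_distrib algebra_simps)
  qed
  thus ?thesis using n0 [OF xU] by (simp add: mult_le_0_iff zero_le_mult_iff)
 qed
 have ac: "0 \<le> a * c"
 proof -
  have "0 \<le> a * c * (cmod y)\<^sup>2"
  proof (rule quadratic_leading_nonneg [OF L'(1)])
   fix n
   have "of_real (L' ^ n) * y \<in> UH" using L'(1) yU(1) by (intro UHscale) auto
   thus "0 \<le> a * c * (cmod y)\<^sup>2 * (L' ^ n)\<^sup>2 + (a * d + b * c) * Re y * L' ^ n + b * d"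
    using ReB [OF _ scale'(1), of n] L'(1)
    by (simp add: norm_mult norm_power power_mult_distrib algebra_simps)
  qed
  thus ?thesis using n0 [OF yU(1)] by (simp add: mult_le_0_iff zero_le_mult_iff)
 qed
 have bd: "0 \<le> b * d"
 proof (rule quadratic_leading_nonneg [OF L'(1)])
  fix n
  have Ln: "0 < L' ^ n" using L'(1) by simp
  define r where "r = 1 / L' ^ n"
  have r: "0 < r" "r * L' ^ n = 1" using Ln L'(1) by (simp_all add: r_def)
  have "of_real r * y \<in> UH" using r yU(1) by (intro UHscale) auto
  hence "0 \<le> a * c * (r\<^sup>2 * (cmod y)\<^sup>2) + (a * d + b * c) * (r * Re y) + b * d"
   using ReB [of "of_real r * y"] scale'(2) [of n] r unfolding r_def [symmetric]
   by (simp add: norm_mult power_mult_distrib)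
  hence "0 \<le> (a * c * (r\<^sup>2 * (cmod y)\<^sup>2) + (a * d + b * c) * (r * Re y) + b * d) * (L' ^ n)\<^sup>2" by simp
  also have "\<dots> = a * c * (cmod y)\<^sup>2 * (r * L' ^ n)\<^sup>2 + (a * d + b * c) * Re y * (r * L' ^ n) * L' ^ n + b * d * (L' ^ n)\<^sup>2"
   by (simp add: algebra_simps power2_eq_square)
  finally show "0 \<le> b * d * (L' ^ n)\<^sup>2 + (a * d + b * c) * Re y * L' ^ n + a * c * (cmod y)\<^sup>2"
   unfolding r(2) by simp
 qed
 \<comment> \<open>The roots are the ends \<open>a / c\<close> and \<open>b / d\<close> of the
   second axis. The signs just found make them nonnegative, and by \<open>not\<close> one of them is
   finite and positive.\<close>
 have "\<exists>u>0. - (c * d) * u\<^sup>2 + (a * d + b * c) * u - a * b = 0"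
 proof (cases "a \<noteq> 0 \<and> c \<noteq> 0")
  case True
  have "0 < a * c" using ac True by (simp add: less_le)
  hence "0 < a / c" by (simp add: zero_less_mult_iff zero_less_divide_iff)
  moreover have "- (c * d) * (a / c)\<^sup>2 + (a * d + b * c) * (a / c) - a * b = 0"
   using True by (simp add: field_simps power2_eq_square)
  ultimately show ?thesis by blast
 next
  case False
  have "b \<noteq> 0" "d \<noteq> 0" using not det False by (auto simp: a_def b_def c_def d_def)
  hence "0 < b * d" using bd by (simp add: less_le)
  hence "0 < b / d" by (simp add: zero_less_mult_iff zero_less_divide_iff)
  moreover have "- (c * d) * (b / d)\<^sup>2 + (a * d + b * c) * (b / d) - a * b = 0"
   using \<open>d \<noteq> 0\<close> by (simp add: field_simps power2_eq_square)
  ultimately show ?thesis by blast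
 qed
 then obtain u where u: "0 < u" "- (c * d) * u\<^sup>2 + (a * d + b * c) * u - a * b = 0" by blast
 define f where "f = (\<lambda>z. Im ((z - of_real u) * cnj (p - of_real u)))"
 have fr: "f (of_real r * x) = u * Im p - r * (Re x * Im p - Im x * (Re p - u))" for r
  by (simp add: f_def algebra_simps)
 have pI: "0 < Im p" using p by simp
 define \<Delta> where "\<Delta> = Re x * Im p - Im x * (Re p - u)"
 have \<Delta>: "0 < \<Delta>"
 proof -
  have "Im x * Re p \<le> Im x * (\<kappa> * Im p)" using p(2) xI by (intro mult_left_mono) auto
  also have "\<dots> = \<kappa> * Im x * Im p" by simp
  also have "\<dots> \<le> Re x * Im p" using \<kappa>(2) [OF G(3)] pI by (intro mult_right_mono) auto
  finally have "Im x * Re p \<le> Re x * Im p" .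
  moreover have "0 < Im x * u" using xI u by simp
  ultimately show ?thesis by (simp add: \<Delta>_def algebra_simps)
 qed
 obtain n where n: "u * Im p / \<Delta> < L ^ n" using real_arch_pow [OF L(1)] by blast
 obtain m where m: "\<Delta> / (u * Im p) < L ^ m" using real_arch_pow [OF L(1)] by blast
 show False
 proof (rule line_separation [OF G(1,2), where al = 1 and \<beta> = "- \<kappa>" and \<gamma> = 0 and u = u and p = p
   and x = "of_real (1 / L ^ m) * x" and y = "of_real (L ^ n) * x"])
  show "0 < Im ((of_real (1 / L ^ m) * x - of_real u) * cnj (p - of_real u))"
   using fr [of "1 / L ^ m"] m L(1) u pI unfolding \<Delta>_def [symmetric] f_def by (simp add: field_simps)
  show "Im ((of_real (L ^ n) * x - of_real u) * cnj (p - of_real u)) < 0"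
   using fr [of "L ^ n"] n \<Delta> unfolding \<Delta>_def [symmetric] f_def by (simp add: field_simps)
  fix l :: real assume l: "0 < l" "l < 1"
  define z where "z = of_real u + of_real l * (p - of_real u)"
  have zU: "z \<in> UH" using l pI by (simp add: z_def)
  define al where "al = - (c * d) * ((Re p - u)\<^sup>2 + (Im p)\<^sup>2)"
  have al: "0 \<le> al" unfolding al_def using cd by (intro mult_nonneg_nonneg) auto
  \<comment> \<open>Along the segment the function defining the second region is convex, 0 at
    \<open>u\<close> and negative at \<open>p\<close>; so it is negative in between.\<close>
  have "q z - \<kappa>' * Im z = (1 - l) * (- (c * d) * u\<^sup>2 + (a * d + b * c) * u - a * b)
    + l * (q p - \<kappa>' * Im p) - l * (1 - l) * al"
   unfolding q_def al_def z_def cmod_power2 by (simp add: algebra_simps power2_eq_square)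
  also have "\<dots> = l * (q p - \<kappa>' * Im p) - l * (1 - l) * al" unfolding u(2) by simp
  also have "\<dots> < 0"
  proof -
   have "l * (q p - \<kappa>' * Im p) < 0" using p(3) l unfolding qI(1) [OF p(1)] by (simp add: mult_less_0_iff)
   moreover have "0 \<le> l * (1 - l) * al" using l al by simp
   ultimately show ?thesis by linarith
  qed
  finally have "\<not> \<kappa>' * Im z \<le> q z" by simp
  thus "of_real u + of_real l * (p - of_real u) \<notin> G" using qG unfolding z_def by blast
 qed (use p u \<kappa>(2) scale [OF G(3)] in \<open>auto simp del: of_real_power of_real_divide\<close>)
qed

text \<open>The signed hyperbolic distance from the imaginary axis.\<close>

definition axis_dist :: "complex \<Rightarrow> real" where
 "axis_dist z = arsinh (Re z / Im z)"

lemma axis_dist_cosh: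
 assumes "z \<in> UH" shows "cosh (axis_dist z) = cmod z / Im z" "sinh (axis_dist z) = Re z / Im z"
proof -
 have I: "0 < Im z" using assms by simp
 show s: "sinh (axis_dist z) = Re z / Im z" by (simp add: axis_dist_def)
 have "(cosh (axis_dist z))\<^sup>2 = 1 + (Re z / Im z)\<^sup>2" using s by (simp add: cosh_square_eq)
 also have "\<dots> = (cmod z / Im z)\<^sup>2" using I by (simp add: power_divide cmod_power2 field_simps)
 finally show "cosh (axis_dist z) = cmod z / Im z" using I by (simp add: power2_eq_iff_nonneg)
qed

lemma cosh_hdist_axis:
 assumes "z \<in> UH" "w \<in> UH"
 shows "cosh (hdist z w) = cosh (axis_dist z - axis_dist w) + (cmod z - cmod w)\<^sup>2 / (2 * Im z * Im w)"
proof -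
 have I: "0 < Im z" "0 < Im w" using assms by auto
 have N: "(cmod (z - w))\<^sup>2 = (cmod z)\<^sup>2 + (cmod w)\<^sup>2 - 2 * (Re z * Re w) - 2 * (Im z * Im w)"
  unfolding cmod_power2 by (simp add: algebra_simps power2_eq_square)
 show ?thesis
  unfolding cosh_hdist [OF assms] N cosh_diff axis_dist_cosh [OF assms(1)] axis_dist_cosh [OF assms(2)]
  using I by (simp add: field_simps power2_eq_square)
qed

lemma axis_dist_le:
 assumes "z \<in> UH" "w \<in> UH"
 shows "\<bar>axis_dist z - axis_dist w\<bar> \<le> hdist z w"
proof -
 have I: "0 < Im z" "0 < Im w" using assms by auto
 have "cosh (axis_dist z - axis_dist w) \<le> cosh (hdist z w)" unfolding cosh_hdist_axis [OF assms] using I by simp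
 hence "cosh \<bar>axis_dist z - axis_dist w\<bar> \<le> cosh (hdist z w)" by simp
 thus ?thesis using hdist_nonneg [of z w] cosh_real_nonneg_le_iff assms by (metis abs_ge_zero)
qed

text \<open>The point moves on the circle about 0 through \<open>z\<close>, which is the geodesic
  perpendicular to the axis.\<close>

lemma axis_dist_move:
 assumes z: "z \<in> UH"
 obtains w where "w \<in> UH" "axis_dist w = u" "hdist w z = \<bar>u - axis_dist z\<bar>"
proof -
 define w where "w = Complex (cmod z * tanh u) (cmod z / cosh u)"
 have z0: "0 < cmod z" using z by auto
 have wU: "w \<in> UH" using z0 by (simp add: w_def)
 have cu: "cosh u \<noteq> 0" using cosh_real_pos [of u] by linarith
 have "Re w / Im w = sinh u" using z0 cu by (simp add: w_def tanh_def)
 hence u: "axis_dist w = u" by (simp add: axis_dist_def arsinh_sinh_real)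
 have "(cmod w)\<^sup>2 = (cmod z)\<^sup>2 * (((sinh u)\<^sup>2 + 1) / (cosh u)\<^sup>2)"
  using cu by (simp add: w_def cmod_power2 tanh_def power_mult_distrib power_divide field_simps)
 also have "\<dots> = (cmod z)\<^sup>2" using cu by (simp flip: cosh_square_eq)
 finally have "cmod w = cmod z" by (simp add: power2_eq_iff_nonneg)
 hence "cosh (hdist w z) = cosh \<bar>u - axis_dist z\<bar>" unfolding cosh_hdist_axis [OF wU z] u by simp
 hence "hdist w z = \<bar>u - axis_dist z\<bar>" using hdist_nonneg [of w z] wU z
  by (metis abs_ge_zero cosh_real_nonneg_le_iff order_antisym order_refl)
 thus ?thesis using that wU u by blast
qed

lemma axis_dist_less_iff: "z \<in> UH \<Longrightarrow> axis_dist z < u \<longleftrightarrow> Re z < sinh u * Im z"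
 using sinh_real_less_iff [of "axis_dist z" u] axis_dist_cosh(2) [of z] by (simp add: pos_divide_less_eq)

lemma mob_Dg': "mob (Dg v) z = of_real (exp v) * z" by simp

lemma Dg_conj_diag:
 assumes "mB B = 0" "mC B = 0" shows "trl B v = Dg v"
proof -
 have "mA B * mD B = 1" using sl2_det [of B] assms by simp
 thus ?thesis by (intro sl2_eqI) (use assms in \<open>simp_all add: sl2_sel algebra_simps\<close>)
qed

lemma Dg_conj_antidiag:
 assumes "mA B = 0" "mD B = 0" shows "trl B v = minv (Dg v)"
proof -
 have "mB B * mC B = - 1" using sl2_det [of B] assms by simp
 hence *: "mB B * (x * mC B) = - x" "mC B * (x * mB B) = - x" for x
  by (metis mult.assoc mult.commute mult_minus1)+
 show ?thesis by (intro sl2_eqI) (use assms in \<open>simp_all add: sl2_sel mult.assoc *\<close>)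
qed

text \<open>If an axis meets the preimage of the core, the injectivity radius of the core bounds the
  translation. If it misses the preimage, the latter is on one side by connectedness, and the
  argument for cusps applies with hypercycle regions: up to deck transformations there are finitely
  many such axes, each with a least translation.\<close>

theorem systole:
 assumes hc: "hyp_cover X pr" and ft: "finite_type X"
 obtains rh where "0 < rh" "\<And>N v. 0 < v \<Longrightarrow> deck pr (trl N v) \<Longrightarrow> rh \<le> v"
proof -
 interpret hyp_cover X pr by fact
 obtain K where K: "compact K" "K \<subseteq> UH" "K \<noteq> {}" "connected {z \<in> UH. pr z \<in> pr ` K}"
  by (rule compact_core [OF ft])
 obtain r where r: "0 < r" "\<And>z g. z \<in> K \<Longrightarrow> deck pr g \<Longrightarrow> hdist z (mob g z) < r \<Longrightarrow> g = 1 \<or> g = - 1"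
  by (rule inj_radius_compact [OF K(1,2)]) blast
 define G where "G = (\<lambda>N. {z \<in> UH. pr (mob N z) \<in> pr ` K})"
 define hyp where "hyp = (\<lambda>N. \<exists>v>0. deck pr (trl N v))"
 define P where "P = {N. hyp N \<and> (\<forall>z\<in>G N. 0 \<le> Re z) \<and> (\<exists>x\<in>UH. mob N x \<in> K \<and> (\<forall>z\<in>G N. axis_dist x \<le> axis_dist z + 1/2))}"
 have Gconn: "connected (G N)" for N unfolding G_def by (rule connected_core_frame [OF K(4)])
 have GUH: "G N \<subseteq> UH" for N by (auto simp: G_def)
 have Gne: "G N \<noteq> {}" for N
 proof -
  obtain k where k: "k \<in> K" "k \<in> UH" using K(2,3) by blast
  hence "mob (minv N) k \<in> G N" using mob_in_UH [OF k(2)] mob_minv(2) [OF k(2)] by (simp add: G_def)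
  thus ?thesis by blast
 qed
 have Gdeck: "G (g * N) = G N" if "deck pr g" for g N
  unfolding G_def using deckD [OF that mob_in_UH] by (auto simp: mob_mult simp del: UH_iff)
 have Gscale: "of_real (exp v) * z \<in> G N" if "deck pr (trl N v)" "z \<in> G N" for N v z
 proof -
  have zU: "z \<in> UH" using that GUH by blast
  have "mob (trl N v) (mob N z) = mob (N * Dg v * minv N * N) z" by (rule mob_mult [OF zU, symmetric])
  also have "N * Dg v * minv N * N = N * Dg v" by (simp add: mult.assoc)
  also have "mob (N * Dg v) z = mob N (of_real (exp v) * z)" unfolding mob_mult [OF zU] mob_Dg' ..
  finally have "pr (mob N (of_real (exp v) * z)) = pr (mob N z)" using deckD [OF that(1) mob_in_UH [OF zU]] by metis
  thus ?thesis using that(2) by (simp add: G_def)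
 qed
 have Gscale': "of_real (1 / exp v) * z \<in> G N" if "deck pr (trl N v)" "z \<in> G N" for N v z
 proof -
  have "minv (trl N v) = trl N (- v)" by (simp add: minv_mult mult.assoc)
  hence "deck pr (trl N (- v))" using deck_minv [OF that(1)] by metis
  from Gscale [OF this that(2)] show ?thesis by (simp add: exp_minus divide_inverse)
 qed
 have red: "\<exists>g. deck pr g \<and> g * N \<in> P" if N: "hyp N" "\<And>z. z \<in> G N \<Longrightarrow> 0 \<le> Re z" for N
 proof -
  \<comment> \<open>A point within 1/2 of the infimum takes the place of the highest point used for
    cusps.\<close>
  define \<iota> where "\<iota> = (INF z\<in>G N. axis_dist z)"
  have "0 \<le> axis_dist z" if "z \<in> G N" for z using axis_dist_less_iff [of z 0] N(2) [OF that] that GUH by fastforce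
  hence bb: "bdd_below (axis_dist ` G N)" by (intro bdd_belowI [of _ 0]) auto
  have "\<iota> < \<iota> + 1/2" by simp
  then obtain x where x: "x \<in> G N" "axis_dist x < \<iota> + 1/2"
   using cINF_less_iff [OF Gne bb, of "\<iota> + 1/2"] by (auto simp: \<iota>_def)
  have min: "axis_dist x \<le> axis_dist z + 1/2" if "z \<in> G N" for z
   using cINF_lower [OF bb that] x(2) by (simp add: \<iota>_def)
  have xU: "x \<in> UH" using x GUH by blast
  obtain k where k: "k \<in> K" "pr (mob N x) = pr k" using x by (auto simp: G_def)
  have kU: "k \<in> UH" using k K by blast
  obtain g where g: "deck pr g" "mob g (mob N x) = k" using deck_trans [OF mob_in_UH [OF xU] kU k(2)] by blast
  obtain v where v: "0 < v" "deck pr (trl N v)" using N(1) by (auto simp: hyp_def)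
  have "g * N * Dg v * minv (g * N) = g * (trl N v) * minv g" by (simp add: minv_mult mult.assoc)
  hence "hyp (g * N)" unfolding hyp_def using v deck_mult [OF deck_mult [OF g(1) v(2)] deck_minv [OF g(1)]] by metis
  moreover have "mob (g * N) x \<in> K" unfolding mob_mult [OF xU] using g k by simp
  ultimately have "g * N \<in> P" unfolding P_def mem_Collect_eq Gdeck [OF g(1)]
   using N(2) min xU by (intro conjI bexI [of _ x] ballI) simp_all
  thus ?thesis using g(1) by blast
 qed
 have "\<forall>N\<in>P. \<exists>x. x\<in>UH \<and> mob N x \<in> K \<and> (\<forall>z\<in>G N. axis_dist x \<le> axis_dist z + 1/2)" by (auto simp: P_def)
 then obtain xx where xx: "\<And>N. N \<in> P \<Longrightarrow> xx N \<in> UH" "\<And>N. N \<in> P \<Longrightarrow> mob N (xx N) \<in> K"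
   "\<And>N z. N \<in> P \<Longrightarrow> z \<in> G N \<Longrightarrow> axis_dist (xx N) \<le> axis_dist z + 1/2" by metis
 \<comment> \<open>Points at distance less than 1 from this witness have signed distance below that
   of \<open>xx N\<close> minus 1, whereas the preimage of the core stays above that of
   \<open>xx N\<close> minus 1/2.\<close>
 have "\<forall>N\<in>P. \<exists>y. y \<in> UH \<and> axis_dist y = axis_dist (xx N) - 2 \<and> hdist y (xx N) = 2"
 proof
  fix N assume "N \<in> P"
  from axis_dist_move [OF xx(1) [OF this], of "axis_dist (xx N) - 2"]
  show "\<exists>y. y \<in> UH \<and> axis_dist y = axis_dist (xx N) - 2 \<and> hdist y (xx N) = 2" by fastforce
 qed
 then obtain yy where yy: "\<And>N. N \<in> P \<Longrightarrow> yy N \<in> UH" "\<And>N. N \<in> P \<Longrightarrow> axis_dist (yy N) = axis_dist (xx N) - 2"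
  "\<And>N. N \<in> P \<Longrightarrow> hdist (yy N) (xx N) = 2" by metis
 \<comment> \<open>A diagonal or antidiagonal transition matrix means the same axis, possibly
   reversed.\<close>
 define R where "R = (\<lambda>M N. let B = minv M * N in (mB B = 0 \<and> mC B = 0) \<or> (mA B = 0 \<and> mD B = 0))"
 obtain F where F: "finite F" "F \<subseteq> P" "\<And>M. M \<in> P \<Longrightarrow> \<exists>N\<in>F. R M N"
 proof (rule finite_frames [OF K(1,2) xx(1,2) yy(1), where R = R])
  show "hdist (yy M) (xx M) \<le> 2" if "M \<in> P" for M using yy(3) [OF that] by simp
  show "R M N" if M: "M \<in> P" and N: "N \<in> P" and pU: "p \<in> UH" and dp: "hdist p (yy M) < 1"
   and pN': "mob (minv (minv M * N)) p = yy N" for M N p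
  proof -
   define B where "B = minv M * N"
   have MB: "M * B = N" by (simp add: B_def)
   have pN: "mob (minv B) p = yy N" using pN' by (simp add: B_def)
   obtain v where v: "0 < v" "deck pr (trl M v)" using M by (auto simp: P_def hyp_def)
   obtain v' where v': "0 < v'" "deck pr (trl N v')" using N by (auto simp: P_def hyp_def)
   define \<iota> where "\<iota> = (\<lambda>N. max 0 (axis_dist (xx N) - 1/2))"
   have lower: "sinh (\<iota> N) * Im z \<le> Re z" if N: "N \<in> P" and z: "z \<in> G N" for N z
   proof -
    have "0 \<le> Re z" using N z by (auto simp: P_def)
    have zU: "z \<in> UH" using z GUH by blast
    have "\<not> axis_dist z < 0" using axis_dist_less_iff [OF zU, of 0] \<open>0 \<le> Re z\<close> by simp
    hence "\<not> axis_dist z < \<iota> N" using xx(3) [OF N z] by (auto simp: \<iota>_def)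
    thus ?thesis using axis_dist_less_iff [OF zU] by simp
   qed
   have \<iota>0: "0 \<le> sinh (\<iota> N)" for N by (simp add: \<iota>_def)
   have upM: "axis_dist p < \<iota> M" using axis_dist_le [OF pU yy(1) [OF M]] dp yy(2) [OF M] by (simp add: \<iota>_def)
   have upN: "axis_dist (mob (minv B) p) < \<iota> N" unfolding pN using yy(2) [OF N] by (simp add: \<iota>_def)
   have GB: "mob B w \<in> G M \<longleftrightarrow> w \<in> G N" if "w \<in> UH" for w
    unfolding G_def using that mob_in_UH [OF that, of B] mob_mult [OF that, of M B] by (simp add: MB del: UH_iff)
   obtain x where x: "x \<in> G M" using Gne by blast
   have "(mB B = 0 \<and> mC B = 0) \<or> (mA B = 0 \<and> mD B = 0)"
   proof (rule hypercycle_separation [OF Gconn GUH x _ Gscale [OF v(2)] Gscale' [OF v(2)] \<iota>0 lower [OF M] _ _ _ \<iota>0 _ pU])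
    show "mob B (of_real (exp v') * w) \<in> G M" if "w \<in> UH" "mob B w \<in> G M" for w
     using Gscale [OF v'(2), of w] that GB by (subst GB) auto
    show "mob B (of_real (1 / exp v') * w) \<in> G M" if "w \<in> UH" "mob B w \<in> G M" for w
     using Gscale' [OF v'(2), of w] that GB by (subst GB) auto
    show "sinh (\<iota> N) * Im w \<le> Re w" if "w \<in> UH" "mob B w \<in> G M" for w
     using lower [OF N] that GB by blast
    show "Re p < sinh (\<iota> M) * Im p" using upM axis_dist_less_iff [OF pU] by simp
    show "Re (mob (minv B) p) < sinh (\<iota> N) * Im (mob (minv B) p)"
     using upN axis_dist_less_iff [OF mob_in_UH [OF pU]] by simp
   qed (use v v' in auto)
   thus ?thesis by (simp add: R_def B_def Let_def)
  qed
 qed auto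
 have "\<forall>N\<in>F. \<exists>m>0. \<forall>w>0. deck pr (trl N w) \<longrightarrow> m \<le> w"
 proof
  fix N assume "N \<in> F"
  then obtain v where v: "0 < v" "deck pr (trl N v)" using F(2) by (auto simp: P_def hyp_def)
  have v0: "v \<noteq> 0" using v by simp
  obtain m where m: "0 < m" "\<And>w. deck pr (trl N w) \<Longrightarrow> \<exists>n::int. w = of_int n * m"
   by (rule deck_axis_discrete [OF v0 v(2)]) blast
  have "m \<le> w" if w: "0 < w" "deck pr (trl N w)" for w
  proof -
   obtain n :: int where n: "w = of_int n * m" using m(2) [OF w(2)] by blast
   hence "0 < n" using that(1) m(1) by (simp add: zero_less_mult_iff)
   hence "1 \<le> real_of_int n" by linarith
   thus ?thesis using n m(1) by simp
  qed
  thus "\<exists>m>0. \<forall>w>0. deck pr (trl N w) \<longrightarrow> m \<le> w" using m(1) by blast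
 qed
 then obtain mm where mm: "\<And>N. N \<in> F \<Longrightarrow> 0 < mm N" "\<And>N w. N \<in> F \<Longrightarrow> 0 < w \<Longrightarrow> deck pr (trl N w) \<Longrightarrow> mm N \<le> w"
  by metis
 define rh where "rh = Min (insert r (mm ` F))"
 have rh: "0 < rh" "rh \<le> r" "\<And>N. N \<in> F \<Longrightarrow> rh \<le> mm N" using F(1) r(1) mm(1) by (auto simp: rh_def)
 have oneside: "rh \<le> v" if v: "0 < v" "deck pr (trl N v)" and side: "\<And>z. z \<in> G N \<Longrightarrow> 0 \<le> Re z" for N v
 proof -
  have "hyp N" using v by (auto simp: hyp_def)
  then obtain g where g: "deck pr g" "g * N \<in> P" using red side by blast
  obtain N' where N': "N' \<in> F" "R (g * N) N'" using F(3) [OF g(2)] by blast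
  define B where "B = minv (g * N) * N'"
  have NB: "N' = g * N * B" by (simp add: B_def)
  have B: "(mB B = 0 \<and> mC B = 0) \<or> (mA B = 0 \<and> mD B = 0)" using N'(2) by (simp add: R_def B_def Let_def)
  have dk: "deck pr (g * (trl N v) * minv g)" by (intro deck_mult g(1) v(2) deck_minv)
  have c1: "trl N' v = g * N * (trl B v) * minv N * minv g"
   by (simp add: NB minv_mult mult.assoc)
  have "deck pr (trl N' v)"
   using B
  proof
   assume "mB B = 0 \<and> mC B = 0"
   hence "trl N' v = g * (trl N v) * minv g" unfolding c1 using Dg_conj_diag by (simp add: mult.assoc)
   thus ?thesis using dk by metis
  next
   assume "mA B = 0 \<and> mD B = 0"
   hence "trl N' v = minv (g * (trl N v) * minv g)" unfolding c1 using Dg_conj_antidiag by (simp add: minv_mult mult.assoc)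
   thus ?thesis using deck_minv [OF dk] by metis
  qed
  hence "mm N' \<le> v" using mm(2) [OF N'(1) v(1)] by blast
  thus ?thesis using rh(3) [OF N'(1)] by linarith
 qed
 have "rh \<le> v" if v: "0 < v" "deck pr (trl N v)" for N v
 proof (cases "\<exists>z\<in>G N. Re z = 0")
  case True
  then obtain z where z: "z \<in> G N" "Re z = 0" by blast
  have zU: "z \<in> UH" using z GUH by blast
  have zI: "0 < Im z" using zU by simp
  obtain k where k: "k \<in> K" "pr (mob N z) = pr k" using z by (auto simp: G_def)
  have kU: "k \<in> UH" using k K by blast
  obtain g where g: "deck pr g" "mob g (mob N z) = k" using deck_trans [OF mob_in_UH [OF zU] kU k(2)] by blast
  define h where "h = g * (trl N v) * minv g"
  have h: "deck pr h" unfolding h_def by (intro deck_mult g(1) v(2) deck_minv)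
  have kz: "k = mob (g * N) z" using g(2) mob_mult [OF zU] by simp
  have "mob h k = mob (h * (g * N)) z" unfolding kz by (rule mob_mult [OF zU, symmetric])
  also have "h * (g * N) = (g * N) * Dg v" by (simp add: h_def mult.assoc)
  finally have hk: "mob h k = mob (g * N) (mob (Dg v) z)" by (simp only: mob_mult [OF zU])
  have z': "z = \<i> * of_real (Im z)" "mob (Dg v) z = \<i> * of_real (exp v * Im z)" using z(2) by (auto simp: complex_eq_iff)
  have "hdist k (mob h k) = hdist z (mob (Dg v) z)" unfolding hk unfolding kz by (rule hdist_mob [OF zU mob_in_UH [OF zU]])
  also have "\<dots> = \<bar>ln (Im z) - ln (exp v * Im z)\<bar>"
   unfolding z'(2) by (subst z'(1)) (rule hdist_iaxis, use zI in simp_all)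
  also have "\<dots> = v" using zI v(1) by (simp add: ln_mult)
  finally have dist: "hdist k (mob h k) = v" .
  have "\<not> v < r"
  proof
   assume "v < r"
   hence "h = 1 \<or> h = - 1" using r(2) [OF k(1) h] dist by simp
   hence "mob h k = k" by auto
   hence "hdist k (mob h k) = 0" using hdist_refl kU by simp
   thus False using dist v(1) by simp
  qed
  thus ?thesis using rh(2) by linarith
 next
  case False
  have int: "is_interval (Re ` G N)"
   unfolding is_interval_connected_1
   by (rule connected_continuous_image [OF continuous_on_Re [OF continuous_on_id] Gconn, simplified])
  have "(\<forall>z\<in>G N. 0 \<le> Re z) \<or> (\<forall>z\<in>G N. Re z \<le> 0)"
  proof (rule ccontr)
   assume "\<not> ?thesis"
   then obtain z w where "z \<in> G N" "w \<in> G N" "Re z \<le> 0" "0 \<le> Re w" by force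
   hence "0 \<in> Re ` G N" using int unfolding is_interval_1 by blast
   thus False using False by auto
  qed
  thus ?thesis
  proof
   assume "\<forall>z\<in>G N. 0 \<le> Re z" thus ?thesis using oneside [OF v] by blast
  next
   assume neg: "\<forall>z\<in>G N. Re z \<le> 0"
   \<comment> \<open>The half-turn exchanges the two sides of the axis and inverts the
     translation.\<close>
   have S: "trl Sm v = minv (Dg v)" by (rule Dg_conj_antidiag) (simp_all add: Sm_sel)
   have "N * Sm * Dg v * minv (N * Sm) = N * (trl Sm v) * minv N" by (simp add: minv_mult mult.assoc)
   also have "\<dots> = minv (trl N v)" unfolding S by (simp add: minv_mult mult.assoc)
   finally have d: "deck pr (N * Sm * Dg v * minv (N * Sm))" using deck_minv [OF v(2)] by metis
   show ?thesis
   proof (rule oneside [OF v(1) d])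
    fix z assume z: "z \<in> G (N * Sm)"
    have zU: "z \<in> UH" using z GUH by blast
    have "mob Sm z \<in> G N" using z mob_in_UH [OF zU] by (simp add: G_def mob_mult [OF zU] del: UH_iff)
    hence "Re (mob Sm z) \<le> 0" using neg by blast
    moreover have "Re (mob Sm z) = - Re z / (cmod (den Sm z))\<^sup>2" unfolding Re_mob [OF zU] by (simp add: Sm_sel)
    moreover have "0 < (cmod (den Sm z))\<^sup>2" using den_nz [OF zU] by simp
    ultimately show "0 \<le> Re z" by (simp only: divide_le_0_iff) linarith
   qed
  qed
 qed
 thus ?thesis using that rh(1) by blast
qed

section \<open>Hyperbolic elements and their displacement\<close>

lemma diagonalize:
 assumes "2 < trc g"
 obtains N v where "0 < v" "g = trl N v"
proof -
 have main: "\<exists>N v. 0 < v \<and> g = trl N v" if t: "2 < trc g" and c: "mC g \<noteq> 0" for g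
 proof -
  define t where "t = trc g"
  define v where "v = 2 * arcosh (t / 2)"
  have t2: "2 < t" using t by (simp add: t_def)
  have v: "0 < v" using t2 by (simp add: v_def)
  define x y where "x = exp (v / 2)" and "y = exp (- (v / 2))"
  have xy: "x * y = 1" by (simp add: x_def y_def exp_minus)
  have "cosh (v / 2) = t / 2" using t2 by (simp add: v_def)
  hence xyt: "x + y = t" by (simp add: cosh_def x_def y_def)
  have "y < x" using v by (simp add: x_def y_def)
  hence D: "mC g * (x - y) \<noteq> 0" using c by simp
  define D where "D = mC g * (x - y)"
  have D0: "D \<noteq> 0" using D by (simp add: D_def)
  \<comment> \<open>The columns are eigenvectors for \<open>x\<close> and \<open>y\<close>; the
    division by \<open>D\<close> makes the determinant 1.\<close>
  define N where "N = mk (x - mD g) ((y - mD g) / D) (mC g) (mC g / D)"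
  have det: "(x - mD g) * (mC g / D) - (y - mD g) / D * mC g = 1"
   using D0 by (simp add: divide_simps) (simp add: D_def algebra_simps)
  note sel = mk_sel [OF det, folded N_def]
  have a: "mA g = x + y - mD g" using xyt by (simp add: t_def trc_def)
  have bc: "mB g * mC g = mA g * mD g - 1" using sl2_det [of g] by simp
  have "g * N = N * Dg v"
  proof (rule sl2_eqI)
   show "mA (g * N) = mA (N * Dg v)" unfolding sl2_sel sel x_def [symmetric] y_def [symmetric]
    using bc xy unfolding a by (simp add: algebra_simps)
   show "mC (g * N) = mC (N * Dg v)" unfolding sl2_sel sel x_def [symmetric] y_def [symmetric]
    by (simp add: algebra_simps)
   show "mD (g * N) = mD (N * Dg v)" unfolding sl2_sel sel x_def [symmetric] y_def [symmetric]
    using D0 by (simp add: field_simps)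
   have "mA g * (y - mD g) + mB g * mC g = (y - mD g) * y" using bc xy unfolding a by (simp add: algebra_simps)
   hence "(mA g * (y - mD g) + mB g * mC g) / D = (y - mD g) * y / D" by simp
   thus "mB (g * N) = mB (N * Dg v)" unfolding sl2_sel sel x_def [symmetric] y_def [symmetric]
    by (simp add: add_divide_distrib)
  qed
  hence "g * N * minv N = trl N v" by simp
  hence "g = trl N v" by (simp add: mult.assoc)
  thus ?thesis using v by blast
 qed
 have "\<exists>N v. 0 < v \<and> g = trl N v"
 proof (cases "mC g = 0")
  case False thus ?thesis using main assms by blast
 next
  case True
  have conj: ?thesis if Q: "mC (Q * g * minv Q) \<noteq> 0" for Q
  proof -
   have "2 < trc (Q * g * minv Q)" using assms by (simp add: trc_conj')
   then obtain N v where N: "0 < v" "Q * g * minv Q = trl N v" using main Q by blast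
   have "g = minv Q * (Q * g * minv Q) * Q" by (simp add: mult.assoc)
   also have "\<dots> = (minv Q * N) * Dg v * minv (minv Q * N)" unfolding N(2) by (simp add: minv_mult mult.assoc)
   finally show ?thesis using N(1) by blast
  qed
  show ?thesis
  proof (cases "mB g = 0")
   case False
   hence "mC (Sm * g * minv Sm) \<noteq> 0" using True by (simp add: sl2_sel Sm_sel)
   thus ?thesis by (rule conj)
  next
   case B: True
   define Q where "Q = mk 1 0 1 1"
   have Q: "mA Q = 1" "mB Q = 0" "mC Q = 1" "mD Q = 1" unfolding Q_def by (rule mk_sel; simp)+
   have ad: "mA g * mD g = 1" using sl2_det [of g] True by simp
   have "mA g \<noteq> mD g"
   proof
    assume eq: "mA g = mD g"
    hence "mA g * mA g = 1" "2 < mA g + mA g" using ad assms by (simp_all add: trc_def)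
    hence "1 < mA g" by simp
    hence "1 * 1 < mA g * mA g" by (intro mult_strict_mono) auto
    thus False using \<open>mA g * mA g = 1\<close> by simp
   qed
   hence "mC (Q * g * minv Q) \<noteq> 0" using True B by (simp add: sl2_sel Q)
   thus ?thesis by (rule conj)
  qed
 qed
 thus ?thesis using that by blast
qed

lemma displacement_Dg:
 assumes "0 < v" "z \<in> UH"
 shows "v \<le> hdist z (mob (trl N v) z)"
proof -
 define w where "w = mob (minv N) z"
 have w: "w \<in> UH" "mob N w = z" unfolding w_def using mob_in_UH [OF assms(2)] mob_minv(2) [OF assms(2)] by auto
 have wI: "0 < Im w" using w by simp
 have "mob (trl N v) z = mob (N * Dg v * minv N * N) w" using mob_mult [OF w(1)] w(2) by metis
 also have "N * Dg v * minv N * N = N * Dg v" by (simp add: mult.assoc)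
 finally have "mob (trl N v) z = mob N (mob (Dg v) w)" by (simp only: mob_mult [OF w(1)])
 hence "hdist z (mob (trl N v) z) = hdist w (mob (Dg v) w)"
  using hdist_mob [OF w(1) mob_in_UH [OF w(1)], of N "Dg v"] w(2) by simp
 moreover have "\<bar>ln (Im w) - ln (Im (mob (Dg v) w))\<bar> = v" using wI assms(1) by (simp add: ln_mult)
 ultimately show ?thesis using ln_Im_le_hdist [OF w(1) mob_in_UH [OF w(1)], of "Dg v"] by simp
qed

text \<open>An element with any other trace is, up to sign, a translation along an axis, and it
  moves each point at least by its translation length.\<close>

corollary displacement_hyperbolic:
 assumes hc: "hyp_cover X pr" and ft: "finite_type X"
 obtains rh where "0 < rh" "\<And>g z. deck pr g \<Longrightarrow> \<bar>trc g\<bar> \<noteq> 2 \<Longrightarrow> z \<in> UH \<Longrightarrow> rh \<le> hdist z (mob g z)"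
proof -
 interpret hyp_cover X pr by fact
 obtain rh where rh: "0 < rh" "\<And>N v. 0 < v \<Longrightarrow> deck pr (trl N v) \<Longrightarrow> rh \<le> v"
  by (rule systole [OF hc ft]) blast
 have pos: "rh \<le> hdist z (mob g z)" if g: "deck pr g" "2 < trc g" and z: "z \<in> UH" for g z
 proof -
  obtain N v where N: "0 < v" "g = trl N v" by (rule diagonalize [OF g(2)])
  have "rh \<le> v" using rh(2) [OF N(1)] g(1) N(2) by simp
  also have "v \<le> hdist z (mob g z)" unfolding N(2) by (rule displacement_Dg [OF N(1) z])
  finally show ?thesis .
 qed
 show ?thesis
 proof (rule that [OF rh(1)])
  fix g z assume g: "deck pr g" "\<bar>trc g\<bar> \<noteq> 2" and z: "z \<in> UH"
  have "2 \<le> \<bar>trc g\<bar>" by (rule deck_trace [OF g(1)])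
  then consider "2 < trc g" | "2 < trc (- g)" using g(2) by (simp add: trc_def sl2_sel) linarith
  thus "rh \<le> hdist z (mob g z)"
  proof cases
   case 1 thus ?thesis using pos g z by blast
  next
   case 2
   hence "rh \<le> hdist z (mob (- g) z)" using pos [of "- g"] g z by simp
   thus ?thesis by simp
  qed
 qed
qed

section \<open>Self-intersections away from a cusp\<close>

definition low :: "(complex \<Rightarrow> 'a) \<Rightarrow> real \<Rightarrow> complex \<Rightarrow> bool" where
 "low pr Y z \<longleftrightarrow> (\<forall>M. frame pr M \<longrightarrow> Im (mob (minv M) z) \<le> Y)"

lemma frames_same_translation:
 assumes hc: "hyp_cover X pr" and M: "frame pr M" and N: "frame pr N"
  and C: "mC (minv M * N) = 0" and u: "u \<in> UH"
 shows "mob N (mob (minv N) u + of_real x) = mob M (mob (minv M) u + of_real x)"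
  and "Im (mob (minv N) u) = Im (mob (minv M) u)"
proof -
 define B where "B = minv M * N"
 have C: "mC B = 0" using C by (simp add: B_def)
 have A: "(mA B)\<^sup>2 = 1" unfolding B_def by (rule frames_upper [OF hc M N]) (use C B_def in simp)
 have MB: "M * B = N" by (simp add: B_def)
 have "B * Tr x * minv B = Tr x" using upper_conj_Tr [OF C] A by simp
 have NM: "N * Tr x * minv N = M * Tr x * minv M"
 proof -
  have "N * Tr x * minv N = M * (B * Tr x * minv B) * minv M" by (simp add: MB [symmetric] minv_mult mult.assoc)
  thus ?thesis using \<open>B * Tr x * minv B = Tr x\<close> by simp
 qed
 have t: "mob K (mob (minv K) u + of_real x) = mob (K * Tr x * minv K) u" for K
  using mob_mult [OF u, of "K * Tr x" "minv K"] mob_mult [OF mob_in_UH [OF u], of K "Tr x" "minv K"] by simp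
 show "mob N (mob (minv N) u + of_real x) = mob M (mob (minv M) u + of_real x)" unfolding t NM ..
 have "mob (minv M) u = mob B (mob (minv N) u)"
  using mob_mult [OF u, of B "minv N"] by (simp add: B_def mult.assoc)
 thus "Im (mob (minv N) u) = Im (mob (minv M) u)" using Im_mob_upper [OF C] A by simp
qed

text \<open>A nontrivial element that moves \<open>z\<close> by less than \<open>rh\<close> is
  parabolic. As \<open>cosh rh \<le> 3 / 2\<close>, it is in some frame a translation by an integer
  smaller than the height of \<open>z\<close>. That height exceeds 1, so by
  \<open>frames_horoball\<close> one cusp accounts for all such elements.\<close>

lemma small_displacement:
 assumes hc: "hyp_cover X pr"
  and rh: "cosh rh \<le> 3 / 2" "\<And>g z. deck pr g \<Longrightarrow> \<bar>trc g\<bar> \<noteq> 2 \<Longrightarrow> z \<in> UH \<Longrightarrow> rh \<le> hdist z (mob g z)"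
  and Y: "0 \<le> Y" and z: "z \<in> UH" "low pr Y z"
 obtains M where "\<And>h. deck pr h \<Longrightarrow> hdist z (mob h z) < rh \<Longrightarrow>
  \<exists>n::int. \<bar>n\<bar> \<le> \<lfloor>Y\<rfloor> \<and> (\<forall>u\<in>UH. mob h u = mob M (mob (minv M) u + of_int n))"
proof -
 interpret hyp_cover X pr by fact
 have para: "\<exists>M n. frame pr M \<and> \<bar>n\<bar> \<le> \<lfloor>Y\<rfloor> \<and> 1 < Im (mob (minv M) z) \<and>
   (\<forall>u\<in>UH. mob h u = mob M (mob (minv M) u + of_int n))"
  if h: "deck pr h" "hdist z (mob h z) < rh" "h \<noteq> 1" "h \<noteq> - 1" for h
 proof -
  have "\<bar>trc h\<bar> = 2" using rh(2) [OF h(1) _ z(1)] h(2) by force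
  then obtain M n where M: "frame pr M" "n \<noteq> (0::int)"
   "\<And>z. z \<in> UH \<Longrightarrow> mob h (mob M z) = mob M (z + of_int n)"
   using parabolic_frame [OF hc h(1,3,4)] by metis
  define w where "w = mob (minv M) z"
  have w: "w \<in> UH" "mob M w = z" unfolding w_def using mob_in_UH [OF z(1)] mob_minv(2) [OF z(1)] by auto
  have wn: "w + of_int n \<in> UH" using w(1) by simp
  have wI: "0 < Im w" using w by simp
  have "mob h z = mob M (w + of_int n)" using M(3) [OF w(1)] w(2) by simp
  hence "hdist z (mob h z) = hdist w (w + of_int n)" using hdist_mob [OF w(1) wn, of M] w(2) by simp
  hence "hdist w (w + of_real (of_int n)) < rh" using h(2) by simp
  hence "cosh (hdist w (w + of_real (of_int n))) < cosh rh"
   using hdist_nonneg [OF w(1) wn] by (simp add: cosh_real_nonneg_less_iff)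
  hence "(of_int n)\<^sup>2 / (2 * (Im w)\<^sup>2) < 1 / 2" unfolding hdist_Tr [OF w(1)] using rh(1) by simp
  hence "(of_int n)\<^sup>2 < (Im w)\<^sup>2" using wI by (simp add: field_simps)
  hence n: "\<bar>of_int n\<bar> < Im w" by (intro power2_less_imp_less [of "\<bar>of_int n\<bar>"]) (use wI in simp_all)
  have "Im w \<le> Y" using z(2) M(1) unfolding low_def w_def by blast
  hence nY: "real_of_int \<bar>n\<bar> \<le> Y" using n by simp
  have "1 \<le> real_of_int \<bar>n\<bar>" using M(2) by linarith
  hence "1 < Im w" using n by simp
  moreover have "mob h u = mob M (mob (minv M) u + of_int n)" if "u \<in> UH" for u
   using M(3) [OF mob_in_UH [OF that], of "minv M"] mob_minv(2) [OF that] by simp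
  ultimately show ?thesis using M(1) nY unfolding w_def by (metis le_floor_iff)
 qed
 show ?thesis
 proof (cases "\<exists>h. deck pr h \<and> hdist z (mob h z) < rh \<and> h \<noteq> 1 \<and> h \<noteq> - 1")
  case True
  then obtain h0 where h0: "deck pr h0" "hdist z (mob h0 z) < rh" "h0 \<noteq> 1" "h0 \<noteq> - 1" by blast
  obtain M where M: "frame pr M" "1 < Im (mob (minv M) z)" using para [OF h0] by blast
  show ?thesis
  proof (rule that [of M])
   fix h assume h: "deck pr h" "hdist z (mob h z) < rh"
   show "\<exists>n::int. \<bar>n\<bar> \<le> \<lfloor>Y\<rfloor> \<and> (\<forall>u\<in>UH. mob h u = mob M (mob (minv M) u + of_int n))"
   proof (cases "h = 1 \<or> h = - 1")
    case True
    thus ?thesis using Y by (intro exI [of _ 0]) (auto simp del: UH_iff)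
   next
    case False
    then obtain N n where N: "frame pr N" "\<bar>n\<bar> \<le> \<lfloor>Y\<rfloor>" "1 < Im (mob (minv N) z)"
     "\<And>u. u \<in> UH \<Longrightarrow> mob h u = mob N (mob (minv N) u + of_int n)" using para [OF h] by blast
    have C: "mC (minv M * N) = 0"
    proof (rule ccontr)
     assume "mC (minv M * N) \<noteq> 0"
     hence "Im (mob (minv M) z) * Im (mob (minv N) z) \<le> 1 / 4" using frames_horoball [OF hc M(1) N(1) _ z(1)] by blast
     moreover have "1 * 1 < Im (mob (minv M) z) * Im (mob (minv N) z)" using M(2) N(3) by (intro mult_strict_mono) auto
     ultimately show False by simp
    qed
    have "mob h u = mob M (mob (minv M) u + of_int n)" if "u \<in> UH" for u
     using N(4) [OF that] frames_same_translation(1) [OF hc M(1) N(1) C that, of "of_int n"] by simp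
    thus ?thesis using N(2) by blast
   qed
  qed
 next
  case False
  show ?thesis
  proof (rule that [of 1])
   fix h assume h: "deck pr h" "hdist z (mob h z) < rh"
   hence "h = 1 \<or> h = - 1" using False by blast
   thus "\<exists>n::int. \<bar>n\<bar> \<le> \<lfloor>Y\<rfloor> \<and> (\<forall>u\<in>UH. mob h u = mob 1 (mob (minv 1) u + of_int n))"
    using Y by (intro exI [of _ 0]) (auto simp del: UH_iff)
  qed
 qed
qed

context hyp_cover
begin

text \<open>Each intersection has a deck transformation carrying its first passage to its second.
  For nearby parameters these differ by elements of small displacement, hence by translations by
  integers up to \<open>Y\<close>. The integer determines the pair: one transformation serving two
  pairs would translate along the axis by a proper fraction of the period, against
  \<open>prim\<close>.\<close>

lemma cell_count:
 assumes rh: "cosh rh \<le> 3 / 2" "\<And>g z. deck pr g \<Longrightarrow> \<bar>trc g\<bar> \<noteq> 2 \<Longrightarrow> z \<in> UH \<Longrightarrow> rh \<le> hdist z (mob g z)"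
  and v: "0 < v" and prim: "\<And>w. deck pr (trl N w) \<Longrightarrow> \<exists>n::int. w = of_int n * v"
  and Y: "0 \<le> Y"
  and S: "\<And>s t. (s, t) \<in> S \<Longrightarrow> 0 \<le> s \<and> s < t \<and> t < 1 \<and> pr (gl N v s) = pr (gl N v t) \<and> low pr Y (gl N v s)"
  and near: "\<And>s t s' t'. (s, t) \<in> S \<Longrightarrow> (s', t') \<in> S \<Longrightarrow> v * \<bar>s - s'\<bar> + v * \<bar>t - t'\<bar> < rh"
 shows "finite S" "card S \<le> nat (2 * \<lfloor>Y\<rfloor> + 1)"
proof -
 have "finite S \<and> card S \<le> nat (2 * \<lfloor>Y\<rfloor> + 1)"
 proof (cases "S = {}")
  case True thus ?thesis using Y by simp
 next
  case False
  then obtain s0 t0 where st0: "(s0, t0) \<in> S" by auto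
  define H where "H = (\<lambda>p. SOME h. deck pr h \<and> mob h (gl N v (fst p)) = gl N v (snd p))"
  have H: "deck pr (H (s, t))" "mob (H (s, t)) (gl N v s) = gl N v t" if "(s, t) \<in> S" for s t
   using someI_ex [OF deck_trans [OF gl_UH gl_UH, of N v s N v t]] S [OF that] unfolding H_def by simp_all
  define h0 where "h0 = H (s0, t0)"
  have h0: "deck pr h0" "mob h0 (gl N v s0) = gl N v t0" using H [OF st0] by (simp_all add: h0_def)
  obtain M where M: "\<And>h. deck pr h \<Longrightarrow> hdist (gl N v s0) (mob h (gl N v s0)) < rh \<Longrightarrow>
   \<exists>n::int. \<bar>n\<bar> \<le> \<lfloor>Y\<rfloor> \<and> (\<forall>u\<in>UH. mob h u = mob M (mob (minv M) u + of_int n))"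
   by (rule small_displacement [OF hyp_cover_axioms rh Y gl_UH]) (use S [OF st0] in blast)+
  have "\<exists>n::int. \<bar>n\<bar> \<le> \<lfloor>Y\<rfloor> \<and> (\<forall>u\<in>UH. mob (minv h0 * H p) u = mob M (mob (minv M) u + of_int n))" if p: "p \<in> S" for p
  proof (rule M)
   obtain s t where st: "p = (s, t)" by force
   have stS: "(s, t) \<in> S" using p st by simp
   note Hp = H [OF stS]
   show "deck pr (minv h0 * H p)" unfolding st by (intro deck_mult deck_minv h0(1) Hp(1))
   have U: "mob (H (s, t)) (gl N v s0) \<in> UH" by (rule mob_in_UH [OF gl_UH])
   have "hdist (gl N v s0) (mob (minv h0 * H (s, t)) (gl N v s0))
     = hdist (mob h0 (gl N v s0)) (mob h0 (mob (minv h0 * H (s, t)) (gl N v s0)))"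
    by (rule hdist_mob [OF gl_UH mob_in_UH [OF gl_UH], symmetric])
   also have "mob h0 (mob (minv h0 * H (s, t)) (gl N v s0)) = mob (H (s, t)) (gl N v s0)"
    unfolding mob_mult [OF gl_UH] by (rule mob_minv(2) [OF U])
   also have "hdist (mob h0 (gl N v s0)) (mob (H (s, t)) (gl N v s0))
     \<le> hdist (mob h0 (gl N v s0)) (gl N v t) + hdist (gl N v t) (mob (H (s, t)) (gl N v s0))"
    by (rule hdist_triangle [OF mob_in_UH [OF gl_UH] gl_UH U])
   also have "hdist (gl N v t) (mob (H (s, t)) (gl N v s0)) = hdist (gl N v s) (gl N v s0)"
    unfolding Hp(2) [symmetric] by (rule hdist_mob [OF gl_UH gl_UH])
   also have "hdist (mob h0 (gl N v s0)) (gl N v t) + hdist (gl N v s) (gl N v s0) = v * \<bar>s - s0\<bar> + v * \<bar>t - t0\<bar>"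
   proof -
    have "\<bar>v * t0 - v * t\<bar> = v * \<bar>t - t0\<bar>" "\<bar>v * s - v * s0\<bar> = v * \<bar>s - s0\<bar>"
     using v by (simp_all add: abs_mult flip: right_diff_distrib)
    thus ?thesis unfolding h0(2) hdist_gl by simp
   qed
   also have "\<dots> < rh" by (rule near [OF stS st0])
   finally show "hdist (gl N v s0) (mob (minv h0 * H p) (gl N v s0)) < rh" by (simp add: st)
  qed
  then obtain n where n: "\<And>p. p \<in> S \<Longrightarrow> \<bar>n p\<bar> \<le> \<lfloor>Y\<rfloor>"
   "\<And>p u. p \<in> S \<Longrightarrow> u \<in> UH \<Longrightarrow> mob (minv h0 * H p) u = mob M (mob (minv M) u + of_int (n p))" by metis
  have "inj_on n S"
  proof (rule inj_onI)
   fix p p' assume p: "p \<in> S" "p' \<in> S" "n p = n p'"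
   obtain s t s' t' where st: "p = (s, t)" "p' = (s', t')" by force
   have stS: "(s, t) \<in> S" "(s', t') \<in> S" using p st by simp_all
   have eq: "mob (H p) u = mob (H p') u" if u: "u \<in> UH" for u
   proof -
    have "mob (minv h0) (mob (H p) u) = mob (minv h0) (mob (H p') u)"
     using n(2) [OF p(1) u] n(2) [OF p(2) u] p(3) by (simp add: mob_mult [OF u])
    hence "mob h0 (mob (minv h0) (mob (H p) u)) = mob h0 (mob (minv h0) (mob (H p') u))" by simp
    thus ?thesis by (simp add: mob_minv(2) [OF mob_in_UH [OF u]])
   qed
   have h: "deck pr (H p)" "mob (H p) (gl N v s) = gl N v t" "mob (H p) (gl N v s') = gl N v t'"
    using H [OF stS(1)] H [OF stS(2)] eq [OF gl_UH] st by simp_all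
   have "s = s'"
   proof (rule ccontr)
    assume "s \<noteq> s'"
    from axis_deck [OF v h(1) this h(2,3)] have "deck pr (trl N (v * (t - s)))"
     using h(1) by (metis deck_uminus)
    then obtain k :: int where "v * (t - s) = of_int k * v" using prim by blast
    hence "t - s = of_int k" using v by simp
    hence "0 < real_of_int k" "real_of_int k < 1" using S [OF stS(1)] by linarith+
    thus False by simp
   qed
   moreover have "t = t'" using h(2,3) \<open>s = s'\<close> gl_inj [OF v] by metis
   ultimately show "p = p'" by (simp add: st)
  qed
  moreover have sub: "n ` S \<subseteq> {- \<lfloor>Y\<rfloor>..\<lfloor>Y\<rfloor>}" using n(1) by force
  ultimately have "finite S" "card S \<le> card {- \<lfloor>Y\<rfloor>..\<lfloor>Y\<rfloor>}"
   using finite_imageD [OF finite_subset [OF sub]] card_inj_on_le [OF _ sub] by auto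
  moreover have "card {- \<lfloor>Y\<rfloor>..\<lfloor>Y\<rfloor>} = nat (2 * \<lfloor>Y\<rfloor> + 1)" by simp
  ultimately show ?thesis by simp
 qed
 thus "finite S" "card S \<le> nat (2 * \<lfloor>Y\<rfloor> + 1)" by simp_all
qed

text \<open>Cells of side 1 / m in the square of parameters are small enough for
  \<open>cell_count\<close>.\<close>

lemma thick_count:
 assumes rh: "cosh rh \<le> 3 / 2" "\<And>g z. deck pr g \<Longrightarrow> \<bar>trc g\<bar> \<noteq> 2 \<Longrightarrow> z \<in> UH \<Longrightarrow> rh \<le> hdist z (mob g z)"
  and v: "0 < v" and prim: "\<And>w. deck pr (trl N w) \<Longrightarrow> \<exists>n::int. w = of_int n * v"
  and Y: "0 \<le> Y"
  and S: "\<And>s t. (s, t) \<in> S \<Longrightarrow> 0 \<le> s \<and> s < t \<and> t < 1 \<and> pr (gl N v s) = pr (gl N v t) \<and> low pr Y (gl N v s)"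
  and m: "2 * v \<le> rh * real m"
 shows "finite S" "real (card S) \<le> (real m)\<^sup>2 * (2 * Y + 1)"
proof -
 have m0: "0 < m"
 proof (rule ccontr)
  assume "\<not> 0 < m" thus False using m v by simp
 qed
 define C where "C = (\<lambda>(i, j). {(s, t) \<in> S. nat \<lfloor>s * m\<rfloor> = i \<and> nat \<lfloor>t * m\<rfloor> = j})"
 have fl: "v * \<bar>x - y\<bar> < v / m" if "nat \<lfloor>x * m\<rfloor> = nat \<lfloor>y * m\<rfloor>" "0 \<le> x" "0 \<le> y" for x y :: real
 proof -
  have "0 \<le> \<lfloor>x * m\<rfloor>" "0 \<le> \<lfloor>y * m\<rfloor>" using that by simp_all
  hence "\<lfloor>x * m\<rfloor> = \<lfloor>y * m\<rfloor>" using that(1) by (simp only: eq_nat_nat_iff)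
  hence "\<bar>x * m - y * m\<bar> < 1" by linarith
  hence "\<bar>x - y\<bar> * m < 1" by (simp add: abs_mult flip: left_diff_distrib)
  thus ?thesis using m0 v by (simp add: field_simps)
 qed
 have cell: "finite (C c)" "card (C c) \<le> nat (2 * \<lfloor>Y\<rfloor> + 1)" for c
 proof -
  obtain i j where c: "c = (i, j)" by force
  have *: "v * \<bar>s - s'\<bar> + v * \<bar>t - t'\<bar> < rh" if "(s, t) \<in> C c" "(s', t') \<in> C c" for s t s' t'
  proof -
   have "(s, t) \<in> S" "(s', t') \<in> S" using that by (auto simp: C_def c)
   hence "0 \<le> s" "0 \<le> t" "0 \<le> s'" "0 \<le> t'" using S by force+
   hence "v * \<bar>s - s'\<bar> < v / m" "v * \<bar>t - t'\<bar> < v / m" using fl that by (auto simp: C_def c)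
   moreover have "v / m + v / m \<le> rh" using m m0 by (simp add: field_simps)
   ultimately show ?thesis by linarith
  qed
  have **: "0 \<le> s \<and> s < t \<and> t < 1 \<and> pr (gl N v s) = pr (gl N v t) \<and> low pr Y (gl N v s)" if "(s, t) \<in> C c" for s t
   using S that by (auto simp: C_def c)
  show "finite (C c)" "card (C c) \<le> nat (2 * \<lfloor>Y\<rfloor> + 1)"
   by (rule cell_count [OF rh v prim Y ** *]; assumption)+
 qed
 define I where "I = {..<m} \<times> {..<m}"
 have SI: "S = (\<Union>c\<in>I. C c)"
 proof
  show "(\<Union>c\<in>I. C c) \<subseteq> S" by (auto simp: C_def)
  show "S \<subseteq> (\<Union>c\<in>I. C c)"
  proof clarify
   fix s t assume st: "(s, t) \<in> S"
   have "nat \<lfloor>x * m\<rfloor> < m" if "0 \<le> x" "x < 1" for x :: real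
   proof -
    have "x * real m < 1 * real m" using that m0 by (intro mult_strict_right_mono) auto
    hence "\<lfloor>x * m\<rfloor> < int m" by (simp add: floor_less_iff)
    thus ?thesis using m0 by linarith
   qed
   hence "(nat \<lfloor>s * m\<rfloor>, nat \<lfloor>t * m\<rfloor>) \<in> I" using S [OF st] by (simp add: I_def)
   moreover have "(s, t) \<in> C (nat \<lfloor>s * m\<rfloor>, nat \<lfloor>t * m\<rfloor>)" using st by (simp add: C_def)
   ultimately show "(s, t) \<in> (\<Union>c\<in>I. C c)" by blast
  qed
 qed
 have fI: "finite I" "card I = m * m" by (simp_all add: I_def)
 show "finite S" unfolding SI using fI(1) cell(1) by blast
 have "card S \<le> (\<Sum>c\<in>I. card (C c))" unfolding SI by (rule card_UN_le [OF fI(1)])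
 also have "\<dots> \<le> (\<Sum>c\<in>I. nat (2 * \<lfloor>Y\<rfloor> + 1))" by (rule sum_mono [OF cell(2)])
 also have "\<dots> = m * m * nat (2 * \<lfloor>Y\<rfloor> + 1)" using fI(2) by simp
 finally have "real (card S) \<le> real (m * m * nat (2 * \<lfloor>Y\<rfloor> + 1))" by (simp only: of_nat_le_iff)
 also have "\<dots> = (real m)\<^sup>2 * (2 * real_of_int \<lfloor>Y\<rfloor> + 1)" using Y by (simp add: power2_eq_square)
 also have "\<dots> \<le> (real m)\<^sup>2 * (2 * Y + 1)" by (intro mult_left_mono) auto
 finally show "real (card S) \<le> (real m)\<^sup>2 * (2 * Y + 1)" .
qed

text \<open>Each point of the period is within v / 2 of the apex, hence higher than exp (- v / 4).
  If it were also higher than exp (v / 4) above another parabolic fixed point,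
  \<open>frames_horoball\<close> would fail. So the deep intersections are integer translations, and
  the diameter 2 R bounds their number.\<close>

lemma deep_intersections:
 assumes cf: "cusp_frame pr" and v: "0 < v" and R: "exp (v / 4) < R" and sg: "sg = 1 \<or> sg = - 1"
  and arc: "\<And>t. gl N v t = arc_pt x0 R sg v t"
  and S: "\<And>s t. (s, t) \<in> S \<Longrightarrow> 0 \<le> s \<and> s < t \<and> t < 1 \<and> pr (gl N v s) = pr (gl N v t) \<and> \<not> low pr (exp (v / 4)) (gl N v s)"
 shows "finite S" "real (card S) \<le> 2 * R"
proof -
 have R0: "0 < R" using R by (meson exp_gt_zero less_trans)
 have cf1: "frame pr 1" using cf by simp
 have same: "mC M = 0" if M: "frame pr M" and t: "0 \<le> t" "t \<le> 1"
  and h: "exp (v / 4) < Im (mob (minv M) (gl N v t))" for M t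
 proof (rule ccontr)
  assume "mC M \<noteq> 0"
  hence le: "Im (gl N v t) * Im (mob (minv M) (gl N v t)) \<le> 1 / 4"
   using frames_horoball [OF hyp_cover_axioms cf1 M _ gl_UH, of N v t] by simp
  have I: "0 < Im (gl N v t)" using gl_UH [of N v t] by simp
  have "\<bar>ln (Im (gl N v (1/2))) - ln (Im (gl N v t))\<bar> \<le> hdist (gl N v (1/2)) (gl N v t)"
   by (rule ln_Im_le_hdist [OF gl_UH gl_UH])
  also have "\<dots> = v * \<bar>1/2 - t\<bar>" unfolding hdist_gl right_diff_distrib [symmetric] using v by (simp add: abs_mult del: right_diff_distrib)
  also have "\<bar>1/2 - t\<bar> \<le> 1/2" using t by linarith
  hence "v * \<bar>1/2 - t\<bar> \<le> v * (1/2)" using v by (intro mult_left_mono) auto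
  finally have "\<bar>ln (Im (gl N v (1/2))) - ln (Im (gl N v t))\<bar> \<le> v / 2" by simp
  hence "\<bar>ln R - ln (Im (gl N v t))\<bar> \<le> v / 2" by (simp add: arc [of "1/2"] Im_arc_pt)
  moreover have "v / 4 < ln R" using R R0 by (metis exp_ln exp_less_cancel_iff)
  ultimately have "- (v / 4) < ln (Im (gl N v t))" by linarith
  hence "exp (- (v / 4)) < Im (gl N v t)" using I by (metis exp_ln exp_less_cancel_iff)
  hence "exp (- (v / 4)) * exp (v / 4) < Im (gl N v t) * Im (mob (minv M) (gl N v t))"
   using h I by (intro mult_strict_mono) auto
  moreover have "exp (- (v / 4)) * exp (v / 4) = 1" by (simp flip: exp_add)
  ultimately show False using le by linarith
 qed
 have key: "t = 1 - s \<and> (\<exists>n::int. 2 * R * tanh (v * (1/2 - s)) = of_int n)" if st: "(s, t) \<in> S" for s t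
 proof -
  note st = S [OF st]
  obtain M where M: "frame pr M" "exp (v / 4) < Im (mob (minv M) (gl N v s))"
   using st unfolding low_def by (auto simp: not_le)
  have s01: "0 \<le> s" "s \<le> 1" "0 \<le> t" "t \<le> 1" using st by auto
  have "mC (minv 1 * M) = 0" using same [OF M(1) s01(1,2) M(2)] by simp
  from frames_same_translation(2) [OF hyp_cover_axioms cf1 M(1) this gl_UH]
  have hs: "exp (v / 4) < Im (gl N v s)" using M(2) by simp
  obtain h where h: "deck pr h" "mob h (gl N v s) = gl N v t" using deck_trans [OF gl_UH gl_UH] st by metis
  have "deck (pull pr h) k = deck pr k" for k
   unfolding deck_def using deckD [OF h(1) mob_in_UH] deckD [OF h(1)] by (simp del: UH_iff)
  hence cfh: "frame pr h" using cf unfolding cusp_frame_def by simp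
  have "mob (minv h) (gl N v t) = gl N v s" using h(2) mob_minv(1) [OF gl_UH] by metis
  hence "mC h = 0" using same [OF cfh s01(3,4)] hs by simp
  then obtain n :: int where n: "\<And>z. mob h z = z + of_int n" using cusp_stabiliser [OF cf h(1)] by metis
  have L: "gl N v t = gl N v s + of_int n" using h(2) n by simp
  hence "Im (gl N v s) = Im (gl N v t)" by simp
  hence t: "t = 1 - s" using arc_pt_same_height [OF v R0, of s t x0 sg] st by (simp add: arc)
  have "of_real (sg * (2 * R * tanh (v * (1/2 - s)))) = complex_of_real (of_int n)"
   using L unfolding arc t arc_pt_opposite by simp
  hence "sg * (2 * R * tanh (v * (1/2 - s))) = of_int n" by (simp only: of_real_eq_iff)
  hence "2 * R * tanh (v * (1/2 - s)) = of_int n \<or> 2 * R * tanh (v * (1/2 - s)) = of_int (- n)"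
   using sg by auto
  thus ?thesis using t by blast
 qed
 define f where "f = (\<lambda>p::real \<times> real. \<lfloor>2 * R * tanh (v * (1/2 - fst p))\<rfloor>)"
 have inj: "inj_on f S"
 proof (rule inj_onI)
  fix p p' assume p: "p \<in> S" "p' \<in> S" "f p = f p'"
  obtain s t s' t' where st: "p = (s, t)" "p' = (s', t')" by force
  have "2 * R * tanh (v * (1/2 - s)) = 2 * R * tanh (v * (1/2 - s'))"
  proof -
   have k: "\<exists>n::int. 2 * R * tanh (v * (1/2 - s)) = of_int n" "\<exists>n::int. 2 * R * tanh (v * (1/2 - s')) = of_int n"
    using p key [of s t] key [of s' t'] by (simp_all add: st)
   have fl: "\<lfloor>2 * R * tanh (v * (1/2 - s))\<rfloor> = \<lfloor>2 * R * tanh (v * (1/2 - s'))\<rfloor>"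
    using p(3) by (simp only: st f_def fst_conv)
   from k fl show ?thesis by (metis floor_of_int)
  qed
  hence "v * (1/2 - s) = v * (1/2 - s')" using R0 by (simp del: right_diff_distrib)
  hence "s = s'" using v by simp
  thus "p = p'" using key p st by metis
 qed
 have sub: "f ` S \<subseteq> {1..\<lfloor>2 * R\<rfloor>}"
 proof clarify
  fix s t assume st: "(s, t) \<in> S"
  have t: "t = 1 - s" "s < t" using key [OF st] S [OF st] by auto
  hence "0 < tanh (v * (1/2 - s))" using v by simp
  hence pos: "0 < 2 * R * tanh (v * (1/2 - s))" using R0 by simp
  obtain n :: int where n: "2 * R * tanh (v * (1/2 - s)) = of_int n" using key [OF st] by blast
  have "2 * R * tanh (v * (1/2 - s)) \<le> 2 * R * 1" using R0 tanh_real_lt_1 [of "v * (1/2 - s)"] by (intro mult_left_mono) auto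
  hence "of_int n \<le> 2 * R" using n by simp
  moreover have "0 < n" using pos n by simp
  ultimately show "f (s, t) \<in> {1..\<lfloor>2 * R\<rfloor>}" using n by (simp add: f_def le_floor_iff)
 qed
 show "finite S" using finite_imageD [OF finite_subset [OF sub] inj] by simp
 have "card S \<le> card {1..\<lfloor>2 * R\<rfloor>}" by (rule card_inj_on_le [OF inj sub]) simp
 hence "real (card S) \<le> real (nat \<lfloor>2 * R\<rfloor>)" by simp
 also have "\<dots> \<le> 2 * R" using R0 by simp
 finally show "real (card S) \<le> 2 * R" .
qed

text \<open>After the period is centred at the apex, the intersections at low points are bounded by
  \<open>thick_count\<close> and the others by \<open>deep_intersections\<close>.\<close>

lemma deep_count:
 assumes rh: "cosh rh \<le> 3 / 2" "\<And>g z. deck pr g \<Longrightarrow> \<bar>trc g\<bar> \<noteq> 2 \<Longrightarrow> z \<in> UH \<Longrightarrow> rh \<le> hdist z (mob g z)"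
  and v: "0 < v" "deck pr (trl N v)" and prim: "\<And>w. deck pr (trl N w) \<Longrightarrow> \<exists>n::int. w = of_int n * v"
  and m: "2 * v \<le> rh * real m"
  and cf: "cusp_frame pr" and deep: "exp (v / 4) < Im (gl N v s0)"
 obtains n where "self_intersection_number (\<lambda>t. pr (gl N v t)) = enat n"
  "real n \<le> 2 * cosh (v / 2) / \<bar>mC (trl N v)\<bar> + (real m)\<^sup>2 * (2 * exp (v / 4) + 1)"
proof -
 define g where "g = trl N v"
 have C: "mC g \<noteq> 0" unfolding g_def by (rule frame_hyperbolic_C [OF cf v])
 define R where "R = sinh (v / 2) / \<bar>mC g\<bar>"
 obtain N' a x0 sg where N': "\<And>t. gl N v (t + a) = gl N' v t" "trl N' v = g"
  "sg = 1 \<or> sg = - 1" "\<And>t. gl N' v t = arc_pt x0 R sg v t"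
  using frame_arc [OF cf v] unfolding g_def R_def by metis
 have R0: "0 < R" using v C by (simp add: R_def)
 have "gl N v s0 = arc_pt x0 R sg v (s0 - a)" using N'(1) [of "s0 - a"] N'(4) by simp
 hence "Im (gl N v s0) = R / cosh (v * (s0 - a - 1/2))" by (simp add: Im_arc_pt)
 also have "\<dots> \<le> R" using R0 cosh_real_ge_1 [of "v * (s0 - a - 1/2)"] by (simp add: divide_le_eq)
 finally have R: "exp (v / 4) < R" using deep by linarith
 have "gl (N * Dg (v * a)) v t = gl N' v t" for t
  unfolding gl_mult N'(1) [symmetric] by (simp add: gl_def distrib_left)
 hence NN: "N * Dg (v * a) = N' \<or> N * Dg (v * a) = - N'" using gl_eq_two [OF v(1), of 0 1] by auto
 have conj: "trl N' w = trl N w" for w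
 proof -
  have "Dg (v * a) * (Dg w * Dg (- (v * a))) = Dg w" by (simp add: Dg_add)
  hence "N * Dg (v * a) * Dg w * minv (N * Dg (v * a)) = trl N w"
   by (simp add: minv_mult mult.assoc) (metis mult.assoc)
  thus ?thesis using NN by auto
 qed
 have prim': "\<exists>n::int. w = of_int n * v" if "deck pr (trl N' w)" for w
  using prim that unfolding conj by blast
 have Y: "0 \<le> exp (v / 4)" by simp
 define \<gamma> where "\<gamma> = (\<lambda>t. pr (gl N v t))"
 have per: "\<gamma> (t + 1) = \<gamma> t" for t unfolding \<gamma>_def by (rule deck_gl_period(2) [OF v(2)])
 have num: "self_intersection_number \<gamma> = self_intersection_number (\<lambda>t. pr (gl N' v t))"
  using self_intersection_shift [of \<gamma> a] per unfolding \<gamma>_def N'(1) by simp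
 define S1 where "S1 = {(s, t). 0 \<le> s \<and> s < t \<and> t < 1 \<and> pr (gl N' v s) = pr (gl N' v t) \<and> low pr (exp (v / 4)) (gl N' v s)}"
 define S2 where "S2 = {(s, t). 0 \<le> s \<and> s < t \<and> t < 1 \<and> pr (gl N' v s) = pr (gl N' v t) \<and> \<not> low pr (exp (v / 4)) (gl N' v s)}"
 have "finite S1" "real (card S1) \<le> (real m)\<^sup>2 * (2 * exp (v / 4) + 1)"
  by (rule thick_count [OF rh v(1) prim' Y _ m, where S = S1]; auto simp: S1_def)+
 moreover have "finite S2" "real (card S2) \<le> 2 * R"
  by (rule deep_intersections [OF cf v(1) R N'(3,4), where S = S2]; auto simp: S2_def)+
 moreover have "self_intersections (\<lambda>t. pr (gl N' v t)) = S1 \<union> S2"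
  by (auto simp: self_intersections_def S1_def S2_def)
 moreover have "card (S1 \<union> S2) \<le> card S1 + card S2" by (rule card_Un_le)
 hence "real (card (S1 \<union> S2)) \<le> real (card S1) + real (card S2)" by linarith
 moreover have "2 * R \<le> 2 * cosh (v / 2) / \<bar>mC g\<bar>"
  unfolding R_def using sinh_less_cosh_real [of "v / 2"] C by (simp add: divide_le_cancel)
 ultimately show ?thesis using num unfolding \<gamma>_def g_def
  by (intro that [of "card (S1 \<union> S2)"]) (auto simp: self_intersection_number_def)
qed

end

text \<open>\<open>x\<close> bounds the share of the one cusp that the geodesic enters deeply, if
  there is one. Its coefficient is sharp: only the stray intersections come with an unspecified
  constant, which is why c0 can be told from larger values.\<close>

theorem intersection_bound:
 assumes hc: "hyp_cover X pr" and ft: "finite_type X"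
 obtains rh where "0 < rh"
  "\<And>N v m. 0 < v \<Longrightarrow> deck pr (trl N v) \<Longrightarrow> (\<And>w. deck pr (trl N w) \<Longrightarrow> \<exists>n::int. w = of_int n * v) \<Longrightarrow>
   2 * v \<le> rh * real m \<Longrightarrow>
   \<exists>n x. self_intersection_number (\<lambda>t. pr (gl N v t)) = enat n \<and> real n \<le> x + (real m)\<^sup>2 * (2 * exp (v / 4) + 1) \<and>
    (x = 0 \<or> (\<exists>M. frame pr M \<and>
     x = 2 * cosh (v / 2) / \<bar>mC (trl (minv M * N) v)\<bar>))"
proof -
 interpret hyp_cover X pr by fact
 obtain rh0 where rh0: "0 < rh0" "\<And>g z. deck pr g \<Longrightarrow> \<bar>trc g\<bar> \<noteq> 2 \<Longrightarrow> z \<in> UH \<Longrightarrow> rh0 \<le> hdist z (mob g z)"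
  by (rule displacement_hyperbolic [OF hc ft]) blast
 \<comment> \<open>The second bound is what turns a small displacement into a translation shorter
   than the height.\<close>
 define rh where "rh = min rh0 (arcosh (3 / 2))"
 have a: "0 < arcosh (3 / 2 :: real)" by simp
 have rhp: "0 < rh" using rh0 a by (simp add: rh_def)
 have "cosh rh \<le> cosh (arcosh (3 / 2))" using rhp by (subst cosh_real_nonneg_le_iff) (auto simp: rh_def)
 hence rhc: "cosh rh \<le> 3 / 2" by (simp add: cosh_arcosh_real)
 have rhd: "rh \<le> hdist z (mob g z)" if "deck pr g" "\<bar>trc g\<bar> \<noteq> 2" "z \<in> UH" for g z
  using rh0(2) [OF that] by (simp add: rh_def)
 show ?thesis
 proof (rule that [OF rhp])
  fix N v m
  assume v: "0 < v" "deck pr (trl N v)" and prim: "\<And>w. deck pr (trl N w) \<Longrightarrow> \<exists>n::int. w = of_int n * v"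
   and m: "2 * v \<le> rh * real m"
  show "\<exists>n x. self_intersection_number (\<lambda>t. pr (gl N v t)) = enat n \<and> real n \<le> x + (real m)\<^sup>2 * (2 * exp (v / 4) + 1) \<and>
    (x = 0 \<or> (\<exists>M. frame pr M \<and>
     x = 2 * cosh (v / 2) / \<bar>mC (trl (minv M * N) v)\<bar>))"
  proof (cases "\<exists>M s. frame pr M \<and> exp (v / 4) < Im (mob (minv M) (gl N v s))")
   case True
   then obtain M s where M: "frame pr M" "exp (v / 4) < Im (mob (minv M) (gl N v s))" by blast
   interpret M: hyp_cover X "pull pr M" by (rule hyp_cover_mob [OF hc])
   define N' where "N' = minv M * N"
   have dN: "deck (pull pr M) (trl N' w) \<longleftrightarrow> deck pr (trl N w)" for w
    unfolding deck_conj N'_def by (simp add: minv_mult mult.assoc)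
   have d: "exp (v / 4) < Im (gl N' v s)" using M(2) unfolding mob_gl N'_def .
   have tr: "trc (M * g * minv M) = trc g" for g by (rule trc_conj')
   have disp: "rh \<le> hdist z (mob g z)" if g: "deck (pull pr M) g" "\<bar>trc g\<bar> \<noteq> 2" and z: "z \<in> UH" for g z
   proof -
    have "rh \<le> hdist (mob M z) (mob (M * g * minv M) (mob M z))"
     using rhd [of "M * g * minv M" "mob M z"] g mob_in_UH [OF z] unfolding deck_conj tr by blast
    also have "mob (M * g * minv M) (mob M z) = mob M (mob g z)"
     using mob_mult [OF z, of "M * g * minv M" M] mob_mult [OF z, of M g] by (simp add: mult.assoc)
    also have "hdist (mob M z) (mob M (mob g z)) = hdist z (mob g z)" by (rule hdist_mob [OF z mob_in_UH [OF z]])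
    finally show ?thesis .
   qed
   obtain n where n: "self_intersection_number (\<lambda>t. pr (mob M (gl N' v t))) = enat n"
    "real n \<le> 2 * cosh (v / 2) / \<bar>mC (trl N' v)\<bar> + (real m)\<^sup>2 * (2 * exp (v / 4) + 1)"
   proof (rule M.deep_count [OF rhc disp v(1) _ _ m M(1) d])
    show "deck (pull pr M) (trl N' v)" using v(2) dN by blast
    show "\<exists>n::int. w = of_int n * v" if "deck (pull pr M) (trl N' w)" for w
     using prim that dN by blast
   qed
   have "mob M (gl N' v t) = gl N v t" for t unfolding mob_gl N'_def by simp
   hence "self_intersection_number (\<lambda>t. pr (gl N v t)) = enat n" using n(1) by simp
   thus ?thesis using n(2) M(1) unfolding N'_def by blast
  next
   case False
   hence low: "low pr (exp (v / 4)) (gl N v s)" for s unfolding low_def by (meson not_le)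
   define S where "S = self_intersections (\<lambda>t. pr (gl N v t))"
   have Y: "0 \<le> exp (v / 4)" by simp
   have "finite S" "real (card S) \<le> (real m)\<^sup>2 * (2 * exp (v / 4) + 1)"
    by (rule thick_count [OF rhc rhd v(1) prim Y _ m, where S = S]; use low in \<open>auto simp: S_def self_intersections_def\<close>)+
   thus ?thesis
    by (intro exI [of _ "card S"] exI [of _ 0]) (auto simp: self_intersection_number_def S_def)
  qed
 qed
qed

section \<open>A cusp provides a parabolic deck transformation\<close>

lemma geodesic_through:
 assumes "z \<in> UH" "w \<in> UH" "z \<noteq> w"
 obtains M where "gl M (hdist z w) 0 = z" "gl M (hdist z w) 1 = w"
proof -
 define c where "c = (\<lambda>s::real. if s = 0 then z else w)"
 have d: "0 < hdist z w" using assms hdist_nonneg [of z w] hdist_eq_0 [of z w] by (simp add: less_le del: UH_iff)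
 have cU: "c s \<in> UH" for s using assms by (simp add: c_def)
 have iso: "hdist (c r) (c s) = hdist z w * \<bar>r - s\<bar>" if "r \<in> {0, 1}" "s \<in> {0, 1}" for r s
  using that by (auto simp: c_def hdist_commute)
 obtain M where M: "\<And>s. s \<in> {0, 1} \<Longrightarrow> c s = gl M (hdist z w) s"
  using geodesic_local_gl [of 0 "{0, 1}" 1 "hdist z w" c, OF _ _ _ d cU iso] by auto
 show ?thesis using M [of 0] M [of 1] that [of M] by (simp add: c_def)
qed

text \<open>The chart lifts to a local isometry \<open>L\<close>, and the unit translation becomes a
  deck transformation \<open>g\<close>. High up \<open>g\<close> moves points by less than any
  hyperbolic element does, so it is parabolic. A chart may reverse the orientation; therefore
  \<open>L\<close> is followed along a geodesic instead of being matched with a Moebius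
  transformation.\<close>

theorem cusp_frame_exists:
 assumes hc: "hyp_cover X pr" and ft: "finite_type X" and cusp: "has_cusp X"
 obtains M where "frame pr M"
proof -
 interpret hyp_cover X pr by fact
 obtain h \<phi> where ch: "cusp_chart X h \<phi>" using cusp by (auto simp: has_cusp_def)
 define U where "U = {z. h < Im z}"
 have h0: "0 < h" and im: "\<phi> ` U \<subseteq> X" and per: "\<And>z w. z \<in> U \<Longrightarrow> w \<in> U \<Longrightarrow> \<phi> z = \<phi> w \<longleftrightarrow> z - w \<in> \<int>"
  and iso: "\<And>z. z \<in> U \<Longrightarrow> \<exists>e>0. \<forall>u\<in>ball z e. \<forall>v\<in>ball z e. Im u > h \<longrightarrow> Im v > h \<longrightarrow> dist (\<phi> u) (\<phi> v) = hdist u v"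
  using ch unfolding cusp_chart_def U_def by auto
 have oU: "open U" unfolding U_def by (rule open_halfspace_Im_gt)
 have UU: "U \<subseteq> UH" using h0 by (auto simp: U_def)
 have cvx: "convex U" unfolding U_def by (rule convex_halfspace_Im_gt)
 have iso': "\<exists>e>0. ball z e \<subseteq> U \<and> (\<forall>u\<in>ball z e. \<forall>v\<in>ball z e. dist (\<phi> u) (\<phi> v) = hdist u v)" if z: "z \<in> U" for z
 proof -
  obtain e1 where e1: "0 < e1" "\<forall>u\<in>ball z e1. \<forall>v\<in>ball z e1. Im u > h \<longrightarrow> Im v > h \<longrightarrow> dist (\<phi> u) (\<phi> v) = hdist u v"
   using iso [OF z] by blast
  obtain e2 where e2: "0 < e2" "ball z e2 \<subseteq> U" using oU z open_contains_ball by blast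
  have "Im u > h" if "u \<in> ball z e2" for u using e2 that by (auto simp: U_def)
  thus ?thesis using e1 e2 by (intro exI [of _ "min e1 e2"]) auto
 qed
 have c\<phi>: "continuous_on U \<phi>"
 proof (rule continuous_at_imp_continuous_on, rule ballI)
  fix z assume z: "z \<in> U"
  obtain e where e: "0 < e" "ball z e \<subseteq> U" "\<forall>u\<in>ball z e. \<forall>v\<in>ball z e. dist (\<phi> u) (\<phi> v) = hdist u v" using iso' [OF z] by blast
  have zU: "z \<in> UH" using z UU by blast
  have "((\<lambda>u. hdist u z) \<longlongrightarrow> hdist z z) (at z)"
   using isCont_hdist [OF zU zU] by (simp add: isCont_def)
  hence "((\<lambda>u. hdist u z) \<longlongrightarrow> 0) (at z)" by simp
  moreover have "\<forall>\<^sub>F u in at z. u \<in> ball z e" using e(1) by (intro eventually_at_in_open') auto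
  hence "\<forall>\<^sub>F u in at z. hdist u z = dist (\<phi> u) (\<phi> z)"
   by (rule eventually_mono) (use e in \<open>metis centre_in_ball\<close>)
  ultimately have "((\<lambda>u. dist (\<phi> u) (\<phi> z)) \<longlongrightarrow> 0) (at z)" by (rule Lim_transform_eventually)
  thus "isCont \<phi> z" unfolding isCont_def by (subst tendsto_dist_iff)
 qed
 define z0 where "z0 = Complex 0 (h + 1)"
 have z0: "z0 \<in> U" by (simp add: z0_def U_def)
 obtain a where a: "a \<in> UH" "pr a = \<phi> z0" using im z0 image by (metis image_iff image_subset_iff)
 obtain L where L: "continuous_on U L" "\<And>y. y \<in> U \<Longrightarrow> L y \<in> UH" "\<And>y. y \<in> U \<Longrightarrow> pr (L y) = \<phi> y"
  using lift [OF cvx c\<phi> im z0 a(1)] a(2) by metis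
 have shift: "z + 1 \<in> U" if "z \<in> U" for z using that by (simp add: U_def)
 have per1: "\<phi> (z + 1) = \<phi> z" if "z \<in> U" for z using per [OF shift [OF that] that] by simp
 obtain g where g: "deck pr g" "mob g (L z0) = L (z0 + 1)"
  using deck_trans [OF L(2) [OF z0] L(2) [OF shift [OF z0]]] L(3) [OF z0] L(3) [OF shift [OF z0]] per1 [OF z0] by auto
 have gL: "mob g (L z) = L (z + 1)" if z: "z \<in> U" for z
 proof (rule lift_unique [of U "\<lambda>z. mob g (L z)" "\<lambda>z. L (z + 1)" z0 z])
  show "connected U" "z0 \<in> U" "mob g (L z0) = L (z0 + 1)" "z \<in> U" by (fact convex_connected [OF cvx] z0 g(2) z)+
  show "continuous_on U (\<lambda>z. mob g (L z))"
   by (rule continuous_on_compose2 [OF continuous_on_mob L(1)]) (use L(2) in blast)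
  show "continuous_on U (\<lambda>z. L (z + 1))"
   by (rule continuous_on_compose2 [OF L(1)]) (use shift in \<open>auto intro!: continuous_intros\<close>)
  fix x assume x: "x \<in> U"
  show "mob g (L x) \<in> UH" "L (x + 1) \<in> UH" using mob_in_UH L(2) x shift by blast+
  show "pr (mob g (L x)) = pr (L (x + 1))"
   using deckD [OF g(1) L(2) [OF x]] L(3) [OF x] L(3) [OF shift [OF x]] per1 [OF x] by simp
 qed
 have isoL: "\<exists>e>0. \<forall>u\<in>ball z e. \<forall>v\<in>ball z e. hdist (L u) (L v) = hdist u v" if z: "z \<in> U" for z
 proof -
  obtain e1 where e1: "0 < e1" "ball z e1 \<subseteq> U" "\<forall>u\<in>ball z e1. \<forall>v\<in>ball z e1. dist (\<phi> u) (\<phi> v) = hdist u v" using iso' [OF z] by blast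
  obtain e2 where e2: "0 < e2" "\<forall>u\<in>ball (L z) e2. \<forall>v\<in>ball (L z) e2. dist (pr u) (pr v) = hdist u v" using loc [OF L(2) [OF z]] by blast
  have "isCont L z" using L(1) oU z by (simp add: continuous_on_eq_continuous_at)
  then obtain d where d: "0 < d" "\<And>u. dist u z < d \<Longrightarrow> dist (L u) (L z) < e2" using e2(1) unfolding continuous_at_eps_delta by metis
  show ?thesis
  proof (intro exI [of _ "min d e1"] conjI ballI)
   show "0 < min d e1" using d e1 by simp
   fix u v assume "u \<in> ball z (min d e1)" "v \<in> ball z (min d e1)"
   hence uv: "u \<in> ball z e1" "v \<in> ball z e1" "L u \<in> ball (L z) e2" "L v \<in> ball (L z) e2"
    using d(2) [of u] d(2) [of v] by (simp_all add: dist_commute)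
   hence "u \<in> U" "v \<in> U" using e1(2) by blast+
   thus "hdist (L u) (L v) = hdist u v" using e1(3) e2(2) uv L(3) by metis
  qed
 qed
 obtain rh where rh: "0 < rh" "\<And>g z. deck pr g \<Longrightarrow> \<bar>trc g\<bar> \<noteq> 2 \<Longrightarrow> z \<in> UH \<Longrightarrow> rh \<le> hdist z (mob g z)"
  by (rule displacement_hyperbolic [OF hc ft]) blast
 \<comment> \<open>The first bound makes the displacement smaller than \<open>rh\<close>; the second
   keeps the geodesic from \<open>z\<close> to \<open>z + 1\<close>, with room at its ends, inside
   the domain of the chart.\<close>
 define y where "y = max (1 + 1 / rh) (exp 2 * h + 1)"
 define z where "z = \<i> * of_real y"
 have "0 < 1 / rh" using rh(1) by simp
 hence y: "1 \<le> y" "1 / rh < y" "exp 2 * h < y" unfolding y_def by linarith+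
 have "h \<le> exp 2 * h" using h0 by simp
 hence zU: "z \<in> U" using y(3) by (simp add: z_def U_def)
 have zH: "z \<in> UH" "z + 1 \<in> UH" using zU shift UU by blast+
 define v where "v = hdist z (z + 1)"
 have v0: "0 < v" using hdist_nonneg [OF zH] hdist_eq_0 [OF zH] by (simp add: v_def less_le)
 have vy: "v \<le> 1 / y" using hdist_le_Euclid [of y z "z + 1"] y(1) by (simp add: v_def z_def)
 have "1 / y \<le> 1" using y(1) by simp
 hence v1: "v \<le> 1" using vy by linarith
 have "1 < y * rh" using y(2) rh(1) by (simp add: pos_divide_less_eq)
 hence "1 / y < rh" using y(1) by (simp add: pos_divide_less_eq mult.commute)
 hence vrh: "v < rh" using vy by linarith
 have "z \<noteq> z + 1" by simp
 then obtain M where M: "gl M v 0 = z" "gl M v 1 = z + 1" unfolding v_def by (rule geodesic_through [OF zH])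
 \<comment> \<open>An open interval around the parameters 0 and 1, as continuation of geodesics
   needs one; on it the height drops at most by the factor \<open>exp 2\<close>.\<close>
 define J where "J = {-1<..<2::real}"
 have glU: "gl M v t \<in> U" if "t \<in> J" for t
 proof -
  have "\<bar>ln (Im (gl M v 0)) - ln (Im (gl M v t))\<bar> \<le> v * \<bar>t\<bar>"
   using ln_Im_le_hdist [OF gl_UH gl_UH, of M v 0 M v t] v0 unfolding hdist_gl by (simp add: abs_mult)
  also have "\<dots> \<le> 1 * 2" using that v1 v0 by (intro mult_mono) (auto simp: J_def)
  finally have "ln y - 2 \<le> ln (Im (gl M v t))" unfolding M(1) by (simp add: z_def)
  moreover have "ln (exp 2 * h) < ln y" using y h0 by simp
  hence "2 + ln h < ln y" using h0 by (simp add: ln_mult)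
  ultimately have "ln h < ln (Im (gl M v t))" by linarith
  thus ?thesis using h0 gl_UH [of M v t] by (simp add: U_def)
 qed
 obtain M' where M': "\<And>t. t \<in> J \<Longrightarrow> L (gl M v t) = gl M' v t"
 proof (rule geodesic_gl [of J 0 v "\<lambda>t. L (gl M v t)"])
  show "open J" "connected J" "0 \<in> J" by (simp_all add: J_def)
  show "0 < v" by (rule v0)
  show "L (gl M v t) \<in> UH" if "t \<in> J" for t using L(2) glU that by blast
  show "\<exists>e>0. \<forall>r\<in>ball t e. \<forall>s\<in>ball t e. hdist (L (gl M v r)) (L (gl M v s)) = v * \<bar>r - s\<bar>" if t: "t \<in> J" for t
  proof -
   obtain e where e: "0 < e" "\<forall>u\<in>ball (gl M v t) e. \<forall>w\<in>ball (gl M v t) e. hdist (L u) (L w) = hdist u w" using isoL [OF glU [OF t]] by blast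
   have "isCont (gl M v) t" using continuous_on_gl [of UNIV M v] by (simp add: continuous_on_eq_continuous_at)
   then obtain d where d: "0 < d" "\<And>s. dist s t < d \<Longrightarrow> dist (gl M v s) (gl M v t) < e" using e(1) unfolding continuous_at_eps_delta by metis
   show ?thesis
   proof (intro exI [of _ d] conjI ballI)
    fix r s assume "r \<in> ball t d" "s \<in> ball t d"
    hence "gl M v r \<in> ball (gl M v t) e" "gl M v s \<in> ball (gl M v t) e" using d(2) by (simp_all add: dist_commute)
    hence "hdist (L (gl M v r)) (L (gl M v s)) = hdist (gl M v r) (gl M v s)" using e(2) by blast
    thus "hdist (L (gl M v r)) (L (gl M v s)) = v * \<bar>r - s\<bar>"
     unfolding hdist_gl right_diff_distrib [symmetric] using v0 by (simp add: abs_mult del: right_diff_distrib)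
   qed (use d in simp)
  qed
 qed blast
 have L01: "L z = gl M' v 0" "L (z + 1) = gl M' v 1" using M' [of 0] M' [of 1] M by (simp_all add: J_def)
 \<comment> \<open>\<open>L\<close> takes the geodesic to one of the same length, so its ends stay
   distinct and \<open>g\<close> is not trivial.\<close>
 have "L (z + 1) \<noteq> L z" unfolding L01 using gl_inj [OF v0] by simp
 hence "mob g (L z) \<noteq> L z" using gL [OF zU] by simp
 hence g1: "g \<noteq> 1" "g \<noteq> - 1" by auto
 have "hdist (L z) (mob g (L z)) = v" unfolding gL [OF zU] L01(2) unfolding L01(1) hdist_gl using v0 by simp
 hence "\<bar>trc g\<bar> = 2" using rh(2) [OF g(1) _ L(2) [OF zU]] vrh by force
 thus ?thesis using parabolic_frame [OF hc g(1) g1] that by metis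
qed

section \<open>The homotopy class\<close>

context hyp_cover
begin

text \<open>Above height 1 only translations identify points, since all other elements have an entry
  of absolute value at least 4 and send such points to height at most 1. The sign \<open>eps\<close>
  provides both directions around the cusp.\<close>

lemma cusp_chart_frame:
 assumes cf: "cusp_frame pr" and eps: "eps = 1 \<or> eps = - 1"
 shows "cusp_chart X 1 (\<lambda>z. pr (Complex (eps * Re z) (Im z)))"
proof -
 define r where "r = (\<lambda>z. Complex (eps * Re z) (Im z))"
 have r: "Im (r z) = Im z" "Re (r z) = eps * Re z" for z by (simp_all add: r_def)
 have rd: "cmod (r u - r w) = cmod (u - w)" for u w
 proof -
  have "(eps * Re u - eps * Re w)\<^sup>2 = (Re u - Re w)\<^sup>2" using eps by (auto simp: power2_commute)
  thus ?thesis by (simp add: cmod_def r)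
 qed
 have rh: "hdist (r u) (r w) = hdist u w" for u w by (simp add: hdist_def rd r(1))
 have rU: "r z \<in> UH" if "1 < Im z" for z using that by (simp add: r)
 have iff: "pr (r z) = pr (r w) \<longleftrightarrow> z - w \<in> \<int>" if zw: "1 < Im z" "1 < Im w" for z w
 proof
  assume "pr (r z) = pr (r w)"
  then obtain g where g: "deck pr g" "mob g (r z) = r w" using deck_trans [OF rU [OF zw(1)] rU [OF zw(2)]] by blast
  have "mC g = 0"
  proof (rule ccontr)
   assume C: "mC g \<noteq> 0"
   have "Im (r w) \<le> 1 / ((mC g)\<^sup>2 * Im (r z))" using Im_mob_le [OF rU [OF zw(1)] C] g(2) by simp
   moreover have "1 * 1 \<le> (mC g)\<^sup>2 * Im (r z)"
   proof (rule mult_mono)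
    have "1\<^sup>2 \<le> \<bar>mC g\<bar>\<^sup>2" using cusp_c_ge4 [OF cf g(1) C] by (intro power_mono) auto
    thus "1 \<le> (mC g)\<^sup>2" by simp
   qed (use zw in \<open>simp_all add: r\<close>)
   hence "1 / ((mC g)\<^sup>2 * Im (r z)) \<le> 1" by simp
   ultimately show False using zw by (simp add: r)
  qed
  then obtain n :: int where "\<And>z. mob g z = z + of_int n" using cusp_stabiliser [OF cf g(1)] by metis
  hence rw: "r w = r z + of_int n" using g(2) by simp
  have "Re (r w) = Re (r z) + of_int n" "Im (r w) = Im (r z)" unfolding rw by simp_all
  hence e: "eps * Re w = eps * Re z + of_int n" "Im w = Im z" unfolding r by simp_all
  have "z - w = of_int n \<or> z - w = of_int (- n)" using eps e by (auto simp: complex_eq_iff)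
  thus "z - w \<in> \<int>" by (metis Ints_of_int)
 next
  assume "z - w \<in> \<int>"
  then obtain n :: int where n: "z - w = of_int n" by (auto elim: Ints_cases)
  hence "z = w + of_int n" by (simp add: algebra_simps)
  hence "r z = r w + of_int n \<or> r z = r w + of_int (- n)" using eps by (auto simp: r_def complex_eq_iff)
  then obtain m :: int where "r z = r w + of_int m" by blast
  hence "r z = mob (Tr (of_int m)) (r w)" by simp
  thus "pr (r z) = pr (r w)" using deckD [OF deck_Tr_int [OF cf] rU [OF zw(2)]] by metis
 qed
 have locr: "\<exists>e>0. \<forall>u\<in>ball z e. \<forall>w\<in>ball z e. 1 < Im u \<longrightarrow> 1 < Im w \<longrightarrow> dist (pr (r u)) (pr (r w)) = hdist u w"
  if z: "1 < Im z" for z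
 proof -
  obtain e where e: "0 < e" "\<forall>u\<in>ball (r z) e. \<forall>v\<in>ball (r z) e. dist (pr u) (pr v) = hdist u v" using loc [OF rU [OF z]] by blast
  have "r u \<in> ball (r z) e" if "u \<in> ball z e" for u using that rd [of z u] by (simp add: dist_norm)
  thus ?thesis using e rh by (intro exI [of _ e]) simp
 qed
 have "cusp_chart X 1 (\<lambda>z. pr (r z))" unfolding cusp_chart_def using in_X [OF rU] iff locr by auto
 thus ?thesis by (simp only: r_def)
qed

lemma homotopic_to_cusp_translation:
 assumes cf: "cusp_frame pr" and eps: "eps = 1 \<or> eps = - 1" and w: "w \<in> UH"
 shows "homotopic_to_cusp X (\<lambda>t. pr (w + of_real (eps * t)))"
proof -
 define p where "p = (\<lambda>t::real. w + of_real (eps * t))"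
 define q where "q = (\<lambda>t::real. Complex (eps * t) 2)"
 have d: "deck pr (Tr eps)" using deck_Tr_int [OF cf, of 1] deck_Tr_int [OF cf, of "- 1"] eps by auto
 have "path p" unfolding path_def p_def by (intro continuous_intros)
 moreover have "path q" unfolding path_def q_def Complex_eq by (intro continuous_intros)
 ultimately have "homotopic_loops X (pr \<circ> p) (pr \<circ> q)"
  by (intro homotopic_loops_lift [OF _ _ _ _ _ _ d])
   (use w in \<open>auto simp: p_def q_def path_image_def pathstart_def pathfinish_def complex_eq_iff\<close>)
 moreover have "closed_horocycle X (pr \<circ> q)"
  unfolding closed_horocycle_def
  by (intro exI [of _ 1] exI [of _ "\<lambda>z. pr (Complex (eps * Re z) (Im z))"] exI [of _ 2])
   (use cusp_chart_frame [OF cf eps] in \<open>auto simp: q_def\<close>)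
 ultimately show ?thesis unfolding homotopic_to_cusp_def by (intro exI [of _ "pr \<circ> q"]) (simp add: p_def o_def)
qed

lemma loop_power_lift:
 assumes d: "deck pr (Tr eps)" and w: "w \<in> UH"
 defines "\<tau> \<equiv> \<lambda>t. pr (w + of_real (eps * t))"
 shows "\<exists>q. path q \<and> path_image q \<subseteq> UH \<and> pathstart q = w \<and> pathfinish q = w + of_real (eps * real k) \<and>
  (\<forall>t\<in>{0..1}. pr (q t) = loop_power \<tau> k t)"
proof (induction k)
 case 0
 thus ?case using w by (intro exI [of _ "\<lambda>_. w"]) (auto simp: path_def path_image_def pathstart_def pathfinish_def \<tau>_def)
next
 case (Suc k)
 then obtain q where q: "path q" "path_image q \<subseteq> UH" "pathstart q = w" "pathfinish q = w + of_real (eps * real k)"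
  "\<forall>t\<in>{0..1}. pr (q t) = loop_power \<tau> k t" by blast
 define p where "p = (\<lambda>t::real. w + of_real (eps * t))"
 define q' where "q' = (\<lambda>t. q t + of_real eps)"
 have qU: "q t \<in> UH" if "t \<in> {0..1}" for t using q(2) that unfolding path_image_def by blast
 have p: "path p" unfolding path_def p_def by (intro continuous_intros)
 have q': "path q'" using q(1) unfolding path_def q'_def by (intro continuous_intros)
 have pU: "path_image p \<subseteq> UH" "path_image q' \<subseteq> UH" using w qU by (auto simp: path_image_def p_def q'_def)
 have pi: "pr (q' t) = loop_power \<tau> k t" if t: "t \<in> {0..1}" for t
 proof -
  have "q' t = mob (Tr eps) (q t)" by (simp add: q'_def)
  thus ?thesis using deckD [OF d qU [OF t]] q(5) t by simp
 qed
 have j: "pathfinish p = pathstart q'" using q(3) by (simp add: p_def q'_def pathstart_def pathfinish_def)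
 show ?case
 proof (intro exI [of _ "p +++ q'"] conjI ballI)
  show "path (p +++ q')" using p q' j by simp
  show "path_image (p +++ q') \<subseteq> UH" using pU by (rule subset_path_image_join)
  show "pathstart (p +++ q') = w" by (simp add: p_def pathstart_def joinpaths_def)
  have "pathfinish q' = w + of_real (eps * real k) + of_real eps" using q(4) by (simp add: q'_def pathfinish_def)
  thus "pathfinish (p +++ q') = w + of_real (eps * real (Suc k))" by (simp add: algebra_simps)
  show "pr ((p +++ q') t) = loop_power \<tau> (Suc k) t" if "t \<in> {0..1}" for t
   using pi [of "2 * t - 1"] that by (simp add: joinpaths_def \<tau>_def p_def)
 qed
qed

text \<open>The simple loop comes from an arc that joins a point of the isometric circle of
  \<open>A\<close> to its image under \<open>A\<close>. No isometric circle rises above 1 / c and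
  the arc does not fall below this height; its width is less than 1. So only its ends are
  identified.\<close>

theorem homotopy_class:
 assumes cf: "cusp_frame pr" and v: "0 < v" and d: "deck pr (trl N v)"
 defines "c \<equiv> \<bar>mC (trl N v)\<bar>"
 assumes min: "\<And>x. x \<in> cspec pr \<Longrightarrow> c \<le> x" and k: "int k = \<lfloor>2 * cosh (v / 2) / c\<rfloor>"
 shows "\<exists>\<kappa> \<tau>. homotopic_to_cusp X \<tau> \<and> simple_loop X \<kappa> \<and> \<not> contractible_loop X \<kappa> \<and>
  \<not> homotopic_loops X \<kappa> \<tau> \<and> pathstart \<kappa> = pathstart \<tau> \<and>
  homotopic_loops X (\<lambda>t. pr (gl N v t)) (\<kappa> +++ loop_power \<tau> k)"
proof -
 define g where "g = trl N v"
 have g: "deck pr g" "mC g \<noteq> 0" using d frame_hyperbolic_C [OF cf v d] by (simp_all add: g_def)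
 have cg: "c = \<bar>mC g\<bar>" by (simp add: c_def g_def)
 have tr: "trc g = 2 * cosh (v / 2)" unfolding g_def by (rule conj_Dg_sel)
 have c4: "4 \<le> c" unfolding cg by (rule cusp_c_ge4 [OF cf g])
 define eps where "eps = sgn (mC g)"
 have eps: "eps = 1 \<or> eps = - 1" "mC g = eps * c" using g(2) by (auto simp: eps_def cg sgn_if)
 have dT: "deck pr (Tr (of_int n))" for n by (rule deck_Tr_int [OF cf])
 have deps: "deck pr (Tr eps)" using dT [of 1] dT [of "- 1"] eps(1) by auto
 define A where "A = g * Tr (- eps * of_int \<lfloor>trc g / c\<rfloor>)"
 define f where "f = trc g / c - of_int \<lfloor>trc g / c\<rfloor>"
 have kT: "of_int \<lfloor>trc g / c\<rfloor> = real k" using k tr by (metis of_int_of_nat_eq)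
 have trA: "trc A = f * c" "2 \<le> f * c" "f * c \<le> c - 2"
  using trace_gap [OF cf g] eps unfolding f_def A_def cg by blast+
 define al where "al = trc A"
 have al: "2 \<le> al" "al \<le> c - 2" using trA by (simp_all add: al_def)
 have CA: "mC A = eps * c" using eps(2) by (simp add: A_def sl2_sel)
 have "- eps * of_int \<lfloor>trc g / c\<rfloor> = of_int (- \<lfloor>trc g / c\<rfloor>) \<or> - eps * of_int \<lfloor>trc g / c\<rfloor> = real_of_int \<lfloor>trc g / c\<rfloor>"
  using eps(1) by auto
 hence "deck pr (Tr (- eps * of_int \<lfloor>trc g / c\<rfloor>))" using dT by metis
 hence dA: "deck pr A" unfolding A_def by (intro deck_mult g(1))
 have gA: "g = A * Tr (eps * real k)"
 proof -
  have "A * Tr (eps * real k) = g * (Tr (- eps * real k) * Tr (eps * real k))" by (simp add: A_def kT mult.assoc)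
  also have "Tr (- eps * real k) * Tr (eps * real k) = 1" unfolding Tr_add by simp
  finally show ?thesis by simp
 qed
 \<comment> \<open>The top of the isometric circle of \<open>A\<close>, which \<open>A\<close> sends
   to the top of that of its inverse, at the same height.\<close>
 define w where "w = Complex (- mD A / mC A) (1 / c)"
 have wU: "w \<in> UH" using c4 by (simp add: w_def)
 have Aw: "mob A w = w + of_real (eps * al / c)"
 proof -
  have C0: "mC A \<noteq> 0" using CA eps(1) c4 by auto
  have den: "of_real (mC A) * w + of_real (mD A) = \<i> * of_real eps"
   using C0 c4 unfolding w_def by (simp add: complex_eq_iff CA)
  have num: "of_real (mA A) * w + of_real (mB A) = (w + of_real (eps * al / c)) * (\<i> * of_real eps)"
  proof -
   have "mA A * mD A - mB A * mC A = 1" by (rule sl2_det)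
   hence B: "mB A = (mA A * mD A - 1) / mC A" using C0 by (simp add: field_simps)
   have i: "1 / mC A = eps / c" using eps(1) unfolding CA by auto
   have al: "eps * al / c = (mA A + mD A) / mC A"
    using eps(1) unfolding al_def trc_def CA by (auto simp: minus_divide_left)
   have "w + of_real (eps * al / c) = Complex (mA A / mC A) (1 / c)"
    unfolding al w_def by (simp add: complex_eq_iff diff_divide_distrib add_divide_distrib)
   moreover have "of_real (mA A) * w + of_real (mB A) = Complex (- 1 / mC A) (mA A / c)"
    unfolding w_def B using C0 by (simp add: complex_eq_iff diff_divide_distrib)
   ultimately show ?thesis using eps(1) c4 unfolding CA by (auto simp: complex_eq_iff)
  qed
  have "\<i> * of_real eps \<noteq> (0::complex)" using eps(1) by auto
  thus ?thesis unfolding mob_def den num by simp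
 qed
 \<comment> \<open>The term \<open>s * (1 - s)\<close> lifts all inner points strictly above height
   1 / c.\<close>
 define kt where "kt = (\<lambda>s::real. w + of_real (s * (eps * al / c)) + \<i> * of_real (s * (1 - s)))"
 define tt where "tt = (\<lambda>t::real. w + of_real (eps * t))"
 define \<kappa> where "\<kappa> = pr \<circ> kt"
 define \<tau> where "\<tau> = (\<lambda>t. pr (w + of_real (eps * t)))"
 have Imk: "Im (kt s) = 1 / c + s * (1 - s)" for s by (simp add: kt_def w_def)
 have Rek: "Re (kt s) = Re w + s * (eps * al / c)" for s by (simp add: kt_def)
 have ktU: "kt s \<in> UH" if "s \<in> {0..1}" for s
 proof -
  have "0 \<le> s * (1 - s)" using that by simp
  moreover have "0 < 1 / c" using c4 by simp
  ultimately show ?thesis by (simp add: Imk add_pos_nonneg del: zero_less_divide_1_iff)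
 qed
 have kt: "path kt" "path_image kt \<subseteq> UH" "kt 0 = w" "kt 1 = mob A w"
 proof -
  show "path kt" unfolding path_def kt_def by (intro continuous_intros)
  show "path_image kt \<subseteq> UH" using ktU unfolding path_image_def by blast
  show "kt 0 = w" "kt 1 = mob A w" unfolding Aw by (simp_all add: kt_def)
 qed
 have ktA: "pathfinish kt = mob A (pathstart kt)" using kt by (simp add: pathstart_def pathfinish_def)
 have tt: "path tt" "path_image tt \<subseteq> UH"
  using wU by (auto simp: tt_def path_def path_image_def intro!: continuous_intros)
 have pk: "path \<kappa>" "path_image \<kappa> \<subseteq> X" "pathfinish \<kappa> = pathstart \<kappa>" "pathstart \<kappa> = pr w"
 proof -
  show "path \<kappa>" unfolding \<kappa>_def by (rule path_continuous_image [OF kt(1) continuous_on_subset [OF cont kt(2)]])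
  show "path_image \<kappa> \<subseteq> X" unfolding \<kappa>_def path_image_compose using kt(2) in_X by blast
  show "pathfinish \<kappa> = pathstart \<kappa>" "pathstart \<kappa> = pr w"
   using kt deckD [OF dA wU] by (simp_all add: \<kappa>_def pathstart_def pathfinish_def)
 qed
 have inj: "s = 0 \<and> s' = 1" if s: "s \<in> {0..1}" "s' \<in> {0..1}" "s < s'" and eq: "\<kappa> s = \<kappa> s'" for s s'
 proof -
  obtain h where h: "deck pr h" "mob h (kt s) = kt s'" using deck_trans [OF ktU [OF s(1)] ktU [OF s(2)]] eq by (auto simp: \<kappa>_def)
  have u: "0 \<le> s * (1 - s)" "0 \<le> s' * (1 - s')" using s by simp_all
  show ?thesis
  proof (cases "mC h = 0")
   case True
   then obtain n :: int where "\<And>z. mob h z = z + of_int n" using cusp_stabiliser [OF cf h(1)] by metis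
   hence "kt s' = kt s + of_int n" using h(2) by simp
   hence "Re (kt s') = Re (kt s) + of_int n" by simp
   hence n: "of_int n = eps * ((s' - s) * al / c)" by (simp add: Rek algebra_simps diff_divide_distrib)
   have "(s' - s) * al \<le> 1 * al" using s al by (intro mult_right_mono) auto
   hence "(s' - s) * al < c" using al by linarith
   hence "(s' - s) * al / c < 1" using c4 by simp
   moreover have "0 < (s' - s) * al / c" using s al c4 by simp
   moreover have "real_of_int n = (s' - s) * al / c \<or> real_of_int n = - ((s' - s) * al / c)" using eps(1) unfolding n by auto
   ultimately have "0 < \<bar>real_of_int n\<bar>" "\<bar>real_of_int n\<bar> < 1" by linarith+
   thus ?thesis by simp
  next
   case False
   hence "\<bar>mC h\<bar> \<in> cspec pr" using h(1) by (auto simp: cspec_def)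
   hence cC: "c \<le> \<bar>mC h\<bar>" by (rule min)
   \<comment> \<open>The product of the two heights is at most 1 / c^2, while each is at least 1 /
     c; so both points are ends of the arc.\<close>
   define a b where "a = s * (1 - s)" and "b = s' * (1 - s')"
   have ab: "0 \<le> a" "0 \<le> b" using u by (simp_all add: a_def b_def)
   have "1 / c + b \<le> 1 / ((mC h)\<^sup>2 * (1 / c + a))"
    using Im_mob_le [OF ktU [OF s(1)] False] h(2) by (simp add: Imk a_def b_def)
   also have "\<dots> \<le> 1 / (c\<^sup>2 * (1 / c + a))"
   proof (rule divide_left_mono)
    have "c\<^sup>2 \<le> \<bar>mC h\<bar>\<^sup>2" using cC c4 by (intro power_mono) auto
    moreover have p: "0 < 1 / c + a" using ab c4 by (intro add_pos_nonneg) auto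
    ultimately show "c\<^sup>2 * (1 / c + a) \<le> (mC h)\<^sup>2 * (1 / c + a)" by (intro mult_right_mono) auto
    show "0 < (mC h)\<^sup>2 * (1 / c + a) * (c\<^sup>2 * (1 / c + a))" using p False c4 by simp
   qed simp
   also have "c\<^sup>2 * (1 / c + a) = c * (1 + c * a)" using c4 by (simp add: field_simps power2_eq_square)
   finally have "(1 / c + b) * (c * (1 + c * a)) \<le> 1"
    using ab c4 by (simp add: pos_le_divide_eq add_pos_nonneg)
   moreover have "(1 / c + b) * (c * (1 + c * a)) = (1 + c * b) * (1 + c * a)" using c4 by (simp add: field_simps)
   ultimately have "c * a + c * b + (c * a) * (c * b) \<le> 0" by (simp add: algebra_simps)
   moreover have "0 \<le> c * a" "0 \<le> c * b" using ab c4 by simp_all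
   hence "0 \<le> (c * a) * (c * b)" by simp
   ultimately have "c * a = 0" "c * b = 0" using \<open>0 \<le> c * a\<close> \<open>0 \<le> c * b\<close> by linarith+
   thus ?thesis using s c4 by (auto simp: a_def b_def)
  qed
 qed
 have simple: "simple_loop X \<kappa>"
  unfolding simple_loop_def simple_path_def loop_free_def
 proof (intro conjI ballI impI pk(1,2,3))
  fix s s' assume "s \<in> {0..1}" "s' \<in> {0..1}" "\<kappa> s = \<kappa> s'"
  thus "s = s' \<or> s = 0 \<and> s' = 1 \<or> s = 1 \<and> s' = 0"
   using inj [of s s'] inj [of s' s] by (cases s s' rule: linorder_cases) auto
 qed
 \<comment> \<open>A lift of a constant loop is constant, so \<open>A\<close> would have a fixed
   point.\<close>
 have noncontr: "\<not> contractible_loop X \<kappa>"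
 proof
  assume "contractible_loop X \<kappa>"
  then obtain a where "homotopic_loops X (pr \<circ> kt) (\<lambda>_. a)" unfolding contractible_loop_def \<kappa>_def by blast
  then obtain q where q: "path q" "path_image q \<subseteq> UH" "pathfinish q = mob A (pathstart q)" "\<And>t. t \<in> {0..1} \<Longrightarrow> pr (q t) = a"
   by (rule homotopic_loops_lift_conv [OF _ kt(1,2) ktA dA]) blast
  have qU: "q t \<in> UH" if "t \<in> {0..1}" for t using q(2) that unfolding path_image_def by blast
  have z: "0 \<in> {0..1::real}" "1 \<in> {0..1::real}" by simp_all
  have "q 1 = q 0"
  proof (rule lift_unique [of "{0..1}" q "\<lambda>_. q 0" 0 1])
   show "connected {0..1::real}" "0 \<in> {0..1::real}" "1 \<in> {0..1::real}" "continuous_on {0..1::real} (\<lambda>_. q 0)" by simp_all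
   show "continuous_on {0..1} q" using q(1) by (simp add: path_def)
   show "q x \<in> UH" "q 0 \<in> UH" "pr (q x) = pr (q 0)" if "x \<in> {0..1}" for x
    using qU [OF that] qU [OF z(1)] q(4) [OF that] q(4) [OF z(1)] by simp_all
  qed simp
  hence "mob A (q 0) = q 0" using q(3) by (simp add: pathstart_def pathfinish_def)
  hence "A = 1 \<or> A = - 1" by (rule deck_free [OF dA qU [OF z(1)]])
  thus False using CA eps(1) c4 by (auto simp: sl2_sel)
 qed
 have nothom: "\<not> homotopic_loops X \<kappa> \<tau>"
 proof
  assume "homotopic_loops X \<kappa> \<tau>"
  hence "homotopic_loops X (pr \<circ> kt) \<tau>" by (simp add: \<kappa>_def)
  then obtain q where q: "path q" "path_image q \<subseteq> UH" "pathfinish q = mob A (pathstart q)" "\<And>t. t \<in> {0..1} \<Longrightarrow> pr (q t) = \<tau> t"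
   by (rule homotopic_loops_lift_conv [OF _ kt(1,2) ktA dA]) blast
  have qU: "q t \<in> UH" if "t \<in> {0..1}" for t using q(2) that unfolding path_image_def by blast
  have ttU: "tt t \<in> UH" for t using wU by (simp add: tt_def)
  have z: "0 \<in> {0..1::real}" "1 \<in> {0..1::real}" by simp_all
  have "pr (tt 0) = pr (q 0)" using q(4) [OF z(1)] by (simp add: \<tau>_def tt_def)
  then obtain B where B: "deck pr B" "mob B (tt 0) = q 0" using deck_trans [OF ttU qU [OF z(1)]] by blast
  have "mob B (tt 1) = q 1"
  proof (rule lift_unique [of "{0..1}" "\<lambda>t. mob B (tt t)" q 0 1])
   show "connected {0..1::real}" "0 \<in> {0..1::real}" "1 \<in> {0..1::real}" "mob B (tt 0) = q 0" by (simp_all add: B(2))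
   show "continuous_on {0..1} q" using q(1) by (simp add: path_def)
   show "continuous_on {0..1} (\<lambda>t. mob B (tt t))"
    by (rule continuous_on_compose2 [OF continuous_on_mob]) (use tt ttU in \<open>auto simp: path_def simp del: UH_iff\<close>)
   show "mob B (tt x) \<in> UH" "q x \<in> UH" "pr (mob B (tt x)) = pr (q x)" if "x \<in> {0..1}" for x
    using mob_in_UH [OF ttU] qU [OF that] deckD [OF B(1) ttU] q(4) [OF that] by (simp_all add: \<tau>_def tt_def)
  qed
  also have "q 1 = mob A (q 0)" using q(3) by (simp add: pathstart_def pathfinish_def)
  also have "q 0 = mob B w" using B(2) by (simp add: tt_def)
  finally have eq: "mob B (tt 1) = mob A (mob B w)" .
  have "tt 1 = mob (Tr eps) w" by (simp add: tt_def)
  hence eq2: "mob (B * Tr eps) w = mob (A * B) w" using eq by (simp only: mob_mult [OF wU])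
  define h where "h = minv (B * Tr eps) * (A * B)"
  have "mob h w = w" unfolding h_def mob_mult [OF wU] eq2 [symmetric, unfolded mob_mult [OF wU]]
   by (metis eq2 mob_minv(1) mob_mult wU)
  moreover have "deck pr h" unfolding h_def by (intro deck_mult deck_minv B(1) deps dA)
  ultimately have "h = 1 \<or> h = - 1" using deck_free wU by blast
  moreover have "B * Tr eps * h = A * B" unfolding h_def by (rule minv_right2)
  hence "B * Tr eps * h * minv B = A" by (simp only: mult.assoc minv_right mult.right_neutral)
  ultimately have "A = B * Tr eps * minv B \<or> A = - (B * Tr eps * minv B)" by auto
  \<comment> \<open>A conjugate of the unit translation has a square as its entry, up to sign. Here
    the square of \<open>mC B\<close> would be \<open>c\<close> while \<open>mC B\<close> is itself
    at least \<open>c\<close> in absolute value, which \<open>4 \<le> c\<close> forbids.\<close>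
  moreover have "mC (B * Tr eps * minv B) = - eps * (mC B)\<^sup>2" by (simp add: sl2_sel power2_eq_square algebra_simps)
  ultimately have "mC A = - eps * (mC B)\<^sup>2 \<or> mC A = eps * (mC B)\<^sup>2" by (auto simp: sl2_sel)
  hence "\<bar>mC A\<bar> = (mC B)\<^sup>2" using eps(1) by auto
  hence cB: "c = (mC B)\<^sup>2" using CA eps(1) c4 by auto
  hence "mC B \<noteq> 0" using c4 by auto
  hence "\<bar>mC B\<bar> \<in> cspec pr" using B(1) by (auto simp: cspec_def)
  hence "c \<le> \<bar>mC B\<bar>" by (rule min)
  hence "c * c \<le> \<bar>mC B\<bar> * \<bar>mC B\<bar>" using c4 by (intro mult_mono) auto
  also have "\<dots> = c" unfolding cB by (simp add: power2_eq_square)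
  finally show False using c4 mult_strict_right_mono [of 1 c c] by simp
 qed
 obtain q where q: "path q" "path_image q \<subseteq> UH" "pathstart q = w" "pathfinish q = w + of_real (eps * real k)"
  "\<forall>t\<in>{0..1}. pr (q t) = loop_power \<tau> k t"
  using loop_power_lift [OF deps wU, of k] unfolding \<tau>_def by blast
 have qU: "q t \<in> UH" if "t \<in> {0..1}" for t using q(2) that unfolding path_image_def by blast
 define r where "r = kt +++ (mob A \<circ> q)"
 have r1: "path (mob A \<circ> q)" by (rule path_continuous_image [OF q(1) continuous_on_subset [OF continuous_on_mob q(2)]])
 have r2: "path_image (mob A \<circ> q) \<subseteq> UH" unfolding path_image_compose using q(2) mob_in_UH by blast
 have r3: "pathfinish kt = pathstart (mob A \<circ> q)" using kt(3) ktA q(3) by (simp add: pathstart_compose) (simp add: pathstart_def)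
 have rfin: "pathfinish r = mob g (pathstart r)"
 proof -
  have "pathfinish r = mob A (w + of_real (eps * real k))" unfolding r_def by (simp add: pathfinish_compose q(4))
  also have "w + of_real (eps * real k) = mob (Tr (eps * real k)) w" by simp
  also have "mob A (mob (Tr (eps * real k)) w) = mob g w" unfolding gA by (rule mob_mult [OF wU, symmetric])
  finally show ?thesis using kt(3) by (simp add: r_def) (simp add: pathstart_def)
 qed
 define p where "p = gl N v"
 have p: "path p" "path_image p \<subseteq> UH" "pathfinish p = mob g (pathstart p)"
  using continuous_on_gl gl_UH deck_gl_period(1) [OF d, of 0]
  by (auto simp: p_def path_def path_image_def pathstart_def pathfinish_def g_def simp del: UH_iff)
 have rp: "path r" "path_image r \<subseteq> UH" unfolding r_def using kt r1 r2 r3 by (simp, intro subset_path_image_join)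
 have h1: "homotopic_loops X (pr \<circ> p) (pr \<circ> r)"
  by (rule homotopic_loops_lift [OF p rp rfin g(1)])
 have "homotopic_loops X (pr \<circ> r) (\<kappa> +++ loop_power \<tau> k)"
 proof (rule homotopic_loops_eq)
  show "path (pr \<circ> r)" by (rule path_continuous_image [OF rp(1) continuous_on_subset [OF cont rp(2)]])
  show "path_image (pr \<circ> r) \<subseteq> X" unfolding path_image_compose using rp(2) in_X by blast
  have "pathstart r \<in> UH" using rp(2) pathstart_in_path_image by blast
  thus "pathfinish (pr \<circ> r) = pathstart (pr \<circ> r)" using rfin deckD [OF g(1)] by (simp add: pathstart_compose pathfinish_compose)
  fix t :: real assume t: "t \<in> {0..1}"
  show "(pr \<circ> r) t = (\<kappa> +++ loop_power \<tau> k) t"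
   using t q(5) deckD [OF dA qU, of "2 * t - 1"] by (simp add: r_def joinpaths_def \<kappa>_def)
 qed
 with h1 have "homotopic_loops X (\<lambda>t. pr (gl N v t)) (\<kappa> +++ loop_power \<tau> k)"
  unfolding p_def o_def by (rule homotopic_loops_trans)
 moreover have "homotopic_to_cusp X \<tau>" unfolding \<tau>_def by (rule homotopic_to_cusp_translation [OF cf eps(1) wU])
 moreover have "pathstart \<kappa> = pathstart \<tau>" unfolding pk(4) by (simp add: \<tau>_def pathstart_def)
 ultimately show ?thesis using simple noncontr nothom by (intro exI [of _ \<kappa>] exI [of _ \<tau>] conjI)
qed

end

section \<open>The shortest geodesics\<close>

text \<open>In terms of the fourth root u of (k + 1) c the logarithm is at most 8 sqrt u. The second
  summand is then O(u^3), whereas k grows like u^4.\<close>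

lemma log_sqrt_sublinear:
 fixes a c q :: real
 assumes a: "0 \<le> a" and c: "1 \<le> c" and q: "q < 1"
 obtains K :: nat where "\<And>k. K \<le> k \<Longrightarrow>
  (real k + 1) * q + (a * ln ((real k + 1) * c) + 1)\<^sup>2 * (2 * sqrt ((real k + 1) * c) + 1) < real k"
proof -
 \<comment> \<open>The product of the constants in (a ln y + 1)^2 \<le> (8 a + 1)^2 u and 2 sqrt y +
   1 \<le> 3 u^2.\<close>
 define C where "C = 3 * (8 * a + 1)\<^sup>2"
 have C: "0 \<le> C" by (simp add: C_def)
 define u0 where "u0 = (C + 1) * c / (1 - q)"
 obtain K :: nat where K: "u0 ^ 4 \<le> real K" using real_arch_simple by blast
 show ?thesis
 proof (rule that [of K])
  fix k assume k: "K \<le> k"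
  define y where "y = (real k + 1) * c"
  define u where "u = sqrt (sqrt y)"
  have "1 * 1 \<le> y" unfolding y_def using c by (intro mult_mono) auto
  hence y1: "1 \<le> y" by simp
  have u1: "1 \<le> u" using y1 by (simp add: u_def)
  have u2: "sqrt y = u\<^sup>2" using y1 by (simp add: u_def)
  have "(sqrt y)\<^sup>2 = y" using y1 by simp
  hence u4: "y = u ^ 4" unfolding u2 by simp
  have u0: "u0 < u"
  proof (rule power_less_imp_less_base [of _ 4])
   have "u0 ^ 4 < real k + 1" using K k by linarith
   also have "\<dots> \<le> y" unfolding y_def using c mult_left_mono [of 1 c "real k + 1"] by simp
   finally show "u0 ^ 4 < u ^ 4" using u4 by simp
  qed (use u1 in simp)
  have "ln (sqrt u) \<le> sqrt u" using u1 ln_le_minus_one [of "sqrt u"] by simp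
  hence "ln u \<le> 2 * sqrt u" using u1 by (simp add: ln_sqrt)
  moreover have "ln y = 4 * ln u" unfolding u4 using u1 by (simp add: ln_realpow)
  ultimately have ly: "ln y \<le> 8 * sqrt u" by simp
  have su: "1 \<le> sqrt u" using u1 by simp
  have "a * ln y \<le> a * (8 * sqrt u)" by (rule mult_left_mono [OF ly a])
  hence "a * ln y + 1 \<le> a * (8 * sqrt u) + sqrt u" using su by linarith
  hence "a * ln y + 1 \<le> (8 * a + 1) * sqrt u" by (simp add: algebra_simps)
  moreover have "0 \<le> a * ln y + 1" using a y1 by simp
  ultimately have "(a * ln y + 1)\<^sup>2 \<le> ((8 * a + 1) * sqrt u)\<^sup>2" by (rule power_mono)
  hence 1: "(a * ln y + 1)\<^sup>2 \<le> (8 * a + 1)\<^sup>2 * u" using u1 by (simp add: power_mult_distrib)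
  have "1 \<le> u\<^sup>2" using u1 by simp
  hence 2: "2 * sqrt y + 1 \<le> 3 * u\<^sup>2" unfolding u2 by simp
  have "(a * ln y + 1)\<^sup>2 * (2 * sqrt y + 1) \<le> ((8 * a + 1)\<^sup>2 * u) * (3 * u\<^sup>2)"
   using 1 2 y1 u1 by (intro mult_mono) auto
  also have "\<dots> = C * u ^ 3" by (simp add: C_def power2_eq_square power3_eq_cube)
  finally have "(a * ln y + 1)\<^sup>2 * (2 * sqrt y + 1) \<le> C * u ^ 3" .
  moreover have "C * u ^ 3 + 1 < (real k + 1) * (1 - q)"
  proof -
   have "1 \<le> u ^ 3" using u1 by simp
   hence "C * u ^ 3 + 1 \<le> (C + 1) * u ^ 3" by (simp add: distrib_right)
   also have "(C + 1) * u ^ 3 < (real k + 1) * (1 - q)"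
   proof -
    have "(C + 1) * c < u * (1 - q)" using u0 q unfolding u0_def by (simp add: pos_divide_less_eq)
    hence "(C + 1) * c * u ^ 3 < u * (1 - q) * u ^ 3" using u1 by (intro mult_strict_right_mono) auto
    also have "\<dots> = (1 - q) * y" unfolding u4 by (simp add: eval_nat_numeral)
    also have "\<dots> = (real k + 1) * (1 - q) * c" by (simp add: y_def)
    finally have "((C + 1) * u ^ 3) * c < ((real k + 1) * (1 - q)) * c" by (simp add: mult.commute mult.left_commute)
    thus ?thesis using c by simp
   qed
   finally show ?thesis .
  qed
  ultimately show "(real k + 1) * q + (a * ln ((real k + 1) * c) + 1)\<^sup>2 * (2 * sqrt ((real k + 1) * c) + 1) < real k"
   unfolding y_def [symmetric] by (simp add: algebra_simps)
 qed
qed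

context hyp_cover
begin

text \<open>A translation brings the trace between k c and (k + 1) c and keeps the entry c;
  \<open>3 \<le> k\<close> and 4 \<le> c make the trace large enough for
  \<open>minimal_self_intersections\<close>. The geodesic is primitive because a proper root has the
  same axis and an entry reduced in the ratio of the values sinh (v / 2), against minimality of
  c.\<close>

lemma competitor:
 assumes cf: "cusp_frame pr" and A: "deck pr A" "0 < mC A"
  and min: "\<And>x. x \<in> cspec pr \<Longrightarrow> mC A \<le> x" and k: "3 \<le> k"
 shows "\<exists>\<delta> v. 0 < v \<and> primitive_closed_geodesic X \<delta> \<and> self_intersection_number \<delta> = enat k \<and>
  curve_length \<delta> = ereal v \<and> 2 * cosh (v / 2) = trc A + (real k - of_int \<lfloor>trc A / mC A\<rfloor>) * mC A"
proof -
 define c where "c = mC A"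
 define j where "j = \<lfloor>trc A / c\<rfloor>"
 define g where "g = A * Tr (of_int (int k - j))"
 have c4: "4 \<le> c" using cusp_c_ge4 [OF cf A(1)] A(2) by (simp add: c_def)
 have g: "deck pr g" "mC g = c" unfolding g_def by (rule deck_mult [OF A(1) deck_Tr_int [OF cf]]) (simp add: sl2_sel c_def)
 have tg: "trc g = trc A + (real k - of_int j) * c" by (simp add: g_def trc_def sl2_sel c_def)
 have fl: "of_int j \<le> trc A / c" "trc A / c < of_int j + 1" unfolding j_def by linarith+
 have fl': "of_int j * c \<le> trc A" "trc A < (of_int j + 1) * c"
  using fl c4 by (simp_all add: pos_le_divide_eq pos_divide_less_eq)
 have tk: "real k * c \<le> trc g" "trc g < (real k + 1) * c" unfolding tg using fl' by (simp_all add: algebra_simps)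
 have "3 * 4 \<le> real k * c" using k c4 by (intro mult_mono) auto
 hence t9: "9 \<le> trc g" using tk by linarith
 hence "2 < trc g" by simp
 then obtain N v where N: "0 < v" "g = trl N v" by (rule diagonalize)
 have d: "deck pr (trl N v)" using g N by simp
 have T: "2 * cosh (v / 2) = trc g" unfolding N(2) by (rule conj_Dg_sel(3) [symmetric])
 have prim: "\<exists>n::int. w = of_int n * v" if w: "deck pr (trl N w)" for w
 proof -
  have v0: "v \<noteq> 0" using N by simp
  obtain m where m: "0 < m" "deck pr (trl N m)" "\<And>w. deck pr (trl N w) \<Longrightarrow> \<exists>n::int. w = of_int n * m"
   by (rule deck_axis_discrete [OF v0 d]) blast
  obtain n :: int where n: "v = of_int n * m" using m(3) [OF d] by blast
  have n0: "0 < n" using n N(1) m(1) by (simp add: zero_less_mult_iff)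
  have "mC (trl N m) \<noteq> 0" by (rule frame_hyperbolic_C [OF cf m(1,2)])
  hence "\<bar>mC (trl N m)\<bar> \<in> cspec pr" using m(2) by (auto simp: cspec_def)
  hence "c \<le> \<bar>mC (trl N m)\<bar>" unfolding c_def by (rule min)
  moreover have "\<bar>mC (trl N m)\<bar> = 2 * \<bar>mC N * mD N\<bar> * sinh (m / 2)"
   unfolding conj_Dg_sel(1) using m(1) by (simp add: abs_mult)
  moreover have cv: "c = 2 * \<bar>mC N * mD N\<bar> * sinh (v / 2)"
  proof -
   have "\<bar>mC (trl N v)\<bar> = 2 * \<bar>mC N * mD N\<bar> * sinh (v / 2)"
    unfolding conj_Dg_sel(1) using N(1) by (simp add: abs_mult)
   thus ?thesis using g(2) N(2) c4 by simp
  qed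
  ultimately have "2 * \<bar>mC N * mD N\<bar> * sinh (v / 2) \<le> 2 * \<bar>mC N * mD N\<bar> * sinh (m / 2)" by simp
  moreover have "0 < 2 * \<bar>mC N * mD N\<bar>" using cv c4 by (cases "mC N * mD N = 0") auto
  ultimately have "sinh (v / 2) \<le> sinh (m / 2)" by (simp only: mult_le_cancel_left_pos)
  hence "v \<le> m" by simp
  hence "of_int n * m \<le> 1 * m" using n by simp
  hence "real_of_int n \<le> 1" using m(1) by (simp only: mult_le_cancel_right_pos)
  hence "n = 1" using n0 by simp
  thus ?thesis using m(3) [OF w] n by simp
 qed
 have Cg: "\<bar>mC (trl N v)\<bar> = c" using g N c4 by simp
 have "self_intersection_number (\<lambda>t. pr (gl N v t)) = enat (nat \<lfloor>2 * cosh (v / 2) / \<bar>mC (trl N v)\<bar>\<rfloor>)"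
  by (rule minimal_self_intersections [OF cf N(1) d]) (use min T t9 Cg in \<open>simp_all add: c_def\<close>)
 moreover have "\<lfloor>2 * cosh (v / 2) / \<bar>mC (trl N v)\<bar>\<rfloor> = int k"
  unfolding Cg T using tk c4 by (intro floor_unique) (simp_all add: pos_le_divide_eq pos_divide_less_eq)
 moreover have trace: "2 * cosh (v / 2) = trc A + (real k - of_int \<lfloor>trc A / mC A\<rfloor>) * mC A"
  using T tg unfolding j_def c_def by (rule HOL.trans)
 ultimately have i: "self_intersection_number (\<lambda>t. pr (gl N v t)) = enat k" by simp
 show ?thesis
  by (intro exI [of _ "\<lambda>t. pr (gl N v t)"] exI [of _ v] conjI N(1) primitive_glI [OF N(1) d prim] i gl_length [OF N(1)] trace)
qed

end

lemma cosh_length_mono: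
 assumes "0 < v" "0 < w" "ereal v \<le> ereal w" shows "2 * cosh (v / 2 :: real) \<le> 2 * cosh (w / 2)"
 using assms by (simp add: cosh_real_nonneg_le_iff)

theorem theorem1p1:
 fixes X :: "'a::metric_space set"
 assumes "hyperbolic_surface X" and "complete X" and "finite_type X" and "has_cusp X"
 shows "\<exists>K::nat. \<forall>k\<ge>K. \<forall>\<gamma>. shortest_geodesic X k \<gamma> \<longrightarrow>
      self_intersection_number \<gamma> = enat k \<and>
      (\<exists>\<kappa> \<tau>. homotopic_to_cusp X \<tau> \<and>
         simple_loop X \<kappa> \<and> \<not> contractible_loop X \<kappa> \<and>
         \<not> homotopic_loops X \<kappa> \<tau> \<and>
         pathstart \<kappa> = pathstart \<tau> \<and>
         homotopic_loops X \<gamma> (\<kappa> +++ loop_power \<tau> k))"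
proof -
 obtain pr where hc: "hyp_cover X pr" using hyperbolic_surface_cover assms(1,2) by blast
 interpret hyp_cover X pr by fact
 obtain M0 where M0: "frame pr M0" by (rule cusp_frame_exists [OF hc assms(3,4)])
 define S where "S = {x. \<exists>M. frame pr M \<and> x \<in> cspec (pull pr M)}"
 have fin: "finite {x \<in> S. x \<le> b}" for b
 proof -
  have "{x \<in> S. x \<le> b} = {x. x \<le> b \<and> (\<exists>M. frame pr M \<and> x \<in> cspec (pull pr M))}"
   by (auto simp: S_def)
  thus ?thesis using finitely_many_cusps [OF hc assms(3), of b] by simp
 qed
 have conj: "deck (pull pr M) (minv M * N * Dg w * minv (minv M * N)) \<longleftrightarrow> deck pr (trl N w)" for M N w
  unfolding deck_conj by (simp add: minv_mult mult.assoc)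
 have hypS: "\<bar>mC (trl (minv M * N) v)\<bar> \<in> S"
  if M: "frame pr M" and v: "0 < v" "deck pr (trl N v)" for M N v
 proof -
  interpret M: hyp_cover X "pull pr M" by (rule hyp_cover_mob [OF hc])
  have d: "deck (pull pr M) (trl (minv M * N) v)" using conj v(2) by blast
  have "mC (trl (minv M * N) v) \<noteq> 0" by (rule M.frame_hyperbolic_C [OF M v(1) d])
  thus ?thesis using M d unfolding S_def cspec_def by blast
 qed
 show ?thesis
 proof (cases "S = {}")
  \<comment> \<open>There is no closed geodesic in this case, and the claim is vacuous.\<close>
  case True
  have "\<not> shortest_geodesic X k \<gamma>" for k \<gamma>
  proof
   assume "shortest_geodesic X k \<gamma>"
   hence "closed_geodesic X \<gamma>" by (simp add: shortest_geodesic_def primitive_closed_geodesic_def)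
   then obtain N v where "0 < v" "deck pr (trl N v)" by (rule closed_geodesic_lift) blast
   thus False using hypS [OF M0] True by blast
  qed
  thus ?thesis by blast
 next
  case False
  then obtain b where b: "b \<in> S" by blast
  define c0 where "c0 = Min {x \<in> S. x \<le> b}"
  have "c0 \<in> {x \<in> S. x \<le> b}" unfolding c0_def using fin b by (intro Min_in) auto
  hence c0S: "c0 \<in> S" by simp
  have c0le: "c0 \<le> x" if x: "x \<in> S" for x
  proof (cases "x \<le> b")
   case True thus ?thesis unfolding c0_def using fin x by (intro Min_le) auto
  next
   case False
   have "c0 \<le> b" unfolding c0_def using fin b by (intro Min_le) auto
   thus ?thesis using False by simp
  qed
  \<comment> \<open>The set of values just above \<open>c0\<close>. It is finite, so
    \<open>c1\<close> leaves a gap above \<open>c0\<close>; the cap \<open>c0 + 1\<close> covers the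
    case of no value nearby.\<close>
  define E where "E = {x \<in> S. x \<le> c0 + 1 \<and> c0 < x}"
  define c1 where "c1 = Min (insert (c0 + 1) E)"
  have finE: "finite E" by (rule finite_subset [OF _ fin [of "c0 + 1"]]) (auto simp: E_def)
  have c01: "c0 < c1" using finE by (auto simp: c1_def E_def)
  have gap: "x = c0 \<or> c1 \<le> x" if x: "x \<in> S" for x
  proof (cases "x \<in> E")
   case True
   thus ?thesis using finE by (simp add: c1_def)
  next
   case False
   hence "x = c0 \<or> c0 + 1 \<le> x" using x c0le [OF x] by (auto simp: E_def)
   moreover have "c1 \<le> c0 + 1" using finE by (simp add: c1_def)
   ultimately show ?thesis by linarith
  qed
  obtain M1 A1 where M1: "frame pr M1" and A1: "deck (pull pr M1) A1" "mC A1 \<noteq> 0" "c0 = \<bar>mC A1\<bar>"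
   using c0S by (auto simp: S_def cspec_def)
  interpret M1: hyp_cover X "pull pr M1" by (rule hyp_cover_mob [OF hc])
  have c4: "4 \<le> c0" using M1.cusp_c_ge4 [OF M1 A1(1,2)] A1(3) by simp
  \<comment> \<open>The competitors are built from a positive entry; passing to the inverse changes
    its sign and keeps the trace.\<close>
  have signed: "\<exists>A. deck pr' A \<and> mC A = \<bar>mC g\<bar> \<and> trc A = trc g" if "deck pr' g" for pr' :: "complex \<Rightarrow> 'a" and g
  proof (cases "0 \<le> mC g")
   case True thus ?thesis using that by (intro exI [of _ g]) simp
  next
   case False
   thus ?thesis using deck_minv [OF that] by (intro exI [of _ "minv g"]) (simp add: minv_sel trc_def)
  qed
  obtain A where A: "deck (pull pr M1) A" "mC A = c0" using signed [OF A1(1)] A1(3) by metis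
  have minS: "c0 \<le> x" if "frame pr M" "x \<in> cspec (pull pr M)" for M x
   using c0le that by (auto simp: S_def)
  obtain rh where rh: "0 < rh"
   "\<And>N v m. 0 < v \<Longrightarrow> deck pr (trl N v) \<Longrightarrow> (\<And>w. deck pr (trl N w) \<Longrightarrow> \<exists>n::int. w = of_int n * v) \<Longrightarrow>
   2 * v \<le> rh * real m \<Longrightarrow>
   \<exists>n x. self_intersection_number (\<lambda>t. pr (gl N v t)) = enat n \<and> real n \<le> x + (real m)\<^sup>2 * (2 * exp (v / 4) + 1) \<and>
    (x = 0 \<or> (\<exists>M. frame pr M \<and>
     x = 2 * cosh (v / 2) / \<bar>mC (trl (minv M * N) v)\<bar>))"
   by (rule intersection_bound [OF hc assms(3)]) blast
  \<comment> \<open>The number m of cells per side is at most 2 v / rh + 1, and v / 2 is at most the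
    logarithm of the trace.\<close>
  define a where "a = 4 / rh"
  have a: "0 \<le> a" using rh(1) by (simp add: a_def)
  have q: "c0 / c1 < 1" "1 \<le> c0" using c01 c4 by simp_all
  obtain K0 :: nat where K0: "\<And>k. K0 \<le> k \<Longrightarrow>
   (real k + 1) * (c0 / c1) + (a * ln ((real k + 1) * c0) + 1)\<^sup>2 * (2 * sqrt ((real k + 1) * c0) + 1) < real k"
   by (rule log_sqrt_sublinear [OF a q(2,1)]) blast
  \<comment> \<open>From \<open>K1\<close> on the trace is at least 9, as
    \<open>minimal_self_intersections\<close> demands: a smaller trace allows fewer than
    \<open>K1\<close> self-intersections.\<close>
  obtain K1 :: nat where K1: "9 + (a * ln 9 + 1)\<^sup>2 * (2 * sqrt 9 + 1) < real K1" using reals_Archimedean2 by blast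
  define K where "K = max 3 (max K0 K1)"
  have "self_intersection_number \<gamma> = enat k \<and>
      (\<exists>\<kappa> \<tau>. homotopic_to_cusp X \<tau> \<and>
         simple_loop X \<kappa> \<and> \<not> contractible_loop X \<kappa> \<and>
         \<not> homotopic_loops X \<kappa> \<tau> \<and>
         pathstart \<kappa> = pathstart \<tau> \<and>
         homotopic_loops X \<gamma> (\<kappa> +++ loop_power \<tau> k))"
   if k: "K \<le> k" and short: "shortest_geodesic X k \<gamma>" for k \<gamma>
  proof -
   have k3: "3 \<le> k" "K0 \<le> k" "K1 \<le> k" using k by (simp_all add: K_def)
   have pg: "primitive_closed_geodesic X \<gamma>" and ik: "enat k \<le> self_intersection_number \<gamma>"
    and min: "\<And>\<delta>. primitive_closed_geodesic X \<delta> \<Longrightarrow> self_intersection_number \<delta> \<ge> enat k \<Longrightarrow> curve_length \<gamma> \<le> curve_length \<delta>"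
    using short by (auto simp: shortest_geodesic_def)
   have "closed_geodesic X \<gamma>" using pg by (simp add: primitive_closed_geodesic_def)
   then obtain N v where v: "0 < v" "deck pr (trl N v)" and \<gamma>: "\<gamma> = (\<lambda>t. pr (gl N v t))"
    by (rule closed_geodesic_lift) blast
   have prim: "\<exists>n::int. w = of_int n * v" if "deck pr (trl N w)" for w
    by (rule primitive_gl [OF pg [unfolded \<gamma>] v that])
   have len: "curve_length \<gamma> = ereal v" unfolding \<gamma> by (rule gl_length [OF v(1)])
   define T where "T = 2 * cosh (v / 2)"
   have shorter: "T \<le> 2 * cosh (w / 2)"
    if "0 < w" "primitive_closed_geodesic X \<delta>" "self_intersection_number \<delta> = enat k" "curve_length \<delta> = ereal w" for \<delta> w
   proof -
    have "curve_length \<gamma> \<le> curve_length \<delta>" by (rule min [OF that(2)]) (simp add: that(3))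
    thus ?thesis unfolding T_def using that len v(1) by (intro cosh_length_mono) auto
   qed
   define y where "y = (real k + 1) * c0"
   have Ty: "T \<le> y"
   proof -
    have "0 < mC A" using A c4 by simp
    then obtain \<delta> w where \<delta>: "0 < w" "primitive_closed_geodesic X \<delta>" "self_intersection_number \<delta> = enat k" "curve_length \<delta> = ereal w"
     "2 * cosh (w / 2) = trc A + (real k - of_int \<lfloor>trc A / mC A\<rfloor>) * mC A"
     using M1.competitor [OF M1 A(1) _ _ k3(1)] minS [OF M1] A(2) by metis
    have "trc A / c0 < of_int \<lfloor>trc A / c0\<rfloor> + 1" by linarith
    hence "trc A < (of_int \<lfloor>trc A / c0\<rfloor> + 1) * c0" using c4 by (subst (asm) pos_divide_less_eq) auto
    hence "trc A + (real k - of_int \<lfloor>trc A / c0\<rfloor>) * c0 \<le> y" by (simp add: y_def algebra_simps)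
    thus ?thesis using shorter [OF \<delta>(1-4)] \<delta>(5) A(2) by simp
   qed
   define m where "m = nat \<lceil>2 * v / rh\<rceil>"
   have r0: "0 < 2 * v / rh" using v rh by simp
   have m: "2 * v / rh \<le> real m" "real m \<le> 2 * v / rh + 1" unfolding m_def using r0 by linarith+
   have "2 * v \<le> rh * real m" using m(1) rh(1) by (simp add: pos_divide_le_eq mult.commute)
   from rh(2) [OF v prim this] obtain n x where n: "self_intersection_number \<gamma> = enat n"
     "real n \<le> x + (real m)\<^sup>2 * (2 * exp (v / 4) + 1)"
    and x: "x = 0 \<or> (\<exists>M. frame pr M \<and> x = T / \<bar>mC (trl (minv M * N) v)\<bar>)"
    unfolding \<gamma> T_def by blast
   have kn: "k \<le> n" using ik n(1) by simp
   have T2: "2 \<le> T" unfolding T_def using cosh_real_ge_1 [of "v / 2"] by simp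
   have thick: "(real m)\<^sup>2 * (2 * exp (v / 4) + 1) \<le> (a * ln Z + 1)\<^sup>2 * (2 * sqrt Z + 1)" if Z: "T \<le> Z" for Z
   proof -
    have "exp (v / 2) \<le> T" unfolding T_def by (simp add: cosh_def)
    hence eZ: "exp (v / 2) \<le> Z" using Z by simp
    have Z0: "0 < Z" using T2 Z by simp
    have "exp (v / 4) = sqrt (exp (v / 2))"
    proof -
     have "(exp (v / 4))\<^sup>2 = exp (v / 2)" by (simp add: power2_eq_square flip: exp_add)
     thus ?thesis by (metis exp_ge_zero real_sqrt_unique)
    qed
    hence e: "exp (v / 4) \<le> sqrt Z" using eZ by simp
    have "v / 2 \<le> ln Z" using eZ Z0 by (metis exp_le_cancel_iff exp_ln)
    hence "a * (v / 2) \<le> a * ln Z" by (rule mult_left_mono [OF _ a])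
    moreover have "a * (v / 2) = 2 * v / rh" by (simp add: a_def)
    ultimately have "real m \<le> a * ln Z + 1" using m(2) by linarith
    hence "(real m)\<^sup>2 \<le> (a * ln Z + 1)\<^sup>2" by (intro power_mono) auto
    thus ?thesis using e by (intro mult_mono) (auto intro: add_nonneg_nonneg)
   qed
   have "9 \<le> T"
   proof (rule ccontr)
    assume "\<not> 9 \<le> T"
    hence T9: "T \<le> 9" by simp
    have "x \<le> 9"
     using x
    proof
     assume "\<exists>M. frame pr M \<and> x = T / \<bar>mC (trl (minv M * N) v)\<bar>"
     then obtain M where M: "frame pr M" "x = T / \<bar>mC (trl (minv M * N) v)\<bar>" by blast
     have "1 \<le> \<bar>mC (trl (minv M * N) v)\<bar>" using c0le [OF hypS [OF M(1) v]] c4 by linarith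
     hence "x \<le> T / 1" unfolding M(2) using T2 by (intro divide_left_mono) auto
     thus ?thesis using T9 by simp
    qed simp
    hence "real n < real K1" using n(2) thick [OF T9] K1 by linarith
    thus False using kn k3(3) by simp
   qed
   \<comment> \<open>Otherwise the entry at every cusp is at least \<open>c1\<close>, the deep
     excursion contributes at most y / c1, and by the choice of \<open>K0\<close> fewer than k
     self-intersections remain in total.\<close>
   have "\<exists>M. frame pr M \<and> \<bar>mC (trl (minv M * N) v)\<bar> = c0"
   proof (rule ccontr)
    assume no: "\<not> ?thesis"
    have "x \<le> (real k + 1) * (c0 / c1)"
     using x
    proof
     assume "x = 0" thus ?thesis using c4 c01 by simp
    next
     assume "\<exists>M. frame pr M \<and> x = T / \<bar>mC (trl (minv M * N) v)\<bar>"
     then obtain M where M: "frame pr M" "x = T / \<bar>mC (trl (minv M * N) v)\<bar>" by blast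
     have "c1 \<le> \<bar>mC (trl (minv M * N) v)\<bar>" using gap [OF hypS [OF M(1) v]] no M(1) by blast
     hence "x \<le> y / c1" unfolding M(2) using T2 Ty c4 c01 by (intro frac_le) auto
     thus ?thesis by (simp add: y_def)
    qed
    moreover have "real n \<le> x + (a * ln y + 1)\<^sup>2 * (2 * sqrt y + 1)" using n(2) thick [OF Ty] by linarith
    ultimately have "real n < real k" using K0 [OF k3(2)] unfolding y_def by linarith
    thus False using kn by simp
   qed
   then obtain M where M: "frame pr M" "\<bar>mC (trl (minv M * N) v)\<bar> = c0" by blast
   interpret M: hyp_cover X "pull pr M" by (rule hyp_cover_mob [OF hc])
   define N' where "N' = minv M * N"
   have d: "deck (pull pr M) (trl N' v)" unfolding N'_def using conj v(2) by blast
   have C: "\<bar>mC (trl N' v)\<bar> = c0" using M(2) by (simp add: N'_def)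
   have "mob M (gl N' v t) = gl N v t" for t unfolding mob_gl N'_def by simp
   hence \<gamma>': "\<gamma> = (\<lambda>t. pr (mob M (gl N' v t)))" by (simp add: \<gamma>)
   have minC: "\<bar>mC (trl N' v)\<bar> \<le> x" if "x \<in> cspec (pull pr M)" for x
    unfolding C by (rule minS [OF M(1) that])
   have num: "self_intersection_number \<gamma> = enat (nat \<lfloor>T / c0\<rfloor>)"
    using M.minimal_self_intersections [OF M(1) v(1) d minC] \<open>9 \<le> T\<close> unfolding C \<gamma>' T_def by blast
   have fl: "int k \<le> \<lfloor>T / c0\<rfloor>" using ik k3(1) unfolding num by simp
   obtain B where B: "deck (pull pr M) B" "mC B = c0" "trc B = T"
    using signed [OF d] unfolding C conj_Dg_sel(3) T_def by blast
   have "0 < mC B" using B c4 by simp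
   then obtain \<delta> w where \<delta>: "0 < w" "primitive_closed_geodesic X \<delta>" "self_intersection_number \<delta> = enat k" "curve_length \<delta> = ereal w"
    "2 * cosh (w / 2) = trc B + (real k - of_int \<lfloor>trc B / mC B\<rfloor>) * mC B"
    using M.competitor [OF M(1) B(1) _ _ k3(1)] minS [OF M(1)] B(2) by metis
   \<comment> \<open>The competitor built from the element of \<open>\<gamma>\<close> itself has its
     trace reduced by \<open>c0\<close> for every self-intersection in excess of k; since
     \<open>\<gamma>\<close> is shortest, there is no excess.\<close>
   have "T \<le> T + (real k - of_int \<lfloor>T / c0\<rfloor>) * c0" using shorter [OF \<delta>(1-4)] unfolding \<delta>(5) B(2,3) .
   hence "0 \<le> real k - of_int \<lfloor>T / c0\<rfloor>" using c4 by (simp add: zero_le_mult_iff)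
   hence eq: "int k = \<lfloor>T / c0\<rfloor>" using fl by linarith
   have "self_intersection_number \<gamma> = enat k" unfolding num eq [symmetric] by simp
   moreover have "\<exists>\<kappa> \<tau>. homotopic_to_cusp X \<tau> \<and> simple_loop X \<kappa> \<and> \<not> contractible_loop X \<kappa> \<and>
     \<not> homotopic_loops X \<kappa> \<tau> \<and> pathstart \<kappa> = pathstart \<tau> \<and>
     homotopic_loops X \<gamma> (\<kappa> +++ loop_power \<tau> k)"
   proof -
    have "int k = \<lfloor>2 * cosh (v / 2) / \<bar>mC (trl N' v)\<bar>\<rfloor>" unfolding C T_def [symmetric] by (rule eq)
    from M.homotopy_class [OF M(1) v(1) d minC this] show ?thesis unfolding \<gamma>' .
   qed
   ultimately show ?thesis by blast
  qed
  thus ?thesis by blast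
 qed
qed

end
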